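(* Let $K$ be a number field, let $X$ be a geometrically irreducible affine variety of dimension $d\geq 1$ over $K$, and let $f:X\to X$ be a dominant endomorphism defined over $K$. Fix an embedding $X\subseteq \mathbb A^N_K$, with coordinates $(x_1,\dots,x_N)$ on $\mathbb A^N$. Let $P\subseteq X(\overline{K})$ be a subset satisfying the following three conditions: (DCI) $P$ is Zariski-dense in $X$, and there is an integer $M\geq 1$ such that for every $y\in P$ and every $1\leq i\leq N$ we have $M\cdot x_i(y)\in\mathcal O_{K^c}$, where $\mathcal O_{K^c}$ is the ring of algebraic integers of $K^c$; (BH) there is a constant $c>0$ such that $C(y):=\max\{C(y_i):1\leq i\leq N\}\leq c$ for every $y=(y_1,\dots,y_N)\in P$; (AI) the set $P\setminus f^{-1}(P)$ is not Zariski-dense in $X$. Then $(X,f)$ is of monomial type.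
   Context: Fix an algebraic closure $\overline{\mathbb Q}\subset\mathbb C$ of $\mathbb Q$; number fields are regarded as subfields of $\overline{\mathbb Q}$. For $\alpha\in\overline{\mathbb Q}$, its house is $C(\alpha)=\max\{|\sigma(\alpha)|:\sigma:\mathbb Q(\alpha)\hookrightarrow\mathbb C\}$. For a number field $K$, its maximal cyclotomic extension is $K^c=K(U(\mathbb C))$, the subfield of $\mathbb C$ generated over $K$ by the group $U(\mathbb C)$ of all roots of unity. Definition: let $X$ be a quasi-projective variety of dimension $d$ and $f:X\dashrightarrow X$ a dominant rational self-map, both over a field $k$ of characteristic zero. $(X,f)$ is of monomial type if there exist integers $l\geq1$, $n\geq d$, a group endomorphism $g:\mathbb G_{m,\overline k}^n\to\mathbb G_{m,\overline k}^n$ over $\overline k$ and a dominant morphism $\phi:\mathbb G_{m,\overline k}^n\to X_{\overline k}$ over $\overline k$ such that $f_{\overline k}^{\circ l}\circ\phi=\phi\circ g$, where $f_{\overline k}$ is the base change of $f$ to $\overline k$. *)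

theory Defs
  imports "HOL-Computational_Algebra.Polynomial" "HOL-Library.Poly_Mapping"
begin

definition subfield_C :: "complex set \<Rightarrow> bool" where
  "subfield_C L \<longleftrightarrow> 0 \<in> L \<and> 1 \<in> L \<and>
     (\<forall>x\<in>L. \<forall>y\<in>L. x + y \<in> L \<and> x - y \<in> L \<and> x * y \<in> L) \<and>
     (\<forall>x\<in>L. x \<noteq> 0 \<longrightarrow> inverse x \<in> L)"

definition number_field :: "complex set \<Rightarrow> bool" where
  "number_field K \<longleftrightarrow> subfield_C K \<and>
     (\<exists>B. finite B \<and> B \<subseteq> K \<and> K \<subseteq> {\<Sum>b\<in>B. of_rat (c b) * b | c. True})"

definition qbar :: "complex set" where
  "qbar = {z. algebraic z}"

definition roots_of_unity :: "complex set" where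
  "roots_of_unity = {z. \<exists>n>0. z ^ n = 1}"

definition cyclo_ext :: "complex set \<Rightarrow> complex set" where
  "cyclo_ext K = \<Inter>{L. subfield_C L \<and> K \<subseteq> L \<and> roots_of_unity \<subseteq> L}"

definition alg_integers_of :: "complex set \<Rightarrow> complex set" where
  "alg_integers_of L = {z \<in> L. algebraic_int z}"

definition rat_adjoin :: "complex \<Rightarrow> complex set" where
  "rat_adjoin a = \<Inter>{L. subfield_C L \<and> a \<in> L}"

definition field_embedding :: "complex set \<Rightarrow> (complex \<Rightarrow> complex) \<Rightarrow> bool" where
  "field_embedding L \<sigma> \<longleftrightarrow> \<sigma> 1 = 1 \<and>
     (\<forall>x\<in>L. \<forall>y\<in>L. \<sigma> (x + y) = \<sigma> x + \<sigma> y \<and> \<sigma> (x * y) = \<sigma> x * \<sigma> y)"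

definition house :: "complex \<Rightarrow> real" where
  "house a = (SUP \<sigma> \<in> {\<sigma>. field_embedding (rat_adjoin a) \<sigma>}. cmod (\<sigma> a))"

type_synonym mpoly = "(nat \<Rightarrow>\<^sub>0 nat) \<Rightarrow>\<^sub>0 complex"

definition peval :: "mpoly \<Rightarrow> (nat \<Rightarrow> complex) \<Rightarrow> complex" where
  "peval p x = (\<Sum>m\<in>Poly_Mapping.keys p. Poly_Mapping.lookup p m * (\<Prod>i\<in>Poly_Mapping.keys m. x i ^ Poly_Mapping.lookup m i))"

definition poly_over :: "complex set \<Rightarrow> nat \<Rightarrow> mpoly \<Rightarrow> bool" where
  "poly_over L N p \<longleftrightarrow> (\<forall>m. Poly_Mapping.lookup p m \<in> L) \<and> (\<forall>m\<in>Poly_Mapping.keys p. Poly_Mapping.keys m \<subseteq> {..<N})"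

definition qbar_pts :: "nat \<Rightarrow> (nat \<Rightarrow> complex) set" where
  "qbar_pts N = {x. (\<forall>i<N. x i \<in> qbar) \<and> (\<forall>i\<ge>N. x i = 0)}"

definition zero_set :: "nat \<Rightarrow> mpoly set \<Rightarrow> (nat \<Rightarrow> complex) set" where
  "zero_set N S = {x \<in> qbar_pts N. \<forall>p\<in>S. peval p x = 0}"

definition zclosed :: "nat \<Rightarrow> (nat \<Rightarrow> complex) set \<Rightarrow> bool" where
  "zclosed N Z \<longleftrightarrow> (\<exists>S. (\<forall>p\<in>S. poly_over qbar N p) \<and> Z = zero_set N S)"

definition zclosure :: "nat \<Rightarrow> (nat \<Rightarrow> complex) set \<Rightarrow> (nat \<Rightarrow> complex) set" where
  "zclosure N A = {x \<in> qbar_pts N. \<forall>p. poly_over qbar N p \<and> (\<forall>a\<in>A. peval p a = 0) \<longrightarrow> peval p x = 0}"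

definition zariski_dense_in :: "nat \<Rightarrow> (nat \<Rightarrow> complex) set \<Rightarrow> (nat \<Rightarrow> complex) set \<Rightarrow> bool" where
  "zariski_dense_in N A X \<longleftrightarrow> zclosure N A = X"

definition zirreducible :: "nat \<Rightarrow> (nat \<Rightarrow> complex) set \<Rightarrow> bool" where
  "zirreducible N Z \<longleftrightarrow> zclosed N Z \<and> Z \<noteq> {} \<and>
     (\<forall>Z1 Z2. zclosed N Z1 \<and> zclosed N Z2 \<and> Z \<subseteq> Z1 \<union> Z2 \<longrightarrow> Z \<subseteq> Z1 \<or> Z \<subseteq> Z2)"

definition zchain :: "nat \<Rightarrow> (nat \<Rightarrow> complex) set \<Rightarrow> nat \<Rightarrow> bool" where
  "zchain N X k \<longleftrightarrow> (\<exists>Z. (\<forall>j\<le>k. zirreducible N (Z j) \<and> Z j \<subseteq> X) \<and> (\<forall>j<k. Z j \<subset> Z (Suc j)))"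

definition zdim :: "nat \<Rightarrow> (nat \<Rightarrow> complex) set \<Rightarrow> nat" where
  "zdim N X = (GREATEST k. zchain N X k)"

definition affine_variety_over :: "complex set \<Rightarrow> nat \<Rightarrow> (nat \<Rightarrow> complex) set \<Rightarrow> bool" where
  "affine_variety_over K N X \<longleftrightarrow> (\<exists>S. (\<forall>p\<in>S. poly_over K N p) \<and> X = zero_set N S)"

definition polymap :: "nat \<Rightarrow> (nat \<Rightarrow> mpoly) \<Rightarrow> (nat \<Rightarrow> complex) \<Rightarrow> (nat \<Rightarrow> complex)" where
  "polymap k F x = (\<lambda>i. if i < k then peval (F i) x else 0)"

type_synonym lpoly = "(nat \<Rightarrow>\<^sub>0 int) \<Rightarrow>\<^sub>0 complex"

definition lpeval :: "lpoly \<Rightarrow> (nat \<Rightarrow> complex) \<Rightarrow> complex" where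
  "lpeval p t = (\<Sum>m\<in>Poly_Mapping.keys p. Poly_Mapping.lookup p m * (\<Prod>i\<in>Poly_Mapping.keys m. t i powi Poly_Mapping.lookup m i))"

definition lpoly_over :: "complex set \<Rightarrow> nat \<Rightarrow> lpoly \<Rightarrow> bool" where
  "lpoly_over L n p \<longleftrightarrow> (\<forall>m. Poly_Mapping.lookup p m \<in> L) \<and> (\<forall>m\<in>Poly_Mapping.keys p. Poly_Mapping.keys m \<subseteq> {..<n})"

definition gm_pts :: "nat \<Rightarrow> (nat \<Rightarrow> complex) set" where
  "gm_pts n = {t. (\<forall>i<n. t i \<in> qbar \<and> t i \<noteq> 0) \<and> (\<forall>i\<ge>n. t i = 0)}"

definition lpmap :: "nat \<Rightarrow> (nat \<Rightarrow> lpoly) \<Rightarrow> (nat \<Rightarrow> complex) \<Rightarrow> (nat \<Rightarrow> complex)" where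
  "lpmap k G t = (\<lambda>i. if i < k then lpeval (G i) t else 0)"

definition gm_endo :: "nat \<Rightarrow> (nat \<Rightarrow> lpoly) \<Rightarrow> bool" where
  "gm_endo n G \<longleftrightarrow> (\<forall>i<n. lpoly_over qbar n (G i)) \<and> lpmap n G ` gm_pts n \<subseteq> gm_pts n \<and>
     (\<forall>s\<in>gm_pts n. \<forall>t\<in>gm_pts n.
        lpmap n G (\<lambda>i. s i * t i) = (\<lambda>i. lpmap n G s i * lpmap n G t i))"

definition dominant_torus_morphism :: "nat \<Rightarrow> nat \<Rightarrow> (nat \<Rightarrow> lpoly) \<Rightarrow> (nat \<Rightarrow> complex) set \<Rightarrow> bool" where
  "dominant_torus_morphism n N Phi X \<longleftrightarrow> (\<forall>i<N. lpoly_over qbar n (Phi i)) \<and>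
     lpmap N Phi ` gm_pts n \<subseteq> X \<and> zariski_dense_in N (lpmap N Phi ` gm_pts n) X"

definition monomial_type :: "nat \<Rightarrow> (nat \<Rightarrow> complex) set \<Rightarrow> ((nat \<Rightarrow> complex) \<Rightarrow> (nat \<Rightarrow> complex)) \<Rightarrow> bool" where
  "monomial_type N X f \<longleftrightarrow> (\<exists>l n G Phi. l \<ge> 1 \<and> n \<ge> zdim N X \<and> gm_endo n G \<and>
     dominant_torus_morphism n N Phi X \<and>
     (\<forall>t\<in>gm_pts n. (f ^^ l) (lpmap N Phi t) = lpmap N Phi (lpmap n G t)))"

end

theory Submission
  imports Defs "Jordan_Normal_Form.Char_Poly" "HOL-Number_Theory.Number_Theory"
begin

text \<open>By Loxton's theorem every coordinate of a point of P is a sum of at most R terms e \<zeta> with e in a fixed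
  finite set and \<zeta> a root of unity. Choosing representations with the fewest nonzero terms splits P into
  finitely many pieces, each the image of a set Z of torsion points of a torus under a map with Laurent
  polynomial coordinates. A decomposition of Manin-Mumford type allows one to assume that no Z is covered by
  finitely many proper torsion cosets, so that Laurent polynomials vanishing on Z vanish identically.
  If f carries one piece into another, minimality of the representations forbids cancellation, and f lifts to a
  monomial map \<open>x \<mapsto> u x\<^sup>H\<close> between the two tori. Condition (AI) gives every Zariski-dense piece a
  dense successor, so some iterate of f lifts to a monomial map of one torus to itself. This map has a
  periodic torsion point; with that point as origin, a further iterate becomes a group endomorphism.
  The dimension of X plays no role, because the torus may be enlarged by coordinates that are not used.\<close>

hide_const (open) UnivPoly.coeff UnivPoly.monom Module.smult Coset.order

section \<open>Algebraic numbers and algebraic integers\<close>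

text \<open>Galois theory is done with automorphisms of \<open>qbar\<close> alone; a field enters
  only through the stabiliser of its generators. Loxton's theorem rests on Cassels' mean of the
  squared absolute values of the conjugates. It is at least 1 on nonzero integers and nearly
  additive when an element is expanded along one prime of the conductor, so a bounded mean leaves
  few nonzero coefficients, each with a smaller mean. Over K the coefficients come from Lagrange
  interpolation at a primitive element, with denominators from a finite list.

  The obstacle in lifting f is that representations by roots of unity are far from unique: for every
  point there is merely some choice of a representation of its image, with no algebraic dependence
  on the point. The graph of such a choice is a set of torsion points, and this makes it rigid. On
  tori, density is replaced by \<open>\<not> thin\<close>, a notion made for sets of torsion points;
  thin sets are closed under finite unions. The periodic torsion point comes from finiteness: if Q
  kills the entries of \<open>u\<close>, the map preserves the finite set of Q-torsion
  points.\<close>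

definition subring_C :: "complex set \<Rightarrow> bool" where
  "subring_C R \<longleftrightarrow> 0 \<in> R \<and> 1 \<in> R \<and> (\<forall>x\<in>R. \<forall>y\<in>R. x + y \<in> R \<and> x * y \<in> R \<and> - x \<in> R)"

lemma subring_C_Ints: "subring_C \<int>" and subring_C_Rats: "subring_C \<rat>"
  by (auto simp: subring_C_def)

lemma subring_C_sum: "subring_C R \<Longrightarrow> (\<And>i. i \<in> I \<Longrightarrow> f i \<in> R) \<Longrightarrow> sum f I \<in> R"
  by (induction I rule: infinite_finite_induct) (auto simp: subring_C_def)

lemma subring_C_power: "subring_C R \<Longrightarrow> x \<in> R \<Longrightarrow> x ^ n \<in> R"
  by (induction n) (auto simp: subring_C_def)

definition coeffs_in :: "complex set \<Rightarrow> complex poly \<Rightarrow> bool" where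
  "coeffs_in R p \<longleftrightarrow> (\<forall>i. coeff p i \<in> R)"

lemma coeffs_in_ring:
  assumes "subring_C R"
  shows "coeffs_in R 0" "coeffs_in R 1" "coeffs_in R p \<Longrightarrow> coeffs_in R q \<Longrightarrow> coeffs_in R (p + q)"
    "coeffs_in R p \<Longrightarrow> coeffs_in R q \<Longrightarrow> coeffs_in R (p * q)" "coeffs_in R p \<Longrightarrow> coeffs_in R (- p)"
    "a \<in> R \<Longrightarrow> coeffs_in R p \<Longrightarrow> coeffs_in R (pCons a p)"
    "coeffs_in R p \<Longrightarrow> coeffs_in R q \<Longrightarrow> coeffs_in R (p - q)"
proof -
  show "coeffs_in R p \<Longrightarrow> coeffs_in R q \<Longrightarrow> coeffs_in R (p * q)"
    unfolding coeffs_in_def coeff_mult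
    by (intro allI subring_C_sum[OF assms]) (use assms in \<open>auto simp: subring_C_def\<close>)
  have "x - y = x + (- y)" for x y :: complex by simp
  then show "coeffs_in R p \<Longrightarrow> coeffs_in R q \<Longrightarrow> coeffs_in R (p - q)"
    using assms unfolding coeffs_in_def subring_C_def by (metis coeff_diff)
qed (use assms in \<open>auto simp: coeffs_in_def subring_C_def coeff_1 coeff_pCons split: nat.splits\<close>)

lemma coeffs_in_sum: "subring_C R \<Longrightarrow> (\<And>i. i \<in> I \<Longrightarrow> coeffs_in R (f i)) \<Longrightarrow> coeffs_in R (sum f I)"
  by (induction I rule: infinite_finite_induct) (auto intro: coeffs_in_ring)

lemma coeffs_in_prod: "subring_C R \<Longrightarrow> (\<And>i. i \<in> I \<Longrightarrow> coeffs_in R (f i)) \<Longrightarrow> coeffs_in R (prod f I)"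
  by (induction I rule: infinite_finite_induct) (auto intro: coeffs_in_ring)

definition integral_over :: "complex set \<Rightarrow> complex \<Rightarrow> bool" where
  "integral_over R x \<longleftrightarrow> (\<exists>p. coeffs_in R p \<and> lead_coeff p = 1 \<and> poly p x = 0)"

definition lin_span :: "complex set \<Rightarrow> complex set \<Rightarrow> complex set" where
  "lin_span R B = {\<Sum>b\<in>B. c b * b | c. \<forall>b\<in>B. c b \<in> R}"

text \<open>The determinant trick: x is an eigenvalue of the matrix of multiplication by x on the
  generators B, and the characteristic polynomial of a matrix over R is monic with coefficients in
  R. The generator \<open>b0\<close> makes the eigenvector nonzero.\<close>

lemma integral_over_if_stable:
  assumes R: "subring_C R" and B: "finite B" "b0 \<in> B" "b0 \<noteq> 0"
    and st: "\<And>b. b \<in> B \<Longrightarrow> x * b \<in> lin_span R B"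
  shows "integral_over R x"
proof -
  obtain n b where b: "bij_betw b {0..<n::nat} B"
    using ex_bij_betw_nat_finite[OF B(1)] by auto
  have "\<exists>c. \<forall>i<n. x * b i = (\<Sum>j = 0..<n. c i j * b j) \<and> (\<forall>j<n. c i j \<in> R)"
  proof -
    have "\<forall>i. \<exists>c. i < n \<longrightarrow> x * b i = (\<Sum>j = 0..<n. c j * b j) \<and> (\<forall>j<n. c j \<in> R)"
    proof (intro allI)
      fix i
      show "\<exists>c. i < n \<longrightarrow> x * b i = (\<Sum>j = 0..<n. c j * b j) \<and> (\<forall>j<n. c j \<in> R)"
      proof (cases "i < n")
        case True
        then have "b i \<in> B" using b by (auto simp: bij_betw_def)
        then obtain c where c: "x * b i = (\<Sum>b\<in>B. c b * b)" "\<forall>b\<in>B. c b \<in> R"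
          using st by (auto simp: lin_span_def)
        have "(\<Sum>b\<in>B. c b * b) = (\<Sum>j = 0..<n. c (b j) * b j)"
          using sum.reindex_bij_betw[OF b, of "\<lambda>b. c b * b"] by simp
        with c b show ?thesis by (intro exI[of _ "\<lambda>j. c (b j)"]) (auto simp: bij_betw_def)
      qed auto
    qed
    then show ?thesis by metis
  qed
  then obtain c where c: "\<And>i. i < n \<Longrightarrow> x * b i = (\<Sum>j = 0..<n. c i j * b j)"
    and cR: "\<And>i j. i < n \<Longrightarrow> j < n \<Longrightarrow> c i j \<in> R" by blast
  define A where "A = mat n n (\<lambda>(i, j). c i j)"
  have A: "A \<in> carrier_mat n n" by (simp add: A_def)
  have "eigenvector A (vec n b) x"
  proof -
    obtain i where "i < n" "b i = b0" using b B(2) by (auto simp: bij_betw_def)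
    then have "vec n b \<noteq> 0\<^sub>v n" using B(3) by (metis index_vec index_zero_vec(1))
    moreover have "A *\<^sub>v vec n b = x \<cdot>\<^sub>v vec n b"
      by (rule eq_vecI) (auto simp: A_def scalar_prod_def c)
    ultimately show ?thesis by (simp add: eigenvector_def A_def)
  qed
  then have root: "poly (char_poly A) x = 0"
    using eigenvalue_root_char_poly[OF A] by (auto simp: eigenvalue_def)
  have "coeffs_in R (char_poly A)"
    unfolding char_poly_def det_def'[OF char_poly_matrix_closed[OF A]]
  proof (intro coeffs_in_sum[OF R])
    fix p assume "p \<in> {p. p permutes {0..<n}}"
    then have p: "\<And>i. i < n \<Longrightarrow> p i < n" using permutes_in_image by fastforce
    have "coeffs_in R (signof p)"
      using coeffs_in_ring(2,5)[OF R] by (auto simp: sign_def)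
    moreover have "coeffs_in R (\<Prod>i = 0..<n. char_poly_matrix A $$ (i, p i))"
    proof (intro coeffs_in_prod[OF R])
      fix i assume i: "i \<in> {0..<n}"
      have "char_poly_matrix A $$ (i, p i) = (if i = p i then [:0, 1:] else 0) + [: - c i (p i) :]"
        using i p[of i] by (auto simp: char_poly_matrix_def A_def)
      moreover have "- c i (p i) \<in> R" using i p[of i] cR[of i "p i"] R by (auto simp: subring_C_def)
      ultimately show "coeffs_in R (char_poly_matrix A $$ (i, p i))"
        using R by (auto intro!: coeffs_in_ring[OF R] simp: subring_C_def)
    qed
    ultimately show "coeffs_in R (signof p * (\<Prod>i = 0..<n. char_poly_matrix A $$ (i, p i)))"
      by (rule coeffs_in_ring(4)[OF R])
  qed
  then show ?thesis
    using root degree_monic_char_poly[OF A] by (auto simp: integral_over_def)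
qed

lemma lin_spanI: "(\<Sum>b\<in>B. c b * b) \<in> lin_span R B" if "\<And>b. b \<in> B \<Longrightarrow> c b \<in> R"
  using that by (auto simp: lin_span_def)

lemma lin_span_add:
  assumes "subring_C R" "u \<in> lin_span R B" "v \<in> lin_span R B"
  shows "u + v \<in> lin_span R B"
proof -
  obtain c d where "u = (\<Sum>b\<in>B. c b * b)" "v = (\<Sum>b\<in>B. d b * b)" "\<forall>b\<in>B. c b \<in> R" "\<forall>b\<in>B. d b \<in> R"
    using assms(2,3) by (auto simp: lin_span_def)
  then have "u + v = (\<Sum>b\<in>B. (c b + d b) * b)" "\<forall>b\<in>B. c b + d b \<in> R"
    using assms(1) by (auto simp: sum.distrib algebra_simps subring_C_def)
  then show ?thesis by (auto simp: lin_span_def)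
qed

lemma lin_span_scale:
  assumes "subring_C R" "a \<in> R" "u \<in> lin_span R B"
  shows "a * u \<in> lin_span R B"
proof -
  obtain c where "u = (\<Sum>b\<in>B. c b * b)" "\<forall>b\<in>B. c b \<in> R"
    using assms(3) by (auto simp: lin_span_def)
  then have "a * u = (\<Sum>b\<in>B. (a * c b) * b)" "\<forall>b\<in>B. a * c b \<in> R"
    using assms(1,2) by (auto simp: sum_distrib_left algebra_simps subring_C_def)
  then show ?thesis by (auto simp: lin_span_def)
qed

lemma lin_span_0: "subring_C R \<Longrightarrow> 0 \<in> lin_span R B"
  using lin_spanI[of B "\<lambda>_. 0" R] by (auto simp: subring_C_def)

lemma lin_span_sum:
  "subring_C R \<Longrightarrow> (\<And>i. i \<in> I \<Longrightarrow> f i \<in> lin_span R B) \<Longrightarrow> sum f I \<in> lin_span R B"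
  by (induction I rule: infinite_finite_induct) (auto intro: lin_span_0 lin_span_add)

lemma lin_span_base: "subring_C R \<Longrightarrow> finite B \<Longrightarrow> b \<in> B \<Longrightarrow> b \<in> lin_span R B"
  using lin_spanI[of B "\<lambda>x. if x = b then 1 else 0" R]
  by (auto simp: subring_C_def if_distrib[of "\<lambda>x. x * _"] sum.delta cong: if_cong)

text \<open>A monic equation rewrites x^n through lower powers, so the span of the
  \<open>x ^ k * y\<close> with k < n is stable under multiplication by x. The free factor y and the
  arbitrary set B allow products of powers of two integral elements to be treated one variable at a
  time.\<close>

lemma integral_over_stable_powers:
  assumes R: "subring_C R" and x: "integral_over R x"
  shows "\<exists>n>0. \<forall>B y i. finite B \<longrightarrow> i < n \<longrightarrow> (\<forall>k<n. x ^ k * y \<in> B) \<longrightarrow> x * (x ^ i * y) \<in> lin_span R B"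
proof -
  obtain p where p: "coeffs_in R p" "lead_coeff p = 1" "poly p x = 0"
    using x by (auto simp: integral_over_def)
  define n where "n = degree p"
  have "n > 0"
  proof (rule ccontr)
    assume "\<not> n > 0"
    then have "p = [:1:]" using p(2) degree_0_id[of p] unfolding n_def by force
    then show False using p(3) by simp
  qed
  have xn: "x ^ n = (\<Sum>k<n. - coeff p k * x ^ k)"
  proof -
    have "0 = (\<Sum>k\<le>n. coeff p k * x ^ k)" using p(3) by (simp add: poly_altdef n_def)
    also have "\<dots> = x ^ n + (\<Sum>k<n. coeff p k * x ^ k)"
      using p(2) by (simp add: n_def lessThan_Suc_atMost[symmetric])
    finally have "x ^ n = - (\<Sum>k<n. coeff p k * x ^ k)"
      by (metis add_eq_0_iff2)
    then show ?thesis by (simp add: sum_negf)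
  qed
  show ?thesis
  proof (intro exI[of _ n] conjI allI impI \<open>n > 0\<close>)
    fix B y i assume B: "finite B" and i: "i < n" and mem': "\<forall>k<n. x ^ k * y \<in> B"
    then have mem: "\<And>k. k < n \<Longrightarrow> x ^ k * y \<in> B" by blast
    show "x * (x ^ i * y) \<in> lin_span R B"
    proof (cases "Suc i < n")
      case True
      then show ?thesis using lin_span_base[OF R B mem[OF True]] by (simp add: mult.assoc)
    next
      case False
      then have "n = Suc i" using i by simp
      then have "x * (x ^ i * y) = x ^ n * y" by (simp add: mult.assoc)
      also have "\<dots> = (\<Sum>k<n. - coeff p k * (x ^ k * y))"
        unfolding xn by (simp add: sum_distrib_right mult.assoc)
      also have "\<dots> \<in> lin_span R B"
        using p(1) R mem B
        by (intro lin_span_sum lin_span_scale lin_span_base) (auto simp: coeffs_in_def subring_C_def)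
      finally show ?thesis .
    qed
  qed
qed

text \<open>The monomials x^i y^j below both degrees generate a module that is stable under x and
  under y, hence under the sum and the product.\<close>

lemma integral_over_add_mult:
  assumes R: "subring_C R" and x: "integral_over R x" and y: "integral_over R y"
  shows "integral_over R (x + y)" "integral_over R (x * y)"
proof -
  obtain n where n: "n > 0" "\<And>B z i. finite B \<Longrightarrow> i < n \<Longrightarrow> (\<forall>k<n. x ^ k * z \<in> B) \<Longrightarrow> x * (x ^ i * z) \<in> lin_span R B"
    using integral_over_stable_powers[OF R x] by metis
  obtain m where m: "m > 0" "\<And>B z i. finite B \<Longrightarrow> i < m \<Longrightarrow> (\<forall>k<m. y ^ k * z \<in> B) \<Longrightarrow> y * (y ^ i * z) \<in> lin_span R B"
    using integral_over_stable_powers[OF R y] by metis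
  define B where "B = (\<lambda>(i, j). x ^ i * y ^ j) ` ({..<n} \<times> {..<m})"
  have fin: "finite B" by (simp add: B_def)
  have mem: "x ^ i * y ^ j \<in> B" if "i < n" "j < m" for i j using that by (auto simp: B_def)
  have one: "1 \<in> B" using mem[of 0 0] n(1) m(1) by simp
  have sx: "x * b \<in> lin_span R B" if b: "b \<in> B" for b
  proof -
    obtain i j where "i < n" "j < m" "b = x ^ i * y ^ j" using b by (auto simp: B_def)
    then show ?thesis using n(2)[OF fin, of i "y ^ j"] mem by auto
  qed
  have sy: "y * b \<in> lin_span R B" if b: "b \<in> B" for b
  proof -
    obtain i j where "i < n" "j < m" "b = y ^ j * x ^ i" using b by (auto simp: B_def mult.commute)
    then show ?thesis using m(2)[OF fin, of j "x ^ i"] mem by (auto simp: mult.commute)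
  qed
  show "integral_over R (x + y)"
    by (rule integral_over_if_stable[OF R fin one])
      (auto simp: distrib_right intro!: lin_span_add R sx sy)
  show "integral_over R (x * y)"
  proof (rule integral_over_if_stable[OF R fin one])
    fix b assume "b \<in> B"
    then obtain c where c: "y * b = (\<Sum>b\<in>B. c b * b)" "\<forall>b\<in>B. c b \<in> R" using sy[of b] by (auto simp: lin_span_def)
    have "x * y * b = (\<Sum>b\<in>B. c b * (x * b))"
      using c(1) by (simp add: mult.assoc sum_distrib_left mult.left_commute)
    also have "\<dots> \<in> lin_span R B" using c(2) by (intro lin_span_sum lin_span_scale R sx) auto
    finally show "x * y * b \<in> lin_span R B" .
  qed simp
qed

section \<open>Closure properties of algebraic numbers and algebraic integers\<close>

lemma algebraic_int_iff_integral_over: "algebraic_int x \<longleftrightarrow> integral_over \<int> x"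
  by (auto simp: algebraic_int.simps integral_over_def coeffs_in_def)

lemma algebraic_iff_integral_over: "algebraic x \<longleftrightarrow> integral_over \<rat> x" for x :: complex
proof
  assume "algebraic x"
  then obtain p where p: "\<forall>i. coeff p i \<in> \<rat>" "p \<noteq> 0" "poly p x = 0"
    using algebraic_altdef[of x] by blast
  define q where "q = smult (inverse (lead_coeff p)) p"
  have "coeffs_in \<rat> q" "lead_coeff q = 1" "poly q x = 0" using p by (auto simp: q_def coeffs_in_def)
  then show "integral_over \<rat> x" by (auto simp: integral_over_def)
next
  assume "integral_over \<rat> x"
  then obtain p where "coeffs_in \<rat> p" "lead_coeff p = 1" "poly p x = 0" by (auto simp: integral_over_def)
  then have "p \<noteq> 0 \<and> (\<forall>i. coeff p i \<in> \<rat>) \<and> poly p x = 0" by (auto simp: coeffs_in_def)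
  then show "algebraic x" using algebraic_altdef[of x] by blast
qed

lemma algebraic_int_add: "algebraic_int x \<Longrightarrow> algebraic_int y \<Longrightarrow> algebraic_int (x + y)"
  and algebraic_int_mult: "algebraic_int x \<Longrightarrow> algebraic_int y \<Longrightarrow> algebraic_int (x * y)" for x y :: complex
  using integral_over_add_mult[OF subring_C_Ints] by (auto simp: algebraic_int_iff_integral_over)

lemma algebraic_int_diff: "algebraic_int x \<Longrightarrow> algebraic_int y \<Longrightarrow> algebraic_int (x - y)" for x y :: complex
  using algebraic_int_add[of x "- y"] by (auto intro: algebraic_int_minus)

lemma algebraic_int_sum: "(\<And>i. i \<in> I \<Longrightarrow> algebraic_int (f i)) \<Longrightarrow> algebraic_int (sum f I :: complex)"
  by (induction I rule: infinite_finite_induct) (auto intro: algebraic_int_add)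

lemma algebraic_int_prod: "(\<And>i. i \<in> I \<Longrightarrow> algebraic_int (f i)) \<Longrightarrow> algebraic_int (prod f I :: complex)"
  by (induction I rule: infinite_finite_induct) (auto intro: algebraic_int_mult)

lemma algebraic_int_power: "algebraic_int x \<Longrightarrow> algebraic_int (x ^ n :: complex)"
  by (induction n) (auto intro: algebraic_int_mult)

lemma qbar_0 [simp]: "0 \<in> qbar" and qbar_1 [simp]: "1 \<in> qbar"
  by (auto simp: qbar_def intro: algebraic_int_imp_algebraic)

lemma qbar_add: "x \<in> qbar \<Longrightarrow> y \<in> qbar \<Longrightarrow> x + y \<in> qbar"
  and qbar_mult: "x \<in> qbar \<Longrightarrow> y \<in> qbar \<Longrightarrow> x * y \<in> qbar"
  using integral_over_add_mult[OF subring_C_Rats] by (auto simp: qbar_def algebraic_iff_integral_over)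

lemma qbar_uminus: "x \<in> qbar \<Longrightarrow> - x \<in> qbar" and qbar_inverse: "x \<in> qbar \<Longrightarrow> inverse x \<in> qbar"
  by (auto simp: qbar_def)

lemma qbar_diff: "x \<in> qbar \<Longrightarrow> y \<in> qbar \<Longrightarrow> x - y \<in> qbar"
  using qbar_add[of x "- y"] qbar_uminus by simp

lemma qbar_divide: "x \<in> qbar \<Longrightarrow> y \<in> qbar \<Longrightarrow> x / y \<in> qbar"
  by (simp add: divide_inverse qbar_mult qbar_inverse)

lemma qbar_sum: "(\<And>i. i \<in> I \<Longrightarrow> f i \<in> qbar) \<Longrightarrow> sum f I \<in> qbar"
  by (induction I rule: infinite_finite_induct) (auto intro: qbar_add)

lemma qbar_prod: "(\<And>i. i \<in> I \<Longrightarrow> f i \<in> qbar) \<Longrightarrow> prod f I \<in> qbar"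
  by (induction I rule: infinite_finite_induct) (auto intro: qbar_mult)

lemma qbar_power: "x \<in> qbar \<Longrightarrow> x ^ n \<in> qbar"
  by (induction n) (auto intro: qbar_mult)

lemma qbar_powi: "x \<in> qbar \<Longrightarrow> x powi n \<in> qbar"
  by (auto simp: power_int_def intro: qbar_power qbar_inverse)

lemma Rats_subset_qbar: "\<rat> \<subseteq> qbar"
proof
  fix x :: complex assume "x \<in> \<rat>"
  then have "coeffs_in \<rat> [:-x, 1:]" "lead_coeff [:-x, 1:] = 1" "poly [:-x, 1:] x = 0"
    by (auto simp: coeffs_in_def coeff_pCons split: nat.splits)
  then have "integral_over \<rat> x" unfolding integral_over_def by blast
  then show "x \<in> qbar" by (simp add: qbar_def algebraic_iff_integral_over)
qed

text \<open>Multiplication by x stabilises the rational span of B, so the determinant trick applies;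
  some element of B is nonzero because 1 lies in the span.\<close>

lemma number_field_subset_qbar:
  assumes "number_field K"
  shows "K \<subseteq> qbar"
proof
  fix x assume x: "x \<in> K"
  obtain B where B: "finite B" "B \<subseteq> K" "K \<subseteq> {\<Sum>b\<in>B. of_rat (c b) * b | c. True}"
    using assms by (auto simp: number_field_def)
  have K: "1 \<in> K" "\<And>x y. x \<in> K \<Longrightarrow> y \<in> K \<Longrightarrow> x * y \<in> K"
    using assms by (auto simp: number_field_def subfield_C_def)
  obtain c where "1 = (\<Sum>b\<in>B. of_rat (c b) * b)" using K(1) B(3) by blast
  then obtain b0 where "b0 \<in> B" "b0 \<noteq> 0"
    by (metis (no_types, lifting) mult_eq_0_iff sum.neutral zero_neq_one)
  moreover have "x * b \<in> lin_span \<rat> B" if "b \<in> B" for b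
  proof -
    have "x * b \<in> K" using K(2)[OF x] that B(2) by auto
    then obtain c where "x * b = (\<Sum>b\<in>B. of_rat (c b) * b)" using B(3) by blast
    then show ?thesis by (auto intro!: lin_spanI)
  qed
  ultimately have "integral_over \<rat> x"
    using integral_over_if_stable[OF subring_C_Rats B(1)] by blast
  then show "x \<in> qbar" by (simp add: qbar_def algebraic_iff_integral_over)
qed

section \<open>Automorphisms of the algebraic numbers\<close>

text \<open>Graphs of isomorphisms between subrings of \<open>qbar\<close>; a maximal one is a total automorphism.\<close>
definition partial_iso :: "(complex \<times> complex) set \<Rightarrow> bool" where
  "partial_iso r \<longleftrightarrow> r \<subseteq> qbar \<times> qbar \<and> (1, 1) \<in> r \<and>
     (\<forall>(x, x') \<in> r. (- x, - x') \<in> r \<and> (x = 0 \<longleftrightarrow> x' = 0)) \<and>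
     (\<forall>(x, x') \<in> r. \<forall>(y, y') \<in> r. (x + y, x' + y') \<in> r \<and> (x * y, x' * y') \<in> r)"

text \<open>A polynomial together with its image under the isomorphism with graph r. The relational
  form suits an r that is not total while it is being extended, and it treats both sides
  symmetrically.\<close>

definition poly_pairs :: "(complex \<times> complex) set \<Rightarrow> (complex poly \<times> complex poly) set" where
  "poly_pairs r = {(p, p'). \<forall>i. (coeff p i, coeff p' i) \<in> r}"

lemma partial_isoD:
  assumes "partial_iso r"
  shows "(0, 0) \<in> r" "(1, 1) \<in> r" "(x, x') \<in> r \<Longrightarrow> (- x, - x') \<in> r" "(x, x') \<in> r \<Longrightarrow> x = 0 \<longleftrightarrow> x' = 0"
    "(x, x') \<in> r \<Longrightarrow> (y, y') \<in> r \<Longrightarrow> (x + y, x' + y') \<in> r"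
    "(x, x') \<in> r \<Longrightarrow> (y, y') \<in> r \<Longrightarrow> (x * y, x' * y') \<in> r"
    "(x, x') \<in> r \<Longrightarrow> x \<in> qbar \<and> x' \<in> qbar"
proof -
  have *: "(1, 1) \<in> r" "(-1, -1) \<in> r" using assms by (auto simp: partial_iso_def)
  have "(1 + -1, 1 + -1) \<in> r"
    using assms * unfolding partial_iso_def by blast
  then show "(0, 0) \<in> r" by simp
qed (use assms in \<open>auto simp: partial_iso_def\<close>)

lemma partial_iso_sum:
  "partial_iso r \<Longrightarrow> (\<And>i. i \<in> I \<Longrightarrow> (f i, g i) \<in> r) \<Longrightarrow> (sum f I, sum g I) \<in> r"
  by (induction I rule: infinite_finite_induct) (auto intro: partial_isoD)

lemma partial_iso_int: assumes "partial_iso r" shows "(of_int n, of_int n) \<in> r"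
proof -
  have nat: "(of_nat k, of_nat k) \<in> r" for k
    by (induction k) (auto intro: partial_isoD[OF assms])
  show ?thesis
  proof (cases "n \<ge> 0")
    case True
    then show ?thesis using nat[of "nat n"] by simp
  next
    case False
    then show ?thesis using partial_isoD(3)[OF assms nat[of "nat (-n)"]] by simp
  qed
qed

lemma poly_pairs_ring:
  assumes "partial_iso r"
  shows "(0, 0) \<in> poly_pairs r" "(p, p') \<in> poly_pairs r \<Longrightarrow> (q, q') \<in> poly_pairs r \<Longrightarrow> (p + q, p' + q') \<in> poly_pairs r"
    "(p, p') \<in> poly_pairs r \<Longrightarrow> (q, q') \<in> poly_pairs r \<Longrightarrow> (p * q, p' * q') \<in> poly_pairs r"
    "(p, p') \<in> poly_pairs r \<Longrightarrow> (- p, - p') \<in> poly_pairs r"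
    "(a, a') \<in> r \<Longrightarrow> (p, p') \<in> poly_pairs r \<Longrightarrow> (smult a p, smult a' p') \<in> poly_pairs r"
    "(a, a') \<in> r \<Longrightarrow> (monom a n, monom a' n) \<in> poly_pairs r"
    "(a, a') \<in> r \<Longrightarrow> (p, p') \<in> poly_pairs r \<Longrightarrow> (pCons a p, pCons a' p') \<in> poly_pairs r"
    "(p, p') \<in> poly_pairs r \<Longrightarrow> (q, q') \<in> poly_pairs r \<Longrightarrow> (p - q, p' - q') \<in> poly_pairs r"
proof -
  show "(p, p') \<in> poly_pairs r \<Longrightarrow> (q, q') \<in> poly_pairs r \<Longrightarrow> (p * q, p' * q') \<in> poly_pairs r"
    unfolding poly_pairs_def coeff_mult
    by (auto intro!: partial_iso_sum[OF assms] partial_isoD(6)[OF assms] simp: coeff_mult)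
  have "x - y = x + (- y)" for x y :: complex by simp
  then show "(p, p') \<in> poly_pairs r \<Longrightarrow> (q, q') \<in> poly_pairs r \<Longrightarrow> (p - q, p' - q') \<in> poly_pairs r"
    unfolding poly_pairs_def using partial_isoD(5)[OF assms _ partial_isoD(3)[OF assms]] by auto
qed (use assms in \<open>auto simp: poly_pairs_def coeff_pCons intro: partial_isoD split: nat.splits\<close>)

lemma poly_pairs_degree:
  assumes "partial_iso r" "(p, p') \<in> poly_pairs r"
  shows "degree p = degree p'" "p = 0 \<longleftrightarrow> p' = 0"
proof -
  have *: "coeff p i = 0 \<longleftrightarrow> coeff p' i = 0" for i
    using assms partial_isoD(4)[OF assms(1)] by (auto simp: poly_pairs_def)
  show "degree p = degree p'"
    by (rule antisym; rule degree_le) (use * in \<open>metis coeff_eq_0\<close>)+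
  show "p = 0 \<longleftrightarrow> p' = 0" using * by (auto simp: poly_eq_iff)
qed

text \<open>Pseudo-division: r relates only subrings, so p has to be multiplied by a nonzero c built
  from the leading coefficient of m. Performing the same steps on both sides keeps quotients and
  remainders related.\<close>

lemma poly_pairs_division:
  assumes r: "partial_iso r" and p: "(p, p') \<in> poly_pairs r" and m: "(m, m') \<in> poly_pairs r" "m \<noteq> 0"
  shows "\<exists>c c' q q' s s'. c \<noteq> 0 \<and> (c, c') \<in> r \<and> (q, q') \<in> poly_pairs r \<and> (s, s') \<in> poly_pairs r \<and>
     smult c p = q * m + s \<and> smult c' p' = q' * m' + s' \<and> (s = 0 \<or> degree s < degree m)"
  using p
proof (induction "degree p" arbitrary: p p' rule: less_induct)
  case less
  note pp = less.prems
  show ?case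
  proof (cases "p = 0 \<or> degree p < degree m")
    case True
    then show ?thesis
      by (intro exI[of _ 1] exI[of _ 0] exI[of _ p] exI[of _ p'])
        (use pp partial_isoD(2)[OF r] poly_pairs_ring(1)[OF r] in auto)
  next
    case False
    then have ge: "degree m \<le> degree p" and p0: "p \<noteq> 0" by auto
    define c where "c = lead_coeff m" define c' where "c' = lead_coeff m'"
    define d where "d = lead_coeff p" define d' where "d' = lead_coeff p'"
    define k where "k = degree p - degree m"
    have deg: "degree m = degree m'" "degree p = degree p'"
      using poly_pairs_degree[OF r] m pp by auto
    have cd: "(c, c') \<in> r" "(d, d') \<in> r" "c \<noteq> 0" "d \<noteq> 0"
      unfolding c_def c'_def d_def d'_def using m pp p0 by (simp_all add: poly_pairs_def deg[symmetric])
    define t where "t = smult c p - monom d k * m"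
    define t' where "t' = smult c' p' - monom d' k * m'"
    have tt: "(t, t') \<in> poly_pairs r"
      unfolding t_def t'_def using cd m pp by (intro poly_pairs_ring[OF r])
    have dt: "t = 0 \<or> degree t < degree p"
    proof (cases "degree p = 0")
      case True
      then have k: "k = 0" "degree m = 0" using ge by (auto simp: k_def)
      have "p = [:d:]" "m = [:c:]" using True k(2) by (auto simp: d_def c_def degree_0_id)
      then have "t = 0" using k by (simp add: t_def monom_0 mult.commute)
      then show ?thesis ..
    next
      case False
      have "degree (monom d k * m) = degree p" "degree (smult c p) = degree p"
        using cd m ge by (auto simp: degree_mult_eq degree_monom_eq k_def)
      then have le: "degree t \<le> degree p" unfolding t_def by (intro degree_diff_le) auto
      have "coeff (monom d k * m) (degree p) = d * c"
        using ge by (simp add: coeff_monom_mult k_def c_def)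
      then have "coeff t (degree p) = 0"
        by (simp add: t_def d_def c_def)
      then have "t = 0 \<or> degree t \<noteq> degree p" by (metis leading_coeff_0_iff)
      then show ?thesis using le by linarith
    qed
    have "\<exists>e e' q q' s s'. e \<noteq> 0 \<and> (e, e') \<in> r \<and> (q, q') \<in> poly_pairs r \<and> (s, s') \<in> poly_pairs r \<and>
      smult e t = q * m + s \<and> smult e' t' = q' * m' + s' \<and> (s = 0 \<or> degree s < degree m)"
    proof (cases "t = 0")
      case True
      then have "t' = 0" using poly_pairs_degree(2)[OF r tt] by simp
      with True show ?thesis using partial_isoD(2)[OF r] poly_pairs_ring(1)[OF r]
        by (intro exI[of _ 1] exI[of _ 0]) auto
    next
      case False
      then show ?thesis using less.hyps[of t t'] dt tt by blast
    qed
    then obtain e e' q q' s s' where *: "e \<noteq> 0" "(e, e') \<in> r" "(q, q') \<in> poly_pairs r" "(s, s') \<in> poly_pairs r"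
      "smult e t = q * m + s" "smult e' t' = q' * m' + s'" "s = 0 \<or> degree s < degree m" by blast
    have "smult (e * c) p = (q + smult e (monom d k)) * m + s"
      using *(5) by (simp add: t_def smult_diff_right algebra_simps)
    moreover have "smult (e' * c') p' = (q' + smult e' (monom d' k)) * m' + s'"
      using *(6) by (simp add: t'_def smult_diff_right algebra_simps)
    moreover have "(e * c, e' * c') \<in> r" "e * c \<noteq> 0" using * cd partial_isoD(6)[OF r] by auto
    moreover have "(q + smult e (monom d k), q' + smult e' (monom d' k)) \<in> poly_pairs r"
      using * cd by (intro poly_pairs_ring[OF r])
    ultimately show ?thesis using *(4,7) by blast
  qed
qed

text \<open>Evaluating related pairs at a and at b gives the graph of a larger isomorphism, provided
  that p vanishes at a exactly when p' vanishes at b. Both directions use pseudo-division by a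
  polynomial of least degree, chosen separately for a and for b.\<close>

lemma partial_iso_extend:
  assumes r: "partial_iso r" and a: "a \<in> qbar"
    and m: "(m, m') \<in> poly_pairs r" "m \<noteq> 0" "poly m a = 0"
    and min: "\<And>p p'. (p, p') \<in> poly_pairs r \<Longrightarrow> p \<noteq> 0 \<Longrightarrow> poly p a = 0 \<Longrightarrow> degree m \<le> degree p"
    and b: "poly m' b = 0"
  shows "\<exists>r'. partial_iso r' \<and> r \<subseteq> r' \<and> (a, b) \<in> r'"
proof -
  note PP = poly_pairs_ring[OF r] and rD = partial_isoD[OF r]
  have ab: "poly p' b = 0" if p: "(p, p') \<in> poly_pairs r" "poly p a = 0" for p p'
  proof -
    obtain c c' q q' s s' where *: "c \<noteq> 0" "(c, c') \<in> r" "(q, q') \<in> poly_pairs r" "(s, s') \<in> poly_pairs r"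
      "smult c p = q * m + s" "smult c' p' = q' * m' + s'" "s = 0 \<or> degree s < degree m"
      using poly_pairs_division[OF r p(1) m(1,2)] by blast
    have "poly s a = 0" using arg_cong[OF *(5), of "\<lambda>p. poly p a"] p m by simp
    then have "s = 0" using min[OF *(4)] *(7) by fastforce
    then have "s' = 0" using poly_pairs_degree(2)[OF r *(4)] by simp
    then have "c' * poly p' b = 0" using arg_cong[OF *(6), of "\<lambda>p. poly p b"] b by simp
    then show ?thesis using * rD(4)[OF *(2)] by simp
  qed
  \<comment> \<open>Minimality of \<open>m\<close> is known only at a, so a polynomial of least
    degree at b is chosen anew. If it did not vanish at a, the cofactor of \<open>m\<close> would,
    and its degree forces \<open>n\<close> to be constant.\<close>
  define Q where "Q = {n. \<exists>n'. (n, n') \<in> poly_pairs r \<and> n \<noteq> 0 \<and> poly n' b = 0}"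
  have "m \<in> Q" using m b by (auto simp: Q_def)
  then obtain n where "n \<in> Q" "\<And>k. k \<in> Q \<Longrightarrow> degree n \<le> degree k"
    using ex_has_least_nat[of "\<lambda>n. n \<in> Q" m degree] by blast
  then obtain n' where n: "(n, n') \<in> poly_pairs r" "n \<noteq> 0" "poly n' b = 0"
    and nmin: "\<And>p p'. (p, p') \<in> poly_pairs r \<Longrightarrow> p \<noteq> 0 \<Longrightarrow> poly p' b = 0 \<Longrightarrow> degree n \<le> degree p"
    unfolding Q_def by blast
  have div: "\<exists>c q. c \<noteq> 0 \<and> (\<exists>q'. (q, q') \<in> poly_pairs r) \<and> smult c p = q * n"
    if p: "(p, p') \<in> poly_pairs r" "poly p' b = 0" for p p'
  proof -
    obtain c c' q q' s s' where *: "c \<noteq> 0" "(c, c') \<in> r" "(q, q') \<in> poly_pairs r" "(s, s') \<in> poly_pairs r"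
      "smult c p = q * n + s" "smult c' p' = q' * n' + s'" "s = 0 \<or> degree s < degree n"
      using poly_pairs_division[OF r p(1) n(1,2)] by blast
    have "poly s' b = 0" using arg_cong[OF *(6), of "\<lambda>p. poly p b"] p n by simp
    then have "s = 0" using nmin[OF *(4)] *(7) by fastforce
    then show ?thesis using * by auto
  qed
  have na: "poly n a = 0"
  proof (rule ccontr)
    assume na: "poly n a \<noteq> 0"
    obtain c q q' where q: "c \<noteq> 0" "(q, q') \<in> poly_pairs r" "smult c m = q * n"
      using div[OF m(1) b] by blast
    have "q \<noteq> 0" using q m by auto
    have "poly q a = 0" using arg_cong[OF q(3), of "\<lambda>p. poly p a"] m na by simp
    then have "degree m \<le> degree q" using min[OF q(2) \<open>q \<noteq> 0\<close>] by simp
    moreover have "degree m = degree q + degree n"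
      using arg_cong[OF q(3), of degree] q(1) \<open>q \<noteq> 0\<close> n(2) by (simp add: degree_mult_eq)
    ultimately have "degree n = 0" by simp
    then have "degree n' = 0" "n' \<noteq> 0" using poly_pairs_degree[OF r n(1)] n(2) by auto
    then show False using n(3) by (metis degree_0_id poly_const_conv pCons_eq_0_iff)
  qed
  have ba: "poly p a = 0" if p: "(p, p') \<in> poly_pairs r" "poly p' b = 0" for p p'
  proof -
    obtain c q where q: "c \<noteq> 0" "smult c p = q * n" using div[OF p] by blast
    show ?thesis using arg_cong[OF q(2), of "\<lambda>p. poly p a"] q(1) na by simp
  qed
  define r' where "r' = {(poly p a, poly p' b) | p p'. (p, p') \<in> poly_pairs r}"
  have rI: "(poly p a, poly p' b) \<in> r'" if "(p, p') \<in> poly_pairs r" for p p' using that by (auto simp: r'_def)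
  have const: "(x, x') \<in> r'" if "(x, x') \<in> r" for x x' using rI[OF PP(7)[OF that PP(1)]] by simp
  \<comment> \<open>Integer polynomials are related to themselves, so b satisfies an integral
    equation of a and is algebraic.\<close>
  obtain z where z: "\<forall>i. coeff z i \<in> \<int>" "z \<noteq> 0" "poly z a = 0" using a by (auto simp: qbar_def algebraic_def)
  have zz: "(z, z) \<in> poly_pairs r"
    using z partial_iso_int[OF r] by (auto simp: poly_pairs_def elim!: Ints_cases) (metis Ints_cases)
  have "poly z b = 0" using ab[OF zz] z by simp
  then have bq: "b \<in> qbar" using z by (auto simp: qbar_def algebraic_def)
  have val: "poly p x \<in> qbar" if "\<forall>i. coeff p i \<in> qbar" "x \<in> qbar" for p :: "complex poly" and x
    unfolding poly_altdef using that by (intro qbar_sum qbar_mult qbar_power) auto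
  have "partial_iso r'"
    unfolding partial_iso_def
  proof (intro conjI ballI, goal_cases)
    case 1
    show ?case using val a bq rD(7) unfolding r'_def poly_pairs_def by blast
  next
    case 2
    show ?case using const rD by blast
  next
    case (3 x)
    then obtain p p' where p: "(p, p') \<in> poly_pairs r" "x = (poly p a, poly p' b)" by (auto simp: r'_def)
    then show ?case using rI[OF PP(4)[OF p(1)]] ab[OF p(1)] ba[OF p(1)] by auto
  next
    case (4 x)
    then obtain p p' where p: "(p, p') \<in> poly_pairs r" "x = (poly p a, poly p' b)" by (auto simp: r'_def)
    show ?case unfolding p(2) case_prod_conv
    proof (intro ballI)
      fix y assume "y \<in> r'"
      then obtain q q' where q: "(q, q') \<in> poly_pairs r" "y = (poly q a, poly q' b)" by (auto simp: r'_def)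
      show "case y of (y, y') \<Rightarrow> (poly p a + y, poly p' b + y') \<in> r' \<and> (poly p a * y, poly p' b * y') \<in> r'"
        using rI[OF PP(2)[OF p(1) q(1)]] rI[OF PP(3)[OF p(1) q(1)]] q(2) by simp
    qed
  qed
  moreover have "(a, b) \<in> r'"
    using rI[OF PP(7)[OF rD(1) PP(7)[OF rD(2) PP(1)]]] by simp
  ultimately show ?thesis using const by (auto simp: subrelI)
qed

lemma minimal_poly_pair:
  assumes r: "partial_iso r" and a: "a \<in> qbar"
  obtains m m' where "(m, m') \<in> poly_pairs r" "m \<noteq> 0" "poly m a = 0" "degree m' > 0"
    "\<And>p p'. (p, p') \<in> poly_pairs r \<Longrightarrow> p \<noteq> 0 \<Longrightarrow> poly p a = 0 \<Longrightarrow> degree m \<le> degree p"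
proof -
  define Q where "Q = {n. \<exists>n'. (n, n') \<in> poly_pairs r \<and> n \<noteq> 0 \<and> poly n a = 0}"
  obtain z where z: "\<forall>i. coeff z i \<in> \<int>" "z \<noteq> 0" "poly z a = 0" using a by (auto simp: qbar_def algebraic_def)
  have zz: "(z, z) \<in> poly_pairs r"
    using z partial_iso_int[OF r] by (auto simp: poly_pairs_def) (metis Ints_cases)
  then have "z \<in> Q" using z by (auto simp: Q_def)
  then obtain n where "n \<in> Q" "\<And>k. k \<in> Q \<Longrightarrow> degree n \<le> degree k"
    using ex_has_least_nat[of "\<lambda>n. n \<in> Q" z degree] by blast
  then obtain n' where n: "(n, n') \<in> poly_pairs r" "n \<noteq> 0" "poly n a = 0"
    and nmin: "\<And>p p'. (p, p') \<in> poly_pairs r \<Longrightarrow> p \<noteq> 0 \<Longrightarrow> poly p a = 0 \<Longrightarrow> degree n \<le> degree p"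
    unfolding Q_def by blast
  have "degree n \<noteq> 0" using n by (metis degree_0_id poly_const_conv pCons_eq_0_iff)
  then have "degree n' > 0" using poly_pairs_degree(1)[OF r n(1)] by simp
  then show ?thesis using that n nmin by blast
qed

lemma partial_iso_converse: "partial_iso r \<Longrightarrow> partial_iso (r\<inverse>)"
  using partial_isoD[of r] unfolding partial_iso_def[of "r\<inverse>"] by auto

text \<open>The values outside \<open>qbar\<close> are unspecified.\<close>
definition gal :: "(complex \<Rightarrow> complex) \<Rightarrow> bool" where
  "gal \<sigma> \<longleftrightarrow> bij_betw \<sigma> qbar qbar \<and>
     (\<forall>x\<in>qbar. \<forall>y\<in>qbar. \<sigma> (x + y) = \<sigma> x + \<sigma> y \<and> \<sigma> (x * y) = \<sigma> x * \<sigma> y)"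

lemma partial_iso_Union:
  assumes "C \<noteq> {}" and CA: "\<And>r. r \<in> C \<Longrightarrow> partial_iso r"
    and tot: "\<And>u v. u \<in> \<Union>C \<Longrightarrow> v \<in> \<Union>C \<Longrightarrow> \<exists>r\<in>C. u \<in> r \<and> v \<in> r"
  shows "partial_iso (\<Union>C)"
    unfolding partial_iso_def
  proof (intro conjI ballI, goal_cases)
    case 1 show ?case by (rule Union_least) (use CA in \<open>simp add: partial_iso_def\<close>)
  next
    case 2
    obtain t where "t \<in> C" using assms(1) by blast
    then show ?case using CA[of t] partial_isoD(2)[of t] by blast
  next
    case (3 x)
    then obtain t where t: "t \<in> C" "x \<in> t" by blast
    then have "partial_iso t" "(fst x, snd x) \<in> t" using CA by auto
    then have "(- fst x, - snd x) \<in> t" "fst x = 0 \<longleftrightarrow> snd x = 0" using partial_isoD(3,4) by metis+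
    then show ?case using t(1) by (auto simp: case_prod_beta)
  next
    case (4 x)
    have "(fst x + fst y, snd x + snd y) \<in> \<Union>C \<and> (fst x * fst y, snd x * snd y) \<in> \<Union>C" if y: "y \<in> \<Union>C" for y
    proof -
      obtain t where t: "t \<in> C" "x \<in> t" "y \<in> t" using tot[OF 4 y] by blast
      then have "partial_iso t" "(fst x, snd x) \<in> t" "(fst y, snd y) \<in> t" using CA by auto
      then have "(fst x + fst y, snd x + snd y) \<in> t" "(fst x * fst y, snd x * snd y) \<in> t"
        using partial_isoD(5,6)[of t "fst x" "snd x" "fst y" "snd y"] by simp_all
      then show ?thesis using t(1) by blast
    qed
    then show ?case unfolding case_prod_beta by (rule ballI)
  qed

text \<open>Zorn's lemma gives a maximal extension. It is total because any algebraic a could be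
  sent to a complex root of the image of its minimal polynomial. Surjectivity is totality of the
  converse relation, which is maximal as well.\<close>

lemma partial_iso_imp_gal:
  assumes "partial_iso r0"
  shows "\<exists>\<sigma>. gal \<sigma> \<and> (\<forall>(a, b) \<in> r0. \<sigma> a = b)"
proof -
  define A where "A = {r. partial_iso r \<and> r0 \<subseteq> r}"
  have "\<exists>M\<in>A. \<forall>X\<in>A. M \<subseteq> X \<longrightarrow> X = M"
  proof (rule subset_Zorn_nonempty)
    show "A \<noteq> {}" using assms by (auto simp: A_def)
    fix C assume C: "C \<noteq> {}" "subset.chain A C"
    then have CA: "\<And>r. r \<in> C \<Longrightarrow> partial_iso r \<and> r0 \<subseteq> r" unfolding subset.chain_def A_def by blast
    have tot: "\<exists>r\<in>C. u \<in> r \<and> v \<in> r" if uv: "u \<in> \<Union>C" "v \<in> \<Union>C" for u v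
    proof -
      obtain r s where rs: "r \<in> C" "s \<in> C" "u \<in> r" "v \<in> s" using uv by blast
      have "r \<subseteq> s \<or> s \<subseteq> r" using C(2) rs(1,2) by (auto simp: subset.chain_def)
      then show ?thesis using rs by blast
    qed
    have "partial_iso (\<Union>C)" by (rule partial_iso_Union[OF C(1)]) (use CA tot in \<open>simp_all only:\<close>)
    moreover have "r0 \<subseteq> \<Union>C"
    proof -
      obtain t where "t \<in> C" using C(1) by blast
      with CA[of t] have "r0 \<subseteq> t" "t \<subseteq> \<Union>C" by (simp_all add: Union_upper)
      then show ?thesis by (rule subset_trans)
    qed
    ultimately show "\<Union>C \<in> A" by (simp add: A_def)
  qed
  then obtain r where "r \<in> A" and rmax: "\<forall>X\<in>A. r \<subseteq> X \<longrightarrow> X = r" by (rule bexE)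
  then have r: "partial_iso r" "r0 \<subseteq> r" by (simp_all add: A_def)
  have max: "s = r" if "partial_iso s" "r \<subseteq> s" for s
    using rmax that r(2) by (auto simp: A_def)
  have total: "\<exists>b. (a, b) \<in> s" if s: "partial_iso s" "\<And>s'. partial_iso s' \<Longrightarrow> s \<subseteq> s' \<Longrightarrow> s' = s"
    and a: "a \<in> qbar" for a s
  proof -
    obtain m m' where m: "(m, m') \<in> poly_pairs s" "m \<noteq> 0" "poly m a = 0" "degree m' > 0"
      "\<And>p p'. (p, p') \<in> poly_pairs s \<Longrightarrow> p \<noteq> 0 \<Longrightarrow> poly p a = 0 \<Longrightarrow> degree m \<le> degree p"
      using minimal_poly_pair[OF s(1) a] by metis
    obtain b where b: "poly m' b = 0"
      using fundamental_theorem_of_algebra[of m'] m(4) by (auto simp: constant_degree)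
    have "\<exists>s'. partial_iso s' \<and> s \<subseteq> s' \<and> (a, b) \<in> s'"
      using partial_iso_extend[OF s(1) a m(1-3) _ b] m(5) by metis
    then obtain s' where s': "partial_iso s'" "s \<subseteq> s'" "(a, b) \<in> s'" by blast
    then have "s' = s" using s(2) by simp
    then show ?thesis using s'(3) by auto
  qed
  have maxc: "s = r\<inverse>" if "partial_iso s" "r\<inverse> \<subseteq> s" for s
  proof -
    have "r \<subseteq> s\<inverse>" using that(2) by auto
    from max[OF partial_iso_converse[OF that(1)] this] show ?thesis by auto
  qed
  have dom: "\<exists>b. (a, b) \<in> r" if "a \<in> qbar" for a using total[OF r(1) max that] .
  have ran: "\<exists>a. (a, b) \<in> r" if "b \<in> qbar" for b
    using total[OF partial_iso_converse[OF r(1)] maxc that] by auto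
  have sv: "b = b'" if "(a, b) \<in> r" "(a, b') \<in> r" for a b b'
    using partial_isoD(4)[OF r(1) partial_isoD(5)[OF r(1) that(1) partial_isoD(3)[OF r(1) that(2)]]] by simp
  have inj: "a = a'" if "(a, b) \<in> r" "(a', b) \<in> r" for a a' b
    using partial_isoD(4)[OF r(1) partial_isoD(5)[OF r(1) that(1) partial_isoD(3)[OF r(1) that(2)]]] by simp
  define \<sigma> where "\<sigma> a = (THE b. (a, b) \<in> r)" for a
  have \<sigma>: "\<sigma> a = b \<longleftrightarrow> (a, b) \<in> r" if aq: "a \<in> qbar" for a b
  proof -
    obtain b' where b': "(a, b') \<in> r" using dom[OF aq] by blast
    then have "\<sigma> a = b'" unfolding \<sigma>_def using sv by (intro the_equality) auto
    then show ?thesis using b' sv by auto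
  qed
  have "bij_betw \<sigma> qbar qbar"
  proof (rule bij_betw_imageI)
    show "inj_on \<sigma> qbar" by (rule inj_onI) (metis \<sigma> inj)
    show "\<sigma> ` qbar = qbar"
    proof
      show "\<sigma> ` qbar \<subseteq> qbar" using \<sigma> partial_isoD(7)[OF r(1)] by blast
      show "qbar \<subseteq> \<sigma> ` qbar"
      proof
        fix b assume "b \<in> qbar"
        then obtain a where "(a, b) \<in> r" using ran by blast
        then have "a \<in> qbar" "\<sigma> a = b" using \<sigma> partial_isoD(7)[OF r(1)] by auto
        then show "b \<in> \<sigma> ` qbar" by blast
      qed
    qed
  qed
  moreover have "\<sigma> (x + y) = \<sigma> x + \<sigma> y \<and> \<sigma> (x * y) = \<sigma> x * \<sigma> y" if "x \<in> qbar" "y \<in> qbar" for x y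
    proof -
    have *: "(x, \<sigma> x) \<in> r" "(y, \<sigma> y) \<in> r" using \<sigma> that by auto
    show ?thesis
      using partial_isoD(5,6)[OF r(1) *] \<sigma>[OF qbar_add[OF that]] \<sigma>[OF qbar_mult[OF that]] by simp
  qed
  ultimately have "gal \<sigma>" by (auto simp: gal_def)
  moreover have "\<forall>(a, b) \<in> r0. \<sigma> a = b" using r(2) \<sigma> partial_isoD(7)[OF r(1)] by blast
  ultimately show ?thesis by blast
qed

text \<open>Starting from the identity on the integers, a may be sent to any root of an integer
  polynomial of least degree, so the roots of \<open>m\<close> are the Galois conjugates of a.
  \<open>m\<close> is not made monic.\<close>

lemma gal_conjugates:
  assumes a: "a \<in> qbar"
  obtains m where "coeffs_in \<int> m" "m \<noteq> 0" "poly m a = 0" "degree m > 0" "\<And>b. poly m b = 0 \<Longrightarrow> \<exists>\<sigma>. gal \<sigma> \<and> \<sigma> a = b"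
    "\<And>p. coeffs_in \<int> p \<Longrightarrow> p \<noteq> 0 \<Longrightarrow> poly p a = 0 \<Longrightarrow> degree m \<le> degree p"
proof -
  define r where "r = {(x, x) | x :: complex. x \<in> \<int>}"
  have r: "partial_iso r"
    unfolding partial_iso_def r_def using Rats_subset_qbar Ints_subset_Rats by auto
  have PP: "(p, p') \<in> poly_pairs r \<longleftrightarrow> coeffs_in \<int> p \<and> p = p'" for p p'
    unfolding poly_pairs_def r_def coeffs_in_def by (auto simp: poly_eq_iff)
  obtain m m' where m: "(m, m') \<in> poly_pairs r" "m \<noteq> 0" "poly m a = 0" "degree m' > 0"
    "\<And>p p'. (p, p') \<in> poly_pairs r \<Longrightarrow> p \<noteq> 0 \<Longrightarrow> poly p a = 0 \<Longrightarrow> degree m \<le> degree p"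
    using minimal_poly_pair[OF r a] by metis
  have "\<exists>\<sigma>. gal \<sigma> \<and> \<sigma> a = b" if "poly m b = 0" for b
  proof -
    have "poly m' b = 0" using that m(1) PP by auto
    have "\<exists>r'. partial_iso r' \<and> r \<subseteq> r' \<and> (a, b) \<in> r'"
      by (rule partial_iso_extend[OF r a m(1-3) _ \<open>poly m' b = 0\<close>]) (rule m(5))
    then obtain r' where r': "partial_iso r'" "(a, b) \<in> r'" by blast
    show ?thesis using partial_iso_imp_gal[OF r'(1)] r'(2) by fast
  qed
  then show ?thesis using that[of m] m PP by auto
qed

text \<open>Every root of the minimal polynomial is a conjugate, hence equal to a; a multiple root
  is impossible since the derivative has smaller degree. So the polynomial is linear.\<close>

lemma gal_fixed_imp_Rats:
  assumes a: "a \<in> qbar" and inv: "\<And>\<sigma>. gal \<sigma> \<Longrightarrow> \<sigma> a = a"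
  shows "a \<in> \<rat>"
proof -
  obtain m where m: "coeffs_in \<int> m" "m \<noteq> 0" "poly m a = 0" "degree m > 0"
    "\<And>b. poly m b = 0 \<Longrightarrow> \<exists>\<sigma>. gal \<sigma> \<and> \<sigma> a = b"
    "\<And>p. coeffs_in \<int> p \<Longrightarrow> p \<noteq> 0 \<Longrightarrow> poly p a = 0 \<Longrightarrow> degree m \<le> degree p"
    using gal_conjugates[OF a] by metis
  obtain q where q: "m = [:-a, 1:] * q" using m(3) by (metis poly_eq_0_iff_dvd dvdE)
  have "q \<noteq> 0" using q m by auto
  have "degree q = 0"
  proof (rule ccontr)
    assume "degree q \<noteq> 0"
    then obtain b where b: "poly q b = 0"
      using fundamental_theorem_of_algebra[of q] by (auto simp: constant_degree)
    then have "poly m b = 0" using q by simp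
    then have "b = a" using m(5) inv by blast
    have "poly (pderiv m) a = 0"
      using b \<open>b = a\<close> unfolding q pderiv_mult by simp
    moreover have "coeffs_in \<int> (pderiv m)"
      using m(1) by (auto simp: coeffs_in_def coeff_pderiv)
    moreover have "pderiv m \<noteq> 0" using m(4) by (auto simp: pderiv_eq_0_iff)
    ultimately have "degree m \<le> degree (pderiv m)" using m(6) by blast
    then show False using m(4) by (simp add: degree_pderiv)
  qed
  then obtain c where c: "q = [:c:]" "c \<noteq> 0" using \<open>q \<noteq> 0\<close> by (metis degree_0_id pCons_0_0)
  have "coeff m 1 = c" "coeff m 0 = - a * c" by (auto simp: q c coeff_pCons)
  then have "c \<in> \<int>" "- a * c \<in> \<int>" using m(1) by (metis coeffs_in_def)+
  then have "- (- a * c) / c \<in> \<rat>" using Ints_subset_Rats by (intro Rats_divide Rats_minus_iff[THEN iffD2]) auto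
  then show ?thesis using c by simp
qed

section \<open>Arithmetic of automorphisms\<close>

lemma gal_closed: "gal \<sigma> \<Longrightarrow> x \<in> qbar \<Longrightarrow> \<sigma> x \<in> qbar"
  by (auto simp: gal_def bij_betw_def)

lemma gal_inj: "gal \<sigma> \<Longrightarrow> x \<in> qbar \<Longrightarrow> y \<in> qbar \<Longrightarrow> \<sigma> x = \<sigma> y \<longleftrightarrow> x = y"
  by (auto simp: gal_def bij_betw_def dest: inj_onD)

lemma gal_add: "gal \<sigma> \<Longrightarrow> x \<in> qbar \<Longrightarrow> y \<in> qbar \<Longrightarrow> \<sigma> (x + y) = \<sigma> x + \<sigma> y"
  and gal_mult: "gal \<sigma> \<Longrightarrow> x \<in> qbar \<Longrightarrow> y \<in> qbar \<Longrightarrow> \<sigma> (x * y) = \<sigma> x * \<sigma> y"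
  by (auto simp: gal_def)

lemma gal_0: "gal \<sigma> \<Longrightarrow> \<sigma> 0 = 0"
  using gal_add[of \<sigma> 0 0] by simp

lemma gal_eq_0_iff: "gal \<sigma> \<Longrightarrow> x \<in> qbar \<Longrightarrow> \<sigma> x = 0 \<longleftrightarrow> x = 0"
  using gal_inj[of \<sigma> x 0] by (simp add: gal_0)

lemma gal_1: assumes "gal \<sigma>" shows "\<sigma> 1 = 1"
proof -
  have "\<sigma> 1 \<noteq> 0" using gal_eq_0_iff[OF assms, of 1] by simp
  moreover have "\<sigma> 1 * \<sigma> 1 = \<sigma> 1" using gal_mult[OF assms, of 1 1] by simp
  ultimately show ?thesis by simp
qed

lemma gal_uminus: "gal \<sigma> \<Longrightarrow> x \<in> qbar \<Longrightarrow> \<sigma> (- x) = - \<sigma> x"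
  using gal_add[of \<sigma> x "- x"] qbar_uminus[of x] by (simp add: gal_0 eq_neg_iff_add_eq_0 add.commute)

lemma gal_diff: "gal \<sigma> \<Longrightarrow> x \<in> qbar \<Longrightarrow> y \<in> qbar \<Longrightarrow> \<sigma> (x - y) = \<sigma> x - \<sigma> y"
  using gal_add[of \<sigma> x "- y"] by (simp add: gal_uminus qbar_uminus)

lemma gal_sum: "gal \<sigma> \<Longrightarrow> (\<And>i. i \<in> I \<Longrightarrow> f i \<in> qbar) \<Longrightarrow> \<sigma> (sum f I) = (\<Sum>i\<in>I. \<sigma> (f i))"
  by (induction I rule: infinite_finite_induct) (auto simp: gal_0 gal_add qbar_sum)

lemma gal_prod: "gal \<sigma> \<Longrightarrow> (\<And>i. i \<in> I \<Longrightarrow> f i \<in> qbar) \<Longrightarrow> \<sigma> (prod f I) = (\<Prod>i\<in>I. \<sigma> (f i))"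
  by (induction I rule: infinite_finite_induct) (auto simp: gal_1 gal_mult qbar_prod)

lemma gal_power: "gal \<sigma> \<Longrightarrow> x \<in> qbar \<Longrightarrow> \<sigma> (x ^ n) = \<sigma> x ^ n"
  by (induction n) (auto simp: gal_1 gal_mult qbar_power)

lemma gal_divide: assumes "gal \<sigma>" "x \<in> qbar" "y \<in> qbar" shows "\<sigma> (x / y) = \<sigma> x / \<sigma> y"
proof (cases "y = 0")
  case False
  then have "\<sigma> y \<noteq> 0" using gal_eq_0_iff assms by simp
  moreover have "\<sigma> (x / y) * \<sigma> y = \<sigma> x"
    using gal_mult[OF assms(1) qbar_divide[OF assms(2,3)] assms(3)] False by simp
  ultimately show ?thesis by (simp add: field_simps)
qed (simp add: gal_0 assms)

lemma qbar_of_nat [simp]: "of_nat n \<in> qbar" and qbar_of_int [simp]: "of_int k \<in> qbar"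
  using Rats_subset_qbar by auto

lemma gal_of_nat: "gal \<sigma> \<Longrightarrow> \<sigma> (of_nat n) = of_nat n"
  by (induction n) (auto simp: gal_0 gal_1 gal_add)

lemma gal_of_int: "gal \<sigma> \<Longrightarrow> \<sigma> (of_int n) = of_int n"
  by (cases n rule: int_cases2) (auto simp: gal_of_nat gal_uminus)

lemma gal_Rats: assumes "gal \<sigma>" "x \<in> \<rat>" shows "\<sigma> x = x"
proof -
  obtain q where "x = of_rat q" using assms(2) by (auto elim: Rats_cases)
  then obtain a b where "x = of_int a / of_int b" by (metis of_rat_rat quotient_of_div surj_pair Fract_of_int_quotient of_rat_divide of_rat_of_int_eq)
  then show ?thesis
    using assms(1) by (auto simp: gal_divide gal_of_int)
qed

lemma qbar_poly: "(\<And>i. coeff p i \<in> qbar) \<Longrightarrow> x \<in> qbar \<Longrightarrow> poly p x \<in> qbar"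
  unfolding poly_altdef by (intro qbar_sum qbar_mult qbar_power)

lemma gal_poly:
  assumes "gal \<sigma>" "\<And>i. coeff p i \<in> qbar" "x \<in> qbar"
  shows "\<sigma> (poly p x) = (\<Sum>i\<le>degree p. \<sigma> (coeff p i) * \<sigma> x ^ i)"
  unfolding poly_altdef using assms
  by (simp add: gal_sum gal_mult gal_power qbar_mult qbar_power)

lemma coeffs_Rats_qbar: "coeffs_in \<rat> p \<Longrightarrow> coeff p i \<in> qbar" and coeffs_Ints_qbar: "coeffs_in \<int> p \<Longrightarrow> coeff p i \<in> qbar"
  using Rats_subset_qbar Ints_subset_Rats by (auto simp: coeffs_in_def)

lemma gal_poly_Rats:
  assumes "gal \<sigma>" "coeffs_in \<rat> p" "x \<in> qbar"
  shows "\<sigma> (poly p x) = poly p (\<sigma> x)"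
proof -
  have "\<sigma> (coeff p i) = coeff p i" for i using assms by (auto simp: gal_Rats coeffs_in_def)
  then show ?thesis using gal_poly[OF assms(1) coeffs_Rats_qbar[OF assms(2)] assms(3)] by (simp add: poly_altdef)
qed

lemma gal_poly_Ints: "gal \<sigma> \<Longrightarrow> coeffs_in \<int> p \<Longrightarrow> x \<in> qbar \<Longrightarrow> \<sigma> (poly p x) = poly p (\<sigma> x)"
  by (rule gal_poly_Rats) (use Ints_subset_Rats in \<open>auto simp: coeffs_in_def\<close>)

lemma algebraic_int_qbar: "algebraic_int x \<Longrightarrow> x \<in> qbar"
  by (auto simp: qbar_def)

lemma gal_algebraic_int: assumes "gal \<sigma>" "algebraic_int x" shows "algebraic_int (\<sigma> x)"
proof -
  obtain p where p: "coeffs_in \<int> p" "lead_coeff p = 1" "poly p x = 0"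
    using assms(2) by (auto simp: algebraic_int_iff_integral_over integral_over_def)
  then have "poly p (\<sigma> x) = 0"
    using gal_poly_Ints[OF assms(1) p(1) algebraic_int_qbar[OF assms(2)]] gal_0[OF assms(1)] by simp
  then show ?thesis using p by (auto simp: algebraic_int_iff_integral_over integral_over_def)
qed

lemma gal_comp: "gal \<sigma> \<Longrightarrow> gal \<tau> \<Longrightarrow> gal (\<sigma> \<circ> \<tau>)"
  unfolding gal_def by (auto intro: bij_betw_trans simp: bij_betwE)

lemma gal_id: "gal id"
  by (auto simp: gal_def)

lemma gal_inverse:
  assumes "gal \<sigma>"
  obtains \<tau> where "gal \<tau>" "\<And>x. x \<in> qbar \<Longrightarrow> \<tau> (\<sigma> x) = x" "\<And>x. x \<in> qbar \<Longrightarrow> \<sigma> (\<tau> x) = x"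
proof -
  define \<tau> where "\<tau> = inv_into qbar \<sigma>"
  have b: "bij_betw \<sigma> qbar qbar" using assms by (simp add: gal_def)
  have l: "\<tau> (\<sigma> x) = x" and r: "\<sigma> (\<tau> x) = x" if "x \<in> qbar" for x
    using that b by (auto simp: \<tau>_def bij_betw_def f_inv_into_f)
  have bt: "bij_betw \<tau> qbar qbar" unfolding \<tau>_def using b by (rule bij_betw_inv_into)
  have c: "\<tau> x \<in> qbar" if "x \<in> qbar" for x using bt that by (auto simp: bij_betw_def)
  have "\<tau> (x + y) = \<tau> x + \<tau> y \<and> \<tau> (x * y) = \<tau> x * \<tau> y" if xy: "x \<in> qbar" "y \<in> qbar" for x y
  proof -
    have "\<sigma> (\<tau> x + \<tau> y) = x + y" "\<sigma> (\<tau> x * \<tau> y) = x * y"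
      using xy c r assms by (auto simp: gal_add gal_mult)
    then show ?thesis using l c xy by (metis qbar_add qbar_mult)
  qed
  then have "gal \<tau>" using bt by (auto simp: gal_def)
  then show ?thesis using that l r by blast
qed

section \<open>Galois orbits\<close>

definition orbit :: "complex \<Rightarrow> complex set" where
  "orbit x = {\<sigma> x | \<sigma>. gal \<sigma>}"

lemma orbit_self: "x \<in> orbit x"
  using gal_id unfolding orbit_def by (metis (mono_tags) id_apply mem_Collect_eq)

lemma orbit_subset_qbar: "x \<in> qbar \<Longrightarrow> orbit x \<subseteq> qbar"
  by (auto simp: orbit_def gal_closed)

lemma finite_orbit: assumes "x \<in> qbar" shows "finite (orbit x)"
proof -
  obtain m where m: "coeffs_in \<int> m" "m \<noteq> 0" "poly m x = 0" using gal_conjugates[OF assms] by metis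
  have "orbit x \<subseteq> {y. poly m y = 0}"
    using gal_poly_Ints[OF _ m(1) assms] m(3) by (auto simp: orbit_def gal_0)
  then show ?thesis using poly_roots_finite[OF m(2)] finite_subset by blast
qed

lemma gal_image_orbit:
  assumes "gal \<sigma>" "x \<in> qbar"
  shows "bij_betw \<sigma> (orbit x) (orbit x)"
proof -
  have inj: "inj_on \<sigma> (orbit x)"
    using orbit_subset_qbar[OF assms(2)] assms(1) by (auto simp: gal_def bij_betw_def intro: inj_on_subset)
  have "\<sigma> ` orbit x \<subseteq> orbit x"
    using gal_comp[OF assms(1)] unfolding orbit_def by (auto, metis comp_apply)
  then have "\<sigma> ` orbit x = orbit x"
    using endo_inj_surj[OF finite_orbit[OF assms(2)]] inj by blast
  then show ?thesis using inj by (simp add: bij_betw_def)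
qed

lemma gal_fixed_imp_Ints:
  assumes "algebraic_int a" "\<And>\<sigma>. gal \<sigma> \<Longrightarrow> \<sigma> a = a"
  shows "a \<in> \<int>"
  using gal_fixed_imp_Rats[of a] algebraic_int_qbar[OF assms(1)] assms rational_algebraic_int_is_int by blast

section \<open>Roots of unity and cyclotomic conjugates\<close>

definition zeta :: "nat \<Rightarrow> complex" where
  "zeta N = cis (2 * pi / real N)"

lemma zeta_power: "zeta N ^ k = cis (2 * pi * real k / real N)"
  by (simp add: zeta_def Complex.DeMoivre mult.commute)

lemma zeta_power_self: "N > 0 \<Longrightarrow> zeta N ^ N = 1"
  by (simp add: zeta_power)

lemma zeta_nonzero [simp]: "zeta N \<noteq> 0"
  by (simp add: zeta_def)

lemma zeta_mult_power: "d > 0 \<Longrightarrow> zeta (d * m) ^ d = zeta m"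
  by (simp add: zeta_power, simp add: zeta_def)

lemma zeta_dvd_power: "N > 0 \<Longrightarrow> m dvd N \<Longrightarrow> zeta N ^ (N div m) = zeta m"
  using zeta_mult_power[of "N div m" m] by (auto simp: dvd_div_eq_0_iff)

lemma root_unity_eq_zeta_power: "N > 0 \<Longrightarrow> w ^ N = 1 \<Longrightarrow> \<exists>k<N. w = zeta N ^ k"
  using bij_betw_roots_unity[of N] by (auto simp: bij_betw_def zeta_power set_eq_iff image_iff)

lemma zeta_power_mod: "N > 0 \<Longrightarrow> zeta N ^ (k mod N) = zeta N ^ k"
proof -
  assume "N > 0"
  have "zeta N ^ k = zeta N ^ (N * (k div N) + k mod N)" by simp
  also have "\<dots> = zeta N ^ (k mod N)" unfolding power_add power_mult zeta_power_self[OF \<open>N > 0\<close>] by simp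
  finally show ?thesis by simp
qed

lemma zeta_power_eq_iff: assumes "N > 0" shows "zeta N ^ j = zeta N ^ k \<longleftrightarrow> [j = k] (mod N)"
proof -
  have "inj_on (\<lambda>k. zeta N ^ k) {..<N}"
    using bij_betw_roots_unity[OF assms] by (auto simp: bij_betw_def zeta_power)
  then have "zeta N ^ (j mod N) = zeta N ^ (k mod N) \<longleftrightarrow> j mod N = k mod N"
    using assms by (auto dest: inj_onD)
  then show ?thesis using assms by (simp add: zeta_power_mod cong_def)
qed

lemma zeta_power_eq_1_iff: "N > 0 \<Longrightarrow> zeta N ^ k = 1 \<longleftrightarrow> N dvd k"
  using zeta_power_eq_iff[of N k 0] by (auto simp: cong_0_iff)

lemma root_unity_algebraic_int: "N > 0 \<Longrightarrow> w ^ N = 1 \<Longrightarrow> algebraic_int (w :: complex)"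
  by (rule algebraic_int_root[of 1 "monom 1 N"]) (auto simp: poly_monom degree_monom_eq coeff_monom)

lemma root_unity_qbar: "N > 0 \<Longrightarrow> w ^ N = 1 \<Longrightarrow> w \<in> qbar"
  using root_unity_algebraic_int algebraic_int_qbar by blast

lemma zeta_qbar: "N > 0 \<Longrightarrow> zeta N \<in> qbar"
  using root_unity_qbar zeta_power_self by blast

lemma gal_root_unity: "gal \<sigma> \<Longrightarrow> N > 0 \<Longrightarrow> w ^ N = 1 \<Longrightarrow> \<sigma> w ^ N = 1"
  using gal_power[of \<sigma> w N] root_unity_qbar[of N w] by (simp add: gal_1)

lemma gal_zeta_power: "gal \<sigma> \<Longrightarrow> N > 0 \<Longrightarrow> \<exists>k<N. \<sigma> (zeta N) = zeta N ^ k"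
  using gal_root_unity zeta_power_self root_unity_eq_zeta_power by blast

lemma norm_root_unity: "N > 0 \<Longrightarrow> w ^ N = 1 \<Longrightarrow> cmod w = 1"
  by (metis norm_one norm_power power_eq_1_iff norm_ge_zero less_irrefl)

section \<open>Differences of roots of unity and irreducibility of cyclotomic polynomials\<close>

lemma geometric_weighted_sum:
  "(w - 1) * (\<Sum>j<n. of_nat j * w ^ j) = of_nat n * w ^ n - w * (\<Sum>j<n. w ^ j)" for w :: complex
  by (induction n) (simp_all add: algebra_simps)

text \<open>An explicit cofactor showing that w - 1 divides N already in the ring generated by
  w.\<close>

lemma divide_root_unity_minus_1:
  fixes w :: complex
  assumes "N > 0" "w ^ N = 1" "w \<noteq> 1"
  shows "of_nat N / (w - 1) = (\<Sum>j<N. of_nat j * w ^ j)"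
proof -
  have "(w - 1) * (\<Sum>j<N. w ^ j) = 0" using assms(2) power_diff_1_eq[of w N] by simp
  then have "(w - 1) * (\<Sum>j<N. of_nat j * w ^ j) = of_nat N"
    using geometric_weighted_sum[of w N] assms by simp
  then show ?thesis using assms(3) by (simp add: field_simps)
qed

lemma algebraic_int_of_nat: "algebraic_int (of_nat n :: complex)"
  using int_imp_algebraic_int[of "of_nat n :: complex"] by simp

lemma algebraic_int_divide_root_diff:
  fixes u v :: complex
  assumes "N > 0" "u ^ N = 1" "v ^ N = 1" "u \<noteq> v"
  shows "algebraic_int (of_nat N / (u - v))"
proof -
  have v: "v \<noteq> 0" using assms(1,3) by (auto simp: power_0_left)
  have w: "(u / v) ^ N = 1" "u / v \<noteq> 1" using assms v by (auto simp: power_divide)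
  have "algebraic_int (of_nat N / (u / v - 1))"
    unfolding divide_root_unity_minus_1[OF assms(1) w]
    by (intro algebraic_int_sum algebraic_int_mult algebraic_int_of_nat algebraic_int_power root_unity_algebraic_int[OF assms(1) w(1)])
  moreover have "algebraic_int (inverse v)"
    using root_unity_algebraic_int[OF assms(1), of "inverse v"] assms(3) by (simp add: power_inverse)
  moreover have "of_nat N / (u - v) = of_nat N / (u / v - 1) * inverse v"
    using v by (simp add: field_simps)
  ultimately show ?thesis using algebraic_int_mult by metis
qed

text \<open>Modulo p only the two extreme binomial terms survive, and Fermat's little theorem
  handles the coefficients. The error is kept as p times an explicit integral \<open>h\<close>,
  because the congruence will be evaluated at algebraic integers.\<close>

lemma frobenius_congruence:
  assumes p: "prime p" and f: "coeffs_in \<int> f"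
  shows "\<exists>h. coeffs_in \<int> h \<and> f ^ p = pcompose f (monom 1 p) + smult (of_nat p) h"
  using f
proof (induction f)
  case 0
  have "(0 :: complex poly) ^ p = 0" using p by (simp add: prime_gt_0_nat)
  then show ?case by (intro exI[of _ 0]) (auto simp: coeffs_in_def)
next
  case (pCons a f)
  note R = coeffs_in_ring[OF subring_C_Ints]
  have a: "a \<in> \<int>" using pCons.prems by (auto simp: coeffs_in_def dest: spec[of _ 0])
  have f: "coeffs_in \<int> f" using pCons.prems by (auto simp: coeffs_in_def dest: spec[of _ "Suc _"])
  have pw: "coeffs_in \<int> (g ^ k)" if "coeffs_in \<int> g" for g k by (induction k) (auto intro: R that)
  obtain h where h: "coeffs_in \<int> h" "f ^ p = pcompose f (monom 1 p) + smult (of_nat p) h"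
    using pCons.IH f by blast
  obtain z where z: "a = of_int z" using a by (auto elim: Ints_cases)
  have "[z ^ p = z] (mod int p)"
  proof -
    have "[nat (z mod p) ^ p = nat (z mod p)] (mod p)"
    proof (cases "p dvd nat (z mod p)")
      case True
      then show ?thesis using p by (metis cong_0_iff cong_sym cong_trans dvd_power prime_gt_0_nat dvd_trans dvd_power_same dvd_refl power_one_right le_eq_less_or_eq power_le_dvd prime_ge_1_nat)
    next
      case False
      then have "[nat (z mod p) ^ (p - 1) = 1] (mod p)" using fermat_theorem[OF p] by blast
      then have "[nat (z mod p) * nat (z mod p) ^ (p - 1) = nat (z mod p) * 1] (mod p)" by (rule cong_scalar_left)
      then show ?thesis using p by (simp add: prime_gt_0_nat power_eq_if)
    qed
    then have "[int (nat (z mod p)) ^ p = int (nat (z mod p))] (mod int p)" by (metis cong_int_iff of_nat_power)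
    then have "[(z mod p) ^ p = z mod p] (mod int p)" using p by (simp add: prime_gt_0_nat)
    then show ?thesis by (simp add: cong_def power_mod)
  qed
  then obtain y where y: "z ^ p = z + int p * y" by (metis cong_iff_lin cong_sym)
  \<comment> \<open>The inner binomial terms with their common factor p divided out.\<close>
  define g where "g = (\<Sum>k\<in>{1..<p}. smult (of_nat ((p choose k) div p)) ([:a:] ^ k * (monom 1 1 * f) ^ (p - k)))"
  have p0: "p > 0" using p prime_gt_0_nat by blast
  have "pCons a f = [:a:] + monom 1 1 * f" by (simp add: monom_Suc monom_0)
  then have "pCons a f ^ p = (\<Sum>k\<le>p. of_nat (p choose k) * [:a:] ^ k * (monom 1 1 * f) ^ (p - k))"
    by (simp add: binomial_ring)
  also have "{..p} = insert 0 (insert p {1..<p})" using p0 by auto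
  also have "(\<Sum>k\<in>\<dots>. of_nat (p choose k) * [:a:] ^ k * (monom 1 1 * f) ^ (p - k)) =
      (monom 1 1 * f) ^ p + ([:a:] ^ p + (\<Sum>k\<in>{1..<p}. of_nat (p choose k) * [:a:] ^ k * (monom 1 1 * f) ^ (p - k)))"
    using p0 by simp
  also have "(\<Sum>k\<in>{1..<p}. of_nat (p choose k) * [:a:] ^ k * (monom 1 1 * f) ^ (p - k)) = smult (of_nat p) g"
    unfolding g_def smult_sum2
  proof (intro sum.cong refl)
    fix k assume "k \<in> {1..<p}"
    then have "p dvd p choose k" using dvd_choose_prime[of k p] p by auto
    then have "p * ((p choose k) div p) = p choose k" by simp
    then have e: "(of_nat p :: complex) * of_nat ((p choose k) div p) = of_nat (p choose k)"
      by (metis of_nat_mult)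
    show "of_nat (p choose k) * [:a:] ^ k * (monom 1 1 * f) ^ (p - k) =
        smult (of_nat p) (smult (of_nat ((p choose k) div p)) ([:a:] ^ k * (monom 1 1 * f) ^ (p - k)))"
      by (simp add: e of_nat_poly mult.assoc)
  qed
  also have "[:a:] ^ p = [:a:] + smult (of_nat p) [:of_int y:]"
  proof -
    have "(of_int z :: complex) ^ p = of_int z + of_nat p * of_int y"
      by (metis y of_int_power of_int_add of_int_mult of_int_of_nat_eq)
    then show ?thesis by (simp add: z poly_const_pow)
  qed
  also have "(monom 1 1 * f) ^ p = monom 1 p * pcompose f (monom 1 p) + smult (of_nat p) (monom 1 p * h)"
    by (simp add: power_mult_distrib monom_power h(2) algebra_simps)
  finally have "pCons a f ^ p = pcompose (pCons a f) (monom 1 p) + smult (of_nat p) (monom 1 p * h + [:of_int y:] + g)"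
    by (simp add: pcompose_pCons smult_add_right algebra_simps)
  moreover have "coeffs_in \<int> (monom 1 p * h + [:of_int y:] + g)"
  proof -
    have 1: "coeffs_in \<int> (monom 1 k)" for k by (auto simp: coeffs_in_def coeff_monom)
    have "coeffs_in \<int> g"
      unfolding g_def
    proof (intro coeffs_in_sum[OF subring_C_Ints])
      fix k
      have "coeffs_in \<int> ([:a:] ^ k * (monom 1 1 * f) ^ (p - k))"
        by (intro R pw 1 f a)
      then show "coeffs_in \<int> (smult (of_nat ((p choose k) div p)) ([:a:] ^ k * (monom 1 1 * f) ^ (p - k)))"
        by (auto simp: coeffs_in_def)
    qed
    then show ?thesis by (intro R 1 h) auto
  qed
  ultimately show ?case by blast
qed

lemma subring_C_qbar: "subring_C qbar"
  by (auto simp: subring_C_def qbar_add qbar_mult qbar_uminus)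

lemma subring_C_algebraic_int: "subring_C {x. algebraic_int x}"
  by (auto simp: subring_C_def algebraic_int_add algebraic_int_mult algebraic_int_minus)

lemma coeffs_in_mono: "coeffs_in R p \<Longrightarrow> R \<subseteq> S \<Longrightarrow> coeffs_in S p"
  by (auto simp: coeffs_in_def)

lemma coeffs_in_smult: "subring_C R \<Longrightarrow> a \<in> R \<Longrightarrow> coeffs_in R p \<Longrightarrow> coeffs_in R (smult a p)"
  by (auto simp: coeffs_in_def subring_C_def)

lemma coeffs_in_linear: "subring_C R \<Longrightarrow> s \<in> R \<Longrightarrow> coeffs_in R [:- s, 1:]"
  by (auto simp: coeffs_in_def subring_C_def coeff_pCons split: nat.splits)

lemma subring_C_poly: "subring_C R \<Longrightarrow> coeffs_in R p \<Longrightarrow> x \<in> R \<Longrightarrow> poly p x \<in> R"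
  unfolding poly_altdef
  by (intro subring_C_sum) (use subring_C_power[of R x] in \<open>auto simp: coeffs_in_def subring_C_def\<close>)

lemma Ints_algebraic_int: "x \<in> \<int> \<Longrightarrow> algebraic_int (x :: complex)"
  by (rule int_imp_algebraic_int)

lemma algebraic_int_poly: "coeffs_in \<int> p \<Longrightarrow> algebraic_int x \<Longrightarrow> algebraic_int (poly p x :: complex)"
  using subring_C_poly[OF subring_C_algebraic_int, of p x] coeffs_in_mono[of \<int> p "{x. algebraic_int x}"]
    Ints_algebraic_int by blast

lemma gal_map_poly_mult:
  assumes "gal \<sigma>" "coeffs_in qbar p" "coeffs_in qbar q"
  shows "map_poly \<sigma> (p * q) = map_poly \<sigma> p * map_poly \<sigma> q"
  using assms
  by (intro poly_eqI) (auto simp: coeff_map_poly gal_0 coeff_mult coeffs_in_def gal_sum gal_mult qbar_mult)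

lemma gal_map_poly_prod_linear:
  assumes "gal \<sigma>" "S \<subseteq> qbar"
  shows "map_poly \<sigma> (\<Prod>s\<in>S. [:- s, 1:]) = (\<Prod>s\<in>S. [:- \<sigma> s, 1:])"
  using assms(2)
proof (induction S rule: infinite_finite_induct)
  case (insert s S)
  have "coeffs_in qbar (\<Prod>s\<in>S. [:- s, 1:])" "coeffs_in qbar [:- s, 1:]"
    using insert.prems by (auto intro!: coeffs_in_prod coeffs_in_linear subring_C_qbar)
  then show ?case
    using insert assms(1)
    by (simp add: gal_map_poly_mult map_poly_pCons gal_0 gal_1 gal_uminus del: mult_pCons_left mult_pCons_right)
qed (use assms in \<open>auto simp: gal_1\<close>)

lemma orbit_closed: "gal \<sigma> \<Longrightarrow> w \<in> orbit x \<Longrightarrow> \<sigma> w \<in> orbit x"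
  using gal_comp unfolding orbit_def by (auto, metis comp_apply)

lemma orbit_root_unity: "N > 0 \<Longrightarrow> w \<in> orbit (zeta N) \<Longrightarrow> w ^ N = 1"
  by (auto simp: orbit_def gal_root_unity zeta_power_self)

text \<open>Dedekind's argument. The product f of the linear factors over the orbit has integer
  coefficients, so the Frobenius congruence at its root w gives f(w^p) = - p h(w). If w^p were
  outside the orbit, every factor w^p - s of f(w^p) would divide N, and p would divide a power of
  N.\<close>

lemma orbit_zeta_prime_power:
  assumes N: "N > 0" and w: "w \<in> orbit (zeta N)" and p: "prime p" "\<not> p dvd N"
  shows "w ^ p \<in> orbit (zeta N)"
proof (rule ccontr)
  assume wp: "w ^ p \<notin> orbit (zeta N)"
  define S where "S = orbit (zeta N)"
  define f where "f = (\<Prod>s\<in>S. [:- s, 1:])"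
  have S: "finite S" "S \<subseteq> qbar" using zeta_qbar[OF N] finite_orbit orbit_subset_qbar by (auto simp: S_def)
  have root: "s ^ N = 1" if "s \<in> S" for s using orbit_root_unity N that by (auto simp: S_def)
  have ai: "algebraic_int s" if "s \<in> S" for s using root_unity_algebraic_int[OF N root[OF that]] .
  have "coeffs_in \<int> f"
    unfolding coeffs_in_def
  proof
    fix i
    have "coeffs_in {x. algebraic_int x} f"
      unfolding f_def using ai by (intro coeffs_in_prod coeffs_in_linear subring_C_algebraic_int) auto
    then have "algebraic_int (coeff f i)" by (simp add: coeffs_in_def)
    moreover have "\<sigma> (coeff f i) = coeff f i" if \<sigma>: "gal \<sigma>" for \<sigma>
    proof -
      have "map_poly \<sigma> f = (\<Prod>s\<in>S. [:- \<sigma> s, 1:])"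
        unfolding f_def by (rule gal_map_poly_prod_linear[OF \<sigma> S(2)])
      also have "\<dots> = f" unfolding f_def S_def
        by (rule prod.reindex_bij_betw[OF gal_image_orbit[OF \<sigma> zeta_qbar[OF N]]])
      finally show ?thesis using \<sigma> by (metis coeff_map_poly gal_0)
    qed
    ultimately show "coeff f i \<in> \<int>" by (rule gal_fixed_imp_Ints)
  qed
  then obtain h where h: "coeffs_in \<int> h" "f ^ p = pcompose f (monom 1 p) + smult (of_nat p) h"
    using frobenius_congruence[OF p(1)] by blast
  have "poly f w = 0" using w S(1) by (auto simp: f_def S_def poly_prod)
  then have "poly f (w ^ p) = - of_nat p * poly h w"
    using arg_cong[OF h(2), of "\<lambda>f. poly f w"] prime_gt_0_nat[OF p(1)]
    by (simp add: poly_pcompose poly_monom eq_neg_iff_add_eq_0 zero_power)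
  then have fw: "(\<Prod>s\<in>S. w ^ p - s) = - of_nat p * poly h w" by (simp add: f_def poly_prod)
  have wN: "w ^ N = 1" using root w by (simp add: S_def)
  have "algebraic_int ((\<Prod>s\<in>S. of_nat N / (w ^ p - s)) * - poly h w)"
  proof (intro algebraic_int_mult algebraic_int_prod algebraic_int_minus)
    fix s assume s: "s \<in> S"
    then have "w ^ p \<noteq> s" using wp by (auto simp: S_def)
    then show "algebraic_int (of_nat N / (w ^ p - s))"
      using root[OF s] wN by (intro algebraic_int_divide_root_diff N) (metis power_mult mult.commute power_one)
  next
    show "algebraic_int (poly h w)" using h(1) root_unity_algebraic_int[OF N wN] by (rule algebraic_int_poly)
  qed
  also have "(\<Prod>s\<in>S. of_nat N / (w ^ p - s)) * - poly h w = of_nat N ^ card S / of_nat p"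
  proof -
    have "(\<Prod>s\<in>S. w ^ p - s) \<noteq> 0" using S(1) wp by (auto simp: S_def)
    then have nz: "poly h w \<noteq> 0" using fw by auto
    have "(\<Prod>s\<in>S. of_nat N / (w ^ p - s)) = of_nat N ^ card S / (- of_nat p * poly h w)"
      by (simp only: prod_dividef fw prod_constant)
    then show ?thesis using nz prime_gt_0_nat[OF p(1)] by (simp add: field_simps)
  qed
  finally have "algebraic_int (of_nat N ^ card S / of_nat p :: complex)" .
  moreover have "(of_nat N ^ card S / of_nat p :: complex) \<in> \<rat>" by (intro Rats_divide Rats_power Rats_of_nat)
  ultimately have "(of_nat N ^ card S / of_nat p :: complex) \<in> \<int>" by (rule rational_algebraic_int_is_int)
  then obtain z where "of_nat N ^ card S / of_nat p = (of_int z :: complex)" by (auto elim: Ints_cases)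
  then have "of_int (int N ^ card S) = (of_int (z * int p) :: complex)"
    using prime_gt_0_nat[OF p(1)] by (simp add: field_simps)
  then have "int N ^ card S = z * int p" by (simp only: of_int_eq_iff)
  then have "int p dvd int N ^ card S" by simp
  then have "p dvd N ^ card S" by (metis of_nat_dvd_iff of_nat_power)
  then show False using p prime_dvd_power by blast
qed

text \<open>An exponent coprime to N is a product of primes not dividing N, and these are handled
  one by one. This is irreducibility of the cyclotomic polynomials, in the form in which it is
  used.\<close>

lemma gal_zeta_coprime:
  assumes N: "N > 0" and k: "coprime k N"
  shows "\<exists>\<sigma>. gal \<sigma> \<and> \<sigma> (zeta N) = zeta N ^ k"
proof -
  have "zeta N ^ k \<in> orbit (zeta N)" using k
  proof (induction k rule: prime_divisors_induct)
    case zero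
    then show ?case using N orbit_self[of 1] by (simp add: zeta_def)
  next
    case (unit x)
    then show ?case using orbit_self[of "zeta N"] by simp
  next
    case (factor p x)
    then have "zeta N ^ x \<in> orbit (zeta N)" "\<not> p dvd N"
      by (auto simp: coprime_mult_left_iff prime_imp_coprime_nat coprime_absorb_left dest: coprime_common_divisor_nat)
    then have "(zeta N ^ x) ^ p \<in> orbit (zeta N)" using orbit_zeta_prime_power[OF N] factor.hyps by blast
    then show ?case by (simp add: power_mult mult.commute flip: power_mult)
  qed
  then show ?thesis by (auto simp: orbit_def)
qed

section \<open>Stabilisers and disjointness from cyclotomic fields\<close>

lemma zeta_stabilizer_dvd:
  assumes "gal \<sigma>" "N > 0" "m dvd N" "\<sigma> (zeta N) = zeta N"
  shows "\<sigma> (zeta m) = zeta m"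
  using gal_power[OF assms(1) zeta_qbar[OF assms(2)], of "N div m"] assms(4) zeta_dvd_power[OF assms(2,3)] by simp

text \<open>Choosing D so that the orbit of the list under the stabiliser of zeta D is as small as possible
  makes the field generated by the list linearly disjoint from all roots of unity over that level.\<close>
lemma conductor_exists:
  assumes bs: "set bs \<subseteq> qbar"
  shows "\<exists>D>0. \<forall>N g. N > 0 \<longrightarrow> D dvd N \<longrightarrow> gal g \<longrightarrow> g (zeta D) = zeta D \<longrightarrow>
    (\<exists>h. gal h \<and> (\<forall>b\<in>set bs. h b = b) \<and> h (zeta N) = g (zeta N))"
proof -
  define O' where "O' N = {map \<sigma> bs | \<sigma>. gal \<sigma> \<and> \<sigma> (zeta N) = zeta N}" for N
  have fin: "finite (O' N)" for N
  proof -
    have "O' N \<subseteq> {xs. set xs \<subseteq> (\<Union>b\<in>set bs. orbit b) \<and> length xs = length bs}"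
      unfolding O'_def orbit_def by fastforce
    moreover have "finite \<dots>" using bs by (intro finite_lists_length_eq) (auto intro: finite_orbit)
    ultimately show ?thesis by (rule finite_subset)
  qed
  define D where "D = (ARG_MIN (\<lambda>N. card (O' N)) N. N > 0)"
  have D: "D > 0" "\<And>N. N > 0 \<Longrightarrow> card (O' D) \<le> card (O' N)"
    unfolding D_def using arg_min_natI[of "\<lambda>N. N > (0::nat)" 1 "\<lambda>N. card (O' N)"]
      arg_min_nat_le[of "\<lambda>N. N > (0::nat)" _ "\<lambda>N. card (O' N)"] by auto
  have "\<exists>h. gal h \<and> (\<forall>b\<in>set bs. h b = b) \<and> h (zeta N) = g (zeta N)"
    if N: "N > 0" "D dvd N" and g: "gal g" "g (zeta D) = zeta D" for N g
  proof -
    have "O' N \<subseteq> O' D" using zeta_stabilizer_dvd N unfolding O'_def by blast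
    then have "O' N = O' D" using fin D(2)[OF N(1)] by (metis card_seteq)
    moreover have "map g bs \<in> O' D" using g by (auto simp: O'_def)
    ultimately have "map g bs \<in> O' N" by simp
    \<comment> \<open>\<open>h\<close> agrees with \<open>g\<close> on the list but fixes
      \<open>zeta N\<close>; the inverse of \<open>h\<close> composed with \<open>g\<close>
      therefore fixes the list and still acts on \<open>zeta N\<close> as \<open>g\<close>
      does.\<close>
    then obtain h where h: "map g bs = map h bs" "gal h" "h (zeta N) = zeta N" unfolding O'_def mem_Collect_eq by blast
    obtain h' where h': "gal h'" "\<And>x. x \<in> qbar \<Longrightarrow> h' (h x) = x" using gal_inverse[OF h(2)] by metis
    have "h' (g b) = b" if "b \<in> set bs" for b
    proof -
      have "g b = h b" using h(1) that by simp
      then show ?thesis using h'(2)[of b] that bs by auto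
    qed
    moreover obtain k where k: "g (zeta N) = zeta N ^ k" using gal_zeta_power[OF g(1) N(1)] by blast
    have "h' (zeta N) = zeta N" using h'(2)[OF zeta_qbar[OF N(1)]] h(3) by simp
    then have "h' (g (zeta N)) = g (zeta N)" using k gal_power[OF h'(1) zeta_qbar[OF N(1)]] by simp
    ultimately show ?thesis using gal_comp[OF h'(1) g(1)] by (intro exI[of _ "h' \<circ> g"]) auto
  qed
  then show ?thesis using D(1) by blast
qed

lemma subfield_C_qbar: "subfield_C qbar"
  by (auto simp: subfield_C_def qbar_add qbar_mult qbar_diff qbar_inverse)

text \<open>The supremum in \<open>house\<close> bounds its members only if the set is bounded
  above: an embedding maps a to a root of a fixed integer polynomial, so finitely many values occur.
  A restricted automorphism of \<open>qbar\<close> is one of the embeddings.\<close>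

lemma house_bound:
  assumes a: "a \<in> qbar" and h: "house a \<le> c" and \<sigma>: "gal \<sigma>"
  shows "cmod (\<sigma> a) \<le> c"
proof -
  define L where "L = rat_adjoin a"
  have L3: "L \<subseteq> qbar" unfolding L_def rat_adjoin_def using subfield_C_qbar a by (intro Inter_lower) simp
  have Lmem: "x \<in> L \<longleftrightarrow> (\<forall>M. subfield_C M \<longrightarrow> a \<in> M \<longrightarrow> x \<in> M)" for x
    by (auto simp: L_def rat_adjoin_def)
  have L: "0 \<in> L" "1 \<in> L" "a \<in> L" unfolding Lmem by (simp_all add: subfield_C_def)
  have Lop: "x + y \<in> L" "x - y \<in> L" "x * y \<in> L" if "x \<in> L" "y \<in> L" for x y
    using that unfolding Lmem subfield_C_def by simp_all
  have Lint: "of_int k \<in> L" for k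
  proof (induction k rule: int_induct[of _ 0])
    case (step1 i) then show ?case using Lop(1) L(2) by simp
  next
    case (step2 i) then show ?case using Lop(2) L(2) by simp
  qed (use L in simp)
  obtain m where m: "coeffs_in \<int> m" "m \<noteq> 0" "poly m a = 0" using gal_conjugates[OF a] by metis
  have torus_emb: "poly m (\<phi> a) = 0" if "field_embedding L \<phi>" for \<phi>
  proof -
    have \<phi>: "\<phi> 1 = 1" "\<And>x y. x \<in> L \<Longrightarrow> y \<in> L \<Longrightarrow> \<phi> (x + y) = \<phi> x + \<phi> y"
      "\<And>x y. x \<in> L \<Longrightarrow> y \<in> L \<Longrightarrow> \<phi> (x * y) = \<phi> x * \<phi> y"
      using that by (auto simp: field_embedding_def)
    have "\<phi> 0 = 0" using \<phi>(2)[OF L(1) L(1)] by simp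
    have \<phi>i: "\<phi> (of_int k) = of_int k" for k
    proof (induction k rule: int_induct[of _ 0])
      case (step1 i) then show ?case using \<phi>(2)[OF Lint L(2)] \<phi>(1) by simp
    next
      case (step2 i)
      then show ?case using \<phi>(2)[OF Lint[of "i - 1"] L(2)] \<phi>(1) by (simp add: algebra_simps)
    qed (simp add: \<open>\<phi> 0 = 0\<close>)
    have "poly p a \<in> L \<and> \<phi> (poly p a) = poly p (\<phi> a)" if "coeffs_in \<int> p" for p
      using that
    proof (induction p)
      case (pCons b p)
      have "b \<in> \<int>" using pCons.prems by (auto simp: coeffs_in_def dest: spec[of _ 0])
      then obtain k where b: "b = of_int k" by (auto elim: Ints_cases)
      have "coeffs_in \<int> p" using pCons.prems by (auto simp: coeffs_in_def dest: spec[of _ "Suc _"])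
      then have IH: "poly p a \<in> L" "\<phi> (poly p a) = poly p (\<phi> a)" using pCons.IH by auto
      have ap: "a * poly p a \<in> L" using L(3) IH(1) Lop(3) by blast
      then have "b + a * poly p a \<in> L" using Lint Lop(1) b by blast
      moreover have "\<phi> (b + a * poly p a) = b + \<phi> a * poly p (\<phi> a)"
        using \<phi>(2)[OF Lint ap] \<phi>(3)[OF L(3) IH(1)] IH(2) by (simp add: b \<phi>i)
      ultimately show ?case by simp
    qed (simp add: L \<open>\<phi> 0 = 0\<close>)
    from this[OF m(1)] show ?thesis using m(3) \<open>\<phi> 0 = 0\<close> by simp
  qed
  have "{cmod (\<phi> a) | \<phi>. field_embedding L \<phi>} \<subseteq> cmod ` {y. poly m y = 0}" using torus_emb by auto
  then have "finite ((\<lambda>\<phi>. cmod (\<phi> a)) ` {\<phi>. field_embedding L \<phi>})"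
    using finite_subset[OF _ finite_imageI[OF poly_roots_finite[OF m(2)]]]
    by (simp add: setcompr_eq_image)
  moreover have "field_embedding L \<sigma>"
    using \<sigma> L3 by (auto simp: field_embedding_def gal_1 gal_add gal_mult subset_iff)
  ultimately have "cmod (\<sigma> a) \<le> house a"
    unfolding house_def L_def[symmetric] by (intro cSUP_upper bdd_above_finite) auto
  then show ?thesis using h by simp
qed

section \<open>Integral closedness of the rings of cyclotomic integers\<close>

text \<open>The ring Z[zeta N]. That it contains all integers of its fraction field is the aim of
  this section, reached in \<open>fixed_algebraic_int_in_cyc_ring\<close>.\<close>

definition cyc_ring :: "nat \<Rightarrow> complex set" where
  "cyc_ring N = {poly h (zeta N) | h. coeffs_in \<int> h}"

lemma subring_cyc_ring: "subring_C (cyc_ring N)"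
proof -
  note R = coeffs_in_ring[OF subring_C_Ints]
  have "0 \<in> cyc_ring N" "1 \<in> cyc_ring N" unfolding cyc_ring_def using R(1,2) by (force, force)
  moreover have "x + y \<in> cyc_ring N \<and> x * y \<in> cyc_ring N \<and> - x \<in> cyc_ring N"
    if xy: "x \<in> cyc_ring N" "y \<in> cyc_ring N" for x y
  proof -
    obtain g h where "coeffs_in \<int> g" "coeffs_in \<int> h" "x = poly g (zeta N)" "y = poly h (zeta N)"
      using xy by (auto simp: cyc_ring_def)
    then show ?thesis using R(3,4)[of g h] R(5)[of g] unfolding cyc_ring_def
      by (metis (mono_tags, lifting) mem_Collect_eq poly_add poly_mult poly_minus)
  qed
  ultimately show ?thesis by (auto simp: subring_C_def)
qed

lemma Ints_subset_cyc_ring: "\<int> \<subseteq> cyc_ring N"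
proof
  fix x :: complex assume "x \<in> \<int>"
  then have "coeffs_in \<int> [:x:]" by (auto simp: coeffs_in_def coeff_pCons split: nat.splits)
  then show "x \<in> cyc_ring N" unfolding cyc_ring_def by force
qed

lemma root_unity_in_cyc_ring: assumes "N > 0" "w ^ N = 1" shows "w \<in> cyc_ring N"
proof -
  obtain k where "w = poly (monom 1 k) (zeta N)"
    using root_unity_eq_zeta_power[OF assms] by (auto simp: poly_monom)
  moreover have "coeffs_in \<int> (monom 1 k)" by (auto simp: coeffs_in_def)
  ultimately show ?thesis by (auto simp: cyc_ring_def)
qed

lemma zeta_in_cyc_ring: assumes "N > 0" "m dvd N" shows "zeta m ^ k \<in> cyc_ring N"
proof (rule root_unity_in_cyc_ring[OF assms(1)])
  have "m > 0" using assms by (auto intro: Nat.gr0I)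
  then show "(zeta m ^ k) ^ N = 1" using assms(2) by (simp add: power_mult[symmetric] zeta_power_eq_1_iff)
qed

lemma cyc_ring_algebraic_int: "N > 0 \<Longrightarrow> x \<in> cyc_ring N \<Longrightarrow> algebraic_int x"
  using algebraic_int_poly root_unity_algebraic_int zeta_power_self by (auto simp: cyc_ring_def)

lemma subring_C_closed:
  assumes "subring_C R"
  shows "0 \<in> R" "1 \<in> R" "x \<in> R \<Longrightarrow> y \<in> R \<Longrightarrow> x + y \<in> R" "x \<in> R \<Longrightarrow> y \<in> R \<Longrightarrow> x * y \<in> R"
    "x \<in> R \<Longrightarrow> - x \<in> R" "of_nat n \<in> R"
  using assms unfolding subring_C_def by (simp_all, induction n, simp_all)

lemma subring_C_diff: assumes "subring_C R" "x \<in> R" "y \<in> R" shows "x - y \<in> R"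
  using subring_C_closed(3)[OF assms(1,2) subring_C_closed(5)[OF assms(1,3)]] by simp

lemma subring_C_prod: "subring_C R \<Longrightarrow> (\<And>i. i \<in> I \<Longrightarrow> f i \<in> R) \<Longrightarrow> prod f I \<in> R"
  by (induction I rule: infinite_finite_induct) (auto simp: subring_C_def)

section \<open>Congruences in cyclotomic rings\<close>

lemma poly_diff_divisible:
  assumes R: "subring_C R" and x: "x \<in> R" "y \<in> R" and h: "coeffs_in R h"
  shows "\<exists>r\<in>R. poly h x - poly h y = (x - y) * r"
  using h
proof (induction h)
  case 0
  then show ?case using R by (intro bexI[of _ 0]) (auto simp: subring_C_def)
next
  case (pCons a h)
  have h: "coeffs_in R h" using pCons.prems by (auto simp: coeffs_in_def dest: spec[of _ "Suc _"])
  obtain r where r: "r \<in> R" "poly h x - poly h y = (x - y) * r" using pCons.IH[OF h] by blast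
  have "poly (pCons a h) x - poly (pCons a h) y = (x - y) * poly h y + x * (poly h x - poly h y)"
    by (simp add: algebra_simps)
  also have "\<dots> = (x - y) * (poly h y + x * r)" unfolding r(2) by (simp add: algebra_simps)
  finally show ?case using subring_C_poly[OF R h x(2)] r(1) x R
    by (intro bexI[of _ "poly h y + x * r"]) (auto simp: subring_C_def)
qed

lemma power_diff_divisible:
  assumes R: "subring_C R" and x: "x \<in> R" "y \<in> R"
  shows "\<exists>r\<in>R. x ^ n - y ^ n = (x - y) * r"
proof -
  have "coeffs_in R (monom 1 n)" using R by (auto simp: coeffs_in_def subring_C_def)
  then show ?thesis using poly_diff_divisible[OF R x, of "monom 1 n"] by (simp add: poly_monom)
qed

lemma frobenius_iterate:
  assumes R: "subring_C R" "\<int> \<subseteq> R" and p: "prime p" and h: "coeffs_in \<int> h" and x: "x \<in> R"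
  shows "\<exists>r\<in>R. poly h x ^ (p ^ j) = poly h (x ^ (p ^ j)) + of_nat p * r"
proof (induction j)
  case 0
  show ?case using R by (intro bexI[of _ 0]) (auto simp: subring_C_def)
next
  case (Suc j)
  note ops = subring_C_closed[OF R(1)]
  have hR: "coeffs_in R h" using h R(2) by (rule coeffs_in_mono)
  obtain r where r: "r \<in> R" "poly h x ^ (p ^ j) = poly h (x ^ (p ^ j)) + of_nat p * r" using Suc.IH by blast
  have xR: "x ^ (p ^ j) \<in> R" by (rule subring_C_power[OF R(1) x])
  obtain s where s: "s \<in> R" "(poly h x ^ (p ^ j)) ^ p - poly h (x ^ (p ^ j)) ^ p = (poly h x ^ (p ^ j) - poly h (x ^ (p ^ j))) * s"
    using power_diff_divisible[OF R(1) subring_C_power[OF R(1) subring_C_poly[OF R(1) hR x]] subring_C_poly[OF R(1) hR xR]] by blast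
  obtain g where g: "coeffs_in \<int> g" "h ^ p = pcompose h (monom 1 p) + smult (of_nat p) g"
    using frobenius_congruence[OF p h] by blast
  have "poly h (x ^ (p ^ j)) ^ p = poly h (x ^ (p ^ Suc j)) + of_nat p * poly g (x ^ (p ^ j))"
    using arg_cong[OF g(2), of "\<lambda>f. poly f (x ^ (p ^ j))"]
    by (simp add: poly_pcompose poly_monom power_mult[symmetric] mult.commute)
  then have "poly h x ^ (p ^ Suc j) = poly h (x ^ (p ^ Suc j)) + of_nat p * (poly g (x ^ (p ^ j)) + r * s)"
  proof -
    have "poly h x ^ (p ^ Suc j) = (poly h x ^ (p ^ j)) ^ p" by (simp add: power_mult[symmetric] mult.commute)
    also have "\<dots> = poly h (x ^ (p ^ j)) ^ p + (poly h x ^ (p ^ j) - poly h (x ^ (p ^ j))) * s"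
      using s(2) by (simp add: diff_eq_eq add.commute)
    also have "poly h x ^ (p ^ j) - poly h (x ^ (p ^ j)) = of_nat p * r" by (simp add: r(2))
    finally show ?thesis using \<open>poly h (x ^ (p ^ j)) ^ p = _\<close> by (simp add: algebra_simps)
  qed
  moreover have "poly g (x ^ (p ^ j)) + r * s \<in> R"
    by (intro ops r(1) s(1) subring_C_poly[OF R(1) coeffs_in_mono[OF g(1) R(2)] xR])
  ultimately show ?case by blast
qed

text \<open>Modulo the prime element the generator zeta N reduces to a root of unity of order prime to p,
  on which a power of Frobenius acts trivially; hence the reduction has no nilpotents.\<close>
lemma cyc_ring_divide_prime_element:
  assumes p: "prime p" and n: "n > 0" "\<not> p dvd n" and N: "N = p ^ k * n" and k: "k > 0"
    and a: "coprime a p" and al: "algebraic_int \<alpha>" and mem: "(1 - zeta (p ^ k) ^ a) * \<alpha> \<in> cyc_ring N"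
  shows "\<alpha> \<in> cyc_ring N"
proof -
  define R where "R = cyc_ring N"
  define \<xi> where "\<xi> = zeta (p ^ k) ^ a"
  define \<pi> where "\<pi> = 1 - \<xi>"
  have p0: "p > 0" using p prime_gt_0_nat by blast
  have N0: "N > 0" using N n p0 by simp
  have R: "subring_C R" "\<int> \<subseteq> R" by (auto simp: R_def subring_cyc_ring Ints_subset_cyc_ring)
  note ops = subring_C_closed[OF R(1)]
  have \<xi>R: "\<xi> \<in> R" unfolding \<xi>_def R_def by (rule zeta_in_cyc_ring) (use N0 N in auto)
  have oneR: "1 \<in> R" by (rule ops)
  have \<pi>R: "\<pi> \<in> R" unfolding \<pi>_def by (rule subring_C_diff[OF R(1) oneR \<xi>R])
  have div1: "\<exists>r\<in>R. 1 - \<xi> ^ u = \<pi> * r" for u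
    using power_diff_divisible[OF R(1) oneR \<xi>R, of u] by (simp add: \<pi>_def)
  have pk0: "p ^ k > 0" using p0 by simp
  have ak: "coprime a (p ^ k)" using a by simp
  have \<xi>ne: "\<xi> \<noteq> 1"
  proof
    assume "\<xi> = 1"
    then have "p ^ k dvd a" using zeta_power_eq_1_iff[OF pk0] by (simp add: \<xi>_def)
    then have "p dvd a" using k by (metis dvd_power dvd_trans)
    then show False using a p by (metis coprime_absorb_right not_prime_unit)
  qed
  have \<pi>0: "\<pi> \<noteq> 0" using \<xi>ne by (simp add: \<pi>_def)
  \<comment> \<open>\<open>a\<close> is invertible modulo p^k, so \<xi> generates all p^k-th roots
    of unity, and \<pi> divides 1 minus any of them.\<close>
  have gen: "\<exists>u. zeta (p ^ k) ^ j = \<xi> ^ u" for j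
  proof -
    obtain v where "[a * v = 1] (mod p ^ k)" using cong_solve_coprime_nat[OF ak] by auto
    then have "[a * v * j = 1 * j] (mod p ^ k)" by (rule cong_scalar_right)
    then obtain u where "[a * u = j] (mod p ^ k)" by (auto simp: mult.assoc)
    then have "zeta (p ^ k) ^ (a * u) = zeta (p ^ k) ^ j" using zeta_power_eq_iff[OF pk0] by blast
    then show ?thesis by (metis \<xi>_def power_mult)
  qed
  \<comment> \<open>The power \<omega> of \<xi> is a primitive p-th root of unity, so \<omega> - 1
    divides p, while \<pi> divides 1 - \<omega>.\<close>
  have "\<exists>r\<in>R. of_nat p = \<pi> * r"
  proof -
    define \<omega> where "\<omega> = \<xi> ^ (p ^ (k - 1))"
    have "\<xi> ^ (p ^ k) = 1" unfolding \<xi>_def power_mult[symmetric] zeta_power_eq_1_iff[OF pk0] by simp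
    then have \<omega>p: "\<omega> ^ p = 1" using k by (simp add: \<omega>_def power_mult[symmetric] power_Suc2[symmetric] del: power_Suc)
    have "\<omega> \<noteq> 1"
    proof
      assume "\<omega> = 1"
      then have "p ^ k dvd a * p ^ (k - 1)" unfolding \<omega>_def \<xi>_def power_mult[symmetric] zeta_power_eq_1_iff[OF pk0] .
      moreover have "p ^ k = p * p ^ (k - 1)" using k by (simp add: power_eq_if)
      ultimately have "p * p ^ (k - 1) dvd a * p ^ (k - 1)" by simp
      then have "p dvd a" using p0 by simp
      then show False using a p by (metis coprime_absorb_right not_prime_unit)
    qed
    then have "of_nat p = (\<omega> - 1) * (\<Sum>j<p. of_nat j * \<omega> ^ j)"
      using divide_root_unity_minus_1[OF p0 \<omega>p] by (simp add: field_simps)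
    moreover obtain r where "r \<in> R" "1 - \<omega> = \<pi> * r" using div1 unfolding \<omega>_def by blast
    moreover have "(\<Sum>j<p. of_nat j * \<omega> ^ j) \<in> R"
      unfolding \<omega>_def by (intro subring_C_sum[OF R(1)] ops subring_C_power[OF R(1)] \<xi>R)
    ultimately have "of_nat p = - (\<pi> * r) * (\<Sum>j<p. of_nat j * \<omega> ^ j)" "- r * (\<Sum>j<p. of_nat j * \<omega> ^ j) \<in> R"
      by (metis minus_diff_eq) (intro ops; fact)
    then show ?thesis by (intro bexI[of _ "- r * (\<Sum>j<p. of_nat j * \<omega> ^ j)"]) simp_all
  qed
  then obtain rp where rp: "rp \<in> R" "of_nat p = \<pi> * rp" by blast
  have cop: "coprime n (p ^ k)" using prime_imp_coprime_nat[OF p n(2)] by (simp add: coprime_commute)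
  \<comment> \<open>Raising to the power e projects \<open>zeta N\<close> to its component \<rho> of
    order prime to p. The quotient of \<open>zeta N\<close> by \<rho> is a p^k-th root of unity, so
    the two agree modulo \<pi>.\<close>
  obtain e where e: "[e = 1] (mod n)" "[e = 0] (mod p ^ k)" using binary_chinese_remainder_nat[OF cop] by blast
  define \<rho> where "\<rho> = zeta N ^ e"
  have \<rho>R: "\<rho> \<in> R" unfolding \<rho>_def R_def by (rule zeta_in_cyc_ring[OF N0]) simp
  have \<rho>n: "\<rho> ^ n = 1"
  proof -
    have "p ^ k dvd e" using e(2) by (simp add: cong_0_iff)
    then have "N dvd e * n" by (simp add: N)
    then show ?thesis by (simp add: \<rho>_def power_mult[symmetric] zeta_power_eq_1_iff[OF N0])
  qed
  have "\<exists>r\<in>R. zeta N - \<rho> = \<pi> * r"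
  proof -
    have "[p ^ k * e = p ^ k * 1] (mod p ^ k * n)" using e(1) by (rule cong_cmult_leftI)
    then have "zeta N ^ (e * p ^ k) = zeta N ^ (p ^ k)" using zeta_power_eq_iff[OF N0] by (simp add: N mult.commute)
    then have "(zeta N / \<rho>) ^ (p ^ k) = 1" by (simp add: power_divide \<rho>_def power_mult[symmetric])
    then obtain j where "zeta N / \<rho> = zeta (p ^ k) ^ j" using root_unity_eq_zeta_power[OF pk0] by blast
    then obtain u where u: "zeta N = \<rho> * \<xi> ^ u" using gen[of j] by (auto simp: \<rho>_def field_simps)
    obtain r where r: "r \<in> R" "1 - \<xi> ^ u = \<pi> * r" using div1 by blast
    have "zeta N - \<rho> = - (\<rho> * (1 - \<xi> ^ u))" by (simp add: u algebra_simps)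
    then have "zeta N - \<rho> = \<pi> * (- (\<rho> * r))" unfolding r(2) by simp
    then show ?thesis using ops(5)[OF ops(4)[OF \<rho>R r(1)]] by blast
  qed
  then obtain rz where rz: "rz \<in> R" "zeta N - \<rho> = \<pi> * rz" by blast
  obtain h where h: "coeffs_in \<int> h" "\<pi> * \<alpha> = poly h (zeta N)" using mem by (auto simp: \<pi>_def \<xi>_def cyc_ring_def)
  define \<beta> where "\<beta> = \<pi> * \<alpha>"
  define \<gamma> where "\<gamma> = poly h \<rho>"
  have hR: "coeffs_in R h" using h(1) R(2) by (rule coeffs_in_mono)
  have ztR: "zeta N \<in> R" using zeta_in_cyc_ring[OF N0, of N 1] by (simp add: R_def)
  have \<beta>R: "\<beta> \<in> R" using mem by (simp add: \<beta>_def \<pi>_def \<xi>_def R_def)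
  have \<gamma>R: "\<gamma> \<in> R" unfolding \<gamma>_def by (rule subring_C_poly[OF R(1) hR \<rho>R])
  obtain r1 where r1: "r1 \<in> R" "\<beta> - \<gamma> = (zeta N - \<rho>) * r1"
    using poly_diff_divisible[OF R(1) ztR \<rho>R hR] by (auto simp: \<beta>_def \<gamma>_def h(2))
  then have \<beta>\<gamma>: "rz * r1 \<in> R" "\<beta> - \<gamma> = \<pi> * (rz * r1)" using ops(4) rz by auto
  obtain q where q: "coeffs_in \<int> q" "lead_coeff q = 1" "poly q \<alpha> = 0"
    using al by (auto simp: algebraic_int_iff_integral_over integral_over_def)
  define s where "s = degree q"
  \<comment> \<open>The monic equation of \<alpha>, multiplied by \<pi>^s, expresses \<beta>^s by
    terms that all contain \<pi>: \<beta> is nilpotent modulo \<pi>.\<close>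
  have \<beta>s: "\<exists>r\<in>R. \<beta> ^ s = \<pi> * r"
  proof -
    have "0 = (\<Sum>i\<le>s. coeff q i * \<alpha> ^ i)" using q(3) by (simp add: poly_altdef s_def)
    also have "\<dots> = \<alpha> ^ s + (\<Sum>i<s. coeff q i * \<alpha> ^ i)" using q(2) by (simp add: s_def lessThan_Suc_atMost[symmetric])
    finally have "\<alpha> ^ s = - (\<Sum>i<s. coeff q i * \<alpha> ^ i)" by (metis add_eq_0_iff2)
    then have "\<beta> ^ s = - (\<Sum>i<s. \<pi> ^ s * (coeff q i * \<alpha> ^ i))"
      by (simp add: \<beta>_def power_mult_distrib sum_distrib_left)
    also have "(\<Sum>i<s. \<pi> ^ s * (coeff q i * \<alpha> ^ i)) = (\<Sum>i<s. \<pi> * (\<pi> ^ (s - 1 - i) * coeff q i * \<beta> ^ i))"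
    proof (intro sum.cong refl)
      fix i assume "i \<in> {..<s}"
      then have "\<pi> ^ s = \<pi> * \<pi> ^ (s - 1 - i) * \<pi> ^ i"
        by (simp add: power_Suc[symmetric] power_add[symmetric] del: power_Suc)
      then show "\<pi> ^ s * (coeff q i * \<alpha> ^ i) = \<pi> * (\<pi> ^ (s - 1 - i) * coeff q i * \<beta> ^ i)"
        by (simp add: \<beta>_def power_mult_distrib)
    qed
    finally have "\<beta> ^ s = \<pi> * (- (\<Sum>i<s. \<pi> ^ (s - 1 - i) * coeff q i * \<beta> ^ i))" by (simp add: sum_distrib_left)
    moreover have "(\<Sum>i<s. \<pi> ^ (s - 1 - i) * coeff q i * \<beta> ^ i) \<in> R"
      using q(1) R(2)
      by (intro subring_C_sum[OF R(1)] ops subring_C_power[OF R(1)] \<pi>R \<beta>R) (auto simp: coeffs_in_def)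
    ultimately show ?thesis using ops(5) by blast
  qed
  have \<gamma>s: "\<exists>r\<in>R. \<gamma> ^ s = \<pi> * r"
  proof -
    obtain r2 where r2: "r2 \<in> R" "\<beta> ^ s = \<pi> * r2" using \<beta>s by blast
    obtain r3 where r3: "r3 \<in> R" "\<beta> ^ s - \<gamma> ^ s = (\<beta> - \<gamma>) * r3" using power_diff_divisible[OF R(1) \<beta>R \<gamma>R] by blast
    have "\<gamma> ^ s = \<pi> * (r2 + - (rz * r1 * r3))" using r2(2) r3(2) \<beta>\<gamma>(2) by (simp add: algebra_simps)
    moreover have "r2 + - (rz * r1 * r3) \<in> R" by (intro ops r2(1) r3(1) rz(1) r1(1))
    ultimately show ?thesis by blast
  qed
  \<comment> \<open>Since n divides p^(totient n) - 1, the power p^f fixes \<rho>; the factor s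
    ensures p^f \<ge> s, so that \<gamma>^(p^f) is divisible by \<pi>. As this power is congruent to
    \<gamma> modulo p, \<pi> divides \<gamma> too.\<close>
  define f where "f = totient n * s"
  have "[p ^ totient n = 1] (mod n)" using p n(2) by (intro euler_theorem prime_imp_coprime_nat)
  then have "[p ^ f = 1] (mod n)" unfolding f_def power_mult by (metis cong_pow power_one)
  then have "\<rho> ^ (p ^ f) = \<rho>"
  proof -
    obtain i where i: "\<rho> = zeta n ^ i" using root_unity_eq_zeta_power[OF n(1) \<rho>n] by blast
    have "[i * p ^ f = i * 1] (mod n)" using \<open>[p ^ f = 1] (mod n)\<close> by (rule cong_scalar_left)
    then show ?thesis using zeta_power_eq_iff[OF n(1)] by (simp add: i power_mult[symmetric])
  qed
  then obtain r4 where r4: "r4 \<in> R" "\<gamma> ^ (p ^ f) = \<gamma> + of_nat p * r4"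
    using frobenius_iterate[OF R p h(1) \<rho>R, of f] by (auto simp: \<gamma>_def)
  have "s \<le> p ^ f"
  proof -
    have "1 * s \<le> totient n * s" by (rule mult_le_mono1) (use n(1) in \<open>simp add: Suc_leI\<close>)
    then have "s \<le> f" unfolding f_def by simp
    also have "f < p ^ f" using prime_gt_1_nat[OF p] by (simp add: power_gt_expt)
    finally show ?thesis by simp
  qed
  then have "\<gamma> ^ (p ^ f) = \<gamma> ^ s * \<gamma> ^ (p ^ f - s)" by (simp add: power_add[symmetric])
  moreover obtain r5 where r5: "r5 \<in> R" "\<gamma> ^ s = \<pi> * r5" using \<gamma>s by blast
  ultimately have "\<gamma> = \<pi> * (r5 * \<gamma> ^ (p ^ f - s) + - (rp * r4))"
    using r4(2) rp(2) by (simp add: algebra_simps)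
  then have "\<pi> * \<alpha> = \<pi> * (r5 * \<gamma> ^ (p ^ f - s) + - (rp * r4) + rz * r1)"
    using \<beta>\<gamma>(2) unfolding \<beta>_def by (simp add: algebra_simps)
  then have "\<alpha> = r5 * \<gamma> ^ (p ^ f - s) + - (rp * r4) + rz * r1" using \<pi>0 by (metis mult_left_cancel)
  also have "\<dots> \<in> R" by (intro ops r5(1) rp(1) r4(1) r1(1) rz(1) subring_C_power[OF R(1)] \<gamma>R)
  finally show ?thesis by (simp add: R_def)
qed

text \<open>The value at 1 of 1 + X + ... + X^(n-1). It equals the product of the X - zeta^a because
  both are monic of degree n - 1 and share n - 1 roots.\<close>

lemma prod_one_minus_roots_unity:
  assumes "n > 0"
  shows "(\<Prod>a\<in>{1..<n}. 1 - zeta n ^ a) = of_nat n"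
proof -
  define p where "p = (\<Prod>a\<in>{1..<n}. [:- (zeta n ^ a), 1:])"
  define q where "q = (\<Sum>j<n. monom (1 :: complex) j)"
  have inj: "inj_on (\<lambda>a. zeta n ^ a) {1..<n}"
    using zeta_power_eq_iff[OF assms] by (auto simp: inj_on_def cong_def)
  have "p = q"
  proof (rule ccontr)
    assume ne: "p \<noteq> q"
    have cq: "coeff q i = (if i < n then 1 else 0)" for i by (simp add: q_def coeff_sum if_distrib cong: if_cong)
    have lp: "lead_coeff p = 1" unfolding p_def lead_coeff_prod by simp
    have dp: "degree p = n - 1" by (simp add: p_def degree_prod_eq_sum_degree)
    have "coeff (p - q) i = 0" if "i \<ge> n - 1" for i
      using dp lp cq[of i] coeff_eq_0[of p i] that assms by (cases "i = n - 1") auto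
    then have deg: "degree (p - q) < n - 1 \<or> p - q = 0"
      by (metis leading_coeff_0_iff linorder_not_less)
    have "poly (p - q) (zeta n ^ a) = 0" if a: "a \<in> {1..<n}" for a
    proof -
      have "(zeta n ^ a) ^ n = 1" using assms by (simp add: power_mult[symmetric] zeta_power_eq_1_iff)
      then have "(zeta n ^ a - 1) * (\<Sum>j<n. (zeta n ^ a) ^ j) = 0" by (metis power_diff_1_eq right_minus_eq)
      moreover have "zeta n ^ a \<noteq> 1" using a by (auto simp: zeta_power_eq_1_iff assms dest: dvd_imp_le)
      ultimately have "poly q (zeta n ^ a) = 0" by (simp add: q_def poly_sum poly_monom)
      moreover have "poly p (zeta n ^ a) = 0" using a by (auto simp: p_def poly_prod)
      ultimately show ?thesis by simp
    qed
    then have "(\<lambda>a. zeta n ^ a) ` {1..<n} \<subseteq> {x. poly (p - q) x = 0}" by auto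
    then have "card ((\<lambda>a. zeta n ^ a) ` {1..<n}) \<le> degree (p - q)"
      using ne poly_roots_finite[of "p - q"] card_poly_roots_bound[of "p - q"] card_mono
      by (metis (no_types, lifting) eq_iff_diff_eq_0 order_trans)
    then have "n - 1 \<le> degree (p - q)" using card_image[OF inj] by simp
    then show False using deg ne by simp
  qed
  have "poly p 1 = (\<Prod>a\<in>{1..<n}. 1 - zeta n ^ a)" by (simp add: p_def poly_prod)
  moreover have "poly q 1 = of_nat n" by (simp add: q_def poly_sum poly_monom)
  ultimately show ?thesis using \<open>p = q\<close> by simp
qed

text \<open>The products for p^k and p^(k-1) are divided: the factors with p dividing a are exactly
  those of the lower level.\<close>

lemma prod_one_minus_primitive_roots_unity:
  assumes p: "prime p" and k: "k > 0"
  shows "(\<Prod>a\<in>{a \<in> {1..<p ^ k}. \<not> p dvd a}. 1 - zeta (p ^ k) ^ a) = of_nat p"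
proof -
  have p0: "p > 0" using p prime_gt_0_nat by blast
  have e: "p ^ k = p * p ^ (k - 1)" using k by (simp add: power_eq_if)
  define f where "f a = 1 - zeta (p ^ k) ^ a" for a
  have "(\<Prod>a\<in>{1..<p ^ k}. f a) = (\<Prod>a\<in>{a \<in> {1..<p ^ k}. \<not> p dvd a}. f a) * (\<Prod>a\<in>{a \<in> {1..<p ^ k}. p dvd a}. f a)"
    by (subst prod.union_disjoint[symmetric]) (auto intro!: prod.cong)
  moreover have "(\<Prod>a\<in>{a \<in> {1..<p ^ k}. p dvd a}. f a) = (\<Prod>b\<in>{1..<p ^ (k - 1)}. 1 - zeta (p ^ (k - 1)) ^ b)"
  proof (rule prod.reindex_bij_witness[of _ "\<lambda>b. p * b" "\<lambda>a. a div p"], goal_cases)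
    case (2 a)
    then obtain b where "a = p * b" by (auto elim: dvdE)
    with 2 e p0 show ?case by auto
  next
    case (5 a)
    then obtain b where b: "a = p * b" by (auto elim: dvdE)
    have "zeta (p ^ k) ^ a = zeta (p ^ (k - 1)) ^ b" unfolding b e power_mult zeta_mult_power[OF p0] ..
    then show ?case using b p0 by (simp add: f_def)
  qed (use e p0 in \<open>auto simp: \<close>)
  ultimately have "of_nat (p ^ k) = (\<Prod>a\<in>{a \<in> {1..<p ^ k}. \<not> p dvd a}. f a) * of_nat (p ^ (k - 1))"
    using prod_one_minus_roots_unity[of "p ^ k"] prod_one_minus_roots_unity[of "p ^ (k - 1)"] p0 by (simp add: f_def)
  then show ?thesis using p0 unfolding f_def e by simp
qed

text \<open>p is the product of the 1 - zeta^a over the primitive roots whose order is the full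
  power of p in N, and these factors are removed one at a time. Each removal needs the remaining
  multiple of \<alpha> to be integral, so this is carried through the induction.\<close>

lemma cyc_ring_divide_prime:
  assumes N: "N > 0" and p: "prime p" "p dvd N" and al: "algebraic_int \<alpha>" and mem: "of_nat p * \<alpha> \<in> cyc_ring N"
  shows "\<alpha> \<in> cyc_ring N"
proof -
  define k where "k = multiplicity p N"
  define n where "n = N div p ^ k"
  have Nn: "N = p ^ k * n" unfolding n_def k_def by (simp add: multiplicity_dvd)
  have n: "n > 0" "\<not> p dvd n"
  proof -
    show "n > 0" using N Nn by (intro Nat.gr0I) auto
    show "\<not> p dvd n" unfolding n_def k_def
      by (rule multiplicity_decompose) (use N p(1) in \<open>auto dest: not_prime_unit\<close>)
  qed
  have k: "k > 0" using p N by (simp add: k_def prime_multiplicity_gt_zero_iff)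
  define S where "S = {a \<in> {1..<p ^ k}. \<not> p dvd a}"
  have "finite S" by (simp add: S_def)
  have main: "finite T \<Longrightarrow> T \<subseteq> S \<Longrightarrow> algebraic_int \<alpha> \<Longrightarrow> (\<Prod>a\<in>T. 1 - zeta (p ^ k) ^ a) * \<alpha> \<in> cyc_ring N \<Longrightarrow> \<alpha> \<in> cyc_ring N" for T \<alpha>
  proof (induction T arbitrary: \<alpha> rule: finite_induct)
    case (insert a T)
    have "algebraic_int (zeta (p ^ k) ^ a)"
      by (rule cyc_ring_algebraic_int[OF N zeta_in_cyc_ring[OF N]]) (simp add: Nn)
    then have ai: "algebraic_int ((1 - zeta (p ^ k) ^ a) * \<alpha>)"
      using insert.prems by (intro algebraic_int_mult algebraic_int_diff) auto
    have "(\<Prod>a\<in>T. 1 - zeta (p ^ k) ^ a) * ((1 - zeta (p ^ k) ^ a) * \<alpha>) \<in> cyc_ring N"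
      using insert by (simp add: mult_ac)
    then have *: "(1 - zeta (p ^ k) ^ a) * \<alpha> \<in> cyc_ring N" using insert.IH[OF _ ai] insert.prems by simp
    have "coprime a p" using prime_imp_coprime_nat[OF p(1), of a] insert.prems by (auto simp: S_def coprime_commute)
    then show ?case using cyc_ring_divide_prime_element[OF p(1) n Nn k _ insert.prems(2) *] by simp
  qed simp
  show ?thesis
    by (rule main[OF \<open>finite S\<close> subset_refl al])
      (use mem prod_one_minus_primitive_roots_unity[OF p(1) k] in \<open>simp add: S_def\<close>)
qed

lemma cyc_ring_divide:
  assumes N: "N > 0" and m: "m > 0" and "\<And>p. prime p \<Longrightarrow> p dvd m \<Longrightarrow> p dvd N" 
    and "algebraic_int \<alpha>" "of_nat m * \<alpha> \<in> cyc_ring N"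
  shows "\<alpha> \<in> cyc_ring N"
  using assms(2-)
proof (induction m arbitrary: \<alpha> rule: prime_divisors_induct)
  case (factor p x)
  have "of_nat x * (of_nat p * \<alpha>) \<in> cyc_ring N" using factor.prems(4) by (simp add: mult_ac)
  moreover have "x > 0" using factor.prems(1) by (intro Nat.gr0I) simp
  moreover have "q dvd N" if "prime q" "q dvd x" for q using factor.prems(2)[of q] that by simp
  moreover have "algebraic_int (of_nat p * \<alpha>)"
    using factor.prems(3) by (intro algebraic_int_mult algebraic_int_of_nat)
  ultimately have "of_nat p * \<alpha> \<in> cyc_ring N" using factor.IH by blast
  moreover have "p dvd N" using factor.prems(2)[of p] factor.hyps by simp
  ultimately show ?case using cyc_ring_divide_prime[OF N factor.hyps(1) \<open>p dvd N\<close>] factor.prems(3) by simp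
qed auto

text \<open>A crude bound, in terms of \<theta> only, for the coefficients of all products of linear
  factors over subsets of the orbit: the sum of everything that can occur.\<close>

definition conj_bound :: "complex \<Rightarrow> real" where
  "conj_bound \<theta> = (\<Sum>T\<in>Pow (orbit \<theta>). \<Sum>i\<le>card (orbit \<theta>). cmod (coeff (\<Prod>t\<in>T. [:- t, 1:]) i))"

definition rel_orbit :: "complex \<Rightarrow> complex \<Rightarrow> complex set" where
  "rel_orbit \<xi> \<theta> = {\<sigma> \<theta> | \<sigma>. gal \<sigma> \<and> \<sigma> \<xi> = \<xi>}"

text \<open>A is the Lagrange interpolation polynomial, without denominators, that takes the
  conjugates of \<theta> over \<xi> to the corresponding conjugates of x. Its coefficients are
  symmetric, hence invariant over \<xi>, and they inherit integrality and a bound. At \<theta> only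
  one summand survives, so x is a combination of powers of \<theta> with invariant coefficients, up
  to the factor formed by the differences \<theta> - t.\<close>

lemma lagrange_descent:
  assumes \<xi>: "\<xi> \<in> qbar" and \<theta>: "algebraic_int \<theta>" and x: "algebraic_int x"
    and dep: "\<And>\<sigma>. gal \<sigma> \<Longrightarrow> \<sigma> \<xi> = \<xi> \<Longrightarrow> \<sigma> \<theta> = \<theta> \<Longrightarrow> \<sigma> x = x"
    and bd: "\<And>\<sigma>. gal \<sigma> \<Longrightarrow> cmod (\<sigma> x) \<le> c"
  shows "\<exists>A. (\<forall>i. algebraic_int (coeff A i)) \<and> degree A < card (orbit \<theta>) \<and>
    poly A \<theta> = x * (\<Prod>t\<in>rel_orbit \<xi> \<theta> - {\<theta>}. \<theta> - t) \<and>
    (\<forall>\<sigma> i. gal \<sigma> \<longrightarrow> \<sigma> \<xi> = \<xi> \<longrightarrow> \<sigma> (coeff A i) = coeff A i) \<and>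
    (\<forall>\<sigma> i. gal \<sigma> \<longrightarrow> cmod (\<sigma> (coeff A i)) \<le> real (card (orbit \<theta>)) * (c * conj_bound \<theta>))"
proof -
  define H where "H = {\<sigma>. gal \<sigma> \<and> \<sigma> \<xi> = \<xi>}"
  define S where "S = rel_orbit \<xi> \<theta>"
  have \<theta>q: "\<theta> \<in> qbar" and xq: "x \<in> qbar" using \<theta> x algebraic_int_qbar by auto
  have SO: "S \<subseteq> orbit \<theta>" by (auto simp: S_def rel_orbit_def orbit_def)
  have fO: "finite (orbit \<theta>)" by (rule finite_orbit[OF \<theta>q])
  have fS: "finite S" using SO fO finite_subset by blast
  have Sq: "S \<subseteq> qbar" using SO orbit_subset_qbar[OF \<theta>q] by blast
  have \<theta>S: "\<theta> \<in> S" unfolding S_def rel_orbit_def using gal_id by (auto intro!: exI[of _ id])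
  have Hcomp: "\<sigma> \<circ> \<tau> \<in> H" if "\<sigma> \<in> H" "\<tau> \<in> H" for \<sigma> \<tau> using that gal_comp by (auto simp: H_def)
  \<comment> \<open>An automorphism over \<xi> sending \<theta> to s. Its value at x depends on s
    alone, by \<open>dep\<close>; this is the claim \<open>same\<close>.\<close>
  define pick where "pick s = (SOME \<sigma>. \<sigma> \<in> H \<and> \<sigma> \<theta> = s)" for s
  have pick: "pick s \<in> H" "pick s \<theta> = s" if "s \<in> S" for s
  proof -
    have "\<exists>\<sigma>. \<sigma> \<in> H \<and> \<sigma> \<theta> = s" using that by (auto simp: S_def rel_orbit_def H_def)
    from someI_ex[OF this] show "pick s \<in> H" "pick s \<theta> = s" by (auto simp: pick_def)
  qed
  define v where "v s = pick s x" for s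
  have same: "\<sigma> x = \<tau> x" if st: "\<sigma> \<in> H" "\<tau> \<in> H" "\<sigma> \<theta> = \<tau> \<theta>" for \<sigma> \<tau>
  proof -
    obtain \<sigma>' where s': "gal \<sigma>'" "\<And>x. x \<in> qbar \<Longrightarrow> \<sigma>' (\<sigma> x) = x" "\<And>x. x \<in> qbar \<Longrightarrow> \<sigma> (\<sigma>' x) = x"
      using gal_inverse[of \<sigma>] st(1) by (auto simp: H_def)
    have "\<sigma>' \<xi> = \<xi>" using s'(2)[OF \<xi>] st(1) by (simp add: H_def)
    then have "(\<sigma>' \<circ> \<tau>) x = x"
      using st s'(2)[OF \<theta>q] s'(1) by (intro dep gal_comp) (auto simp: H_def)
    then show ?thesis using s'(3)[of "\<tau> x"] gal_closed[of \<tau> x] xq st(2) by (simp add: H_def)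
  qed
  have v: "v (\<sigma> \<theta>) = \<sigma> x" if "\<sigma> \<in> H" for \<sigma>
  proof -
    have "\<sigma> \<theta> \<in> S" using that by (auto simp: S_def rel_orbit_def H_def)
    then show ?thesis unfolding v_def using pick that same by blast
  qed
  define L where "L T = (\<Prod>t\<in>T. [:- t, 1:])" for T :: "complex set"
  define A where "A = (\<Sum>s\<in>S. smult (v s) (L (S - {s})))"
  have vai: "algebraic_int (v s)" if "s \<in> S" for s
    unfolding v_def using pick(1)[OF that] x gal_algebraic_int by (auto simp: H_def)
  have sai: "algebraic_int s" if "s \<in> S" for s
    using that \<theta> gal_algebraic_int by (auto simp: S_def rel_orbit_def)
  have Lai: "coeffs_in {x. algebraic_int x} (L T)" if "T \<subseteq> S" for T
    unfolding L_def using that sai by (intro coeffs_in_prod coeffs_in_linear subring_C_algebraic_int) auto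
  have Aai: "coeffs_in {x. algebraic_int x} A"
    unfolding A_def by (intro coeffs_in_sum coeffs_in_smult subring_C_algebraic_int Lai) (auto simp: vai)
  have degL: "degree (L T) = card T" for T by (simp add: L_def degree_prod_eq_sum_degree)
  have "degree A < card S"
  proof -
    have "degree (smult (v s) (L (S - {s}))) < card S" if "s \<in> S" for s
      using degree_smult_le[of "v s" "L (S - {s})"] that fS card_gt_0_iff[of S] by (auto simp: degL card_Diff_singleton)
    moreover have "card S > 0" using \<theta>S fS card_gt_0_iff by blast
    ultimately show ?thesis unfolding A_def by (intro degree_sum_less) auto
  qed
  then have degA: "degree A < card (orbit \<theta>)" using card_mono[OF fO SO] by simp
  have v\<theta>: "v \<theta> = x" using v[of id] \<xi> gal_id by (simp add: H_def)
  have "poly A \<theta> = (\<Sum>s\<in>S. v s * (\<Prod>t\<in>S - {s}. \<theta> - t))"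
    by (simp add: A_def L_def poly_sum poly_prod)
  also have "\<dots> = (\<Sum>s\<in>{\<theta>}. v s * (\<Prod>t\<in>S - {s}. \<theta> - t))"
  proof (rule sum.mono_neutral_right[OF fS])
    show "\<forall>s\<in>S - {\<theta>}. v s * (\<Prod>t\<in>S - {s}. \<theta> - t) = 0" using \<theta>S fS by (auto intro!: prod_zero)
  qed (use \<theta>S in auto)
  finally have val: "poly A \<theta> = x * (\<Prod>t\<in>S - {\<theta>}. \<theta> - t)" by (simp add: v\<theta>)
  have image: "\<sigma> (coeff A i) = (\<Sum>s\<in>S. \<sigma> (v s) * coeff (L (\<sigma> ` (S - {s}))) i)" if \<sigma>: "gal \<sigma>" for \<sigma> i
  proof -
    have "\<sigma> (coeff (L (S - {s})) i) = coeff (L (\<sigma> ` (S - {s}))) i" for s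
    proof -
      have "\<sigma> (coeff (L (S - {s})) i) = coeff (map_poly \<sigma> (L (S - {s}))) i" using \<sigma> by (simp add: coeff_map_poly gal_0)
      also have "map_poly \<sigma> (L (S - {s})) = (\<Prod>s\<in>S - {s}. [:- \<sigma> s, 1:])"
        unfolding L_def by (rule gal_map_poly_prod_linear[OF \<sigma>]) (use Sq in auto)
      also have "\<dots> = L (\<sigma> ` (S - {s}))"
        unfolding L_def by (subst prod.reindex) (use Sq \<sigma> in \<open>auto simp: inj_on_def gal_inj subset_iff\<close>)
      finally show ?thesis .
    qed
    moreover have "coeff (L (S - {s})) i \<in> qbar" for s
      using Lai[of "S - {s}"] algebraic_int_qbar by (auto simp: coeffs_in_def)
    ultimately show ?thesis
      using vai algebraic_int_qbar \<sigma> by (simp add: A_def coeff_sum gal_sum gal_mult qbar_mult)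
  qed
  have inv: "\<sigma> (coeff A i) = coeff A i" if \<sigma>: "gal \<sigma>" "\<sigma> \<xi> = \<xi>" for \<sigma> i
  proof -
    have bij: "bij_betw \<sigma> S S"
    proof -
      have "\<sigma> ` S \<subseteq> S"
        using gal_comp[OF \<sigma>(1)] \<sigma>(2) unfolding S_def rel_orbit_def by (auto, metis comp_apply)
      moreover have inj: "inj_on \<sigma> S" using Sq \<sigma>(1) by (auto simp: inj_on_def gal_inj subset_iff)
      ultimately show ?thesis using endo_inj_surj[OF fS] by (auto simp: bij_betw_def)
    qed
    have "\<sigma> (coeff A i) = (\<Sum>s\<in>S. v (\<sigma> s) * coeff (L (S - {\<sigma> s})) i)"
      unfolding image[OF \<sigma>(1)]
    proof (intro sum.cong refl)
      fix s assume s: "s \<in> S"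
      have "\<sigma> \<in> H" using \<sigma> by (simp add: H_def)
      then have "v (\<sigma> s) = \<sigma> (v s)" using v[OF Hcomp[OF _ pick(1)[OF s]], of \<sigma>] pick(2)[OF s] by (simp add: v_def)
      moreover have "\<sigma> ` (S - {s}) = S - {\<sigma> s}"
        using bij s by (auto simp: bij_betw_def inj_on_image_set_diff[of \<sigma> S])
      ultimately show "\<sigma> (v s) * coeff (L (\<sigma> ` (S - {s}))) i = v (\<sigma> s) * coeff (L (S - {\<sigma> s})) i" by simp
    qed
    also have "\<dots> = (\<Sum>s\<in>S. v s * coeff (L (S - {s})) i)"
      by (rule sum.reindex_bij_betw[OF bij])
    also have "\<dots> = coeff A i" by (simp add: A_def coeff_sum)
    finally show ?thesis .
  qed
  have c0: "c \<ge> 0" using bd[OF gal_id] norm_ge_zero order_trans by blast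
  have bound: "cmod (\<sigma> (coeff A i)) \<le> real (card (orbit \<theta>)) * (c * conj_bound \<theta>)" if \<sigma>: "gal \<sigma>" for \<sigma> i
  proof -
    have cb0: "conj_bound \<theta> \<ge> 0" unfolding conj_bound_def by (intro sum_nonneg) auto
    have t: "cmod (\<sigma> (v s) * coeff (L (\<sigma> ` (S - {s}))) i) \<le> c * conj_bound \<theta>" if s: "s \<in> S" for s
    proof -
      have "\<sigma> (v s) = (\<sigma> \<circ> pick s) x" by (simp add: v_def)
      then have 1: "cmod (\<sigma> (v s)) \<le> c" using bd gal_comp[OF \<sigma>] pick(1)[OF s] by (simp add: H_def del: comp_apply)
      let ?T = "\<sigma> ` (S - {s})"
      have T: "?T \<subseteq> orbit \<theta>" using SO orbit_closed[OF \<sigma>] by blast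
      have "cmod (coeff (L ?T) i) \<le> conj_bound \<theta>"
      proof (cases "i \<le> card (orbit \<theta>)")
        case True
        have "cmod (coeff (L ?T) i) \<le> (\<Sum>i\<le>card (orbit \<theta>). cmod (coeff (L ?T) i))"
          using True by (intro member_le_sum) auto
        also have "\<dots> \<le> conj_bound \<theta>" unfolding conj_bound_def L_def
          using T fO by (intro member_le_sum[where f = "\<lambda>T. \<Sum>i\<le>card (orbit \<theta>). cmod (coeff (\<Prod>t\<in>T. [:- t, 1:]) i)"] sum_nonneg) auto
        finally show ?thesis .
      next
        case False
        then have "degree (L ?T) < i" using card_mono[OF fO T] by (simp add: degL)
        then show ?thesis using cb0 by (simp add: coeff_eq_0)
      qed
      then show ?thesis unfolding norm_mult using 1 c0 by (intro mult_mono) auto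
    qed
    have "cmod (\<sigma> (coeff A i)) \<le> (\<Sum>s\<in>S. c * conj_bound \<theta>)"
      unfolding image[OF \<sigma>] by (rule sum_norm_le) (rule t)
    also have "\<dots> \<le> real (card (orbit \<theta>)) * (c * conj_bound \<theta>)"
      using card_mono[OF fO SO] c0 cb0 by (simp add: mult_right_mono)
    finally show ?thesis .
  qed
  show ?thesis
    using Aai degA val inv bound unfolding S_def by (intro exI[of _ A]) (auto simp: coeffs_in_def)
qed

text \<open>Interpolation at the conjugates of \<open>zeta N\<close> over the rationals yields
  integer coefficients, so x times the product of the differences lies in the ring. Each difference
  divides N there; hence so does a multiple of x by a power of N, and N can be divided out because
  its primes divide the level.\<close>

lemma fixed_algebraic_int_in_cyc_ring:
  assumes N: "N > 0" and x: "algebraic_int x"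
    and dep: "\<And>\<sigma>. gal \<sigma> \<Longrightarrow> \<sigma> (zeta N) = zeta N \<Longrightarrow> \<sigma> x = x"
  shows "x \<in> cyc_ring N"
proof -
  let ?z = "zeta N"
  define S where "S = rel_orbit 1 ?z"
  have xq: "x \<in> qbar" by (rule algebraic_int_qbar[OF x])
  have "\<exists>c. \<forall>\<sigma>. gal \<sigma> \<longrightarrow> cmod (\<sigma> x) \<le> c"
  proof -
    have "finite (cmod ` orbit x)" using finite_orbit[OF xq] by simp
    then have "\<forall>y\<in>cmod ` orbit x. y \<le> Max (cmod ` orbit x)" by simp
    then show ?thesis by (auto simp: orbit_def)
  qed
  then obtain c where c: "\<And>\<sigma>. gal \<sigma> \<Longrightarrow> cmod (\<sigma> x) \<le> c" by blast
  have zai: "algebraic_int ?z" using root_unity_algebraic_int[OF N zeta_power_self[OF N]] .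
  have "\<exists>A. (\<forall>i. algebraic_int (coeff A i)) \<and> degree A < card (orbit ?z) \<and>
      poly A ?z = x * (\<Prod>t\<in>rel_orbit 1 ?z - {?z}. ?z - t) \<and>
      (\<forall>\<sigma> i. gal \<sigma> \<longrightarrow> \<sigma> 1 = 1 \<longrightarrow> \<sigma> (coeff A i) = coeff A i) \<and>
      (\<forall>\<sigma> i. gal \<sigma> \<longrightarrow> cmod (\<sigma> (coeff A i)) \<le> real (card (orbit ?z)) * (c * conj_bound ?z))"
    by (rule lagrange_descent[OF qbar_1 zai x]) (use dep c in auto)
  then obtain A where A: "\<forall>i. algebraic_int (coeff A i)" "poly A ?z = x * (\<Prod>t\<in>S - {?z}. ?z - t)"
    "\<forall>\<sigma> i. gal \<sigma> \<longrightarrow> \<sigma> 1 = 1 \<longrightarrow> \<sigma> (coeff A i) = coeff A i"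
    unfolding S_def by blast
  have "coeffs_in \<int> A" unfolding coeffs_in_def using A gal_1 gal_fixed_imp_Ints by metis
  then have mem: "x * (\<Prod>t\<in>S - {?z}. ?z - t) \<in> cyc_ring N" unfolding A(2)[symmetric] by (auto simp: cyc_ring_def)
  note R = subring_C_closed[OF subring_cyc_ring[of N]]
  have root: "t ^ N = 1" if "t \<in> S" for t
    using that N by (auto simp: S_def rel_orbit_def gal_root_unity zeta_power_self)
  have "(\<Prod>t\<in>S - {?z}. of_nat N / (?z - t)) \<in> cyc_ring N"
  proof (rule subring_C_prod[OF subring_cyc_ring])
    fix t assume t: "t \<in> S - {?z}"
    have t1: "t \<noteq> 0" using root[of t] N t by (auto simp: power_0_left)
    have w: "(?z / t) ^ N = 1" "?z / t \<noteq> 1" using root[of t] t t1 N by (auto simp: power_divide zeta_power_self)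
    have "of_nat N / (?z - t) = (\<Sum>j<N. of_nat j * (?z / t) ^ j) * (1 / t)"
      using divide_root_unity_minus_1[OF N w] t1 by (simp add: field_simps)
    also have "\<dots> \<in> cyc_ring N"
    proof -
      have "(1 / t) ^ N = 1" using root[of t] t by (simp add: power_one_over)
      then show ?thesis
        by (intro R subring_C_sum[OF subring_cyc_ring] subring_C_power[OF subring_cyc_ring] root_unity_in_cyc_ring[OF N] w(1))
    qed
    finally show "of_nat N / (?z - t) \<in> cyc_ring N" .
  qed
  then have "(x * (\<Prod>t\<in>S - {?z}. ?z - t)) * (\<Prod>t\<in>S - {?z}. of_nat N / (?z - t)) \<in> cyc_ring N"
    by (rule R(4)[OF mem])
  also have "(x * (\<Prod>t\<in>S - {?z}. ?z - t)) * (\<Prod>t\<in>S - {?z}. of_nat N / (?z - t)) = of_nat (N ^ card (S - {?z})) * x"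
  proof -
    have "(\<Prod>t\<in>S - {?z}. ?z - t) * (\<Prod>t\<in>S - {?z}. of_nat N / (?z - t)) = (\<Prod>t\<in>S - {?z}. of_nat N)"
      unfolding prod.distrib[symmetric] by (intro prod.cong) auto
    then show ?thesis by (simp add: mult_ac)
  qed
  finally have "of_nat (N ^ card (S - {?z})) * x \<in> cyc_ring N" .
  then show ?thesis
    by (rule cyc_ring_divide[OF N _ _ x, rotated 2]) (use N in \<open>auto dest: prime_dvd_power\<close>)
qed

section \<open>Loxton's theorem\<close>

text \<open>Coefficients may be 0, so R only bounds the number of terms; for this reason E will
  contain 0.\<close>

definition short_sum :: "nat \<Rightarrow> complex set \<Rightarrow> complex \<Rightarrow> bool" where
  "short_sum R E \<alpha> \<longleftrightarrow> (\<exists>e \<zeta>. (\<forall>j<R. e j \<in> E \<and> \<zeta> j \<in> roots_of_unity) \<and> \<alpha> = (\<Sum>j<R. e j * \<zeta> j))"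

lemma roots_of_unity_1 [simp]: "1 \<in> roots_of_unity"
  by (auto simp: roots_of_unity_def intro: exI[of _ 1])

lemma roots_of_unity_mult: assumes "x \<in> roots_of_unity" "y \<in> roots_of_unity" shows "x * y \<in> roots_of_unity"
proof -
  obtain m n where mn: "m > 0" "x ^ m = 1" "n > 0" "y ^ n = 1" using assms by (auto simp: roots_of_unity_def)
  have "(x * y) ^ (m * n) = (x ^ m) ^ n * (y ^ n) ^ m" by (simp add: power_mult_distrib power_mult[symmetric] mult.commute)
  also have "\<dots> = 1" using mn by simp
  finally show ?thesis using mn unfolding roots_of_unity_def by (auto intro!: exI[of _ "m * n"])
qed

lemma roots_of_unity_inverse: "x \<in> roots_of_unity \<Longrightarrow> inverse x \<in> roots_of_unity"
  by (auto simp: roots_of_unity_def power_inverse)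

lemma roots_of_unity_power: "x \<in> roots_of_unity \<Longrightarrow> x ^ n \<in> roots_of_unity"
  by (induction n) (auto intro: roots_of_unity_mult)

lemma roots_of_unityI: "n > 0 \<Longrightarrow> x ^ n = 1 \<Longrightarrow> x \<in> roots_of_unity"
  by (auto simp: roots_of_unity_def)

lemma zeta_roots_of_unity: "N > 0 \<Longrightarrow> zeta N \<in> roots_of_unity"
  using zeta_power_self roots_of_unityI by blast

lemma roots_of_unity_qbar: "x \<in> roots_of_unity \<Longrightarrow> x \<in> qbar"
  using root_unity_qbar by (auto simp: roots_of_unity_def)

lemma roots_of_unity_nonzero: "x \<in> roots_of_unity \<Longrightarrow> x \<noteq> 0"
  by (auto simp: roots_of_unity_def power_0_left split: if_splits)

lemma short_sum_0: "0 \<in> E \<Longrightarrow> short_sum R E 0"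
  unfolding short_sum_def by (intro exI[of _ "\<lambda>_. 0"] exI[of _ "\<lambda>_. 1"]) auto

lemma short_sum_add:
  assumes "short_sum R1 E a" "short_sum R2 E b"
  shows "short_sum (R1 + R2) E (a + b)"
proof -
  obtain e \<zeta> where 1: "\<forall>j<R1. e j \<in> E \<and> \<zeta> j \<in> roots_of_unity" "a = (\<Sum>j<R1. e j * \<zeta> j)"
    using assms(1) unfolding short_sum_def by blast
  obtain f \<eta> where 2: "\<forall>j<R2. f j \<in> E \<and> \<eta> j \<in> roots_of_unity" "b = (\<Sum>j<R2. f j * \<eta> j)"
    using assms(2) unfolding short_sum_def by blast
  define g where "g j = (if j < R1 then e j else f (j - R1))" for j
  define \<theta> where "\<theta> j = (if j < R1 then \<zeta> j else \<eta> (j - R1))" for j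
  have "(\<Sum>j<R1 + R2. g j * \<theta> j) = (\<Sum>j<R1. g j * \<theta> j) + (\<Sum>j<R2. g (R1 + j) * \<theta> (R1 + j))"
    by (induction R2) (simp_all add: add.assoc)
  also have "\<dots> = a + b" unfolding 1(2) 2(2) g_def \<theta>_def by simp
  finally have "a + b = (\<Sum>j<R1 + R2. g j * \<theta> j)" by simp
  moreover have "\<forall>j<R1 + R2. g j \<in> E \<and> \<theta> j \<in> roots_of_unity" using 1(1) 2(1) by (auto simp: g_def \<theta>_def)
  ultimately show ?thesis unfolding short_sum_def by blast
qed

lemma short_sum_sum:
  "finite S \<Longrightarrow> (\<And>s. s \<in> S \<Longrightarrow> short_sum R E (f s)) \<Longrightarrow> 0 \<in> E \<Longrightarrow> short_sum (card S * R) E (sum f S)"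
  by (induction S rule: finite_induct) (auto intro: short_sum_0 short_sum_add)

lemma short_sum_mono:
  assumes "short_sum R E a" "R \<le> R'" "E \<subseteq> E'" "0 \<in> E'"
  shows "short_sum R' E' a"
proof -
  have "short_sum R E' a" using assms(1,3) unfolding short_sum_def by blast
  from short_sum_add[OF this short_sum_0[OF assms(4), of "R' - R"]] show ?thesis using assms(2) by simp
qed

lemma short_sum_root_mult:
  assumes "w \<in> roots_of_unity" "short_sum R E a" shows "short_sum R E (w * a)"
proof -
  obtain e \<zeta> where 1: "\<forall>j<R. e j \<in> E \<and> \<zeta> j \<in> roots_of_unity" "a = (\<Sum>j<R. e j * \<zeta> j)"
    using assms(2) unfolding short_sum_def by blast
  then have "w * a = (\<Sum>j<R. e j * (w * \<zeta> j))" by (simp add: sum_distrib_left mult_ac)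
  then show ?thesis using 1(1) assms(1) roots_of_unity_mult unfolding short_sum_def
    by (intro exI[of _ e] exI[of _ "\<lambda>j. w * \<zeta> j"]) auto
qed

lemma short_sum_scale:
  assumes "short_sum R E a" shows "short_sum R ((*) c ` E) (c * a)"
proof -
  obtain e \<zeta> where 1: "\<forall>j<R. e j \<in> E \<and> \<zeta> j \<in> roots_of_unity" "a = (\<Sum>j<R. e j * \<zeta> j)"
    using assms unfolding short_sum_def by blast
  then have "c * a = (\<Sum>j<R. (c * e j) * \<zeta> j)" by (simp add: sum_distrib_left mult_ac)
  then show ?thesis using 1(1) unfolding short_sum_def
    by (intro exI[of _ "\<lambda>j. c * e j"] exI[of _ \<zeta>]) auto
qed

lemma short_sum_single: "a \<in> E \<Longrightarrow> short_sum 1 E a"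
  unfolding short_sum_def by (intro exI[of _ "\<lambda>_. a"] exI[of _ "\<lambda>_. 1"]) auto

section \<open>Cassels' mean of the squared conjugates\<close>

definition gal_choice :: "nat \<Rightarrow> complex \<Rightarrow> complex \<Rightarrow> complex" where
  "gal_choice N w = (SOME \<sigma>. gal \<sigma> \<and> \<sigma> (zeta N) = w)"

text \<open>On \<open>cyc_ring N\<close> the value does not depend on the choice of the automorphisms.\<close>
definition mean_sq :: "nat \<Rightarrow> complex \<Rightarrow> real" where
  "mean_sq N \<alpha> = (\<Sum>w\<in>orbit (zeta N). (cmod (gal_choice N w \<alpha>))\<^sup>2) / real (card (orbit (zeta N)))"

lemma gal_choice: assumes "w \<in> orbit (zeta N)" shows "gal (gal_choice N w)" "gal_choice N w (zeta N) = w"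
proof -
  have "\<exists>\<sigma>. gal \<sigma> \<and> \<sigma> (zeta N) = w" using assms by (auto simp: orbit_def)
  from someI_ex[OF this] show "gal (gal_choice N w)" "gal_choice N w (zeta N) = w" by (auto simp: gal_choice_def)
qed

lemma orbit_zeta: assumes "N > 0"
  shows "finite (orbit (zeta N))" "zeta N \<in> orbit (zeta N)" "card (orbit (zeta N)) > 0"
  using finite_orbit[OF zeta_qbar[OF assms]] orbit_self card_gt_0_iff by blast+

lemma mean_sq_poly:
  assumes "N > 0" "coeffs_in \<int> h"
  shows "mean_sq N (poly h (zeta N)) = (\<Sum>w\<in>orbit (zeta N). (cmod (poly h w))\<^sup>2) / real (card (orbit (zeta N)))"
  unfolding mean_sq_def using gal_choice assms zeta_qbar[OF assms(1)] by (simp add: gal_poly_Ints)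

lemma cyc_ring_qbar: "N > 0 \<Longrightarrow> x \<in> cyc_ring N \<Longrightarrow> x \<in> qbar"
  using cyc_ring_algebraic_int algebraic_int_qbar by blast

lemma cyc_ring_mono: assumes "N > 0" "m dvd N" shows "cyc_ring m \<subseteq> cyc_ring N"
proof
  fix x assume "x \<in> cyc_ring m"
  then obtain h where h: "coeffs_in \<int> h" "x = poly h (zeta m)" by (auto simp: cyc_ring_def)
  have "zeta m \<in> cyc_ring N" using zeta_in_cyc_ring[OF assms, of 1] by simp
  then show "x \<in> cyc_ring N" unfolding h(2)
    using subring_C_poly[OF subring_cyc_ring coeffs_in_mono[OF h(1) Ints_subset_cyc_ring]] by blast
qed

text \<open>On the cyclotomic ring g acts by zeta N -> (zeta N)^k, and w -> w^k permutes the orbit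
  because the exponent of the inverse automorphism undoes it.\<close>

lemma mean_sq_gal:
  assumes N: "N > 0" and g: "gal g" and x: "x \<in> cyc_ring N"
  shows "mean_sq N (g x) = mean_sq N x"
proof -
  let ?z = "zeta N"
  note zq = zeta_qbar[OF N]
  obtain h where h: "coeffs_in \<int> h" "x = poly h ?z" using x by (auto simp: cyc_ring_def)
  obtain k where k: "g ?z = ?z ^ k" using gal_zeta_power[OF g N] by blast
  obtain g' where g': "gal g'" "\<And>x. x \<in> qbar \<Longrightarrow> g (g' x) = x" using gal_inverse[OF g] by metis
  obtain l where l: "g' ?z = ?z ^ l" using gal_zeta_power[OF g'(1) N] by blast
  have kl: "?z = (?z ^ k) ^ l" using g'(2)[OF zq] l k gal_power[OF g zq] by simp
  have wkl: "w = (w ^ k) ^ l" if wO: "w \<in> orbit ?z" for w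
  proof -
    obtain \<sigma> where s: "gal \<sigma>" "w = \<sigma> ?z" using wO by (auto simp: orbit_def)
    have "\<sigma> ((?z ^ k) ^ l) = (\<sigma> ?z ^ k) ^ l" using s zq by (simp add: gal_power qbar_power)
    then show ?thesis using kl s by simp
  qed
  have "bij_betw (\<lambda>w. w ^ k) (orbit ?z) (orbit ?z)"
  proof -
    have inj: "inj_on (\<lambda>w. w ^ k) (orbit ?z)" by (rule inj_onI) (metis wkl)
    have "w ^ k \<in> orbit ?z" if "w \<in> orbit ?z" for w
    proof -
      have "gal_choice N w (g ?z) = w ^ k" using gal_choice[OF that] k zq by (simp add: gal_power)
      moreover have "gal_choice N w (g ?z) \<in> orbit ?z"
        using gal_comp[OF gal_choice(1)[OF that] g] unfolding orbit_def by (metis (mono_tags) comp_apply mem_Collect_eq)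
      ultimately show ?thesis by simp
    qed
    then show ?thesis using endo_inj_surj[OF orbit_zeta(1)[OF N] _ inj] inj by (auto simp: bij_betw_def)
  qed
  then have *: "(\<Sum>w\<in>orbit ?z. (cmod (poly h (w ^ k)))\<^sup>2) = (\<Sum>w\<in>orbit ?z. (cmod (poly h w))\<^sup>2)"
    by (rule sum.reindex_bij_betw)
  have "gal_choice N w (g x) = poly h (w ^ k)" if "w \<in> orbit ?z" for w
  proof -
    have "g x = poly h (?z ^ k)" using h g zq k by (simp add: gal_poly_Ints)
    then show ?thesis using gal_choice[OF that] zq h(1) by (simp add: gal_poly_Ints gal_power qbar_power)
  qed
  then have "mean_sq N (g x) = (\<Sum>w\<in>orbit ?z. (cmod (poly h (w ^ k)))\<^sup>2) / real (card (orbit ?z))"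
    unfolding mean_sq_def by simp
  then show ?thesis using * mean_sq_poly[OF N h(1)] h(2) by simp
qed

text \<open>Inserts an extra average over a family of automorphisms inside the mean. Identities
  between means thereby reduce to identities that hold for each \<open>gal_choice N w\<close>
  separately.\<close>

lemma mean_sq_average:
  assumes N: "N > 0" and g: "\<And>i. i \<in> I \<Longrightarrow> gal (g i)" and x: "x \<in> cyc_ring N"
  shows "real (card I) * mean_sq N x =
    (\<Sum>w\<in>orbit (zeta N). \<Sum>i\<in>I. (cmod (gal_choice N w (g i x)))\<^sup>2) / real (card (orbit (zeta N)))"
proof -
  have "real (card I) * mean_sq N x = (\<Sum>i\<in>I. mean_sq N (g i x))"
    using g mean_sq_gal[OF N _ x] by simp
  also have "\<dots> = (\<Sum>i\<in>I. \<Sum>w\<in>orbit (zeta N). (cmod (gal_choice N w (g i x)))\<^sup>2) / real (card (orbit (zeta N)))"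
    unfolding mean_sq_def by (simp add: sum_divide_distrib)
  finally show ?thesis by (subst sum.swap)
qed

lemma mean_sq_nonneg: "mean_sq N x \<ge> 0"
  unfolding mean_sq_def by (intro divide_nonneg_nonneg sum_nonneg) auto

text \<open>The inequality of arithmetic and geometric means: the product of the conjugates is a
  nonzero integer, so the logarithms of their squared absolute values have nonnegative sum, and ln t
  \<le> t - 1.\<close>

lemma mean_sq_ge_1:
  assumes N: "N > 0" and x: "x \<in> cyc_ring N" "x \<noteq> 0"
  shows "mean_sq N x \<ge> 1"
proof -
  let ?O = "orbit (zeta N)"
  note O = orbit_zeta[OF N] and zq = zeta_qbar[OF N]
  obtain h where h: "coeffs_in \<int> h" "x = poly h (zeta N)" using x by (auto simp: cyc_ring_def)
  have Oq: "w \<in> qbar" if "w \<in> ?O" for w using that orbit_subset_qbar[OF zq] by blast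
  have hq: "poly h w \<in> qbar" if "w \<in> ?O" for w using that Oq coeffs_Ints_qbar[OF h(1)] by (intro qbar_poly) auto
  have nz: "poly h w \<noteq> 0" if w: "w \<in> ?O" for w
  proof -
    have "gal_choice N w x = poly h w" using gal_choice[OF w] h zq by (simp add: gal_poly_Ints)
    then show ?thesis using gal_eq_0_iff[OF gal_choice(1)[OF w]] x cyc_ring_qbar[OF N] by metis
  qed
  define P where "P = (\<Prod>w\<in>?O. poly h w)"
  have "P \<in> \<int>"
  proof (rule gal_fixed_imp_Ints)
    show "algebraic_int P" unfolding P_def
      using orbit_root_unity[OF N] root_unity_algebraic_int[OF N] h(1)
      by (intro algebraic_int_prod algebraic_int_poly) auto
    fix \<sigma> assume s: "gal \<sigma>"
    have "\<sigma> P = (\<Prod>w\<in>?O. poly h (\<sigma> w))" unfolding P_def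
      using s hq Oq h(1) by (simp add: gal_prod gal_poly_Ints)
    also have "\<dots> = P" unfolding P_def by (rule prod.reindex_bij_betw[OF gal_image_orbit[OF s zq]])
    finally show "\<sigma> P = P" .
  qed
  moreover have "P \<noteq> 0" using nz O(1) by (auto simp: P_def)
  ultimately obtain k where k: "P = of_int k" "k \<noteq> 0" by (auto elim!: Ints_cases)
  then have "1 \<le> \<bar>k\<bar>" by simp
  then have P1: "cmod P \<ge> 1" unfolding k(1) norm_of_int by linarith
  have "0 \<le> ln ((cmod P)\<^sup>2)" using P1 by (intro ln_ge_zero) (simp add: power2_eq_square mult_ge1_I)
  also have "ln ((cmod P)\<^sup>2) = (\<Sum>w\<in>?O. ln ((cmod (poly h w))\<^sup>2))"
    unfolding P_def prod_norm[symmetric] prod_power_distrib using nz O(1) by (intro ln_prod) auto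
  also have "\<dots> \<le> (\<Sum>w\<in>?O. (cmod (poly h w))\<^sup>2 - 1)"
    using nz by (intro sum_mono ln_le_minus_one) auto
  finally have "real (card ?O) \<le> (\<Sum>w\<in>?O. (cmod (poly h w))\<^sup>2)" by (simp add: sum_subtractf)
  then show ?thesis unfolding h(2) mean_sq_poly[OF N h(1)] using O(3) by simp
qed

section \<open>Splitting off a prime from the conductor\<close>

lemma prime_root_unity_inj:
  fixes w :: complex
  assumes p: "prime p" and w: "w ^ p = 1" "w \<noteq> 1" and jl: "j < p" "l < p" "w ^ j = w ^ l"
  shows "j = l"
proof -
  have p0: "p > 0" using p prime_gt_0_nat by blast
  obtain a where a: "w = zeta p ^ a" using root_unity_eq_zeta_power[OF p0 w(1)] by blast
  have "\<not> p dvd a" using w(2) a zeta_power_eq_1_iff[OF p0] by simp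
  then have "coprime a p" using prime_imp_coprime_nat[OF p] by (simp add: coprime_commute)
  moreover have "[a * j = a * l] (mod p)" using jl(3) zeta_power_eq_iff[OF p0] by (simp add: a power_mult[symmetric])
  ultimately have "[j = l] (mod p)" using cong_mult_lcancel_nat by blast
  then show ?thesis using jl by (simp add: cong_def)
qed

lemma parseval:
  fixes y :: "nat \<Rightarrow> complex"
  assumes p: "prime p" and w: "w ^ p = 1" "w \<noteq> 1"
  shows "(\<Sum>i<p. (cmod (\<Sum>j<p. (w ^ i) ^ j * y j))\<^sup>2) = real p * (\<Sum>j<p. (cmod (y j))\<^sup>2)"
proof -
  have p0: "p > 0" using p prime_gt_0_nat by blast
  have nw: "cmod w = 1" using norm_root_unity[OF p0 w(1)] .
  have orth: "(\<Sum>i<p. (w ^ i) ^ j * cnj ((w ^ i) ^ l)) = (if j = l then of_nat p else 0)" if jl: "j < p" "l < p" for j l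
  proof -
    define u where "u = w ^ j * cnj (w ^ l)"
    have e: "(w ^ i) ^ j * cnj ((w ^ i) ^ l) = u ^ i" for i
      by (simp add: u_def power_mult_distrib power_mult[symmetric] mult.commute)
    have up: "u ^ p = 1" unfolding u_def power_mult_distrib complex_cnj_power[symmetric] power_mult[symmetric]
      by (metis (no_types, lifting) complex_cnj_one mult.commute mult_1 power_mult power_one w(1))
    have cw: "cnj (w ^ l) * w ^ l = 1" using nw complex_norm_square[of "w ^ l"] by (simp add: norm_power mult.commute)
    show ?thesis
    proof (cases "j = l")
      case True
      then have "u = 1" using cw by (simp add: u_def mult.commute)
      then show ?thesis using True e by simp
    next
      case False
      have "u \<noteq> 1"
      proof
        assume "u = 1"
        then have "w ^ j * (cnj (w ^ l) * w ^ l) = w ^ l" unfolding u_def mult.assoc[symmetric] by simp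
        then have "w ^ j = w ^ l" unfolding cw by simp
        then show False using False prime_root_unity_inj[OF p w jl] by simp
      qed
      moreover have "(u - 1) * (\<Sum>i<p. u ^ i) = 0" using up power_diff_1_eq[of u p] by simp
      ultimately show ?thesis using False e by simp
    qed
  qed
  have "complex_of_real (\<Sum>i<p. (cmod (\<Sum>j<p. (w ^ i) ^ j * y j))\<^sup>2) =
      (\<Sum>i<p. \<Sum>j<p. \<Sum>l<p. ((w ^ i) ^ j * cnj ((w ^ i) ^ l)) * (y j * cnj (y l)))"
    unfolding of_real_sum complex_norm_square
    by (simp add: sum_product mult_ac)
  also have "\<dots> = (\<Sum>j<p. \<Sum>l<p. \<Sum>i<p. ((w ^ i) ^ j * cnj ((w ^ i) ^ l)) * (y j * cnj (y l)))"
    by (subst sum.swap, subst (2) sum.swap) simp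
  also have "\<dots> = (\<Sum>j<p. \<Sum>l<p. (if j = l then of_nat p else 0) * (y j * cnj (y l)))"
    by (intro sum.cong refl) (simp only: sum_distrib_right[symmetric] orth lessThan_iff)
  also have "\<dots> = (\<Sum>j<p. of_nat p * (y j * cnj (y j)))"
    by (intro sum.cong refl) (simp add: if_distrib[of "\<lambda>x. x * _"] cong: if_cong)
  also have "\<dots> = complex_of_real (real p * (\<Sum>j<p. (cmod (y j))\<^sup>2))"
    unfolding of_real_mult of_real_sum complex_norm_square by (simp add: sum_distrib_left)
  finally show ?thesis by (simp only: of_real_eq_iff)
qed

text \<open>Powers of \<open>zeta N\<close> are grouped by the exponent r of \<eta>. It will be used
  with \<eta> = zeta N when p * p divides N, and with \<eta> = zeta p when p divides N exactly
  once.\<close>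

lemma cyc_ring_split:
  assumes N: "N > 0" and p: "p > 0" and \<eta>: "\<And>k. \<exists>r<p. \<exists>w. zeta N ^ k = \<eta> ^ r * w \<and> w \<in> cyc_ring m" and x: "x \<in> cyc_ring N"
  shows "\<exists>a. (\<forall>j<p. a j \<in> cyc_ring m) \<and> x = (\<Sum>j<p. \<eta> ^ j * a j)"
proof -
  obtain h where h: "coeffs_in \<int> h" "x = poly h (zeta N)" using x by (auto simp: cyc_ring_def)
  have "\<forall>k. \<exists>r w. r < p \<and> zeta N ^ k = \<eta> ^ r * w \<and> w \<in> cyc_ring m" using \<eta> by blast
  then obtain r w where rw: "\<And>k. r k < p" "\<And>k. zeta N ^ k = \<eta> ^ r k * w k" "\<And>k. w k \<in> cyc_ring m" by metis
  define a where "a j = (\<Sum>i\<in>{i\<in>{..degree h}. r i = j}. coeff h i * w i)" for j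
  have "a j \<in> cyc_ring m" for j
    unfolding a_def using h(1) Ints_subset_cyc_ring rw(3)
    by (intro subring_C_sum[OF subring_cyc_ring] subring_C_closed(4)[OF subring_cyc_ring]) (auto simp: coeffs_in_def)
  moreover have "x = (\<Sum>j<p. \<eta> ^ j * a j)"
  proof -
    have "x = (\<Sum>i\<le>degree h. coeff h i * zeta N ^ i)" by (simp add: h(2) poly_altdef)
    also have "\<dots> = (\<Sum>j<p. \<Sum>i\<in>{i\<in>{..degree h}. r i = j}. coeff h i * zeta N ^ i)"
      by (rule sum.group[symmetric]) (use rw(1) in auto)
    also have "\<dots> = (\<Sum>j<p. \<eta> ^ j * a j)"
      unfolding a_def sum_distrib_left by (intro sum.cong refl) (auto simp: rw(2) mult_ac)
    finally show ?thesis .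
  qed
  ultimately show ?thesis by (intro exI[of _ a]) simp
qed

lemma zeta_power_prime_quotient: "p > 0 \<Longrightarrow> p dvd N \<Longrightarrow> zeta N ^ p = zeta (N div p)"
  using zeta_mult_power[of p "N div p"] by simp

lemma gal_zeta_dvd_power:
  assumes "gal g" "N > 0" "g (zeta N) = zeta N ^ k" "m dvd N"
  shows "g (zeta m) = zeta m ^ k"
proof -
  have "zeta m = zeta N ^ (N div m)" using zeta_dvd_power[OF assms(2,4)] by simp
  then show ?thesis using gal_power[OF assms(1) zeta_qbar[OF assms(2)]] assms(3)
    by (simp add: power_mult[symmetric] mult.commute)
qed

text \<open>The exponent 1 + i * (N div p) is coprime to N because p divides N div p, so N has no
  primes beyond those of N div p.\<close>

lemma gal_square_step:
  assumes N: "N > 0" and p: "prime p" "p * p dvd N"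
  shows "\<exists>g. gal g \<and> g (zeta (N div p)) = zeta (N div p) \<and> g (zeta N) = zeta N * zeta p ^ i"
proof -
  have p0: "p > 0" using p prime_gt_0_nat by blast
  define m where "m = N div p"
  have mono_map: "p dvd m" "N = p * m" using p p0 by (auto simp: m_def dvd_div_iff_mult)
  then have m0: "m > 0" using N by (intro Nat.gr0I) auto
  define k where "k = 1 + i * m"
  have "coprime k N"
  proof (rule ccontr)
    assume "\<not> coprime k N"
    then obtain d where d: "d dvd k" "d dvd N" "d \<noteq> 1" by (auto elim: not_coprimeE)
    obtain q where q: "prime q" "q dvd k" "q dvd N" using prime_factor_nat[OF d(3)] d(1,2) dvd_trans by blast
    have "q dvd m"
    proof (cases "q dvd p")
      case True then show ?thesis using mono_map(1) dvd_trans by blast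
    next
      case False then show ?thesis using q mono_map(2) prime_dvd_mult_iff by auto
    qed
    then have "q dvd 1" using q(2) dvd_add_left_iff[of q "i * m" 1] unfolding k_def by simp
    then show False using q(1) by simp
  qed
  then obtain g where g: "gal g" "g (zeta N) = zeta N ^ k" using gal_zeta_coprime[OF N] by blast
  have "p dvd N" using p(2) by (rule dvd_mult_left)
  then have "zeta N ^ m = zeta p" unfolding m_def by (rule zeta_dvd_power[OF N])
  then have "g (zeta N) = zeta N * zeta p ^ i" using g(2) by (simp add: k_def power_add power_mult mult.commute[of i])
  moreover have "g (zeta m) = zeta m"
    using gal_zeta_dvd_power[OF g(1) N g(2), of m] mono_map m0 by (simp add: k_def power_add power_mult mult.commute[of i] zeta_power_self)
  ultimately show ?thesis using g(1) by (auto simp: m_def)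
qed

text \<open>The Chinese remainder theorem prescribes the exponent modulo p and modulo N div p
  independently.\<close>

lemma gal_simple_step:
  assumes N: "N > 0" and p: "prime p" "p dvd N" "\<not> p dvd N div p" and i: "\<not> p dvd i"
  shows "\<exists>g. gal g \<and> g (zeta (N div p)) = zeta (N div p) \<and> g (zeta p) = zeta p ^ i"
proof -
  have p0: "p > 0" using p prime_gt_0_nat by blast
  define m where "m = N div p"
  have mono_map: "N = p * m" using p by (simp add: m_def)
  then have m0: "m > 0" using N by (intro Nat.gr0I) auto
  have cop: "coprime m p" using prime_imp_coprime_nat[OF p(1) p(3)] by (simp add: m_def coprime_commute)
  obtain k where k: "[k = 1] (mod m)" "[k = i] (mod p)" using binary_chinese_remainder_nat[OF cop] by blast
  have "coprime k m" using k(1) by (metis cong_imp_coprime cong_sym coprime_1_left)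
  moreover have "coprime k p"
    using k(2) prime_imp_coprime_nat[OF p(1) i] by (metis cong_imp_coprime cong_sym coprime_commute)
  ultimately have "coprime k N" by (simp add: mono_map)
  then obtain g where g: "gal g" "g (zeta N) = zeta N ^ k" using gal_zeta_coprime[OF N] by blast
  have "g (zeta m) = zeta m ^ k" "g (zeta p) = zeta p ^ k"
    using gal_zeta_dvd_power[OF g(1) N g(2)] mono_map by auto
  moreover have "zeta m ^ k = zeta m" "zeta p ^ k = zeta p ^ i"
    using zeta_power_eq_iff[OF m0, of k 1] zeta_power_eq_iff[OF p0, of k i] k by auto
  ultimately show ?thesis using g(1) by (auto simp: m_def)
qed

lemma gal_zeta_prime:
  assumes "gal \<sigma>" "prime p"
  shows "\<sigma> (zeta p) ^ p = 1" "\<sigma> (zeta p) \<noteq> 1"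
proof -
  have p0: "p > 0" using assms(2) prime_gt_0_nat by blast
  show "\<sigma> (zeta p) ^ p = 1" using gal_root_unity[OF assms(1) p0 zeta_power_self[OF p0]] .
  have "zeta p \<noteq> 1" using zeta_power_eq_1_iff[OF p0, of 1] assms(2) by (auto simp: prime_nat_iff)
  then show "\<sigma> (zeta p) \<noteq> 1" using gal_inj[OF assms(1) zeta_qbar[OF p0] qbar_1] by (simp add: gal_1[OF assms(1)])
qed

lemma gal_fixes_cyc_ring:
  assumes "gal g" "m > 0" "g (zeta m) = zeta m" "x \<in> cyc_ring m"
  shows "g x = x"
  using assms zeta_qbar[of m] by (auto simp: cyc_ring_def gal_poly_Ints)

text \<open>The p automorphisms over the lower level multiply \<open>zeta N'\<close> by all p-th
  roots of unity, so averaging over them is Parseval and no cross terms remain. The mean is taken at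
  a level N that may exceed N', so that it stays the same while the conductor decreases.\<close>

lemma mean_sq_square_step:
  assumes N: "N > 0" "N' dvd N" and p: "prime p" "p * p dvd N'"
    and a: "\<And>j. j < p \<Longrightarrow> a j \<in> cyc_ring (N' div p)"
  shows "mean_sq N (\<Sum>j<p. zeta N' ^ j * a j) = (\<Sum>j<p. mean_sq N (a j))"
proof -
  have N': "N' > 0" using N by (auto intro: Nat.gr0I)
  have p0: "p > 0" using p prime_gt_0_nat by blast
  have pN: "p dvd N'" using p(2) by (metis dvd_mult_left)
  have m: "N' div p > 0" "N' div p dvd N'" "N' div p dvd N" using N' pN N(2) p0
    by (auto simp: dvd_div_eq_0_iff) (metis dvd_div_mult_self dvd_triv_left dvd_trans)+
  obtain g where g: "\<And>i. gal (g i)" "\<And>i. g i (zeta (N' div p)) = zeta (N' div p)" "\<And>i. g i (zeta N') = zeta N' * zeta p ^ i"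
    using gal_square_step[OF N' p] by metis
  define x where "x = (\<Sum>j<p. zeta N' ^ j * a j)"
  have aq: "a j \<in> qbar" if "j < p" for j using cyc_ring_qbar[OF m(1) a[OF that]] .
  have aN: "a j \<in> cyc_ring N" if "j < p" for j using a[OF that] cyc_ring_mono[OF N(1) m(3)] by blast
  have x: "x \<in> cyc_ring N"
    unfolding x_def by (intro subring_C_sum[OF subring_cyc_ring] subring_C_closed(4)[OF subring_cyc_ring] zeta_in_cyc_ring N aN) simp
  have pt: "(\<Sum>i<p. (cmod (\<tau> (g i x)))\<^sup>2) = real p * (\<Sum>j<p. (cmod (\<tau> (a j)))\<^sup>2)" if \<tau>: "gal \<tau>" for \<tau>
  proof -
    have "\<tau> (g i x) = (\<Sum>j<p. (\<tau> (zeta p) ^ i) ^ j * (\<tau> (zeta N') ^ j * \<tau> (a j)))" for i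
    proof -
      have "g i x = (\<Sum>j<p. g i (zeta N' ^ j * a j))"
        unfolding x_def by (rule gal_sum[OF g(1)]) (auto intro: qbar_mult qbar_power aq zeta_qbar N')
      also have "\<dots> = (\<Sum>j<p. (zeta N' * zeta p ^ i) ^ j * a j)"
        using g aq zeta_qbar[OF N'] gal_fixes_cyc_ring[OF g(1) m(1) g(2) a]
        by (intro sum.cong refl) (simp add: gal_mult gal_power qbar_power)
      finally have "\<tau> (g i x) = (\<Sum>j<p. \<tau> ((zeta N' * zeta p ^ i) ^ j * a j))"
        by (simp only:) (rule gal_sum[OF \<tau>], intro qbar_mult qbar_power zeta_qbar N' p0 aq, simp)
      also have "\<dots> = (\<Sum>j<p. (\<tau> (zeta p) ^ i) ^ j * (\<tau> (zeta N') ^ j * \<tau> (a j)))"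
        using \<tau> aq zeta_qbar[OF N'] zeta_qbar[OF p0]
        by (intro sum.cong refl) (simp add: gal_mult gal_power qbar_mult qbar_power power_mult_distrib mult_ac)
      finally show ?thesis .
    qed
    then have "(\<Sum>i<p. (cmod (\<tau> (g i x)))\<^sup>2) = real p * (\<Sum>j<p. (cmod (\<tau> (zeta N') ^ j * \<tau> (a j)))\<^sup>2)"
      using parseval[OF p(1) gal_zeta_prime[OF \<tau> p(1)]] by simp
    moreover have "cmod (\<tau> (zeta N')) = 1"
      using norm_root_unity[OF N' gal_root_unity[OF \<tau> N' zeta_power_self[OF N']]] .
    ultimately show ?thesis by (simp add: norm_mult norm_power)
  qed
  have "real p * mean_sq N x = (\<Sum>w\<in>orbit (zeta N). real p * (\<Sum>j<p. (cmod (gal_choice N w (a j)))\<^sup>2)) / real (card (orbit (zeta N)))"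
    using mean_sq_average[OF N(1), of "{..<p}" g x] g(1) x pt gal_choice(1) by simp
  also have "\<dots> = real p * (\<Sum>j<p. mean_sq N (a j))"
    unfolding mean_sq_def sum_divide_distrib[symmetric] sum_distrib_left[symmetric] by (simp add: sum.swap[of _ _ "{..<p}"])
  finally show ?thesis using p0 by (simp add: x_def)
qed

text \<open>Here only p - 1 automorphisms are available, since \<open>zeta p\<close> cannot be sent
  to 1. The missing Fourier coefficient i = 0 is the subtracted mean of the plain sum.\<close>

lemma mean_sq_simple_step:
  assumes N: "N > 0" "N' dvd N" and p: "prime p" "p dvd N'" "\<not> p dvd N' div p"
    and a: "\<And>j. j < p \<Longrightarrow> a j \<in> cyc_ring (N' div p)"
  shows "(real p - 1) * mean_sq N (\<Sum>j<p. zeta p ^ j * a j) = real p * (\<Sum>j<p. mean_sq N (a j)) - mean_sq N (\<Sum>j<p. a j)"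
proof -
  have N': "N' > 0" using N by (auto intro: Nat.gr0I)
  have p0: "p > 0" using p prime_gt_0_nat by blast
  have m: "N' div p > 0" "N' div p dvd N'" "N' div p dvd N" using N' p(2) N(2) p0
    by (auto simp: dvd_div_eq_0_iff) (metis dvd_div_mult_self dvd_triv_left dvd_trans)+
  have pN: "p dvd N" using p(2) N(2) dvd_trans by blast
  have "\<forall>i. \<exists>g. i \<in> {1..<p} \<longrightarrow> gal g \<and> g (zeta (N' div p)) = zeta (N' div p) \<and> g (zeta p) = zeta p ^ i"
    using gal_simple_step[OF N' p] by (metis atLeastLessThan_iff nat_dvd_not_less One_nat_def Suc_le_eq)
  then obtain g where g: "\<And>i. i \<in> {1..<p} \<Longrightarrow> gal (g i)" "\<And>i. i \<in> {1..<p} \<Longrightarrow> g i (zeta (N' div p)) = zeta (N' div p)"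
    "\<And>i. i \<in> {1..<p} \<Longrightarrow> g i (zeta p) = zeta p ^ i" by metis
  define x where "x = (\<Sum>j<p. zeta p ^ j * a j)"
  have aq: "a j \<in> qbar" if "j < p" for j using cyc_ring_qbar[OF m(1) a[OF that]] .
  have aN: "a j \<in> cyc_ring N" if "j < p" for j using a[OF that] cyc_ring_mono[OF N(1) m(3)] by blast
  have x: "x \<in> cyc_ring N"
    unfolding x_def by (intro subring_C_sum[OF subring_cyc_ring] subring_C_closed(4)[OF subring_cyc_ring] zeta_in_cyc_ring N pN aN) simp
  have pt: "(\<Sum>i\<in>{1..<p}. (cmod (\<tau> (g i x)))\<^sup>2) = real p * (\<Sum>j<p. (cmod (\<tau> (a j)))\<^sup>2) - (cmod (\<tau> (\<Sum>j<p. a j)))\<^sup>2" if \<tau>: "gal \<tau>" for \<tau>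
  proof -
    have e: "\<tau> (g i x) = (\<Sum>j<p. (\<tau> (zeta p) ^ i) ^ j * \<tau> (a j))" if i: "i \<in> {1..<p}" for i
    proof -
      have "g i x = (\<Sum>j<p. g i (zeta p ^ j * a j))"
        unfolding x_def by (rule gal_sum[OF g(1)[OF i]]) (auto intro: qbar_mult qbar_power aq zeta_qbar p0)
      also have "\<dots> = (\<Sum>j<p. (zeta p ^ i) ^ j * a j)"
        using g[OF i] aq zeta_qbar[OF p0] gal_fixes_cyc_ring[OF g(1)[OF i] m(1) g(2)[OF i] a]
        by (intro sum.cong refl) (simp add: gal_mult gal_power qbar_power)
      finally have "\<tau> (g i x) = (\<Sum>j<p. \<tau> ((zeta p ^ i) ^ j * a j))"
        by (simp only:) (rule gal_sum[OF \<tau>], intro qbar_mult qbar_power zeta_qbar p0 aq, simp)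
      also have "\<dots> = (\<Sum>j<p. (\<tau> (zeta p) ^ i) ^ j * \<tau> (a j))"
        using \<tau> aq zeta_qbar[OF p0]
        by (intro sum.cong refl) (simp add: gal_mult gal_power qbar_mult qbar_power)
      finally show ?thesis .
    qed
    have "{..<p} = insert 0 {1..<p}" using p0 by auto
    then have "(\<Sum>i<p. (cmod (\<Sum>j<p. (\<tau> (zeta p) ^ i) ^ j * \<tau> (a j)))\<^sup>2) =
        (cmod (\<Sum>j<p. \<tau> (a j)))\<^sup>2 + (\<Sum>i\<in>{1..<p}. (cmod (\<Sum>j<p. (\<tau> (zeta p) ^ i) ^ j * \<tau> (a j)))\<^sup>2)" by simp
    moreover have "(\<Sum>i\<in>{1..<p}. (cmod (\<Sum>j<p. (\<tau> (zeta p) ^ i) ^ j * \<tau> (a j)))\<^sup>2) = (\<Sum>i\<in>{1..<p}. (cmod (\<tau> (g i x)))\<^sup>2)"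
      using e by simp
    moreover have "\<tau> (\<Sum>j<p. a j) = (\<Sum>j<p. \<tau> (a j))" by (rule gal_sum[OF \<tau>]) (simp add: aq)
    ultimately show ?thesis
      using parseval[OF p(1) gal_zeta_prime[OF \<tau> p(1)], of "\<lambda>j. \<tau> (a j)"] by simp
  qed
  have "real (card {1..<p}) * mean_sq N x =
      (\<Sum>w\<in>orbit (zeta N). real p * (\<Sum>j<p. (cmod (gal_choice N w (a j)))\<^sup>2) - (cmod (gal_choice N w (\<Sum>j<p. a j)))\<^sup>2) / real (card (orbit (zeta N)))"
    using mean_sq_average[OF N(1), of "{1..<p}" g x] g(1) x pt gal_choice(1) by simp
  also have "\<dots> = real p * (\<Sum>j<p. mean_sq N (a j)) - mean_sq N (\<Sum>j<p. a j)"
    unfolding mean_sq_def sum_divide_distrib[symmetric] sum_subtractf diff_divide_distrib sum_distrib_left[symmetric]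
    by (simp add: sum.swap[of _ _ "{..<p}"])
  finally show ?thesis using p0 by (simp add: x_def of_nat_diff)
qed

lemma sum_diff_squares:
  fixes x :: "'a \<Rightarrow> real"
  shows "(\<Sum>i\<in>S. \<Sum>j\<in>S. (x i - x j)\<^sup>2) = 2 * (real (card S) * (\<Sum>i\<in>S. (x i)\<^sup>2) - (\<Sum>i\<in>S. x i)\<^sup>2)"
proof -
  have "(\<Sum>i\<in>S. \<Sum>j\<in>S. (x i - x j)\<^sup>2) = (\<Sum>i\<in>S. \<Sum>j\<in>S. (x i)\<^sup>2 + (x j)\<^sup>2 - 2 * (x i * x j))"
    by (simp add: power2_diff mult.assoc)
  also have "\<dots> = 2 * (real (card S) * (\<Sum>i\<in>S. (x i)\<^sup>2)) - 2 * (\<Sum>i\<in>S. \<Sum>j\<in>S. x i * x j)"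
    by (simp add: sum.distrib sum_subtractf sum_distrib_left[symmetric])
  also have "(\<Sum>i\<in>S. \<Sum>j\<in>S. x i * x j) = (\<Sum>i\<in>S. x i)\<^sup>2" by (simp add: power2_eq_square sum_product)
  finally show ?thesis by simp
qed

lemma sum_squared_le:
  fixes x :: "'a \<Rightarrow> real"
  shows "(\<Sum>i\<in>S. x i)\<^sup>2 \<le> real (card S) * (\<Sum>i\<in>S. (x i)\<^sup>2)"
proof -
  have "0 \<le> (\<Sum>i\<in>S. \<Sum>j\<in>S. (x i - x j)\<^sup>2)" by (intro sum_nonneg) simp
  then show ?thesis unfolding sum_diff_squares by simp
qed

lemma mean_sq_Cauchy_Schwarz:
  assumes N: "N > 0" and a: "\<And>j. j \<in> S \<Longrightarrow> a j \<in> qbar"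
  shows "mean_sq N (\<Sum>j\<in>S. a j) \<le> real (card S) * (\<Sum>j\<in>S. mean_sq N (a j))"
proof -
  have "(cmod (\<tau> (\<Sum>j\<in>S. a j)))\<^sup>2 \<le> real (card S) * (\<Sum>j\<in>S. (cmod (\<tau> (a j)))\<^sup>2)" if "gal \<tau>" for \<tau>
  proof -
    have "cmod (\<tau> (\<Sum>j\<in>S. a j)) \<le> (\<Sum>j\<in>S. cmod (\<tau> (a j)))" using that a by (simp add: gal_sum norm_sum)
    then have "(cmod (\<tau> (\<Sum>j\<in>S. a j)))\<^sup>2 \<le> (\<Sum>j\<in>S. cmod (\<tau> (a j)))\<^sup>2" by (rule power_mono) simp
    also have "\<dots> \<le> real (card S) * (\<Sum>j\<in>S. (cmod (\<tau> (a j)))\<^sup>2)"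
      by (rule sum_squared_le)
    finally show ?thesis .
  qed
  then have "(\<Sum>w\<in>orbit (zeta N). (cmod (gal_choice N w (\<Sum>j\<in>S. a j)))\<^sup>2) \<le> (\<Sum>w\<in>orbit (zeta N). real (card S) * (\<Sum>j\<in>S. (cmod (gal_choice N w (a j)))\<^sup>2))"
    using gal_choice(1) by (intro sum_mono) blast
  also have "\<dots> = real (card S) * (\<Sum>j\<in>S. \<Sum>w\<in>orbit (zeta N). (cmod (gal_choice N w (a j)))\<^sup>2)"
    unfolding sum_distrib_left[symmetric] by (subst sum.swap) simp
  finally show ?thesis unfolding mean_sq_def sum_divide_distrib[symmetric] times_divide_eq_right
    by (rule divide_right_mono) simp
qed

lemma sum_norm_diff_squares:
  fixes y :: "'a \<Rightarrow> complex"
  shows "(\<Sum>i\<in>S. \<Sum>j\<in>S. (cmod (y i - y j))\<^sup>2) = 2 * (real (card S) * (\<Sum>i\<in>S. (cmod (y i))\<^sup>2) - (cmod (\<Sum>i\<in>S. y i))\<^sup>2)"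
  using sum_diff_squares[of "\<lambda>i. Re (y i)" S] sum_diff_squares[of "\<lambda>i. Im (y i)" S]
  by (simp add: cmod_power2 sum.distrib algebra_simps)

text \<open>Turns the right side of \<open>mean_sq_simple_step\<close> into a sum over pairs. Since
  every pair of distinct coefficients contributes at least 1, a bounded mean makes most coefficients
  equal.\<close>

lemma mean_sq_diff_sum:
  assumes N: "N > 0" and S: "finite S" and a: "\<And>j. j \<in> S \<Longrightarrow> a j \<in> qbar"
  shows "(\<Sum>i\<in>S. \<Sum>j\<in>S. mean_sq N (a i - a j)) = 2 * (real (card S) * (\<Sum>i\<in>S. mean_sq N (a i)) - mean_sq N (\<Sum>i\<in>S. a i))"
proof -
  let ?O = "orbit (zeta N)"
  have pt: "(\<Sum>i\<in>S. \<Sum>j\<in>S. (cmod (\<tau> (a i - a j)))\<^sup>2) = 2 * (real (card S) * (\<Sum>i\<in>S. (cmod (\<tau> (a i)))\<^sup>2) - (cmod (\<tau> (\<Sum>i\<in>S. a i)))\<^sup>2)"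
    if \<tau>: "gal \<tau>" for \<tau>
  proof -
    have "\<tau> (\<Sum>i\<in>S. a i) = (\<Sum>i\<in>S. \<tau> (a i))" by (rule gal_sum[OF \<tau> a])
    moreover have "(\<Sum>i\<in>S. \<Sum>j\<in>S. (cmod (\<tau> (a i - a j)))\<^sup>2) = (\<Sum>i\<in>S. \<Sum>j\<in>S. (cmod (\<tau> (a i) - \<tau> (a j)))\<^sup>2)"
      using a \<tau> by (intro sum.cong refl) (simp add: gal_diff)
    ultimately show ?thesis using sum_norm_diff_squares[of "\<lambda>i. \<tau> (a i)" S] by simp
  qed
  have "(\<Sum>i\<in>S. \<Sum>j\<in>S. mean_sq N (a i - a j)) =
      (\<Sum>w\<in>?O. \<Sum>i\<in>S. \<Sum>j\<in>S. (cmod (gal_choice N w (a i - a j)))\<^sup>2) / real (card ?O)"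
    unfolding mean_sq_def sum_divide_distrib[symmetric]
    by (subst (2) sum.swap, subst sum.swap) (simp add: sum.swap[of _ ?O])
  also have "\<dots> = (\<Sum>w\<in>?O. 2 * (real (card S) * (\<Sum>i\<in>S. (cmod (gal_choice N w (a i)))\<^sup>2) - (cmod (gal_choice N w (\<Sum>i\<in>S. a i)))\<^sup>2)) / real (card ?O)"
    using pt gal_choice(1) by simp
  also have "\<dots> = 2 * (real (card S) * (\<Sum>i\<in>S. mean_sq N (a i)) - mean_sq N (\<Sum>i\<in>S. a i))"
    unfolding mean_sq_def sum_divide_distrib[symmetric] sum_distrib_left[symmetric] sum_subtractf
    by (simp add: sum.swap[of _ ?O] diff_divide_distrib)
  finally show ?thesis .
qed

text \<open>The mean does not depend on the level. In the average over the choices for level m, the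
  inner sum runs over the whole orbit of \<open>zeta m\<close> whatever outer automorphism is
  applied.\<close>

lemma mean_sq_restrict:
  assumes N: "N > 0" "m dvd N" and h: "coeffs_in \<int> h"
  shows "(\<Sum>w\<in>orbit (zeta m). (cmod (poly h w))\<^sup>2) = real (card (orbit (zeta m))) * mean_sq N (poly h (zeta m))"
proof -
  have m: "m > 0" using N by (auto intro: Nat.gr0I)
  let ?O = "orbit (zeta m)"
  have x: "poly h (zeta m) \<in> cyc_ring N" using cyc_ring_mono[OF N] h by (auto simp: cyc_ring_def)
  have zq: "zeta m \<in> qbar" by (rule zeta_qbar[OF m])
  have pt: "(\<Sum>s\<in>?O. (cmod (\<tau> (gal_choice m s (poly h (zeta m)))))\<^sup>2) = (\<Sum>s\<in>?O. (cmod (poly h s))\<^sup>2)" if \<tau>: "gal \<tau>" for \<tau>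
  proof -
    have "\<tau> (gal_choice m s (poly h (zeta m))) = poly h (\<tau> s)" if s: "s \<in> ?O" for s
      using gal_choice[OF s] h zq orbit_subset_qbar[OF zq] s \<tau> by (simp add: gal_poly_Ints subset_iff)
    then have "(\<Sum>s\<in>?O. (cmod (\<tau> (gal_choice m s (poly h (zeta m)))))\<^sup>2) = (\<Sum>s\<in>?O. (cmod (poly h (\<tau> s)))\<^sup>2)" by simp
    also have "\<dots> = (\<Sum>s\<in>?O. (cmod (poly h s))\<^sup>2)" by (rule sum.reindex_bij_betw[OF gal_image_orbit[OF \<tau> zq]])
    finally show ?thesis .
  qed
  have "real (card ?O) * mean_sq N (poly h (zeta m)) = (\<Sum>w\<in>orbit (zeta N). \<Sum>s\<in>?O. (cmod (poly h s))\<^sup>2) / real (card (orbit (zeta N)))"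
    using mean_sq_average[OF N(1), of ?O "gal_choice m" "poly h (zeta m)"] x gal_choice(1) pt by simp
  then show ?thesis using orbit_zeta(2,3)[OF N(1)] by auto
qed

text \<open>The twisted traces \<open>T h k\<close> are rational integers of bounded size, and those
  with k < m determine the element, so there are finitely many codes.\<close>

lemma finite_bounded_cyc_ring:
  assumes m: "m > 0"
  shows "finite {x. \<exists>h. coeffs_in \<int> h \<and> x = poly h (zeta m) \<and> (\<Sum>w\<in>orbit (zeta m). (cmod (poly h w))\<^sup>2) \<le> C}" (is "finite ?F")
proof -
  let ?O = "orbit (zeta m)"
  note O = orbit_zeta[OF m] and zq = zeta_qbar[OF m]
  have Oq: "w \<in> qbar" if "w \<in> ?O" for w using that orbit_subset_qbar[OF zq] by blast
  have rt: "w ^ m = 1" if "w \<in> ?O" for w using orbit_root_unity[OF m that] .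
  define T where "T h k = (\<Sum>w\<in>?O. w ^ k * poly h w)" for h k
  define B where "B = real (card ?O) * (C + 1)"
  have Tint: "T h k \<in> \<int>" if h: "coeffs_in \<int> h" for h k
  proof (rule gal_fixed_imp_Ints)
    show "algebraic_int (T h k)" unfolding T_def
      using rt root_unity_algebraic_int[OF m] h
      by (intro algebraic_int_sum algebraic_int_mult algebraic_int_power algebraic_int_poly) auto
    fix \<sigma> assume s: "gal \<sigma>"
    have hq: "poly h w \<in> qbar" if "w \<in> ?O" for w using that Oq coeffs_Ints_qbar[OF h] by (intro qbar_poly) auto
    have "\<sigma> (T h k) = (\<Sum>w\<in>?O. \<sigma> (w ^ k * poly h w))" unfolding T_def
      by (rule gal_sum[OF s]) (intro qbar_mult qbar_power Oq hq)
    also have "\<dots> = (\<Sum>w\<in>?O. \<sigma> w ^ k * poly h (\<sigma> w))"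
      using s hq Oq h by (intro sum.cong refl) (simp add: gal_mult gal_power qbar_power gal_poly_Ints)
    also have "\<dots> = T h k" unfolding T_def by (rule sum.reindex_bij_betw[OF gal_image_orbit[OF s zq]])
    finally show "\<sigma> (T h k) = T h k" .
  qed
  have Tb: "cmod (T h k) \<le> B" if le: "(\<Sum>w\<in>?O. (cmod (poly h w))\<^sup>2) \<le> C" for h k
  proof -
    have "cmod (w ^ k * poly h w) \<le> C + 1" if w: "w \<in> ?O" for w
    proof -
      have "(cmod (poly h w))\<^sup>2 \<le> (\<Sum>w\<in>?O. (cmod (poly h w))\<^sup>2)" using w O(1) by (intro member_le_sum) auto
      moreover have "cmod (poly h w) \<le> (cmod (poly h w))\<^sup>2 + 1"
      proof -
        have "2 * cmod (poly h w) \<le> (cmod (poly h w))\<^sup>2 + 1" using sum_squares_bound[of "cmod (poly h w)" 1] by simp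
        then show ?thesis using norm_ge_zero[of "poly h w"] by linarith
      qed
      moreover have "cmod w = 1" using norm_root_unity[OF m rt[OF w]] .
      ultimately show ?thesis using le by (simp add: norm_mult norm_power)
    qed
    then have "cmod (T h k) \<le> (\<Sum>w\<in>?O. C + 1)" unfolding T_def by (intro sum_norm_le)
    then show ?thesis by (simp add: B_def)
  qed
  define I where "I = {x :: complex. x \<in> \<int> \<and> cmod x \<le> B}"
  have "finite I"
  proof -
    have "I \<subseteq> of_int ` {- \<lceil>B\<rceil>..\<lceil>B\<rceil>}"
    proof
      fix x assume "x \<in> I"
      then obtain k where k: "x = of_int k" "cmod x \<le> B" by (auto simp: I_def elim: Ints_cases)
      then have "\<bar>real_of_int k\<bar> \<le> B" by (metis norm_of_int of_int_abs)
      then have "k \<in> {- \<lceil>B\<rceil>..\<lceil>B\<rceil>}" by (simp add: abs_le_iff) linarith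
      then show "x \<in> of_int ` {- \<lceil>B\<rceil>..\<lceil>B\<rceil>}" using k(1) by blast
    qed
    then show ?thesis by (rule finite_subset) simp
  qed
  define ph where "ph x = (SOME h. coeffs_in \<int> h \<and> x = poly h (zeta m) \<and> (\<Sum>w\<in>?O. (cmod (poly h w))\<^sup>2) \<le> C)" for x
  have ph: "coeffs_in \<int> (ph x)" "x = poly (ph x) (zeta m)" "(\<Sum>w\<in>?O. (cmod (poly (ph x) w))\<^sup>2) \<le> C" if x: "x \<in> ?F" for x
  proof -
    have "\<exists>h. coeffs_in \<int> h \<and> x = poly h (zeta m) \<and> (\<Sum>w\<in>?O. (cmod (poly h w))\<^sup>2) \<le> C" using x by simp
    from someI_ex[OF this] show "coeffs_in \<int> (ph x)" "x = poly (ph x) (zeta m)" "(\<Sum>w\<in>?O. (cmod (poly (ph x) w))\<^sup>2) \<le> C"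
      by (simp_all add: ph_def)
  qed
  \<comment> \<open>Complex conjugation inverts roots of unity and fixes integers, so the conjugate
    of h(w) is again a polynomial in w. The sum of the squared absolute values is thus an integral
    combination of traces.\<close>
  have zero: "poly h (zeta m) = 0" if h: "coeffs_in \<int> h" and T0: "\<And>k. T h k = 0" for h
  proof -
    have cj: "cnj (poly h w) = (\<Sum>i\<le>degree h. coeff h i * w ^ ((m - 1) * i))" if w: "w \<in> ?O" for w
    proof -
      have "cnj w * w = 1" using norm_root_unity[OF m rt[OF w]] complex_norm_square[of w] by (simp add: mult.commute)
      moreover have "w ^ (m - 1) * w = 1" using rt[OF w] m by (metis One_nat_def Suc_pred power_Suc2)
      ultimately have cw: "cnj w = w ^ (m - 1)" by (metis mult_cancel_right mult_zero_right zero_neq_one)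
      have "cnj (coeff h i) = coeff h i" for i
        using h unfolding coeffs_in_def by (metis Ints_cases complex_cnj_of_int)
      then show ?thesis by (simp add: poly_altdef cw power_mult)
    qed
    have "complex_of_real (\<Sum>w\<in>?O. (cmod (poly h w))\<^sup>2) = (\<Sum>w\<in>?O. poly h w * (\<Sum>i\<le>degree h. coeff h i * w ^ ((m - 1) * i)))"
      unfolding of_real_sum complex_norm_square using cj by simp
    also have "\<dots> = (\<Sum>i\<le>degree h. coeff h i * T h ((m - 1) * i))"
      unfolding sum_distrib_left T_def by (subst sum.swap) (simp add: mult_ac)
    also have "\<dots> = 0" by (simp add: T0)
    finally have "(\<Sum>w\<in>?O. (cmod (poly h w))\<^sup>2) = 0" by (simp only: of_real_eq_0_iff)
    then show ?thesis using O(1,2) by (simp add: sum_nonneg_eq_0_iff)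
  qed
  define code where "code x = map (T (ph x)) [0..<m]" for x
  have "inj_on code ?F"
  proof (rule inj_onI)
    fix x y assume xy: "x \<in> ?F" "y \<in> ?F" "code x = code y"
    define h where "h = ph x - ph y"
    have hc: "coeffs_in \<int> h" unfolding h_def using ph(1) xy by (intro coeffs_in_ring subring_C_Ints) blast+
    have "T h k = 0" for k
    proof -
      have red: "T g k = T g (k mod m)" for g
      proof -
        have "w ^ k = w ^ (k mod m)" if "w \<in> ?O" for w
        proof -
          have "w ^ k = w ^ (m * (k div m) + k mod m)" by simp
          also have "\<dots> = w ^ (k mod m)" unfolding power_add power_mult rt[OF that] by simp
          finally show ?thesis .
        qed
        then show ?thesis unfolding T_def by simp
      qed
      have "T (ph x) (k mod m) = T (ph y) (k mod m)" using xy(3) m unfolding code_def by (simp add: list_eq_iff_nth_eq)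
      moreover have "T h j = T (ph x) j - T (ph y) j" for j
        by (simp add: T_def h_def algebra_simps sum_subtractf)
      ultimately show ?thesis using red[of h] by simp
    qed
    from zero[OF hc this] show "x = y" using ph(2) xy by (simp add: h_def)
  qed
  moreover have "code ` ?F \<subseteq> {xs. set xs \<subseteq> I \<and> length xs = m}"
  proof (rule image_subsetI)
    fix x assume x: "x \<in> ?F"
    have "T (ph x) k \<in> I" for k using Tint[OF ph(1)[OF x]] Tb[OF ph(3)[OF x]] by (simp add: I_def)
    then show "code x \<in> {xs. set xs \<subseteq> I \<and> length xs = m}" by (auto simp: code_def)
  qed
  then have "finite (code ` ?F)" using finite_lists_length_eq[OF \<open>finite I\<close>] finite_subset by blast
  ultimately show ?thesis using finite_image_iff by blast
qed

text \<open>The bound is counted in halves: in the case of a prime dividing the conductor once, the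
  means of the pieces may sum up to 1/2 above the original bound, and the other pieces take away at
  least 1, a net drop of 1/2.\<close>

definition small_sq :: "nat \<Rightarrow> nat \<Rightarrow> complex set \<Rightarrow> bool" where
  "small_sq n R E \<longleftrightarrow> (\<forall>N m x. N > 0 \<longrightarrow> m dvd N \<longrightarrow> x \<in> cyc_ring m \<longrightarrow> mean_sq N x \<le> real n / 2 \<longrightarrow> short_sum R E x)"

lemma card_le_sum_mean_sq:
  assumes "N > 0" "finite S" "\<And>j. j \<in> S \<Longrightarrow> a j \<in> cyc_ring N" "\<And>j. j \<in> S \<Longrightarrow> a j \<noteq> 0"
  shows "real (card S) \<le> (\<Sum>j\<in>S. mean_sq N (a j))"
  using sum_mono[of S "\<lambda>_. 1" "\<lambda>j. mean_sq N (a j)"] mean_sq_ge_1[OF assms(1)] assms(3,4) by simp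

text \<open>If two or more pieces are nonzero, each piece loses a fixed amount of mean square, because the
  others contribute at least 1; if only one is nonzero, the level drops instead.\<close>
lemma split_short_sum:
  assumes IH: "small_sq n R E" and E0: "0 \<in> E" and N: "N > 0" "m dvd N"
    and a: "\<And>j. j < p \<Longrightarrow> a j \<in> cyc_ring m" and w: "\<eta> \<in> roots_of_unity"
    and S: "S = {j. j < p \<and> a j \<noteq> 0}" "card S \<le> k"
    and sm: "card S \<ge> 2 \<Longrightarrow> (\<Sum>j\<in>S. mean_sq N (a j)) \<le> real n / 2 + 1"
    and one: "\<And>j. S = {j} \<Longrightarrow> short_sum (k * R + 1) E (a j)"
  shows "short_sum (k * R + 1) E (\<Sum>j<p. \<eta> ^ j * a j)"
proof -
  have fS: "finite S" unfolding S(1) by simp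
  have aN: "a j \<in> cyc_ring N" if "j \<in> S" for j using that a cyc_ring_mono[OF N] by (auto simp: S(1))
  have eq: "(\<Sum>j<p. \<eta> ^ j * a j) = (\<Sum>j\<in>S. \<eta> ^ j * a j)"
    by (rule sum.mono_neutral_right) (auto simp: S(1))
  consider "S = {}" | j where "S = {j}" | "card S \<ge> 2"
  proof -
    have "card S = 0 \<or> card S = 1 \<or> card S \<ge> 2" by linarith
    then show ?thesis using that fS by (auto simp: card_1_singleton_iff)
  qed
  then show ?thesis
  proof cases
    case 1
    then show ?thesis unfolding eq using short_sum_0[OF E0] by simp
  next
    case (2 j)
    then show ?thesis unfolding eq using short_sum_root_mult[OF roots_of_unity_power[OF w] one[OF 2]] by simp
  next
    case 3
    have "short_sum R E (a j)" if j: "j \<in> S" for j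
    proof -
      have "mean_sq N (a j) + (\<Sum>i\<in>S - {j}. mean_sq N (a i)) \<le> real n / 2 + 1"
        using sm[OF 3] sum.remove[OF fS j, of "\<lambda>j. mean_sq N (a j)"] by simp
      moreover have "real (card (S - {j})) \<le> (\<Sum>i\<in>S - {j}. mean_sq N (a i))"
        using aN fS by (intro card_le_sum_mean_sq[OF N(1)]) (auto simp: S(1))
      moreover have "1 \<le> card (S - {j})" using 3 j fS by simp
      ultimately have "mean_sq N (a j) \<le> real n / 2" by linarith
      then show ?thesis using IH N a j unfolding small_sq_def S(1) by blast
    qed
    then have "short_sum (card S * R) E (\<Sum>j\<in>S. \<eta> ^ j * a j)"
      by (intro short_sum_sum[OF fS _ E0] short_sum_root_mult roots_of_unity_power w)
    moreover have "card S * R \<le> k * R + 1" using mult_le_mono1[OF S(2), of R] by linarith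
    ultimately show ?thesis unfolding eq by (rule short_sum_mono[OF _ _ order_refl E0])
  qed
qed

lemma squarefree_dvd_fact:
  fixes m :: nat
  assumes m: "m > 0" and base: "\<And>p. prime p \<Longrightarrow> p dvd m \<Longrightarrow> \<not> p * p dvd m \<and> p \<le> q"
  shows "m dvd fact q"
proof (rule multiplicity_le_imp_dvd)
  fix p :: nat assume p: "prime p"
  show "multiplicity p m \<le> multiplicity p (fact q)"
  proof (cases "p dvd m")
    case True
    then have "\<not> p ^ 2 dvd m" "p \<le> q" using base[OF p] by (auto simp: power2_eq_square)
    then have "multiplicity p m < 2" using m p by (metis multiplicity_dvd' not_less)
    moreover have "p dvd fact q" using \<open>p \<le> q\<close> prime_gt_0_nat[OF p] by (intro dvd_fact) auto
    then have "multiplicity p (fact q :: nat) \<ge> 1" using p by (intro multiplicity_geI) (auto dest: not_prime_unit)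
    ultimately show ?thesis by simp
  next
    case False
    then show ?thesis by (simp add: not_dvd_imp_multiplicity_0)
  qed
qed (use m in simp)

text \<open>Descent on the conductor m: a repeated prime or a prime above q is split off. If neither
  exists, m is squarefree with primes at most q, hence divides q!, and x lies in one of finitely
  many finite sets that are added to E.\<close>

lemma loxton_step:
  assumes IH: "small_sq n R E0" and E0: "finite E0" "E0 \<subseteq> qbar" "0 \<in> E0"
  shows "\<exists>R' E. finite E \<and> E \<subseteq> qbar \<and> 0 \<in> E \<and> small_sq (Suc n) R' E"
proof -
  define k where "k = n + 1"
  define c where "c = real k / 2"
  \<comment> \<open>A prime p > q exceeds both k and k * k: the former keeps p - k positive, the
    latter gives (p - 1) * c \<le> (p - k) * (c + 1/2).\<close>
  define q where "q = k + k * k"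
  define F where "F m = {x. \<exists>h. coeffs_in \<int> h \<and> x = poly h (zeta m) \<and> (\<Sum>w\<in>orbit (zeta m). (cmod (poly h w))\<^sup>2) \<le> real (card (orbit (zeta m))) * c}" for m
  define D where "D = {m. m dvd fact q \<and> m > (0::nat)}"
  have fD: "finite D" unfolding D_def by (rule finite_subset[OF _ finite_divisors_nat[of "fact q"]]) auto
  define E where "E = E0 \<union> (\<Union>m\<in>D. F m)"
  have "finite E" unfolding E_def F_def using E0(1) fD finite_bounded_cyc_ring by (auto simp: D_def)
  moreover have "E \<subseteq> qbar"
    unfolding E_def F_def using E0(2) zeta_qbar by (auto simp: D_def intro!: qbar_poly coeffs_Ints_qbar)
  moreover have EE: "0 \<in> E" "E0 \<subseteq> E" using E0(3) by (auto simp: E_def)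
  moreover have IH': "small_sq n R E"
    using IH short_sum_mono[OF _ order_refl EE(2,1)] unfolding small_sq_def by blast
  \<comment> \<open>At most k pieces of R terms each arise from a split; the additional 1 covers the
    base case, where x itself belongs to E.\<close>
  have main: "short_sum (k * R + 1) E x"
    if "N > 0" "m dvd N" "x \<in> cyc_ring m" "mean_sq N x \<le> c" for N m x
    using that
  proof (induction m arbitrary: x rule: less_induct)
    case (less m)
    note N = less.prems(1,2) and x = less.prems(3) and sq = less.prems(4)
    have m: "m > 0" using N by (auto intro: Nat.gr0I)
    have drop: "short_sum (k * R + 1) E y" if "prime p" "p dvd m" "y \<in> cyc_ring (m div p)" "mean_sq N y \<le> c" for y p
    proof (rule less.IH[OF _ N(1) _ that(3,4)])
      show "m div p < m" using prime_gt_1_nat[OF that(1)] m by simp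
      show "m div p dvd N" using that(2) N(2) by (metis dvd_div_mult_self dvd_mult_left)
    qed
    consider (sq) p where "prime p" "p * p dvd m" | (simple) p where "prime p" "p dvd m" "\<not> p dvd m div p" "p > q"
      | (base) "\<And>p. prime p \<Longrightarrow> p dvd m \<Longrightarrow> \<not> p * p dvd m \<and> p \<le> q"
      by (metis dvd_div_iff_mult not_le prime_gt_0_nat less_numeral_extra(3))
    then show ?case
    proof cases
      case (sq p)
      have p0: "p > 0" using sq(1) prime_gt_0_nat by blast
      have mono_map: "p dvd m" using sq(2) by (rule dvd_mult_left)
      have "\<exists>r<p. \<exists>w. zeta m ^ i = zeta m ^ r * w \<and> w \<in> cyc_ring (m div p)" for i
      proof (intro exI conjI)
        show "i mod p < p" using p0 by simp
        have "zeta m ^ i = zeta m ^ (i mod p + p * (i div p))" by simp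
        then show "zeta m ^ i = zeta m ^ (i mod p) * zeta (m div p) ^ (i div p)"
          by (simp only: power_add power_mult zeta_power_prime_quotient[OF p0 mono_map])
        show "zeta (m div p) ^ (i div p) \<in> cyc_ring (m div p)"
          using m mono_map p0 by (intro zeta_in_cyc_ring) (auto simp: dvd_div_eq_0_iff)
      qed
      from cyc_ring_split[OF m p0 this x] obtain a where a: "\<forall>j<p. a j \<in> cyc_ring (m div p)" "x = (\<Sum>j<p. zeta m ^ j * a j)" by blast
      have msq: "mean_sq N x = (\<Sum>j<p. mean_sq N (a j))"
        unfolding a(2) by (rule mean_sq_square_step[OF N sq]) (use a in blast)
      define S where "S = {j. j < p \<and> a j \<noteq> 0}"
      have mN: "m div p dvd N" using mono_map N(2) by (metis dvd_div_mult_self dvd_mult_left)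
      have le: "(\<Sum>j\<in>S. mean_sq N (a j)) \<le> mean_sq N x"
        unfolding msq S_def by (intro sum_mono2) (auto intro: mean_sq_nonneg)
      have "real (card S) \<le> (\<Sum>j\<in>S. mean_sq N (a j))"
        using a(1) cyc_ring_mono[OF N(1) mN] by (intro card_le_sum_mean_sq[OF N(1)]) (auto simp: S_def)
      then have "card S \<le> k" using le less.prems(4) unfolding c_def by simp
      then show ?thesis unfolding a(2)
      proof (intro split_short_sum[OF IH' EE(1) N(1) mN _ zeta_roots_of_unity[OF m] S_def])
        show "(\<Sum>j\<in>S. mean_sq N (a j)) \<le> real n / 2 + 1" using le less.prems(4) by (simp add: c_def k_def)
        show "short_sum (k * R + 1) E (a j)" if "S = {j}" for j
        proof (rule drop[OF sq(1) mono_map])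
          show "a j \<in> cyc_ring (m div p)" using a(1) that by (auto simp: S_def)
          show "mean_sq N (a j) \<le> c" using le less.prems(4) that by simp
        qed
      qed (use a in auto)
    next
      case (simple p)
      have p0: "p > 0" using simple(1) prime_gt_0_nat by blast
      have m': "m div p > 0" using simple(2) p0 m by (auto simp: dvd_div_eq_0_iff)
      have mN: "m div p dvd N" using simple(2) N(2) by (metis dvd_div_mult_self dvd_mult_left)
      have "\<exists>r<p. \<exists>w. zeta m ^ i = zeta p ^ r * w \<and> w \<in> cyc_ring (m div p)" for i
      proof -
        have "coprime (m div p) p" using prime_imp_coprime_nat[OF simple(1,3)] by (simp add: coprime_commute)
        then obtain u where u: "[(m div p) * u = 1] (mod p)" using cong_solve_coprime_nat by auto
        \<comment> \<open>With u inverse to m div p modulo p, this is the p-component of the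
          exponent; the quotient is a root of unity of level m div p.\<close>
        define r where "r = (u * i) mod p"
        have "(zeta m ^ i / zeta p ^ r) ^ (m div p) = 1"
        proof -
          have "(zeta m ^ i) ^ (m div p) = zeta p ^ i"
            using zeta_dvd_power[OF m simple(2)] by (metis mult.commute power_mult)
          moreover have "(zeta p ^ r) ^ (m div p) = zeta p ^ i"
          proof -
            have "[r * (m div p) = u * i * (m div p)] (mod p)" by (simp add: r_def cong_def mod_mult_left_eq)
            also have "[u * i * (m div p) = 1 * i] (mod p)" using cong_scalar_right[OF u, of i] by (simp add: mult_ac)
            finally show ?thesis using zeta_power_eq_iff[OF p0] by (simp add: power_mult[symmetric])
          qed
          ultimately show ?thesis by (simp add: power_divide)
        qed
        then have "zeta m ^ i / zeta p ^ r \<in> cyc_ring (m div p)" by (rule root_unity_in_cyc_ring[OF m'])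
        moreover have "zeta m ^ i = zeta p ^ r * (zeta m ^ i / zeta p ^ r)" by simp
        moreover have "r < p" using p0 by (simp add: r_def)
        ultimately show ?thesis by blast
      qed
      from cyc_ring_split[OF m p0 this x] obtain b where b: "\<forall>j<p. b j \<in> cyc_ring (m div p)" "x = (\<Sum>j<p. zeta p ^ j * b j)" by blast
      have bq: "b j \<in> qbar" if "j < p" for j using b(1) that cyc_ring_qbar[OF m'] by blast
      have geom: "(\<Sum>j<p. zeta p ^ j) = 0"
      proof -
        have "(zeta p - 1) * (\<Sum>j<p. zeta p ^ j) = 0" using zeta_power_self[OF p0] power_diff_1_eq[of "zeta p" p] by simp
        moreover have "zeta p \<noteq> 1" using zeta_power_eq_1_iff[OF p0, of 1] simple(1) by (auto simp: prime_nat_iff)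
        ultimately show ?thesis by simp
      qed
      have e: "(real p - 1) * mean_sq N x = real p * (\<Sum>j<p. mean_sq N (b j)) - mean_sq N (\<Sum>j<p. b j)"
        unfolding b(2) by (rule mean_sq_simple_step[OF N simple(1-3)]) (use b in blast)
      define Z where "Z l = {j. j < p \<and> b j \<noteq> b l}" for l
      \<comment> \<open>Otherwise more than p * k ordered pairs of distinct coefficients would each
        contribute at least 1 to a sum that equals 2 * (p - 1) times the mean of x, hence is at most
        (p - 1) * k.\<close>
      have "\<exists>l<p. real (card (Z l)) \<le> real k"
      proof (rule ccontr)
        assume "\<not> ?thesis"
        then have gt: "real k < real (card (Z l))" if "l < p" for l using that by force
        have bN: "b i - b j \<in> cyc_ring N" if "i < p" "j < p" for i j
          using b(1) that cyc_ring_mono[OF N(1) mN] by (intro subring_C_diff[OF subring_cyc_ring]) blast+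
        have "(\<Sum>l<p. real k) < (\<Sum>l<p. real (card (Z l)))" using gt p0 by (intro sum_strict_mono) auto
        also have "\<dots> \<le> (\<Sum>l<p. \<Sum>j<p. mean_sq N (b l - b j))"
        proof (intro sum_mono)
          fix l assume l: "l \<in> {..<p}"
          have "real (card (Z l)) \<le> (\<Sum>j\<in>Z l. mean_sq N (b l - b j))"
            using bN l by (intro card_le_sum_mean_sq[OF N(1)]) (auto simp: Z_def)
          also have "\<dots> \<le> (\<Sum>j<p. mean_sq N (b l - b j))"
            by (intro sum_mono2) (auto simp: Z_def intro: mean_sq_nonneg)
          finally show "real (card (Z l)) \<le> (\<Sum>j<p. mean_sq N (b l - b j))" .
        qed
        also have "\<dots> = 2 * ((real p - 1) * mean_sq N x)"
          using mean_sq_diff_sum[OF N(1), of "{..<p}" b] bq e by simp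
        also have "\<dots> \<le> 2 * ((real p - 1) * c)" using less.prems(4) p0 by (intro mult_left_mono) auto
        also have "\<dots> \<le> real p * real k" using p0 by (simp add: c_def algebra_simps)
        finally show False by simp
      qed
      then obtain l where l: "l < p" "card (Z l) \<le> k" by auto
      \<comment> \<open>Since the powers of \<open>zeta p\<close> sum to 0, a common value may be
        subtracted from all coefficients; at most k of them remain nonzero.\<close>
      define a where "a j = b j - b l" for j
      have aR: "a j \<in> cyc_ring (m div p)" if "j < p" for j
        unfolding a_def using b(1) l that by (intro subring_C_diff[OF subring_cyc_ring]) auto
      have xa: "x = (\<Sum>j<p. zeta p ^ j * a j)"
        using geom by (simp add: b(2) a_def right_diff_distrib sum_subtractf sum_distrib_right[symmetric])
      define S where "S = {j. j < p \<and> a j \<noteq> 0}"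
      have SZ: "S = Z l" by (auto simp: S_def Z_def a_def)
      have Sk: "card S \<le> k" using l(2) SZ by simp
      define T where "T = (\<Sum>j\<in>S. mean_sq N (a j))"
      have T0: "T \<ge> 0" unfolding T_def by (intro sum_nonneg mean_sq_nonneg)
      have zero: "mean_sq N 0 = 0" by (simp add: mean_sq_def gal_0[OF gal_choice(1)])
      have ea: "(real p - 1) * mean_sq N x = real p * T - mean_sq N (\<Sum>j\<in>S. a j)"
      proof -
        have "(real p - 1) * mean_sq N x = real p * (\<Sum>j<p. mean_sq N (a j)) - mean_sq N (\<Sum>j<p. a j)"
          unfolding xa by (rule mean_sq_simple_step[OF N simple(1-3)]) (use aR in blast)
        moreover have "(\<Sum>j<p. mean_sq N (a j)) = T"
          unfolding T_def by (rule sum.mono_neutral_right) (auto simp: S_def zero)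
        moreover have "(\<Sum>j<p. a j) = (\<Sum>j\<in>S. a j)" by (rule sum.mono_neutral_right) (auto simp: S_def)
        ultimately show ?thesis by simp
      qed
      have CS: "mean_sq N (\<Sum>j\<in>S. a j) \<le> real (card S) * T"
        unfolding T_def using aR cyc_ring_qbar[OF m'] by (intro mean_sq_Cauchy_Schwarz[OF N(1)]) (auto simp: S_def)
      show ?thesis unfolding xa
      proof (rule split_short_sum[OF IH' EE(1) N(1) mN aR zeta_roots_of_unity[OF p0] S_def Sk])
        assume "2 \<le> card S"
        have kp: "real k + real k * real k < real p"
          using simple(4) unfolding q_def by (metis of_nat_add of_nat_less_iff of_nat_mult)
        have "(real p - real k) * T \<le> real p * T - real (card S) * T"
          using Sk T0 by (simp add: left_diff_distrib mult_right_mono)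
        also have "\<dots> \<le> (real p - 1) * c"
        proof -
          have "real p * T - real (card S) * T \<le> (real p - 1) * mean_sq N x" using ea CS by linarith
          also have "\<dots> \<le> (real p - 1) * c" using less.prems(4) p0 by (intro mult_left_mono) auto
          finally show ?thesis .
        qed
        finally have 1: "(real p - real k) * T \<le> (real p - 1) * c" .
        have 2: "(real p - 1) * c \<le> (real p - real k) * (c + 1 / 2)"
        proof -
          have "(real p - real k) * (c + 1 / 2) - (real p - 1) * c = (real p - real k - real k * real k + real k) / 2"
            by (simp add: c_def field_simps)
          then show ?thesis using kp by simp
        qed
        have "(real p - real k) * T \<le> (real p - real k) * (c + 1 / 2)" using 1 2 by linarith
        moreover have "real p - real k > 0" using kp by (smt (verit) mult_nonneg_nonneg of_nat_0_le_iff)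
        ultimately have "T \<le> c + 1 / 2" by (simp add: mult_le_cancel_left_pos)
        then show "(\<Sum>j\<in>S. mean_sq N (a j)) \<le> real n / 2 + 1" by (simp add: T_def c_def k_def add_divide_distrib)
      next
        fix j assume j: "S = {j}"
        show "short_sum (k * R + 1) E (a j)"
        proof (rule drop[OF simple(1,2)])
          show "a j \<in> cyc_ring (m div p)" using aR j by (auto simp: S_def)
          have "p > 1" using simple(1) prime_gt_1_nat by blast
          \<comment> \<open>With one nonzero coefficient, T and the mean of the sum coincide, so the
            mean is unchanged and only the conductor drops.\<close>
          have "(real p - 1) * mean_sq N x = (real p - 1) * mean_sq N (a j)"
            using ea j by (simp add: T_def algebra_simps)
          then have "mean_sq N x = mean_sq N (a j)" using \<open>p > 1\<close> by simp
          then show "mean_sq N (a j) \<le> c" using less.prems(4) by simp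
        qed
      qed
    next
      case base
      have "m dvd fact q" by (rule squarefree_dvd_fact[OF m base])
      then have mD: "m \<in> D" using m by (simp add: D_def)
      obtain h where h: "coeffs_in \<int> h" "x = poly h (zeta m)" using x by (auto simp: cyc_ring_def)
      have "(\<Sum>w\<in>orbit (zeta m). (cmod (poly h w))\<^sup>2) \<le> real (card (orbit (zeta m))) * c"
        unfolding mean_sq_restrict[OF N h(1)] using less.prems(4) h(2) by (intro mult_left_mono) auto
      then have "x \<in> E" using h mD unfolding E_def F_def by blast
      then show ?thesis using short_sum_mono[OF short_sum_single _ order_refl EE(1)] by simp
    qed
  qed
  have "small_sq (Suc n) (k * R + 1) E" unfolding small_sq_def using main by (simp add: c_def k_def)
  ultimately show ?thesis by blast
qed

lemma loxton_cyclotomic: "\<exists>R E. finite E \<and> E \<subseteq> qbar \<and> 0 \<in> E \<and> small_sq n R E"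
proof (induction n)
  case 0
  have "x = 0" if "N > 0" "m dvd N" "x \<in> cyc_ring m" "mean_sq N x \<le> real 0 / 2" for N m x
    using mean_sq_ge_1[OF that(1), of x] cyc_ring_mono[OF that(1,2)] that(3,4) by fastforce
  then have "small_sq 0 0 {0}" unfolding small_sq_def using short_sum_0[of "{0}"] by blast
  then show ?case by (intro exI[of _ 0] exI[of _ "{0}"]) auto
next
  case (Suc n)
  then show ?case using loxton_step by blast
qed

section \<open>Passage from cyclotomic fields to a number field\<close>

lemma integral_multiple_exists:
  assumes "x \<in> qbar" shows "\<exists>d>0. algebraic_int (of_nat d * x)"
proof -
  obtain p where p: "coeffs_in \<int> p" "p \<noteq> 0" "poly p x = 0" "degree p > 0" using gal_conjugates[OF assms] by metis
  define n where "n = degree p"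
  define c where "c = lead_coeff p"
  have cZ: "coeff p i \<in> \<int>" for i using p(1) by (simp add: coeffs_in_def)
  have c0: "c \<noteq> 0" using p(2) by (simp add: c_def)
  have n0: "n > 0" using p(4) by (simp add: n_def)
  \<comment> \<open>This is c^(n-1) p(X / c): monic, integral, and vanishing at c * x.\<close>
  define r where "r = monom 1 n + (\<Sum>i<n. monom (coeff p i * c ^ (n - 1 - i)) i)"
  have cr: "coeff r i = (if i = n then 1 else if i < n then coeff p i * c ^ (n - 1 - i) else 0)" for i
    unfolding r_def coeff_add coeff_sum coeff_monom by (simp add: sum.delta)
  have deg: "degree r = n"
  proof (rule antisym)
    show "degree r \<le> n" by (rule degree_le) (simp add: cr)
    show "n \<le> degree r" by (rule le_degree) (simp add: cr)
  qed
  have "poly r (c * x) = c ^ (n - 1) * poly p x"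
  proof -
    have "poly r (c * x) = (\<Sum>i\<le>n. coeff r i * (c * x) ^ i)" by (simp add: poly_altdef deg)
    also have "\<dots> = (\<Sum>i\<le>n. c ^ (n - 1) * (coeff p i * x ^ i))"
    proof (intro sum.cong refl)
      fix i assume i: "i \<in> {..n}"
      show "coeff r i * (c * x) ^ i = c ^ (n - 1) * (coeff p i * x ^ i)"
      proof (cases "i = n")
        case True
        have "c ^ n = c ^ (n - 1) * c" using n0 by (metis power_minus_mult)
        then show ?thesis using True by (simp add: cr power_mult_distrib c_def n_def)
      next
        case False
        then have "c ^ (n - 1) = c ^ (n - 1 - i) * c ^ i" using i by (simp add: power_add[symmetric])
        then show ?thesis using False i by (simp add: cr power_mult_distrib mult_ac)
      qed
    qed
    also have "\<dots> = c ^ (n - 1) * poly p x" by (simp add: poly_altdef n_def sum_distrib_left)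
    finally show ?thesis .
  qed
  then have "poly r (c * x) = 0" using p(3) by simp
  moreover have "lead_coeff r = 1" by (simp add: deg cr)
  moreover have "coeffs_in \<int> r" using cZ unfolding coeffs_in_def cr c_def by auto
  ultimately have "integral_over \<int> (c * x)" unfolding integral_over_def by blast
  then have ai: "algebraic_int (c * x)" by (simp add: algebraic_int_iff_integral_over)
  obtain k where k: "c = of_int k" using cZ[of n] unfolding c_def n_def by (auto elim: Ints_cases)
  show ?thesis
  proof (cases "k > 0")
    case True
    then show ?thesis using ai k by (intro exI[of _ "nat k"]) (simp add: of_nat_nat)
  next
    case False
    then have "of_nat (nat (- k)) * x = - (c * x)" using k c0 by (simp add: of_nat_nat)
    then show ?thesis using ai False k c0 by (intro exI[of _ "nat (- k)"]) (auto simp del: of_nat_nat intro: algebraic_int_minus)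
  qed
qed

lemma gal_fixes_scaled:
  assumes "gal \<sigma>" "x \<in> qbar" "d > 0" "\<sigma> (of_nat d * x) = of_nat d * x"
  shows "\<sigma> x = x"
  using assms gal_mult[OF assms(1), of "of_nat d" x] by (simp add: gal_of_nat)

lemma finite_map_gal: assumes "set bs \<subseteq> qbar" shows "finite {map \<sigma> bs | \<sigma>. gal \<sigma>}"
proof -
  have "{map \<sigma> bs | \<sigma>. gal \<sigma>} \<subseteq> {xs. set xs \<subseteq> (\<Union>b\<in>set bs. orbit b) \<and> length xs = length bs}"
    unfolding orbit_def by fastforce
  moreover have "finite \<dots>" using assms by (intro finite_lists_length_eq) (auto intro: finite_orbit)
  ultimately show ?thesis by (rule finite_subset)
qed

text \<open>The primitive element is a combination with weights 1, n, n^2, ...; only finitely many n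
  are roots of one of the polynomials that separate the conjugates.\<close>
lemma primitive_element:
  assumes bs: "\<And>b. b \<in> set bs \<Longrightarrow> algebraic_int b"
  shows "\<exists>\<theta>. algebraic_int \<theta> \<and> (\<forall>\<sigma>. gal \<sigma> \<longrightarrow> \<sigma> \<theta> = \<theta> \<longrightarrow> (\<forall>b\<in>set bs. \<sigma> b = b))"
proof -
  have q: "set bs \<subseteq> qbar" using bs algebraic_int_qbar by blast
  define V where "V = {map \<sigma> bs | \<sigma>. gal \<sigma>}"
  have fV: "finite V" unfolding V_def by (rule finite_map_gal[OF q])
  define s where "s = length bs"
  define P where "P v = (\<Sum>i<s. monom (v ! i - bs ! i) i)" for v
  have cP: "coeff (P v) i = (if i < s then v ! i - bs ! i else 0)" for v i
    by (auto simp: P_def coeff_sum if_distrib cong: if_cong)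
  define Bad where "Bad = (\<Union>v\<in>{v\<in>V. v \<noteq> bs}. {x. poly (P v) x = 0})"
  have P0: "P v \<noteq> 0" if v: "v \<in> V" "v \<noteq> bs" for v
  proof
    assume "P v = 0"
    then have "v ! i = bs ! i" if "i < s" for i using cP[of v i] that by simp
    moreover have "length v = s" using v(1) by (auto simp: V_def s_def)
    ultimately show False using v(2) by (auto simp: s_def list_eq_iff_nth_eq)
  qed
  have "finite Bad" unfolding Bad_def using fV P0 poly_roots_finite by auto
  then have "finite (of_nat -` Bad :: nat set)" by (rule finite_vimageI) (simp add: inj_on_def)
  then obtain n :: nat where n: "of_nat n \<notin> Bad" using ex_new_if_finite[OF infinite_UNIV_nat] by auto
  define \<theta> where "\<theta> = (\<Sum>i<s. bs ! i * of_nat n ^ i)"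
  have "algebraic_int \<theta>" unfolding \<theta>_def using bs
    by (intro algebraic_int_sum algebraic_int_mult algebraic_int_power algebraic_int_of_nat) (auto simp: s_def)
  moreover have "\<sigma> b = b" if \<sigma>: "gal \<sigma>" "\<sigma> \<theta> = \<theta>" and b: "b \<in> set bs" for \<sigma> b
  proof -
    have bq: "bs ! i \<in> qbar" if "i < s" for i using q that by (auto simp: s_def)
    have "\<sigma> \<theta> = (\<Sum>i<s. \<sigma> (bs ! i * of_nat n ^ i))" unfolding \<theta>_def
      by (rule gal_sum[OF \<sigma>(1)]) (use bq in \<open>auto intro!: qbar_mult qbar_power\<close>)
    also have "\<dots> = (\<Sum>i<s. \<sigma> (bs ! i) * of_nat n ^ i)"
      using bq \<sigma>(1) by (intro sum.cong refl) (simp add: gal_mult gal_power gal_of_nat qbar_power)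
    finally have "(\<Sum>i<s. \<sigma> (bs ! i) * of_nat n ^ i) - (\<Sum>i<s. bs ! i * of_nat n ^ i) = 0"
      using \<sigma>(2) by (simp add: \<theta>_def)
    moreover have "poly (P (map \<sigma> bs)) (of_nat n) = (\<Sum>i<s. (\<sigma> (bs ! i) - bs ! i) * of_nat n ^ i)"
      by (simp add: P_def poly_sum poly_monom s_def)
    ultimately have "poly (P (map \<sigma> bs)) (of_nat n) = 0" by (simp add: sum_subtractf algebra_simps)
    moreover have "map \<sigma> bs \<in> V" using \<sigma>(1) by (auto simp: V_def)
    ultimately have "map \<sigma> bs = bs" using n unfolding Bad_def by blast
    then show ?thesis using b by (metis map_idI map_eq_conv list.map_ident)
  qed
  ultimately show ?thesis by blast
qed

text \<open>Scaling a finite spanning set makes it integral, as \<open>primitive_element\<close>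
  demands; automorphisms fixing the multiples fix the elements and all their rational
  combinations.\<close>

lemma number_field_primitive:
  assumes K: "number_field K"
  shows "\<exists>\<theta>. algebraic_int \<theta> \<and> (\<forall>\<sigma>. gal \<sigma> \<longrightarrow> \<sigma> \<theta> = \<theta> \<longrightarrow> (\<forall>x\<in>K. \<sigma> x = x))"
proof -
  obtain B where B: "finite B" "B \<subseteq> K" "K \<subseteq> {\<Sum>b\<in>B. of_rat (c b) * b | c. True}"
    using K by (auto simp: number_field_def)
  have Bq: "B \<subseteq> qbar" using B(2) number_field_subset_qbar[OF K] by blast
  then have "\<forall>b\<in>B. \<exists>d>0. algebraic_int (of_nat d * b)" using integral_multiple_exists by blast
  then obtain d where d: "\<And>b. b \<in> B \<Longrightarrow> d b > 0 \<and> algebraic_int (of_nat (d b) * b)" by metis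
  obtain bl where bl: "set bl = B" using finite_list[OF B(1)] by blast
  obtain \<theta> where \<theta>: "algebraic_int \<theta>" "\<And>\<sigma>. gal \<sigma> \<Longrightarrow> \<sigma> \<theta> = \<theta> \<Longrightarrow> \<forall>b\<in>set (map (\<lambda>b. of_nat (d b) * b) bl). \<sigma> b = b"
    using primitive_element[of "map (\<lambda>b. of_nat (d b) * b) bl"] d bl by auto
  have "\<sigma> x = x" if \<sigma>: "gal \<sigma>" "\<sigma> \<theta> = \<theta>" and x: "x \<in> K" for \<sigma> x
  proof -
    have fb: "\<sigma> b = b" if "b \<in> B" for b
      using gal_fixes_scaled[OF \<sigma>(1), of b "d b"] \<theta>(2)[OF \<sigma>] d[OF that] that Bq bl by auto
    obtain c where c: "x = (\<Sum>b\<in>B. of_rat (c b) * b)" using x B(3) by blast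
    have rq: "of_rat r \<in> qbar" for r using Rats_subset_qbar by auto
    have "\<sigma> x = (\<Sum>b\<in>B. \<sigma> (of_rat (c b) * b))" unfolding c
      by (rule gal_sum[OF \<sigma>(1)]) (use Bq rq in \<open>auto intro: qbar_mult\<close>)
    also have "\<dots> = x" unfolding c using fb Bq rq \<sigma>(1)
      by (intro sum.cong refl) (auto simp: gal_mult gal_Rats subset_iff)
    finally show ?thesis .
  qed
  then show ?thesis using \<theta>(1) by blast
qed

text \<open>The elements fixed by the common stabiliser of \<theta> and some \<open>zeta N\<close>
  form a field, since two levels N and M have the common multiple N * M. It contains K and all roots
  of unity, hence the whole extension.\<close>

lemma cyclo_ext_fixed:
  assumes K: "K \<subseteq> qbar" and \<theta>: "\<And>\<sigma> x. gal \<sigma> \<Longrightarrow> \<sigma> \<theta> = \<theta> \<Longrightarrow> x \<in> K \<Longrightarrow> \<sigma> x = x"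
    and x: "x \<in> cyclo_ext K"
  shows "\<exists>N>0. \<forall>\<sigma>. gal \<sigma> \<longrightarrow> \<sigma> \<theta> = \<theta> \<longrightarrow> \<sigma> (zeta N) = zeta N \<longrightarrow> \<sigma> x = x"
proof -
  define H where "H N = {\<sigma>. gal \<sigma> \<and> \<sigma> \<theta> = \<theta> \<and> \<sigma> (zeta N) = zeta N}" for N
  have Hgal: "gal \<sigma>" if "\<sigma> \<in> H N" for \<sigma> N using that by (simp add: H_def)
  define P where "P x N \<longleftrightarrow> x \<in> qbar \<and> N > 0 \<and> (\<forall>\<sigma>\<in>H N. \<sigma> x = x)" for x N
  define L where "L = {x. \<exists>N. P x N}"
  have lift: "P x M" if "P x N" "M > 0" "N dvd M" for x N M
  proof -
    have "H M \<subseteq> H N" using zeta_stabilizer_dvd that(2,3) by (auto simp: H_def)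
    then show ?thesis using that(1,2) unfolding P_def by blast
  qed
  have "subfield_C L"
    unfolding subfield_C_def
  proof (intro conjI ballI impI)
    show "0 \<in> L" "1 \<in> L" unfolding L_def P_def using gal_0 gal_1 Hgal by (auto intro!: exI[of _ "1::nat"])
    fix x assume "x \<in> L"
    then obtain N where N: "P x N" by (auto simp: L_def)
    {
      fix y assume "y \<in> L"
      then obtain M where M: "P y M" by (auto simp: L_def)
      have NM: "N * M > 0" using N M by (simp add: P_def)
      have xy: "x \<in> qbar" "y \<in> qbar" using N M by (auto simp: P_def)
      have "\<sigma> (x + y) = x + y \<and> \<sigma> (x - y) = x - y \<and> \<sigma> (x * y) = x * y" if s: "\<sigma> \<in> H (N * M)" for \<sigma>
      proof -
        have "\<sigma> x = x" "\<sigma> y = y" using lift[OF N NM] lift[OF M NM] s by (auto simp: P_def)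
        then show ?thesis using xy Hgal[OF s] by (simp add: gal_add gal_diff gal_mult)
      qed
      then have "P (x + y) (N * M)" "P (x - y) (N * M)" "P (x * y) (N * M)"
        unfolding P_def using xy NM by (simp_all add: qbar_add qbar_diff qbar_mult)
      then show "x + y \<in> L" "x - y \<in> L" "x * y \<in> L" unfolding L_def by blast+
    }
    have "P (inverse x) N"
      unfolding P_def
    proof (intro conjI ballI)
      show "inverse x \<in> qbar" "N > 0" using N by (auto simp: P_def qbar_inverse)
      fix \<sigma> assume s: "\<sigma> \<in> H N"
      have "\<sigma> x = x" "x \<in> qbar" using N s by (auto simp: P_def)
      then show "\<sigma> (inverse x) = inverse x"
        using gal_divide[OF Hgal[OF s] qbar_1, of x] by (simp add: gal_1[OF Hgal[OF s]] inverse_eq_divide)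
    qed
    then show "inverse x \<in> L" unfolding L_def by blast
  qed
  moreover have "K \<subseteq> L" unfolding L_def P_def H_def using \<theta> K by (auto intro!: exI[of _ "1::nat"])
  moreover have "roots_of_unity \<subseteq> L"
  proof
    fix w assume w: "w \<in> roots_of_unity"
    then obtain N where N: "N > 0" "w ^ N = 1" by (auto simp: roots_of_unity_def)
    obtain k where k: "w = zeta N ^ k" using root_unity_eq_zeta_power[OF N] by blast
    have "P w N" unfolding P_def H_def using roots_of_unity_qbar[OF w] N(1) zeta_qbar[OF N(1)] by (auto simp: k gal_power)
    then show "w \<in> L" by (auto simp: L_def)
  qed
  ultimately have "cyclo_ext K \<subseteq> L" unfolding cyclo_ext_def by (intro Inter_lower) simp
  then show ?thesis using x unfolding L_def P_def H_def by blast
qed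

text \<open>Interpolation writes \<alpha> in powers of \<theta> with coefficients in a cyclotomic
  ring, divided by a product over a subset T of the orbit of \<theta>. T depends on the level of
  \<alpha>, but the orbit has finitely many subsets, so the factors \<theta>^i / (product over T)
  can all be absorbed in E.\<close>

theorem loxton:
  assumes K: "number_field K"
  shows "\<exists>R E. finite E \<and> E \<subseteq> qbar \<and> 0 \<in> E \<and>
    (\<forall>\<alpha> \<in> alg_integers_of (cyclo_ext K). (\<forall>\<sigma>. gal \<sigma> \<longrightarrow> cmod (\<sigma> \<alpha>) \<le> c) \<longrightarrow> short_sum R E \<alpha>)"
proof -
  obtain \<theta> where \<theta>: "algebraic_int \<theta>" "\<And>\<sigma> x. gal \<sigma> \<Longrightarrow> \<sigma> \<theta> = \<theta> \<Longrightarrow> x \<in> K \<Longrightarrow> \<sigma> x = x"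
    using number_field_primitive[OF K] by blast
  have \<theta>q: "\<theta> \<in> qbar" by (rule algebraic_int_qbar[OF \<theta>(1)])
  define d where "d = card (orbit \<theta>)"
  define C where "C = real d * (c * conj_bound \<theta>)"
  \<comment> \<open>\<open>C\<close> bounds all conjugates of the interpolation coefficients, so
    their means are at most C^2, which is at most n / 2.\<close>
  define n where "n = nat \<lceil>2 * C\<^sup>2\<rceil>"
  obtain R0 E0 where E0: "finite E0" "E0 \<subseteq> qbar" "0 \<in> E0" "small_sq n R0 E0"
    using loxton_cyclotomic by blast
  define u where "u i T = \<theta> ^ i / (\<Prod>t\<in>T. \<theta> - t)" for i T
  define E where "E = insert 0 (\<Union>i\<in>{..<d}. \<Union>T\<in>Pow (orbit \<theta>). (*) (u i T) ` E0)"
  have fO: "finite (orbit \<theta>)" by (rule finite_orbit[OF \<theta>q])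
  have "finite E" unfolding E_def using E0(1) fO by simp
  moreover have "E \<subseteq> qbar"
  proof -
    have "u i T \<in> qbar" if "T \<subseteq> orbit \<theta>" for i T
      unfolding u_def using that orbit_subset_qbar[OF \<theta>q] \<theta>q by (intro qbar_divide qbar_power qbar_prod qbar_diff) auto
    then show ?thesis unfolding E_def using E0(2) by (auto intro!: qbar_mult)
  qed
  moreover have E00: "0 \<in> E" by (simp add: E_def)
  moreover have "short_sum (d * R0) E \<alpha>"
    if \<alpha>: "\<alpha> \<in> alg_integers_of (cyclo_ext K)" "\<And>\<sigma>. gal \<sigma> \<Longrightarrow> cmod (\<sigma> \<alpha>) \<le> c" for \<alpha>
  proof -
    have ai: "algebraic_int \<alpha>" and mem: "\<alpha> \<in> cyclo_ext K" using \<alpha>(1) by (auto simp: alg_integers_of_def)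
    obtain N where N: "N > 0" "\<And>\<sigma>. gal \<sigma> \<Longrightarrow> \<sigma> \<theta> = \<theta> \<Longrightarrow> \<sigma> (zeta N) = zeta N \<Longrightarrow> \<sigma> \<alpha> = \<alpha>"
    proof -
      have "\<exists>N>0. \<forall>\<sigma>. gal \<sigma> \<longrightarrow> \<sigma> \<theta> = \<theta> \<longrightarrow> \<sigma> (zeta N) = zeta N \<longrightarrow> \<sigma> \<alpha> = \<alpha>"
        by (rule cyclo_ext_fixed[OF number_field_subset_qbar[OF K] _ mem]) (rule \<theta>(2))
      then show ?thesis using that by blast
    qed
    define T where "T = rel_orbit (zeta N) \<theta> - {\<theta>}"
    have "\<exists>A. (\<forall>i. algebraic_int (coeff A i)) \<and> degree A < card (orbit \<theta>) \<and>
      poly A \<theta> = \<alpha> * (\<Prod>t\<in>rel_orbit (zeta N) \<theta> - {\<theta>}. \<theta> - t) \<and>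
      (\<forall>\<sigma> i. gal \<sigma> \<longrightarrow> \<sigma> (zeta N) = zeta N \<longrightarrow> \<sigma> (coeff A i) = coeff A i) \<and>
      (\<forall>\<sigma> i. gal \<sigma> \<longrightarrow> cmod (\<sigma> (coeff A i)) \<le> real (card (orbit \<theta>)) * (c * conj_bound \<theta>))"
      by (rule lagrange_descent[OF zeta_qbar[OF N(1)] \<theta>(1) ai]) (use N(2) \<alpha>(2) in auto)
    then obtain A where A: "\<forall>i. algebraic_int (coeff A i)" "degree A < d" "poly A \<theta> = \<alpha> * (\<Prod>t\<in>T. \<theta> - t)"
      "\<forall>\<sigma> i. gal \<sigma> \<longrightarrow> \<sigma> (zeta N) = zeta N \<longrightarrow> \<sigma> (coeff A i) = coeff A i"
      "\<forall>\<sigma> i. gal \<sigma> \<longrightarrow> cmod (\<sigma> (coeff A i)) \<le> C"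
      unfolding d_def C_def T_def by blast
    have sh: "short_sum R0 E0 (coeff A i)" for i
    proof -
      have mem: "coeff A i \<in> cyc_ring N"
        by (rule fixed_algebraic_int_in_cyc_ring[OF N(1)]) (use A in auto)
      have "mean_sq N (coeff A i) \<le> C\<^sup>2"
      proof -
        have "(\<Sum>w\<in>orbit (zeta N). (cmod (gal_choice N w (coeff A i)))\<^sup>2) \<le> (\<Sum>w\<in>orbit (zeta N). C\<^sup>2)"
          using A(5) gal_choice(1) by (intro sum_mono power_mono) auto
        then show ?thesis unfolding mean_sq_def using orbit_zeta(3)[OF N(1)] by (simp add: divide_le_eq mult.commute)
      qed
      also have "C\<^sup>2 \<le> real n / 2" unfolding n_def by linarith
      finally show ?thesis by (rule E0(4)[unfolded small_sq_def, rule_format, OF N(1) dvd_refl mem])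
    qed
    have TO: "T \<subseteq> orbit \<theta>" by (auto simp: T_def rel_orbit_def orbit_def)
    have nz: "(\<Prod>t\<in>T. \<theta> - t) \<noteq> 0" using finite_subset[OF TO fO] by (auto simp: T_def)
    have "poly A \<theta> = (\<Sum>i<d. coeff A i * \<theta> ^ i)"
      unfolding poly_altdef using A(2) by (intro sum.mono_neutral_left) (auto simp: coeff_eq_0)
    then have "\<alpha> = (\<Sum>i<d. coeff A i * \<theta> ^ i) / (\<Prod>t\<in>T. \<theta> - t)" using A(3) nz by (simp add: field_simps)
    then have \<alpha>e: "\<alpha> = (\<Sum>i<d. u i T * coeff A i)" by (simp add: u_def sum_divide_distrib mult.commute)
    have "short_sum R0 E (u i T * coeff A i)" if "i < d" for i
      by (rule short_sum_mono[OF short_sum_scale[OF sh] order_refl _ E00]) (use that TO in \<open>auto simp: E_def\<close>)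
    then have "short_sum (card {..<d} * R0) E \<alpha>" unfolding \<alpha>e by (intro short_sum_sum E00) auto
    then show ?thesis by simp
  qed
  ultimately show ?thesis by blast
qed

section \<open>Vanishing sums of roots of unity\<close>

text \<open>If the nontrivial Fourier coefficients vanish, Parseval gives p * \<Sum>|y|^2 =
  |\<Sum>y|^2, and by Cauchy-Schwarz the right side is at most the number of nonzero entries times
  \<Sum>|y|^2. With fewer than p nonzero entries this forces y = 0.\<close>

lemma classes_vanish:
  fixes y :: "nat \<Rightarrow> complex"
  assumes p: "prime p" and few: "card {r. r < p \<and> y r \<noteq> 0} < p"
    and z: "\<And>i. i \<in> {1..<p} \<Longrightarrow> (\<Sum>r<p. (zeta p ^ i) ^ r * y r) = 0" and r: "r < p"
  shows "y r = 0"
proof -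
  let ?S = "{r. r < p \<and> y r \<noteq> 0}"
  have p0: "p > 0" using p prime_gt_0_nat by blast
  have z1: "zeta p ^ p = 1" "zeta p \<noteq> 1" using gal_zeta_prime[OF gal_id p] by simp_all
  have "{..<p} = insert 0 {1..<p}" using p0 by auto
  then have "(\<Sum>i<p. (cmod (\<Sum>r<p. (zeta p ^ i) ^ r * y r))\<^sup>2) = (cmod (\<Sum>r<p. y r))\<^sup>2" using z by simp
  then have e: "real p * (\<Sum>r<p. (cmod (y r))\<^sup>2) = (cmod (\<Sum>r<p. y r))\<^sup>2"
    using parseval[OF p z1, of y] by simp
  have s1: "(\<Sum>r<p. y r) = (\<Sum>r\<in>?S. y r)" by (rule sum.mono_neutral_right) auto
  have s2: "(\<Sum>r<p. (cmod (y r))\<^sup>2) = (\<Sum>r\<in>?S. (cmod (y r))\<^sup>2)" by (rule sum.mono_neutral_right) auto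
  have "(cmod (\<Sum>r\<in>?S. y r))\<^sup>2 \<le> (\<Sum>r\<in>?S. cmod (y r))\<^sup>2" by (intro power_mono norm_sum) simp
  also have "\<dots> \<le> real (card ?S) * (\<Sum>r\<in>?S. (cmod (y r))\<^sup>2)" by (rule sum_squared_le)
  finally have le: "real p * (\<Sum>r<p. (cmod (y r))\<^sup>2) \<le> real (card ?S) * (\<Sum>r<p. (cmod (y r))\<^sup>2)" using e s1 s2 by simp
  have nn: "(\<Sum>r<p. (cmod (y r))\<^sup>2) \<ge> 0" by (intro sum_nonneg) simp
  have "(\<Sum>r<p. (cmod (y r))\<^sup>2) = 0"
  proof (rule ccontr)
    assume "\<not> ?thesis"
    then have "(\<Sum>r<p. (cmod (y r))\<^sup>2) > 0" using nn by simp
    then have "real p \<le> real (card ?S)" using le by (simp add: mult_le_cancel_right_pos)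
    then show False using few by simp
  qed
  then show ?thesis using r by (simp add: sum_nonneg_eq_0_iff)
qed

text \<open>Lowers the level by one prime. Automorphisms fixing the coefficients and level N / p see
  the index j only through a residue \<open>r j\<close> modulo p; applying them to the relation and
  inverting the Fourier transform, the terms of each residue class sum to 0. By minimality all
  indices share the class of \<open>j0\<close>, and the normalisation \<xi> j0 = 1 puts them at
  level N / p.\<close>

lemma vanishing_sum_descent:
  assumes J: "finite J" "j0 \<in> J" and c: "set bs \<subseteq> qbar" "\<forall>j\<in>J. c j \<in> set bs"
    and D: "\<forall>N g. N > 0 \<longrightarrow> D dvd N \<longrightarrow> gal g \<longrightarrow> g (zeta D) = zeta D \<longrightarrow> (\<exists>h. gal h \<and> (\<forall>b\<in>set bs. h b = b) \<and> h (zeta N) = g (zeta N))"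
    and N: "N > 0" "D dvd N div p" and p: "prime p" "p dvd N" "p * p dvd N \<or> card J < p"
    and \<xi>': "\<forall>j\<in>J. \<xi> j ^ N = 1" "\<xi> j0 = 1"
    and z: "(\<Sum>j\<in>J. c j * \<xi> j) = 0" and min: "\<forall>S. S \<subseteq> J \<longrightarrow> S \<noteq> {} \<longrightarrow> (\<Sum>j\<in>S. c j * \<xi> j) = 0 \<longrightarrow> S = J"
    and j: "j \<in> J"
  shows "\<xi> j ^ (N div p) = 1"
proof -
  define m where "m = N div p"
  have \<xi>: "\<And>j. j \<in> J \<Longrightarrow> \<xi> j ^ N = 1" "\<xi> j0 = 1" using \<xi>' by auto
  have p0: "p > 0" using p prime_gt_0_nat by blast
  have m: "N = p * m" "m > 0" "m dvd N" "D dvd N" using p N p0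
    by (auto simp: m_def dvd_div_eq_0_iff)
  have cq: "c j \<in> qbar" if "j \<in> J" for j using c that by blast
  have \<xi>q: "\<xi> j \<in> qbar" if "j \<in> J" for j using root_unity_qbar[OF N(1) \<xi>(1)[OF that]] .
  have Dg: "g (zeta D) = zeta D" if "gal g" "g (zeta m) = zeta m" for g
    using zeta_stabilizer_dvd[OF that(1) m(2) _ that(2)] N(2) by (simp add: m_def)
  \<comment> \<open>The common outcome of both cases: \<xi> j is u^(r j) times a root of level m,
    and y holds the class sums up to nonzero factors. If p * p divides N, all Fourier coefficients
    vanish and y = 0; otherwise the coefficient at i = 0 is missing, and card J < p compensates for
    it.\<close>
  have "\<exists>r u. (\<forall>j\<in>J. r j < p \<and> \<xi> j = u ^ r j * (\<xi> j / u ^ r j) \<and> (\<xi> j / u ^ r j) ^ m = 1) \<and> u \<noteq> 0 \<and>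
     (\<exists>y. (\<forall>r'<p. y r' = 0 \<longleftrightarrow> (\<Sum>j\<in>{j\<in>J. r j = r'}. c j * \<xi> j) = 0) \<and> (\<forall>i\<in>{1..<p}. (\<Sum>r<p. (zeta p ^ i) ^ r * y r) = 0)
       \<and> card {r. r < p \<and> y r \<noteq> 0} < p)"
  proof (cases "p * p dvd N")
    case True
    obtain a where a: "\<And>j. j \<in> J \<Longrightarrow> \<xi> j = zeta N ^ a j" using root_unity_eq_zeta_power[OF N(1) \<xi>(1)] by metis
    define r where "r j = a j mod p" for j
    define y where "y r' = (\<Sum>j\<in>{j\<in>J. r j = r'}. c j * \<xi> j)" for r'
    have z0: "(\<Sum>r<p. (zeta p ^ i) ^ r * y r) = 0" for i
    proof -
      obtain g where g: "gal g" "g (zeta m) = zeta m" "g (zeta N) = zeta N * zeta p ^ i"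
        using gal_square_step[OF N(1) p(1) True] by (auto simp: m_def)
      obtain h where h: "gal h" "\<forall>b\<in>set bs. h b = b" "h (zeta N) = zeta N * zeta p ^ i"
        using D[rule_format, OF N(1) m(4) g(1) Dg[OF g(1,2)]] g(3) by auto
      have hx: "h (\<xi> j) = \<xi> j * (zeta p ^ i) ^ r j" if jj: "j \<in> J" for j
      proof -
        have "h (\<xi> j) = (zeta N * zeta p ^ i) ^ a j" using a[OF jj] h zeta_qbar[OF N(1)] by (simp add: gal_power)
        also have "\<dots> = \<xi> j * (zeta p ^ (i * a j))" using a[OF jj] by (simp add: power_mult_distrib power_mult)
        also have "zeta p ^ (i * a j) = zeta p ^ (i * r j)"
          unfolding zeta_power_eq_iff[OF p0] r_def by (simp add: cong_def mod_mult_right_eq)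
        finally show ?thesis by (simp add: power_mult)
      qed
      have "0 = h (\<Sum>j\<in>J. c j * \<xi> j)" using z gal_0[OF h(1)] by simp
      also have "\<dots> = (\<Sum>j\<in>J. h (c j * \<xi> j))" by (rule gal_sum[OF h(1)]) (intro qbar_mult cq \<xi>q)
      also have "\<dots> = (\<Sum>j\<in>J. (zeta p ^ i) ^ r j * (c j * \<xi> j))"
        using h(1,2) c(2) cq \<xi>q hx by (intro sum.cong refl) (simp add: gal_mult mult_ac)
      also have "\<dots> = (\<Sum>r'<p. \<Sum>j\<in>{j\<in>J. r j = r'}. (zeta p ^ i) ^ r j * (c j * \<xi> j))"
        by (rule sum.group[symmetric]) (use J p0 in \<open>auto simp: r_def\<close>)
      also have "\<dots> = (\<Sum>r<p. (zeta p ^ i) ^ r * y r)"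
        unfolding y_def sum_distrib_left by (intro sum.cong refl) auto
      finally show ?thesis by simp
    qed
    have y0: "y r = 0" if "r < p" for r
    proof -
      have z1: "zeta p ^ p = 1" "zeta p \<noteq> 1" using gal_zeta_prime[OF gal_id p(1)] by simp_all
      have "real p * (\<Sum>r<p. (cmod (y r))\<^sup>2) = 0" using parseval[OF p(1) z1, of y] z0 by simp
      then show ?thesis using that p0 by (simp add: sum_nonneg_eq_0_iff)
    qed
    have "(\<xi> j / zeta N ^ r j) ^ m = 1" if jj: "j \<in> J" for j
    proof -
      have "\<xi> j = zeta N ^ r j * zeta m ^ (a j div p)"
        using zeta_power_prime_quotient[OF p0 p(2)] unfolding a[OF jj] r_def m_def
        by (metis mod_mult_div_eq power_add power_mult)
      then show ?thesis by (simp add: power_mult[symmetric] mult.commute power_mult zeta_power_self[OF m(2)])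
    qed
    then have "\<forall>j\<in>J. r j < p \<and> \<xi> j = zeta N ^ r j * (\<xi> j / zeta N ^ r j) \<and> (\<xi> j / zeta N ^ r j) ^ m = 1"
      using p0 by (simp add: r_def)
    moreover have "\<forall>r'<p. y r' = 0 \<longleftrightarrow> (\<Sum>j\<in>{j\<in>J. r j = r'}. c j * \<xi> j) = 0" unfolding y_def by simp
    moreover have "card {r. r < p \<and> y r \<noteq> 0} < p"
    proof -
      have e: "{r. r < p \<and> y r \<noteq> 0} = {}" using y0 by auto
      show ?thesis unfolding e using p0 by simp
    qed
    ultimately show ?thesis using z0 zeta_nonzero[of N] by blast
  next
    case False
    then have few: "card J < p" using p(3) by blast
    have "\<not> p dvd m" using False p0 by (simp add: m(1))
    then have npm: "\<not> p dvd N div p" by (simp add: m_def)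
    have cop: "coprime m p" using prime_imp_coprime_nat[OF p(1) npm] by (simp add: m_def coprime_commute)
    obtain u where u: "[m * u = 1] (mod p)" using cong_solve_coprime_nat[OF cop] by auto
    obtain a where a: "\<And>j. j \<in> J \<Longrightarrow> \<xi> j = zeta N ^ a j" using root_unity_eq_zeta_power[OF N(1) \<xi>(1)] by metis
    define r where "r j = (u * a j) mod p" for j
    define w where "w j = \<xi> j / zeta p ^ r j" for j
    have wm: "w j ^ m = 1" if jj: "j \<in> J" for j
    proof -
      have "\<xi> j ^ m = zeta p ^ a j"
        using zeta_dvd_power[OF N(1) p(2)] unfolding a[OF jj] m_def by (metis mult.commute power_mult)
      moreover have "(zeta p ^ r j) ^ m = zeta p ^ a j"
      proof -
        have "[r j * m = u * a j * m] (mod p)" by (simp add: r_def cong_def mod_mult_left_eq)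
        also have "[u * a j * m = 1 * a j] (mod p)" using cong_scalar_right[OF u, of "a j"] by (simp add: mult_ac)
        finally show ?thesis using zeta_power_eq_iff[OF p0] by (simp add: power_mult[symmetric])
      qed
      ultimately show ?thesis by (simp add: w_def power_divide)
    qed
    have \<xi>w: "\<xi> j = zeta p ^ r j * w j" for j by (simp add: w_def)
    have wq: "w j \<in> qbar" if "j \<in> J" for j using root_unity_qbar[OF m(2) wm[OF that]] .
    define y where "y r' = (\<Sum>j\<in>{j\<in>J. r j = r'}. c j * w j)" for r'
    have yx: "(\<Sum>j\<in>{j\<in>J. r j = r'}. c j * \<xi> j) = zeta p ^ r' * y r'" for r'
      unfolding y_def sum_distrib_left by (intro sum.cong refl) (auto simp: \<xi>w)
    have z0: "(\<Sum>r<p. (zeta p ^ i) ^ r * y r) = 0" if i: "i \<in> {1..<p}" for i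
    proof -
      have "\<not> p dvd i" using i by (auto dest: dvd_imp_le)
      then obtain g where g: "gal g" "g (zeta m) = zeta m" "g (zeta p) = zeta p ^ i"
        using gal_simple_step[OF N(1) p(1,2) npm] by (auto simp: m_def)
      obtain h where h: "gal h" "\<forall>b\<in>set bs. h b = b" "h (zeta N) = g (zeta N)"
        using D[rule_format, OF N(1) m(4) g(1) Dg[OF g(1,2)]] by auto
      obtain k where k: "g (zeta N) = zeta N ^ k" using gal_zeta_power[OF g(1) N(1)] by blast
      have hm: "h (zeta m) = zeta m" "h (zeta p) = zeta p ^ i"
        using gal_zeta_dvd_power[OF h(1) N(1), of k m] gal_zeta_dvd_power[OF g(1) N(1) k, of m]
          gal_zeta_dvd_power[OF h(1) N(1), of k p] gal_zeta_dvd_power[OF g(1) N(1) k, of p] h(3) k g m p(2) by auto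
      have hw: "h (w j) = w j" if jj: "j \<in> J" for j
      proof -
        obtain b where "w j = zeta m ^ b" using root_unity_eq_zeta_power[OF m(2) wm[OF jj]] by blast
        then show ?thesis using hm(1) h(1) zeta_qbar[OF m(2)] by (simp add: gal_power)
      qed
      have hx: "h (\<xi> j) = (zeta p ^ i) ^ r j * w j" if jj: "j \<in> J" for j
        unfolding \<xi>w[of j] using hw[OF jj] hm(2) h(1) wq[OF jj] zeta_qbar[OF p0] by (simp add: gal_mult gal_power qbar_power)
      have "0 = h (\<Sum>j\<in>J. c j * \<xi> j)" using z gal_0[OF h(1)] by simp
      also have "\<dots> = (\<Sum>j\<in>J. h (c j * \<xi> j))" by (rule gal_sum[OF h(1)]) (intro qbar_mult cq \<xi>q)
      also have "\<dots> = (\<Sum>j\<in>J. (zeta p ^ i) ^ r j * (c j * w j))"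
        using h(1,2) c(2) cq \<xi>q hx by (intro sum.cong refl) (simp add: gal_mult mult_ac)
      also have "\<dots> = (\<Sum>r'<p. \<Sum>j\<in>{j\<in>J. r j = r'}. (zeta p ^ i) ^ r j * (c j * w j))"
        by (rule sum.group[symmetric]) (use J p0 in \<open>auto simp: r_def\<close>)
      also have "\<dots> = (\<Sum>r<p. (zeta p ^ i) ^ r * y r)"
        unfolding y_def sum_distrib_left by (intro sum.cong refl) auto
      finally show ?thesis by simp
    qed
    have "{r. r < p \<and> y r \<noteq> 0} \<subseteq> r ` J"
    proof
      fix r' assume "r' \<in> {r. r < p \<and> y r \<noteq> 0}"
      then have "{j\<in>J. r j = r'} \<noteq> {}" unfolding y_def by (metis (mono_tags, lifting) mem_Collect_eq sum.empty)
      then show "r' \<in> r ` J" by blast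
    qed
    then have "card {r. r < p \<and> y r \<noteq> 0} \<le> card J"
      using J(1) card_image_le[of J r] card_mono[of "r ` J"] by (meson finite_imageI order_trans)
    then have cl: "card {r. r < p \<and> y r \<noteq> 0} < p" using few by linarith
    have r1: "r j < p" for j using p0 by (simp add: r_def)
    have "\<forall>j\<in>J. r j < p \<and> \<xi> j = zeta p ^ r j * (\<xi> j / zeta p ^ r j) \<and> (\<xi> j / zeta p ^ r j) ^ m = 1"
      using r1 wm unfolding w_def by simp
    moreover have "\<forall>r'<p. y r' = 0 \<longleftrightarrow> (\<Sum>j\<in>{j\<in>J. r j = r'}. c j * \<xi> j) = 0" unfolding yx by simp
    ultimately show ?thesis using cl z0 zeta_nonzero[of p] by blast
  qed
  then obtain r u y where ru: "\<forall>j\<in>J. r j < p \<and> \<xi> j = u ^ r j * (\<xi> j / u ^ r j) \<and> (\<xi> j / u ^ r j) ^ m = 1" "u \<noteq> 0"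
    and y: "\<forall>r'<p. y r' = 0 \<longleftrightarrow> (\<Sum>j\<in>{j\<in>J. r j = r'}. c j * \<xi> j) = 0"
      "\<forall>i\<in>{1..<p}. (\<Sum>r<p. (zeta p ^ i) ^ r * y r) = (0 :: complex)" "card {r. r < p \<and> y r \<noteq> 0} < p" by blast
  have "y (r j0) = 0" by (rule classes_vanish[OF p(1) y(3)]) (use y(2) ru(1) J(2) in auto)
  then have "(\<Sum>j\<in>{j\<in>J. r j = r j0}. c j * \<xi> j) = 0" using y(1) ru(1) J(2) by blast
  then have all: "{j\<in>J. r j = r j0} = J" using min[rule_format, of "{j\<in>J. r j = r j0}"] J(2) by blast
  have "(1 / u ^ r j0) ^ m = 1" using ru(1) J(2) \<xi>(2) by force
  then have um: "(u ^ r j0) ^ m = 1" by (simp add: power_divide)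
  have "r j = r j0" using all j by blast
  then have "(\<xi> j / u ^ r j0) ^ m = 1" using ru(1) j by force
  then show ?thesis using um by (simp add: power_divide m_def)
qed

text \<open>A minimal vanishing subsum, divided by one of its terms, has as least level D times a
  squarefree number whose primes are at most card J, for otherwise the descent applies. So the
  ratios in it lie in a fixed finite group; nonzero coefficients guarantee at least two
  terms.\<close>

theorem vanishing_sum_of_roots_of_unity:
  assumes J: "finite J" "J \<noteq> {}" and c: "\<And>j. j \<in> J \<Longrightarrow> c j \<in> qbar" "\<And>j. j \<in> J \<Longrightarrow> c j \<noteq> 0"
  shows "\<exists>F. finite F \<and> F \<subseteq> roots_of_unity \<and>
    (\<forall>\<zeta>. (\<forall>j\<in>J. \<zeta> j \<in> roots_of_unity) \<longrightarrow> (\<Sum>j\<in>J. c j * \<zeta> j) = 0 \<longrightarrow>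
      (\<exists>i\<in>J. \<exists>j\<in>J. i \<noteq> j \<and> \<zeta> i / \<zeta> j \<in> F))"
proof -
  obtain bs where bs: "set bs = c ` J" using finite_list[of "c ` J"] J(1) by blast
  have bq: "set bs \<subseteq> qbar" using bs c(1) by auto
  obtain D where D: "D > 0" "\<forall>N g. N > 0 \<longrightarrow> D dvd N \<longrightarrow> gal g \<longrightarrow> g (zeta D) = zeta D \<longrightarrow>
      (\<exists>h. gal h \<and> (\<forall>b\<in>set bs. h b = b) \<and> h (zeta N) = g (zeta N))"
    using conductor_exists[OF bq] by blast
  \<comment> \<open>Every squarefree number with primes at most card J divides the factorial, so M
    is a multiple of all levels that occur.\<close>
  define M where "M = D * fact (card J)"
  have M0: "M > 0" using D(1) by (simp add: M_def)
  define F where "F = {w :: complex. w ^ M = 1}"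
  have "finite F" unfolding F_def using finite_roots_unity[of M, where ?'a = complex] M0 by simp
  moreover have "F \<subseteq> roots_of_unity" unfolding F_def using M0 roots_of_unityI by blast
  moreover have "\<exists>i\<in>J. \<exists>j\<in>J. i \<noteq> j \<and> \<zeta> i / \<zeta> j \<in> F"
    if \<zeta>: "\<forall>j\<in>J. \<zeta> j \<in> roots_of_unity" "(\<Sum>j\<in>J. c j * \<zeta> j) = 0" for \<zeta>
  proof -
    define Q where "Q S \<longleftrightarrow> S \<subseteq> J \<and> S \<noteq> {} \<and> (\<Sum>j\<in>S. c j * \<zeta> j) = 0" for S
    have "Q J" using \<zeta>(2) J by (simp add: Q_def)
    then obtain S where S: "Q S" and Smin: "\<And>T. Q T \<Longrightarrow> card S \<le> card T"
      using ex_has_least_nat[of Q J card] by blast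
    have SJ: "S \<subseteq> J" "S \<noteq> {}" "(\<Sum>j\<in>S. c j * \<zeta> j) = 0" using S by (auto simp: Q_def)
    have fS: "finite S" using SJ(1) J(1) finite_subset by blast
    obtain j0 where j0: "j0 \<in> S" using SJ(2) by blast
    have nz: "\<zeta> j \<noteq> 0" if "j \<in> S" for j using \<zeta>(1) SJ(1) that roots_of_unity_nonzero by blast
    define \<xi> where "\<xi> j = \<zeta> j / \<zeta> j0" for j
    have sc: "(\<Sum>j\<in>T. c j * \<xi> j) = (\<Sum>j\<in>T. c j * \<zeta> j) / \<zeta> j0" for T
      by (simp add: \<xi>_def sum_divide_distrib)
    have zS: "(\<Sum>j\<in>S. c j * \<xi> j) = 0" using SJ(3) sc by simp
    have minS: "T = S" if T: "T \<subseteq> S" "T \<noteq> {}" "(\<Sum>j\<in>T. c j * \<xi> j) = 0" for T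
    proof -
      have "Q T" using T SJ(1) sc nz[OF j0] by (auto simp: Q_def)
      then have "card S \<le> card T" by (rule Smin)
      then show ?thesis using card_seteq[OF fS T(1)] by simp
    qed
    have "\<xi> j \<in> roots_of_unity" if "j \<in> S" for j
      using roots_of_unity_mult roots_of_unity_inverse \<zeta>(1) SJ(1) j0 that unfolding \<xi>_def divide_inverse by blast
    then have "\<forall>j\<in>S. \<exists>n>0. \<xi> j ^ n = 1" by (auto simp: roots_of_unity_def)
    then obtain o' where o': "\<And>j. j \<in> S \<Longrightarrow> o' j > (0::nat) \<and> \<xi> j ^ o' j = 1" by metis
    define G where "G N \<longleftrightarrow> N > 0 \<and> D dvd N \<and> (\<forall>j\<in>S. \<xi> j ^ N = 1)" for N
    have "G (D * (\<Prod>j\<in>S. o' j))"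
    proof -
      have "\<xi> j ^ (D * (\<Prod>j\<in>S. o' j)) = 1" if "j \<in> S" for j
      proof -
        have e: "D * (\<Prod>j\<in>S. o' j) = o' j * (D * (\<Prod>j\<in>S - {j}. o' j))" using prod.remove[OF fS that, of o'] by simp
        show ?thesis unfolding e power_mult using o'[OF that] by simp
      qed
      then show ?thesis using D(1) o' fS by (auto simp: G_def)
    qed
    then obtain N where N: "G N" and Nmin: "\<And>N'. G N' \<Longrightarrow> N \<le> N'" using exists_least_iff[of G] by (metis not_le)
    have N0: "N > 0" "D dvd N" "\<And>j. j \<in> S \<Longrightarrow> \<xi> j ^ N = 1" using N by (auto simp: G_def)
    obtain n where n: "N = D * n" using N0(2) by blast
    have n0: "n > 0" using N0(1) n by (intro Nat.gr0I) auto
    have "n dvd fact (card J)"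
    proof (rule squarefree_dvd_fact[OF n0], rule ccontr)
      fix p assume p: "prime p" "p dvd n" "\<not> (\<not> p * p dvd n \<and> p \<le> card J)"
      have p1: "p > 1" using p(1) prime_gt_1_nat by blast
      have dn: "N div p = D * (n div p)" using n p(2) by (simp add: div_mult_swap)
      have alt: "p * p dvd N \<or> card S < p" using p(3) n card_mono[OF J(1) SJ(1)] by auto
      have pN: "p dvd N" using n p(2) by simp
      have cS: "\<forall>j\<in>S. c j \<in> set bs" using bs SJ(1) by auto
      have DN: "D dvd N div p" using dn by simp
      have \<xi>N: "\<forall>j\<in>S. \<xi> j ^ N = 1" using N0(3) by blast
      have \<xi>0: "\<xi> j0 = 1" using nz[OF j0] by (simp add: \<xi>_def)
      have "\<xi> j ^ (N div p) = 1" if "j \<in> S" for j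
        by (rule vanishing_sum_descent[OF fS j0 bq cS D(2) N0(1) DN p(1) pN alt \<xi>N \<xi>0 zS _ that]) (use minS in blast)
      moreover have "N div p > 0" using p1 pN N0(1) by (auto simp: div_greater_zero_iff dest: dvd_imp_le)
      ultimately have "G (N div p)" using dn by (simp add: G_def)
      then have "N \<le> N div p" by (rule Nmin)
      then show False using N0(1) p1 by (metis div_less_dividend not_le)
    qed
    then have "N dvd M" using n by (simp add: M_def)
    then have FM: "\<xi> j \<in> F" if "j \<in> S" for j
      unfolding F_def using N0(3)[OF that] by (auto elim!: dvdE simp: power_mult)
    have "S \<noteq> {j0}"
    proof
      assume "S = {j0}"
      then have "c j0 * \<zeta> j0 = 0" using SJ(3) by simp
      then show False using nz[OF j0] c(2) SJ(1) j0 by auto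
    qed
    then obtain j where j: "j \<in> S" "j \<noteq> j0" using j0 by blast
    then show ?thesis using FM[OF j(1)] SJ(1) j0 unfolding \<xi>_def by blast
  qed
  ultimately show ?thesis by blast
qed

section \<open>Torsion points of tori\<close>

definition lmon :: "nat \<Rightarrow> (nat \<Rightarrow> int) \<Rightarrow> (nat \<Rightarrow> complex) \<Rightarrow> complex" where
  "lmon q a x = (\<Prod>i<q. x i powi a i)"

definition torus :: "nat \<Rightarrow> (nat \<Rightarrow> complex) set" where
  "torus q = {x. \<forall>i<q. x i \<noteq> 0}"

text \<open>Entries from q on are 0, so torsion points can be compared as functions;
  \<open>torus\<close> leaves these entries free, since monomials do not read them.\<close>

definition tors :: "nat \<Rightarrow> (nat \<Rightarrow> complex) set" where
  "tors q = {x. (\<forall>i<q. x i \<in> roots_of_unity) \<and> (\<forall>i\<ge>q. x i = 0)}"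

definition mono_map :: "nat \<Rightarrow> nat \<Rightarrow> (nat \<Rightarrow> complex) \<Rightarrow> (nat \<Rightarrow> nat \<Rightarrow> int) \<Rightarrow> (nat \<Rightarrow> complex) \<Rightarrow> nat \<Rightarrow> complex" where
  "mono_map m q w A x = (\<lambda>j. if j < m then w j * lmon q (A j) x else 0)"

lemma lmon_nonzero: "x \<in> torus q \<Longrightarrow> lmon q a x \<noteq> 0"
  by (auto simp: lmon_def torus_def)

lemma lmon_add: "x \<in> torus q \<Longrightarrow> lmon q (\<lambda>i. a i + b i) x = lmon q a x * lmon q b x"
  by (simp add: lmon_def torus_def power_int_add prod.distrib)

lemma lmon_diff: "x \<in> torus q \<Longrightarrow> lmon q (\<lambda>i. a i - b i) x = lmon q a x / lmon q b x"
  by (simp add: lmon_def torus_def power_int_diff prod_dividef)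

lemma lmon_0 [simp]: "lmon q (\<lambda>i. 0) x = 1"
  by (simp add: lmon_def)

lemma lmon_cong: "(\<And>i. i < q \<Longrightarrow> a i = b i) \<Longrightarrow> (\<And>i. i < q \<Longrightarrow> x i = y i) \<Longrightarrow> lmon q a x = lmon q b y"
  by (simp add: lmon_def)

lemma lmon_mult: "lmon q a (\<lambda>i. x i * y i) = lmon q a x * lmon q a y"
  by (simp add: lmon_def power_int_mult_distrib prod.distrib)

lemma power_int_prod: "finite I \<Longrightarrow> (\<Prod>i\<in>I. f i) powi n = (\<Prod>i\<in>I. f i powi n)" for f :: "'a \<Rightarrow> complex"
  by (induction I rule: finite_induct) (auto simp: power_int_mult_distrib)

lemma power_int_sum: "finite I \<Longrightarrow> x \<noteq> 0 \<Longrightarrow> x powi (\<Sum>i\<in>I. f i) = (\<Prod>i\<in>I. x powi f i)" for x :: complex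
  by (induction I rule: finite_induct) (auto simp: power_int_add)

lemma lmon_mono_map:
  assumes "y \<in> torus r" "q \<le> m"
  shows "lmon q a (mono_map m r w A y) = lmon q a w * lmon r (\<lambda>k. \<Sum>i<q. a i * A i k) y"
proof -
  have "lmon q a (mono_map m r w A y) = (\<Prod>i<q. w i powi a i * (\<Prod>k<r. y k powi (a i * A i k)))"
    unfolding lmon_def mono_map_def using assms(2)
    by (intro prod.cong refl) (simp add: power_int_mult_distrib power_int_prod power_int_mult[symmetric] mult.commute)
  also have "\<dots> = lmon q a w * (\<Prod>k<r. \<Prod>i<q. y k powi (a i * A i k))"
    unfolding prod.distrib lmon_def by (subst (2) prod.swap) simp
  also have "(\<Prod>k<r. \<Prod>i<q. y k powi (a i * A i k)) = lmon r (\<lambda>k. \<Sum>i<q. a i * A i k) y"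
    unfolding lmon_def using assms(1) by (intro prod.cong refl) (simp add: power_int_sum torus_def)
  finally show ?thesis .
qed

lemma roots_of_unity_powi: "x \<in> roots_of_unity \<Longrightarrow> x powi n \<in> roots_of_unity"
  by (auto simp: power_int_def intro: roots_of_unity_power roots_of_unity_inverse)

lemma roots_of_unity_prod: "(\<And>i. i \<in> I \<Longrightarrow> f i \<in> roots_of_unity) \<Longrightarrow> prod f I \<in> roots_of_unity"
  by (induction I rule: infinite_finite_induct) (auto intro: roots_of_unity_mult)

lemma lmon_roots_of_unity: "(\<And>i. i < q \<Longrightarrow> x i \<in> roots_of_unity) \<Longrightarrow> lmon q a x \<in> roots_of_unity"
  unfolding lmon_def by (intro roots_of_unity_prod roots_of_unity_powi) auto

lemma tors_torus: "tors q \<subseteq> torus q"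
  using roots_of_unity_nonzero by (auto simp: tors_def torus_def)

lemma mono_map_tors: "(\<And>j. j < m \<Longrightarrow> w j \<in> roots_of_unity) \<Longrightarrow> y \<in> tors q \<Longrightarrow> mono_map m q w A y \<in> tors m"
  by (auto simp: tors_def mono_map_def intro!: roots_of_unity_mult lmon_roots_of_unity)

text \<open>Containment in a finite union of proper torsion cosets: a pair in C is a nontrivial
  character of the torus with the value it takes on the coset.\<close>

definition thin :: "nat \<Rightarrow> (nat \<Rightarrow> complex) set \<Rightarrow> bool" where
  "thin q Z \<longleftrightarrow> (\<exists>C. finite C \<and> (\<forall>p\<in>C. (\<exists>i<q. fst p i \<noteq> 0) \<and> snd p \<in> roots_of_unity) \<and>
     (\<forall>x\<in>Z. \<exists>p\<in>C. lmon q (fst p) x = snd p))"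

lemma thin_empty: "thin q {}"
  unfolding thin_def by (intro exI[of _ "{}"]) auto

lemma thin_subset: assumes "thin q Z" "Z' \<subseteq> Z" shows "thin q Z'"
proof -
  obtain C where "finite C" "\<forall>p\<in>C. (\<exists>i<q. fst p i \<noteq> 0) \<and> snd p \<in> roots_of_unity" "\<forall>x\<in>Z. \<exists>p\<in>C. lmon q (fst p) x = snd p"
    using assms(1) unfolding thin_def by blast
  then show ?thesis using assms(2) unfolding thin_def by (intro exI[of _ C]) auto
qed

lemma thin_Un:
  assumes "thin q Y" "thin q Z" shows "thin q (Y \<union> Z)"
proof -
  obtain C where C: "finite C" "\<forall>p\<in>C. (\<exists>i<q. fst p i \<noteq> 0) \<and> snd p \<in> roots_of_unity" "\<forall>x\<in>Y. \<exists>p\<in>C. lmon q (fst p) x = snd p"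
    using assms(1) unfolding thin_def by blast
  obtain D where D: "finite D" "\<forall>p\<in>D. (\<exists>i<q. fst p i \<noteq> 0) \<and> snd p \<in> roots_of_unity" "\<forall>x\<in>Z. \<exists>p\<in>D. lmon q (fst p) x = snd p"
    using assms(2) unfolding thin_def by blast
  show ?thesis unfolding thin_def
  proof (intro exI[of _ "C \<union> D"] conjI)
    show "\<forall>x\<in>Y \<union> Z. \<exists>p\<in>C \<union> D. lmon q (fst p) x = snd p" using C(3) D(3) by fast
  qed (use C D in auto)
qed

lemma thin_Union: "finite \<Z> \<Longrightarrow> (\<And>Z. Z \<in> \<Z> \<Longrightarrow> thin q Z) \<Longrightarrow> thin q (\<Union>\<Z>)"
  by (induction \<Z> rule: finite_induct) (auto intro: thin_empty thin_Un)

lemma thin_single: "i < q \<Longrightarrow> c i \<noteq> 0 \<Longrightarrow> w \<in> roots_of_unity \<Longrightarrow> (\<And>x. x \<in> Z \<Longrightarrow> lmon q c x = w) \<Longrightarrow> thin q Z"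
  unfolding thin_def by (intro exI[of _ "{(c, w)}"]) auto

text \<open>The left inverse C of the exponent matrix makes the map a closed embedding of tori.\<close>
definition torus_emb :: "nat \<Rightarrow> nat \<Rightarrow> (nat \<Rightarrow> complex) \<Rightarrow> (nat \<Rightarrow> nat \<Rightarrow> int) \<Rightarrow> bool" where
  "torus_emb m q w A \<longleftrightarrow> (\<forall>j<m. w j \<in> roots_of_unity) \<and>
     (\<exists>C. \<forall>k<q. \<forall>l<q. (\<Sum>j<m. C k j * A j l) = (if k = l then 1 else 0))"

lemma torus_emb_comp:
  assumes "torus_emb m q w A" "torus_emb q r v B"
  shows "\<exists>u D. torus_emb m r u D \<and> (\<forall>y\<in>torus r. mono_map m q w A (mono_map q r v B y) = mono_map m r u D y)"
proof -
  obtain C where C: "\<forall>k<q. \<forall>l<q. (\<Sum>j<m. C k j * A j l) = (if k = l then 1 else 0)" using assms(1) by (auto simp: torus_emb_def)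
  obtain C' where C': "\<forall>k<r. \<forall>l<r. (\<Sum>j<q. C' k j * B j l) = (if k = l then 1 else 0)" using assms(2) by (auto simp: torus_emb_def)
  define u where "u j = w j * lmon q (A j) v" for j
  define D where "D = (\<lambda>j k. \<Sum>i<q. A j i * B i k)"
  have "\<forall>j<m. u j \<in> roots_of_unity"
    using assms by (auto simp: u_def torus_emb_def intro!: roots_of_unity_mult lmon_roots_of_unity)
  moreover have inv: "(\<Sum>j<m. (\<Sum>i<q. C' k i * C i j) * D j l) = (if k = l then 1 else 0)" if kl: "k < r" "l < r" for k l
  proof -
    have "(\<Sum>j<m. (\<Sum>i<q. C' k i * C i j) * D j l) = (\<Sum>j<m. \<Sum>i<q. \<Sum>s<q. C' k i * (C i j * A j s) * B s l)"
      unfolding D_def sum_product by (intro sum.cong refl) (simp add: mult_ac)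
    also have "\<dots> = (\<Sum>i<q. \<Sum>s<q. \<Sum>j<m. C' k i * (C i j * A j s) * B s l)"
      by (subst sum.swap, subst (2) sum.swap) simp
    also have "\<dots> = (\<Sum>i<q. \<Sum>s<q. C' k i * (\<Sum>j<m. C i j * A j s) * B s l)"
      by (simp add: sum_distrib_left sum_distrib_right)
    also have "\<dots> = (\<Sum>i<q. \<Sum>s<q. C' k i * (if i = s then 1 else 0) * B s l)" using C by simp
    also have "\<dots> = (\<Sum>i<q. C' k i * B i l)"
    proof (intro sum.cong refl)
      fix i assume i: "i \<in> {..<q}"
      have "(\<Sum>s<q. C' k i * (if i = s then 1 else 0) * B s l) = (\<Sum>s<q. if s = i then C' k i * B s l else 0)"
        by (intro sum.cong) auto
      then show "(\<Sum>s<q. C' k i * (if i = s then 1 else 0) * B s l) = C' k i * B i l" using i by simp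
    qed
    finally show ?thesis using C' kl by simp
  qed
  moreover have "\<forall>y\<in>torus r. mono_map m q w A (mono_map q r v B y) = mono_map m r u D y"
  proof
    fix y assume y: "y \<in> torus r"
    show "mono_map m q w A (mono_map q r v B y) = mono_map m r u D y"
      by (rule ext) (simp add: mono_map_def[of m] lmon_mono_map[OF y order_refl] u_def D_def)
  qed
  moreover have "torus_emb m r u D" unfolding torus_emb_def
  proof (intro conjI exI[of _ "\<lambda>k j. \<Sum>i<q. C' k i * C i j"])
    show "\<forall>j<m. u j \<in> roots_of_unity" by fact
  qed (use inv in blast)
  ultimately show ?thesis by blast
qed

section \<open>Lowering the dimension along a monomial relation\<close>

definition slices :: "nat \<Rightarrow> (nat \<Rightarrow> complex) set \<Rightarrow> bool" where
  "slices q Z \<longleftrightarrow> (\<exists>\<D>. finite \<D> \<and> Z = \<Union>\<D> \<and>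
     (\<forall>D\<in>\<D>. \<exists>w A Z'. torus_emb q (q - 1) w A \<and> Z' \<subseteq> tors (q - 1) \<and> D = mono_map q (q - 1) w A ` Z'))"

lemma slices_coordinate:
  assumes a: "a < q" and Z: "Z \<subseteq> tors q" and z: "\<And>x. x \<in> Z \<Longrightarrow> x a = \<rho>" and \<rho>: "\<rho> \<in> roots_of_unity"
  shows "\<exists>w A Z'. torus_emb q (q - 1) w A \<and> Z' \<subseteq> tors (q - 1) \<and> Z = mono_map q (q - 1) w A ` Z'"
proof -
  \<comment> \<open>The increasing enumeration of the indices other than a.\<close>
  define s where "s k = (if k < a then k else Suc k)" for k
  define w where "w j = (if j = a then \<rho> else 1)" for j
  define A where "A j k = (if j = s k then 1 else 0 :: int)" for j k
  define drp where "drp x = (\<lambda>k. if k < q - 1 then x (s k) else 0)" for x :: "nat \<Rightarrow> complex"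
  have sq: "s k < q" if "k < q - 1" for k using that a by (auto simp: s_def)
  have sinj: "s k = s l \<longleftrightarrow> k = l" for k l by (auto simp: s_def)
  have "torus_emb q (q - 1) w A"
    unfolding torus_emb_def
  proof (intro conjI exI[of _ "\<lambda>k j. A j k"] allI impI)
    fix k l assume kl: "k < q - 1" "l < q - 1"
    have "(\<Sum>j<q. A j k * A j l) = (\<Sum>j<q. if j = s k then A j l else 0)"
      by (intro sum.cong) (auto simp: A_def)
    then show "(\<Sum>j<q. A j k * A j l) = (if k = l then 1 else 0)" using sq[OF kl(1)] by (simp add: A_def sinj)
  qed (use \<rho> in \<open>auto simp: w_def\<close>)
  moreover have dZ: "drp ` Z \<subseteq> tors (q - 1)" using Z sq by (auto simp: drp_def tors_def subset_iff)
  have drp_inv: "mono_map q (q - 1) w A (drp x) = x" if x: "x \<in> Z" for x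
  proof
    fix j
    have xt: "x \<in> tors q" using x Z by blast
    show "mono_map q (q - 1) w A (drp x) j = x j"
    proof (cases "j < q")
      case False
      then show ?thesis using xt by (simp add: mono_map_def tors_def)
    next
      case j: True
      show ?thesis
      proof (cases "j = a")
        case True
        have "A a k = 0" for k by (simp add: A_def s_def)
        then have "lmon (q - 1) (A a) (drp x) = 1" by (simp add: lmon_def)
        then show ?thesis using True j z[OF x] by (simp add: mono_map_def w_def)
      next
        case False
        obtain k where k: "j = s k" "k < q - 1"
        proof
          show "j = s (if j < a then j else j - 1)" "(if j < a then j else j - 1) < q - 1"
            using False a j by (auto simp: s_def)
        qed
        have "lmon (q - 1) (A j) (drp x) = (\<Prod>i<q - 1. if i = k then x j else 1)"
          unfolding lmon_def by (intro prod.cong refl) (auto simp: A_def k sinj drp_def)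
        then show ?thesis using False j k(2) by (simp add: mono_map_def w_def)
      qed
    qed
  qed
  moreover have "(\<lambda>x. mono_map q (q - 1) w A (drp x)) ` Z = (\<lambda>x. x) ` Z" by (rule image_cong) (use drp_inv in auto)
  then have "Z = mono_map q (q - 1) w A ` (drp ` Z)" by (simp add: image_image)
  ultimately show ?thesis using dZ by (intro exI[of _ w] exI[of _ A] exI[of _ "drp ` Z"] conjI) simp_all
qed

lemma finite_powi_roots:
  assumes "k \<noteq> 0" shows "finite {x :: complex. x powi k = w}"
proof -
  have "{x :: complex. x powi k = w} = (if k \<ge> 0 then {x. x ^ nat \<bar>k\<bar> = w} else {x. x ^ nat \<bar>k\<bar> = inverse w})"
    by (auto simp: power_int_def power_inverse)
  moreover have "finite {x :: complex. x ^ nat \<bar>k\<bar> = v}" for v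
  proof -
    have "nat \<bar>k\<bar> > 0" using assms by simp
    then have "coeff (monom 1 (nat \<bar>k\<bar>) - [:v:]) (nat \<bar>k\<bar>) = 1" by (simp add: coeff_pCons split: nat.split)
    then have "monom 1 (nat \<bar>k\<bar>) - [:v:] \<noteq> 0" by (metis coeff_0 zero_neq_one)
    from poly_roots_finite[OF this] show ?thesis by (simp add: poly_monom)
  qed
  ultimately show ?thesis by (simp only: split: if_split) blast
qed

lemma slices_image:
  assumes Z: "slices q Z'" and U: "torus_emb q q w B" and ZU: "Z = mono_map q q w B ` Z'"
  shows "slices q Z"
proof -
  obtain \<D> where D: "finite \<D>" "Z' = \<Union>\<D>"
    "\<And>D. D \<in> \<D> \<Longrightarrow> \<exists>w A Y. torus_emb q (q - 1) w A \<and> Y \<subseteq> tors (q - 1) \<and> D = mono_map q (q - 1) w A ` Y"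
    using Z unfolding slices_def by metis
  have "\<exists>w' A Y. torus_emb q (q - 1) w' A \<and> Y \<subseteq> tors (q - 1) \<and> mono_map q q w B ` D = mono_map q (q - 1) w' A ` Y" if DD: "D \<in> \<D>" for D
  proof -
    obtain v A Y where A: "torus_emb q (q - 1) v A" "Y \<subseteq> tors (q - 1)" "D = mono_map q (q - 1) v A ` Y" using D(3)[OF DD] by blast
    obtain u E where E: "torus_emb q (q - 1) u E" "\<forall>y\<in>torus (q - 1). mono_map q q w B (mono_map q (q - 1) v A y) = mono_map q (q - 1) u E y"
      using torus_emb_comp[OF U A(1)] by blast
    have "mono_map q q w B ` D = mono_map q (q - 1) u E ` Y"
      unfolding A(3) image_image by (rule image_cong) (use E(2) A(2) tors_torus in auto)
    then show ?thesis using E(1) A(2) by blast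
  qed
  note piece = this
  show ?thesis unfolding slices_def
  proof (intro exI[of _ "(`) (mono_map q q w B) ` \<D>"] conjI ballI)
    show "finite ((`) (mono_map q q w B) ` \<D>)" using D(1) by simp
    show "Z = \<Union>((`) (mono_map q q w B) ` \<D>)" unfolding ZU D(2) by (simp add: image_Union)
    fix E assume "E \<in> (`) (mono_map q q w B) ` \<D>"
    then obtain D where Dm: "D \<in> \<D>" and e: "E = mono_map q q w B ` D" by blast
    show "\<exists>w A Z'. torus_emb q (q - 1) w A \<and> Z' \<subseteq> tors (q - 1) \<and> E = mono_map q (q - 1) w A ` Z'"
      unfolding e by (rule piece[OF Dm])
  qed
qed

lemma slices_if_finite_coordinate:
  assumes a: "a < q" and Z: "Z \<subseteq> tors q" and fin: "finite ((\<lambda>x. x a) ` Z)"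
  shows "slices q Z"
proof -
  define \<D> where "\<D> = (\<lambda>\<rho>. {x \<in> Z. x a = \<rho>}) ` ((\<lambda>x. x a) ` Z)"
  have "finite \<D>" "Z = \<Union>\<D>" using fin by (auto simp: \<D>_def)
  moreover have "\<exists>w A Z'. torus_emb q (q - 1) w A \<and> Z' \<subseteq> tors (q - 1) \<and> D = mono_map q (q - 1) w A ` Z'" if "D \<in> \<D>" for D
  proof -
    obtain x where x: "x \<in> Z" "D = {y \<in> Z. y a = x a}" using \<open>D \<in> \<D>\<close> by (auto simp: \<D>_def)
    have "x a \<in> roots_of_unity" using x(1) Z a by (auto simp: tors_def)
    then show ?thesis by (intro slices_coordinate[OF a, of D "x a"]) (use x(2) Z in auto)
  qed
  ultimately show ?thesis unfolding slices_def by (intro exI[of _ \<D>] conjI ballI)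
qed

lemma lmon_split2:
  assumes "a < q" "b < q" "a \<noteq> b"
  shows "lmon q c x = x a powi c a * x b powi c b * (\<Prod>i\<in>{..<q} - {a, b}. x i powi c i)"
proof -
  have "{..<q} = insert a (insert b ({..<q} - {a, b}))" using assms by auto
  then show ?thesis unfolding lmon_def using assms by (metis (no_types, lifting) finite_Diff finite_insert finite_lessThan insert_iff Diff_iff mult.assoc prod.insert)
qed

text \<open>The Euclidean algorithm on the exponent vector, by unimodular changes of coordinates,
  reduces a monomial relation to one in a single coordinate.\<close>
lemma slices_relation:
  assumes "\<exists>i<q. c i \<noteq> 0" "Z \<subseteq> tors q" "\<And>x. x \<in> Z \<Longrightarrow> lmon q c x = w"
  shows "slices q Z"
  using assms
proof (induction "nat (\<Sum>i<q. \<bar>c i\<bar>)" arbitrary: c Z rule: less_induct)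
  case less
  obtain a' where a': "a' < q" "c a' \<noteq> 0" using less.prems(1) by blast
  show ?case
  proof (cases "\<exists>b<q. b \<noteq> a' \<and> c b \<noteq> 0")
    case False
    have "x a' powi c a' = w" if "x \<in> Z" for x
    proof -
      have "lmon q c x = (\<Prod>i<q. if i = a' then x a' powi c a' else 1)"
        unfolding lmon_def using False by (intro prod.cong refl) auto
      then show ?thesis using less.prems(3)[OF that] a' by simp
    qed
    then have "(\<lambda>x. x a') ` Z \<subseteq> {z. z powi c a' = w}" by auto
    then show ?thesis
      using slices_if_finite_coordinate[OF a'(1) less.prems(2)] finite_powi_roots[OF a'(2)] finite_subset by blast
  next
    case True
    then obtain a b where ab: "a < q" "b < q" "a \<noteq> b" "c a \<noteq> 0" "c b \<noteq> 0" "\<bar>c b\<bar> \<le> \<bar>c a\<bar>"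
      using a' by (metis linear)
    \<comment> \<open>The sign for which subtracting e * c b brings c a closer to 0; here \<bar>c
      b\<bar> \<le> \<bar>c a\<bar> is used.\<close>
    define e where "e = sgn (c a) * sgn (c b)"
    define c' where "c' = c(a := c a - e * c b)"
    \<comment> \<open>New coordinates in which the relation has exponents \<open>c'\<close>;
      \<open>B\<close> is the exponent matrix of the inverse substitution.\<close>
    define T where "T y = (\<lambda>j. if j = b then y b * y a powi e else y j)" for y :: "nat \<Rightarrow> complex"
    define B where "B j k = (if j = k then 1 else 0) - (if j = b \<and> k = a then e else 0)" for j k :: nat
    have less_abs: "\<bar>c' a\<bar> < \<bar>c a\<bar>"
      using ab unfolding c'_def e_def by (auto simp: sgn_if abs_if split: if_splits)
    have "nat (\<Sum>i<q. \<bar>c' i\<bar>) < nat (\<Sum>i<q. \<bar>c i\<bar>)"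
    proof -
      have "(\<Sum>i<q. \<bar>c' i\<bar>) < (\<Sum>i<q. \<bar>c i\<bar>)"
        by (rule sum_strict_mono_ex1) (use ab(1) less_abs in \<open>auto simp: c'_def\<close>)
      moreover have "(\<Sum>i<q. \<bar>c i\<bar>) \<ge> 0" by (intro sum_nonneg) simp
      moreover have "(\<Sum>i<q. \<bar>c' i\<bar>) \<ge> 0" by (intro sum_nonneg) simp
      ultimately show ?thesis by linarith
    qed
    moreover have "\<exists>i<q. c' i \<noteq> 0" using ab by (intro exI[of _ b]) (auto simp: c'_def)
    moreover have "T ` Z \<subseteq> tors q"
      using less.prems(2) ab roots_of_unity_mult roots_of_unity_powi by (auto simp: T_def tors_def subset_iff)
    moreover have "lmon q c' y = w" if y: "y \<in> T ` Z" for y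
    proof -
      obtain x where x: "x \<in> Z" "y = T x" using y by blast
      have nz: "x a \<noteq> 0" using x(1) less.prems(2) ab(1) tors_torus by (auto simp: torus_def)
      have "lmon q c' y = x a powi (c a - e * c b) * (x b * x a powi e) powi c b * (\<Prod>i\<in>{..<q} - {a, b}. x i powi c i)"
        unfolding lmon_split2[OF ab(1-3)] using ab(3) by (simp add: x(2) T_def c'_def)
      also have "x a powi (c a - e * c b) * (x b * x a powi e) powi c b = x a powi c a * x b powi c b"
        using nz by (simp add: power_int_diff power_int_mult_distrib power_int_mult[symmetric])
      finally show ?thesis using less.prems(3)[OF x(1)] unfolding lmon_split2[OF ab(1-3)] by simp
    qed
    ultimately have "slices q (T ` Z)" by (rule less.hyps)
    moreover have "torus_emb q q (\<lambda>_. 1) B"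
      unfolding torus_emb_def
    proof (intro conjI exI[of _ "\<lambda>k j. (if j = k then 1 else 0) + (if k = b \<and> j = a then e else 0)"] allI impI)
      fix k l assume kl: "k < q" "l < q"
      have "(\<Sum>j<q. ((if j = k then 1 else 0) + (if k = b \<and> j = a then e else 0)) * B j l) =
          (\<Sum>j<q. (if j = k then B j l else 0)) + (\<Sum>j<q. if j = a then (if k = b then e * B a l else 0) else 0)"
        unfolding sum.distrib[symmetric] by (intro sum.cong refl) (auto simp: distrib_right)
      also have "\<dots> = B k l + (if k = b then e * B a l else 0)" using kl ab(1) by simp
      also have "\<dots> = (if k = l then 1 else 0)" using ab(3) by (auto simp: B_def)
      finally show "(\<Sum>j<q. ((if j = k then 1 else 0) + (if k = b \<and> j = a then e else 0)) * B j l) = (if k = l then 1 else 0)" .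
    qed simp
    moreover have "Z = mono_map q q (\<lambda>_. 1) B ` (T ` Z)"
    proof -
      have "mono_map q q (\<lambda>_. 1) B (T x) = x" if x: "x \<in> Z" for x
      proof
        fix j
        have xt: "x \<in> tors q" using x less.prems(2) by blast
        then have nz: "x a \<noteq> 0" using ab(1) tors_torus by (auto simp: torus_def)
        show "mono_map q q (\<lambda>_. 1) B (T x) j = x j"
        proof (cases "j < q")
          case False
          then show ?thesis using xt by (simp add: mono_map_def tors_def)
        next
          case j: True
          have "lmon q (B j) (T x) = x j"
          proof (cases "j = b")
            case False
            have "lmon q (B j) (T x) = (\<Prod>i<q. if i = j then x j else 1)"
              unfolding lmon_def using False by (intro prod.cong refl) (auto simp: B_def T_def)
            then show ?thesis using j by simp
          next
            case True
            have "lmon q (B j) (T x) = x a powi (- e) * (x b * x a powi e) * (\<Prod>i\<in>{..<q} - {a, b}. 1)"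
              unfolding lmon_split2[OF ab(1-3)] using ab(3) True
              by (intro arg_cong2[where f = "(*)"] prod.cong) (auto simp: B_def T_def)
            then show ?thesis using nz True by (simp add: power_int_minus)
          qed
          then show ?thesis using j by (simp add: mono_map_def)
        qed
      qed
      then have "(\<lambda>x. mono_map q q (\<lambda>_. 1) B (T x)) ` Z = (\<lambda>x. x) ` Z" by (intro image_cong) auto
      then show ?thesis by (simp add: image_image)
    qed
    ultimately show ?thesis by (rule slices_image)
  qed
qed

text \<open>A closed torsion coset, parametrised by its own torus, with a set of torsion points that
  is not thin in that torus. Points are charts with q = 0.\<close>

definition chart :: "nat \<Rightarrow> (nat \<Rightarrow> complex) set \<Rightarrow> bool" where
  "chart m Y \<longleftrightarrow> (\<exists>q w A Z. torus_emb m q w A \<and> Z \<subseteq> tors q \<and> \<not> thin q Z \<and> Y = mono_map m q w A ` Z)"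

definition chart_cover :: "nat \<Rightarrow> (nat \<Rightarrow> complex) set \<Rightarrow> bool" where
  "chart_cover m Y \<longleftrightarrow> (\<exists>\<D>. finite \<D> \<and> Y = \<Union>\<D> \<and> (\<forall>D\<in>\<D>. chart m D))"

lemma chart_cover_Union:
  assumes "finite \<Y>" "\<And>Y. Y \<in> \<Y> \<Longrightarrow> chart_cover m Y"
  shows "chart_cover m (\<Union>\<Y>)"
proof -
  have "\<forall>Y\<in>\<Y>. \<exists>\<D>. finite \<D> \<and> Y = \<Union>\<D> \<and> (\<forall>D\<in>\<D>. chart m D)" using assms(2) unfolding chart_cover_def by blast
  then obtain \<D> where D: "\<And>Y. Y \<in> \<Y> \<Longrightarrow> finite (\<D> Y) \<and> Y = \<Union>(\<D> Y) \<and> (\<forall>D\<in>\<D> Y. chart m D)" by metis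
  have "finite (\<Union>Y\<in>\<Y>. \<D> Y)" using assms(1) D by blast
  moreover have "\<Union>\<Y> = \<Union>(\<Union>Y\<in>\<Y>. \<D> Y)"
  proof -
    have "(\<Union>Y\<in>\<Y>. \<Union>(\<D> Y)) = (\<Union>Y\<in>\<Y>. Y)" by (rule SUP_cong) (use D in auto)
    moreover have "\<Union>(\<Union>Y\<in>\<Y>. \<D> Y) = (\<Union>Y\<in>\<Y>. \<Union>(\<D> Y))" by blast
    ultimately show ?thesis by simp
  qed
  ultimately show ?thesis unfolding chart_cover_def using D by (intro exI[of _ "\<Union>Y\<in>\<Y>. \<D> Y"]) auto
qed

text \<open>Induction on the dimension: a thin set is a finite union of sets on which one character
  is constant, and each of these is sliced into sets of dimension q - 1. For q = 0 there is no
  nonzero exponent, so only the empty set is thin.\<close>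

lemma chart_cover_image:
  assumes "torus_emb m q w A" "Z \<subseteq> tors q"
  shows "chart_cover m (mono_map m q w A ` Z)"
  using assms
proof (induction q arbitrary: w A Z rule: less_induct)
  case (less q)
  show ?case
  proof (cases "thin q Z")
    case False
    then have "chart m (mono_map m q w A ` Z)" using less.prems unfolding chart_def by blast
    then show ?thesis unfolding chart_cover_def by (intro exI[of _ "{mono_map m q w A ` Z}"]) auto
  next
    case True
    then obtain C where C: "finite C" "\<forall>p\<in>C. (\<exists>i<q. fst p i \<noteq> 0) \<and> snd p \<in> roots_of_unity"
      "\<forall>x\<in>Z. \<exists>p\<in>C. lmon q (fst p) x = snd p" unfolding thin_def by blast
    define S where "S p = {x \<in> Z. lmon q (fst p) x = snd p}" for p
    have "chart_cover m (mono_map m q w A ` S p)" if p: "p \<in> C" for p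
    proof -
      have q: "\<exists>i<q. fst p i \<noteq> 0" using C(2) p by blast
      then have "q - 1 < q" by auto
      have "slices q (S p)" by (rule slices_relation[OF q, of _ "snd p"]) (use less.prems(2) in \<open>auto simp: S_def\<close>)
      then obtain \<D> where D: "finite \<D>" "S p = \<Union>\<D>"
        "\<And>D. D \<in> \<D> \<Longrightarrow> \<exists>w A Z'. torus_emb q (q - 1) w A \<and> Z' \<subseteq> tors (q - 1) \<and> D = mono_map q (q - 1) w A ` Z'"
        unfolding slices_def by metis
      have "chart_cover m (mono_map m q w A ` D)" if DD: "D \<in> \<D>" for D
      proof -
        obtain v B Y where B: "torus_emb q (q - 1) v B" "Y \<subseteq> tors (q - 1)" "D = mono_map q (q - 1) v B ` Y" using D(3)[OF DD] by blast
        obtain u E where E: "torus_emb m (q - 1) u E" "\<forall>y\<in>torus (q - 1). mono_map m q w A (mono_map q (q - 1) v B y) = mono_map m (q - 1) u E y"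
          using torus_emb_comp[OF less.prems(1) B(1)] by blast
        have "mono_map m q w A ` D = mono_map m (q - 1) u E ` Y"
          unfolding B(3) image_image by (rule image_cong) (use E(2) B(2) tors_torus in auto)
        then show ?thesis using less.IH[OF \<open>q - 1 < q\<close> E(1) B(2)] by simp
      qed
      then have "chart_cover m (\<Union>((`) (mono_map m q w A) ` \<D>))" using D(1) by (intro chart_cover_Union) auto
      then show ?thesis by (simp add: D(2) image_Union)
    qed
    then have "chart_cover m (\<Union>((\<lambda>p. mono_map m q w A ` S p) ` C))" using C(1) by (intro chart_cover_Union) auto
    moreover have "Z = (\<Union>p\<in>C. S p)" using C(3) by (auto simp: S_def)
    then have "mono_map m q w A ` Z = \<Union>((\<lambda>p. mono_map m q w A ` S p) ` C)" by (metis image_UN)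
    ultimately show ?thesis by simp
  qed
qed

theorem tors_chart_cover:
  assumes "Y \<subseteq> tors m" shows "chart_cover m Y"
proof -
  define A where "A j k = (if j = k then 1 else 0 :: int)" for j k :: nat
  have "torus_emb m m (\<lambda>_. 1) A"
    unfolding torus_emb_def
  proof (intro conjI exI[of _ A] allI impI)
    fix k l assume "k < m" "l < m"
    have "(\<Sum>j<m. A k j * A j l) = (\<Sum>j<m. if j = k then A j l else 0)" by (intro sum.cong) (auto simp: A_def)
    then show "(\<Sum>j<m. A k j * A j l) = (if k = l then 1 else 0)" using \<open>k < m\<close> by (simp add: A_def)
  qed simp
  moreover have "mono_map m m (\<lambda>_. 1) A x = x" if "x \<in> Y" for x
  proof
    fix j
    have "lmon m (A j) x = (\<Prod>i<m. if i = j then x j else 1)" unfolding lmon_def by (intro prod.cong) (auto simp: A_def)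
    then show "mono_map m m (\<lambda>_. 1) A x j = x j" using assms that by (auto simp: mono_map_def tors_def)
  qed
  then have "mono_map m m (\<lambda>_. 1) A ` Y = Y" by simp
  ultimately show ?thesis using chart_cover_image[of m m "\<lambda>_. 1" A Y] assms by simp
qed

section \<open>Laurent polynomials on non-thin sets\<close>

lemma lpoly_monomial_lmon:
  assumes "Poly_Mapping.keys m \<subseteq> {..<q}"
  shows "(\<Prod>i\<in>Poly_Mapping.keys m. t i powi Poly_Mapping.lookup m i) = lmon q (Poly_Mapping.lookup m) t"
  unfolding lmon_def using assms
  by (intro prod.mono_neutral_left) (auto simp: in_keys_iff)

lemma lpeval_lmon:
  assumes "lpoly_over L q p"
  shows "lpeval p t = (\<Sum>m\<in>Poly_Mapping.keys p. Poly_Mapping.lookup p m * lmon q (Poly_Mapping.lookup m) t)"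
  unfolding lpeval_def using assms by (intro sum.cong refl) (simp add: lpoly_monomial_lmon lpoly_over_def)

lemma lpeval_superset:
  assumes "finite S" "Poly_Mapping.keys p \<subseteq> S"
  shows "lpeval p t = (\<Sum>m\<in>S. Poly_Mapping.lookup p m * (\<Prod>i\<in>Poly_Mapping.keys m. t i powi Poly_Mapping.lookup m i))"
  unfolding lpeval_def using assms by (intro sum.mono_neutral_left) (auto simp: in_keys_iff)

lemma lpeval_add: "lpeval (p + r) t = lpeval p t + lpeval r t"
proof -
  let ?S = "Poly_Mapping.keys p \<union> Poly_Mapping.keys r"
  have "Poly_Mapping.keys (p + r) \<subseteq> ?S" by (rule Poly_Mapping.keys_add)
  then show ?thesis
    by (simp add: lpeval_superset[of ?S] Poly_Mapping.lookup_add distrib_right sum.distrib)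
qed

lemma lpeval_diff: "lpeval (p - r) t = lpeval p t - lpeval r t"
  using lpeval_add[of "p - r" r t] by simp

lemma lpoly_over_add: "lpoly_over qbar q p \<Longrightarrow> lpoly_over qbar q r \<Longrightarrow> lpoly_over qbar q (p + r)"
  using Poly_Mapping.keys_add[of p r] unfolding lpoly_over_def by (simp add: Poly_Mapping.lookup_add qbar_add) blast

lemma lpoly_over_diff: "lpoly_over qbar q p \<Longrightarrow> lpoly_over qbar q r \<Longrightarrow> lpoly_over qbar q (p - r)"
  using keys_diff[of p r] unfolding lpoly_over_def by (simp add: Poly_Mapping.lookup_minus qbar_diff) blast

text \<open>At a torsion zero of p, two monomials of p have a ratio in the finite set F of the
  vanishing theorem. Their quotient is a nontrivial character with one of finitely many values, so
  the zeros in \<open>tors q\<close> form a thin set.\<close>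

lemma lpoly_zero:
  assumes p: "lpoly_over qbar q p" and Z: "Z \<subseteq> tors q" "\<not> thin q Z" and z: "\<And>x. x \<in> Z \<Longrightarrow> lpeval p x = 0"
  shows "p = 0"
proof (rule ccontr)
  assume "p \<noteq> 0"
  let ?J = "Poly_Mapping.keys p"
  have J: "finite ?J" "?J \<noteq> {}" using \<open>p \<noteq> 0\<close> by auto
  obtain F where F: "finite F" "F \<subseteq> roots_of_unity"
    "\<And>\<zeta>. \<forall>j\<in>?J. \<zeta> j \<in> roots_of_unity \<Longrightarrow> (\<Sum>j\<in>?J. Poly_Mapping.lookup p j * \<zeta> j) = 0 \<Longrightarrow>
      \<exists>i\<in>?J. \<exists>j\<in>?J. i \<noteq> j \<and> \<zeta> i / \<zeta> j \<in> F"
    using vanishing_sum_of_roots_of_unity[OF J, of "Poly_Mapping.lookup p"] p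
    by (auto simp: lpoly_over_def in_keys_iff)
  define C where "C = {(\<lambda>k. Poly_Mapping.lookup i k - Poly_Mapping.lookup j k, w) | i j w. i \<in> ?J \<and> j \<in> ?J \<and> i \<noteq> j \<and> w \<in> F}"
  have "thin q Z"
    unfolding thin_def
  proof (intro exI[of _ C] conjI)
    have "C \<subseteq> (\<lambda>(i, j, w). (\<lambda>k. Poly_Mapping.lookup i k - Poly_Mapping.lookup j k, w)) ` (?J \<times> ?J \<times> F)"
      unfolding C_def by force
    then show "finite C" using F(1) finite_subset by fastforce
    show "\<forall>p\<in>C. (\<exists>i<q. fst p i \<noteq> 0) \<and> snd p \<in> roots_of_unity"
    proof
      fix c assume "c \<in> C"
      then obtain i j w where c: "c = (\<lambda>k. Poly_Mapping.lookup i k - Poly_Mapping.lookup j k, w)" "i \<in> ?J" "j \<in> ?J" "i \<noteq> j" "w \<in> F"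
        unfolding C_def by blast
      obtain k where k: "Poly_Mapping.lookup i k \<noteq> Poly_Mapping.lookup j k" using c(4) by (metis poly_mapping_eqI)
      then have "k \<in> Poly_Mapping.keys i \<or> k \<in> Poly_Mapping.keys j" by (auto simp: in_keys_iff)
      then have "k < q" using p c(2,3) by (auto simp: lpoly_over_def)
      then show "(\<exists>i<q. fst c i \<noteq> 0) \<and> snd c \<in> roots_of_unity" using k c(1,5) F(2) by auto
    qed
    show "\<forall>x\<in>Z. \<exists>p\<in>C. lmon q (fst p) x = snd p"
    proof
      fix x assume x: "x \<in> Z"
      then have xt: "x \<in> tors q" using Z by blast
      have "\<forall>j\<in>?J. lmon q (Poly_Mapping.lookup j) x \<in> roots_of_unity"
        using xt by (auto simp: tors_def intro: lmon_roots_of_unity)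
      then obtain i j where ij: "i \<in> ?J" "j \<in> ?J" "i \<noteq> j" "lmon q (Poly_Mapping.lookup i) x / lmon q (Poly_Mapping.lookup j) x \<in> F"
        using F(3)[of "\<lambda>m. lmon q (Poly_Mapping.lookup m) x"] z[OF x] lpeval_lmon[OF p] by auto
      have "lmon q (\<lambda>k. Poly_Mapping.lookup i k - Poly_Mapping.lookup j k) x = lmon q (Poly_Mapping.lookup i) x / lmon q (Poly_Mapping.lookup j) x"
        using lmon_diff xt tors_torus by blast
      then have "(\<lambda>k. Poly_Mapping.lookup i k - Poly_Mapping.lookup j k, lmon q (\<lambda>k. Poly_Mapping.lookup i k - Poly_Mapping.lookup j k) x) \<in> C"
        using ij unfolding C_def by auto
      then show "\<exists>p\<in>C. lmon q (fst p) x = snd p" by force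
    qed
  qed
  then show False using Z(2) by simp
qed

text \<open>\<Gamma> records which exponents may occur. Exponents are compared on the first q
  entries and values on \<open>torus q\<close>, because vectors and points are arbitrary
  beyond.\<close>

definition laurent :: "nat \<Rightarrow> (nat \<Rightarrow> int) set \<Rightarrow> ((nat \<Rightarrow> complex) \<Rightarrow> complex) \<Rightarrow> bool" where
  "laurent q \<Gamma> g \<longleftrightarrow> (\<exists>p. lpoly_over qbar q p \<and>
     (\<forall>m\<in>Poly_Mapping.keys p. \<exists>a\<in>\<Gamma>. \<forall>i<q. Poly_Mapping.lookup m i = a i) \<and> (\<forall>x\<in>torus q. g x = lpeval p x))"

lemma laurent_cong: "laurent q \<Gamma> g \<Longrightarrow> (\<And>x. x \<in> torus q \<Longrightarrow> g x = h x) \<Longrightarrow> laurent q \<Gamma> h"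
  unfolding laurent_def by (metis (no_types, lifting))

lemma laurent_add:
  assumes "laurent q \<Gamma> g" "laurent q \<Gamma> h" shows "laurent q \<Gamma> (\<lambda>x. g x + h x)"
proof -
  obtain p where p: "lpoly_over qbar q p" "\<forall>m\<in>Poly_Mapping.keys p. \<exists>a\<in>\<Gamma>. \<forall>i<q. Poly_Mapping.lookup m i = a i" "\<forall>x\<in>torus q. g x = lpeval p x"
    using assms(1) unfolding laurent_def by blast
  obtain r where r: "lpoly_over qbar q r" "\<forall>m\<in>Poly_Mapping.keys r. \<exists>a\<in>\<Gamma>. \<forall>i<q. Poly_Mapping.lookup m i = a i" "\<forall>x\<in>torus q. h x = lpeval r x"
    using assms(2) unfolding laurent_def by blast
  have "\<forall>m\<in>Poly_Mapping.keys (p + r). \<exists>a\<in>\<Gamma>. \<forall>i<q. Poly_Mapping.lookup m i = a i"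
    using p(2) r(2) Poly_Mapping.keys_add[of p r] by blast
  then show ?thesis unfolding laurent_def using p r
    by (intro exI[of _ "p + r"]) (simp add: lpoly_over_add lpeval_add)
qed

lemma laurent_monomial:
  assumes "c \<in> qbar" "a \<in> \<Gamma>" shows "laurent q \<Gamma> (\<lambda>x. c * lmon q a x)"
proof -
  define m where "m = Abs_poly_mapping (\<lambda>i. if i < q then a i else 0)"
  have "finite {i. (if i < q then a i else 0) \<noteq> 0}" by (rule finite_subset[of _ "{..<q}"]) auto
  then have lm: "Poly_Mapping.lookup m = (\<lambda>i. if i < q then a i else 0)"
    unfolding m_def by (rule Abs_poly_mapping_inverse[OF CollectI])
  then have km: "Poly_Mapping.keys m \<subseteq> {..<q}" by (auto simp: in_keys_iff split: if_splits)
  have o: "lpoly_over qbar q (Poly_Mapping.single m c)"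
    unfolding lpoly_over_def using assms(1) km by (auto simp: lookup_single when_def split: if_splits)
  have "lpeval (Poly_Mapping.single m c) x = c * lmon q a x" for x
  proof -
    have "lmon q (Poly_Mapping.lookup m) x = lmon q a x" by (rule lmon_cong) (simp_all add: lm)
    then show ?thesis
      using lpeval_superset[of "{m}" "Poly_Mapping.single m c" x] lpoly_monomial_lmon[OF km] by simp
  qed
  then show ?thesis unfolding laurent_def using o assms(2) lm
    by (intro exI[of _ "Poly_Mapping.single m c"]) (auto split: if_splits intro!: bexI[of _ a])
qed

lemma laurent_zero_fun: "laurent q \<Gamma> (\<lambda>x. 0)"
  unfolding laurent_def by (intro exI[of _ 0]) (auto simp: lpoly_over_def lpeval_def)

lemma laurent_sum: "(\<And>i. i \<in> I \<Longrightarrow> laurent q \<Gamma> (g i)) \<Longrightarrow> laurent q \<Gamma> (\<lambda>x. \<Sum>i\<in>I. g i x)"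
  by (induction I rule: infinite_finite_induct) (auto intro: laurent_add laurent_zero_fun)

lemma laurent_expand:
  assumes "laurent q \<Gamma> g"
  shows "\<exists>J c a. finite (J :: nat set) \<and> (\<forall>j\<in>J. c j \<in> qbar \<and> a j \<in> \<Gamma>) \<and> (\<forall>x\<in>torus q. g x = (\<Sum>j\<in>J. c j * lmon q (a j) x))"
proof -
  obtain p where p: "lpoly_over qbar q p" "\<forall>m\<in>Poly_Mapping.keys p. \<exists>a\<in>\<Gamma>. \<forall>i<q. Poly_Mapping.lookup m i = a i" "\<forall>x\<in>torus q. g x = lpeval p x"
    using assms unfolding laurent_def by blast
  obtain b where b: "\<And>m. m \<in> Poly_Mapping.keys p \<Longrightarrow> b m \<in> \<Gamma> \<and> (\<forall>i<q. Poly_Mapping.lookup m i = b m i)" using p(2) by metis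
  obtain n f where f: "bij_betw f {0..<n::nat} (Poly_Mapping.keys p)" using ex_bij_betw_nat_finite[OF finite_keys] by blast
  have fk: "f j \<in> Poly_Mapping.keys p" if "j \<in> {0..<n}" for j using f that by (auto simp: bij_betw_def)
  have "g x = (\<Sum>j\<in>{0..<n}. Poly_Mapping.lookup p (f j) * lmon q (b (f j)) x)" if x: "x \<in> torus q" for x
  proof -
    have "g x = (\<Sum>m\<in>Poly_Mapping.keys p. Poly_Mapping.lookup p m * lmon q (Poly_Mapping.lookup m) x)"
      using p(3) x lpeval_lmon[OF p(1)] by simp
    also have "\<dots> = (\<Sum>m\<in>Poly_Mapping.keys p. Poly_Mapping.lookup p m * lmon q (b m) x)"
      using b by (intro sum.cong refl arg_cong2[where f = "(*)"] lmon_cong) auto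
    also have "\<dots> = (\<Sum>j\<in>{0..<n}. Poly_Mapping.lookup p (f j) * lmon q (b (f j)) x)"
      by (rule sum.reindex_bij_betw[OF f, symmetric])
    finally show ?thesis .
  qed
  moreover have "\<forall>j\<in>{0..<n}. Poly_Mapping.lookup p (f j) \<in> qbar \<and> b (f j) \<in> \<Gamma>" using p(1) b fk by (auto simp: lpoly_over_def)
  ultimately show ?thesis
    by (intro exI[of _ "{0..<n}"] exI[of _ "\<lambda>j. Poly_Mapping.lookup p (f j)"] exI[of _ "\<lambda>j. b (f j)"]) simp
qed

lemma laurent_mult:
  assumes \<Gamma>: "\<forall>a\<in>\<Gamma>. \<forall>b\<in>\<Gamma>. (\<lambda>i. a i + b i) \<in> \<Gamma>" and g: "laurent q \<Gamma> g" and h: "laurent q \<Gamma> h"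
  shows "laurent q \<Gamma> (\<lambda>x. g x * h x)"
proof -
  obtain J c a where J: "finite (J :: nat set)" "\<And>j. j \<in> J \<Longrightarrow> c j \<in> qbar" "\<And>j. j \<in> J \<Longrightarrow> a j \<in> \<Gamma>" "\<And>x. x \<in> torus q \<Longrightarrow> g x = (\<Sum>j\<in>J. c j * lmon q (a j) x)"
    using laurent_expand[OF g] by metis
  obtain K d b where K: "finite (K :: nat set)" "\<And>j. j \<in> K \<Longrightarrow> d j \<in> qbar" "\<And>j. j \<in> K \<Longrightarrow> b j \<in> \<Gamma>" "\<And>x. x \<in> torus q \<Longrightarrow> h x = (\<Sum>j\<in>K. d j * lmon q (b j) x)"
    using laurent_expand[OF h] by metis
  have "laurent q \<Gamma> (\<lambda>x. \<Sum>j\<in>J. \<Sum>k\<in>K. (c j * d k) * lmon q (\<lambda>i. a j i + b k i) x)"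
    using J(2,3) K(2,3) \<Gamma> by (intro laurent_sum laurent_monomial qbar_mult) auto
  then show ?thesis
  proof (rule laurent_cong)
    fix x assume x: "x \<in> torus q"
    show "(\<Sum>j\<in>J. \<Sum>k\<in>K. (c j * d k) * lmon q (\<lambda>i. a j i + b k i) x) = g x * h x"
      unfolding J(4)[OF x] K(4)[OF x] sum_product lmon_add[OF x] by (intro sum.cong refl) (simp add: mult_ac)
  qed
qed

lemma laurent_const: "c \<in> qbar \<Longrightarrow> (\<lambda>i. 0) \<in> \<Gamma> \<Longrightarrow> laurent q \<Gamma> (\<lambda>x. c)"
  using laurent_monomial[of c "\<lambda>i. 0" \<Gamma> q] by simp

lemma laurent_peval:
  assumes \<Gamma>: "\<forall>a\<in>\<Gamma>. \<forall>b\<in>\<Gamma>. (\<lambda>i. a i + b i) \<in> \<Gamma>" "(\<lambda>i. 0) \<in> \<Gamma>"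
    and p: "poly_over qbar N p" and g: "\<And>i. i < N \<Longrightarrow> laurent q \<Gamma> (\<lambda>x. g x i)"
  shows "laurent q \<Gamma> (\<lambda>x. peval p (g x))"
proof -
  have pw: "laurent q \<Gamma> (\<lambda>x. g x i ^ n)" if "i < N" for i n
  proof (induction n)
    case 0
    then show ?case using laurent_const[OF qbar_1 \<Gamma>(2)] by simp
  next
    case (Suc n)
    show ?case unfolding power_Suc by (rule laurent_mult[OF \<Gamma>(1) g[OF that] Suc.IH])
  qed
  have mon: "laurent q \<Gamma> (\<lambda>x. \<Prod>i\<in>I. g x i ^ n i)" if "I \<subseteq> {..<N}" for I n
    using that
  proof (induction I rule: infinite_finite_induct)
    case (insert i I)
    then have "laurent q \<Gamma> (\<lambda>x. g x i ^ n i * (\<Prod>i\<in>I. g x i ^ n i))"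
      by (intro laurent_mult[OF \<Gamma>(1) pw]) auto
    then show ?case using insert.hyps by simp
  qed (simp_all add: laurent_const[OF qbar_1 \<Gamma>(2)])
  show ?thesis
    unfolding peval_def using p
    by (intro laurent_sum laurent_mult[OF \<Gamma>(1) laurent_const[OF _ \<Gamma>(2)] mon]) (auto simp: poly_over_def)
qed

lemma mono_map_torus: "(\<And>k. k < r \<Longrightarrow> u k \<in> roots_of_unity) \<Longrightarrow> x \<in> torus q \<Longrightarrow> mono_map r q u H x \<in> torus r"
  using lmon_nonzero[of x q] roots_of_unity_nonzero by (auto simp: torus_def[of r] mono_map_def)

lemma laurent_compose_mono_map:
  assumes g: "laurent r UNIV g" and u: "\<And>k. k < r \<Longrightarrow> u k \<in> roots_of_unity"
  shows "laurent q UNIV (\<lambda>x. g (mono_map r q u H x))"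
proof -
  obtain J c a where J: "finite (J :: nat set)" "\<forall>j\<in>J. c j \<in> qbar \<and> a j \<in> UNIV" "\<forall>x\<in>torus r. g x = (\<Sum>j\<in>J. c j * lmon r (a j) x)"
    using laurent_expand[OF g] by (elim exE conjE) (rule that)
  have "laurent q UNIV (\<lambda>x. \<Sum>j\<in>J. (c j * lmon r (a j) u) * lmon q (\<lambda>k. \<Sum>i<r. a j i * H i k) x)"
  proof (intro laurent_sum laurent_monomial)
    fix j assume "j \<in> J"
    moreover have "lmon r (a j) u \<in> roots_of_unity" using u by (rule lmon_roots_of_unity)
    ultimately show "c j * lmon r (a j) u \<in> qbar" using J(2) by (intro qbar_mult[OF _ roots_of_unity_qbar]) auto
  qed simp
  then show ?thesis
  proof (rule laurent_cong)
    fix x assume x: "x \<in> torus q"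
    have "mono_map r q u H x \<in> torus r" using u x by (rule mono_map_torus)
    then show "(\<Sum>j\<in>J. (c j * lmon r (a j) u) * lmon q (\<lambda>k. \<Sum>i<r. a j i * H i k) x) = g (mono_map r q u H x)"
      using J(3) by (simp add: lmon_mono_map[OF x order_refl] mult.assoc)
  qed
qed

lemma laurent_vanish:
  assumes g: "laurent q \<Gamma> g" and Z: "Z \<subseteq> tors q" "\<not> thin q Z" and z: "\<And>x. x \<in> Z \<Longrightarrow> g x = 0" and x: "x \<in> torus q"
  shows "g x = 0"
proof -
  obtain p where p: "lpoly_over qbar q p" "\<forall>x\<in>torus q. g x = lpeval p x" using g unfolding laurent_def by blast
  have "p = 0" by (rule lpoly_zero[OF p(1) Z]) (use p(2) z Z(1) tors_torus in force)
  then show ?thesis using p(2) x by (simp add: lpeval_def)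
qed

text \<open>Agreement on a set that is not thin makes the two Laurent polynomials equal; as they
  have no exponent in common, both are zero.\<close>

lemma laurent_separate:
  assumes g: "laurent q \<Gamma> g" and h: "laurent q \<Delta> h" and Z: "Z \<subseteq> tors q" "\<not> thin q Z"
    and disj: "\<And>a b. a \<in> \<Gamma> \<Longrightarrow> b \<in> \<Delta> \<Longrightarrow> \<exists>i<q. a i \<noteq> b i"
    and eq: "\<And>x. x \<in> Z \<Longrightarrow> g x = h x" and x: "x \<in> torus q"
  shows "h x = 0"
proof -
  obtain p where p: "lpoly_over qbar q p" "\<forall>m\<in>Poly_Mapping.keys p. \<exists>a\<in>\<Gamma>. \<forall>i<q. Poly_Mapping.lookup m i = a i" "\<forall>x\<in>torus q. g x = lpeval p x"
    using g unfolding laurent_def by blast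
  obtain r where r: "lpoly_over qbar q r" "\<forall>m\<in>Poly_Mapping.keys r. \<exists>a\<in>\<Delta>. \<forall>i<q. Poly_Mapping.lookup m i = a i" "\<forall>x\<in>torus q. h x = lpeval r x"
    using h unfolding laurent_def by blast
  have "p - r = 0"
    by (rule lpoly_zero[OF lpoly_over_diff[OF p(1) r(1)] Z]) (use p(3) r(3) eq Z(1) tors_torus in \<open>force simp: lpeval_diff\<close>)
  then have "p = r" by simp
  have "Poly_Mapping.keys r = {}"
  proof (rule ccontr)
    assume "Poly_Mapping.keys r \<noteq> {}"
    then obtain m where m: "m \<in> Poly_Mapping.keys r" by blast
    obtain a b where "a \<in> \<Gamma>" "b \<in> \<Delta>" "\<forall>i<q. Poly_Mapping.lookup m i = a i" "\<forall>i<q. Poly_Mapping.lookup m i = b i"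
      using p(2) r(2) m \<open>p = r\<close> by blast
    then show False using disj by metis
  qed
  then show ?thesis using r(3) x by (simp add: lpeval_def)
qed

lemma peval_superset:
  assumes "poly_over L N p"
  shows "peval p x = (\<Sum>m\<in>Poly_Mapping.keys p. Poly_Mapping.lookup p m * (\<Prod>i<N. x i ^ Poly_Mapping.lookup m i))"
  unfolding peval_def
proof (intro sum.cong refl arg_cong2[where f = "(*)"])
  fix m assume "m \<in> Poly_Mapping.keys p"
  then have "Poly_Mapping.keys m \<subseteq> {..<N}" using assms by (auto simp: poly_over_def)
  then show "(\<Prod>i\<in>Poly_Mapping.keys m. x i ^ Poly_Mapping.lookup m i) = (\<Prod>i<N. x i ^ Poly_Mapping.lookup m i)"
    by (intro prod.mono_neutral_left) (auto simp: in_keys_iff)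
qed

section \<open>Polynomial functions and subsets that are not dense\<close>

text \<open>Polynomials seen as functions, so that products and compositions need no formal
  construction.\<close>

definition pfun :: "nat \<Rightarrow> ((nat \<Rightarrow> complex) \<Rightarrow> complex) \<Rightarrow> bool" where
  "pfun N g \<longleftrightarrow> (\<exists>p. poly_over qbar N p \<and> (\<forall>x. g x = peval p x))"

lemma pfun_add: assumes "pfun N g" "pfun N h" shows "pfun N (\<lambda>x. g x + h x)"
proof -
  obtain p r where p: "poly_over qbar N p" "\<And>x. g x = peval p x" and r: "poly_over qbar N r" "\<And>x. h x = peval r x"
    using assms unfolding pfun_def by blast
  let ?S = "Poly_Mapping.keys p \<union> Poly_Mapping.keys r"
  have sub: "Poly_Mapping.keys (p + r) \<subseteq> ?S" by (rule Poly_Mapping.keys_add)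
  have sup: "peval s x = (\<Sum>m\<in>?S. Poly_Mapping.lookup s m * (\<Prod>i\<in>Poly_Mapping.keys m. x i ^ Poly_Mapping.lookup m i))"
    if "Poly_Mapping.keys s \<subseteq> ?S" for s x
    unfolding peval_def using that by (intro sum.mono_neutral_left) (auto simp: in_keys_iff)
  have "poly_over qbar N (p + r)" using sub p(1) r(1) unfolding poly_over_def by (simp add: Poly_Mapping.lookup_add qbar_add) blast
  moreover have "peval (p + r) x = peval p x + peval r x" for x
    using sub by (simp add: sup Poly_Mapping.lookup_add distrib_right sum.distrib)
  ultimately show ?thesis unfolding pfun_def using p(2) r(2) by (intro exI[of _ "p + r"]) simp
qed

lemma pfun_monomial: assumes "c \<in> qbar" shows "pfun N (\<lambda>x. c * (\<Prod>i<N. x i ^ a i))"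
proof -
  define m where "m = Abs_poly_mapping (\<lambda>i. if i < N then a i else 0)"
  have "finite {i. (if i < N then a i else 0) \<noteq> 0}" by (rule finite_subset[of _ "{..<N}"]) auto
  then have lm: "Poly_Mapping.lookup m = (\<lambda>i. if i < N then a i else 0)"
    unfolding m_def by (rule Abs_poly_mapping_inverse[OF CollectI])
  then have km: "Poly_Mapping.keys m \<subseteq> {..<N}" by (auto simp: in_keys_iff split: if_splits)
  have o: "poly_over qbar N (Poly_Mapping.single m c)"
    unfolding poly_over_def using assms km by (auto simp: lookup_single when_def split: if_splits)
  have "peval (Poly_Mapping.single m c) x = c * (\<Prod>i<N. x i ^ a i)" for x
    unfolding peval_superset[OF o] by (cases "c = 0") (auto simp: lm intro!: prod.cong)
  then show ?thesis unfolding pfun_def using o by (intro exI[of _ "Poly_Mapping.single m c"]) simp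
qed

lemma pfun_0: "pfun N (\<lambda>x. 0)"
  using pfun_monomial[of 0 N "\<lambda>i. 0"] by simp

lemma pfun_sum: "(\<And>i. i \<in> I \<Longrightarrow> pfun N (g i)) \<Longrightarrow> pfun N (\<lambda>x. \<Sum>i\<in>I. g i x)"
  by (induction I rule: infinite_finite_induct) (auto intro: pfun_add pfun_0)

lemma pfun_mult: assumes "pfun N g" "pfun N h" shows "pfun N (\<lambda>x. g x * h x)"
proof -
  obtain p r where p: "poly_over qbar N p" "\<And>x. g x = peval p x" and r: "poly_over qbar N r" "\<And>x. h x = peval r x"
    using assms unfolding pfun_def by blast
  have "pfun N (\<lambda>x. \<Sum>m\<in>Poly_Mapping.keys p. \<Sum>n\<in>Poly_Mapping.keys r. (Poly_Mapping.lookup p m * Poly_Mapping.lookup r n) *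
      (\<Prod>i<N. x i ^ (Poly_Mapping.lookup m i + Poly_Mapping.lookup n i)))"
    using p(1) r(1) by (intro pfun_sum pfun_monomial qbar_mult) (auto simp: poly_over_def)
  moreover have "(\<Sum>m\<in>Poly_Mapping.keys p. \<Sum>n\<in>Poly_Mapping.keys r. (Poly_Mapping.lookup p m * Poly_Mapping.lookup r n) *
      (\<Prod>i<N. x i ^ (Poly_Mapping.lookup m i + Poly_Mapping.lookup n i))) = g x * h x" for x
    unfolding p(2) r(2) peval_superset[OF p(1)] peval_superset[OF r(1)] sum_product
    by (intro sum.cong refl) (simp add: power_add prod.distrib mult_ac)
  ultimately show ?thesis by simp
qed

lemma pfun_const: "c \<in> qbar \<Longrightarrow> pfun N (\<lambda>x. c)"
  using pfun_monomial[of c N "\<lambda>i. 0"] by simp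

lemma pfun_comp:
  assumes p: "poly_over qbar N p" and g: "\<And>i. i < N \<Longrightarrow> pfun N (\<lambda>x. g x i)"
  shows "pfun N (\<lambda>x. peval p (g x))"
proof -
  have pw: "pfun N (\<lambda>x. g x i ^ n)" if "i < N" for i n
  proof (induction n)
    case 0
    then show ?case using pfun_const[OF qbar_1] by simp
  next
    case (Suc n)
    then show ?case using pfun_mult[OF g[OF that] Suc.IH] by simp
  qed
  have "pfun N (\<lambda>x. \<Prod>i\<in>I. g x i ^ n i)" if "I \<subseteq> {..<N}" for I n
    using that by (induction I rule: infinite_finite_induct) (auto intro: pfun_mult pw pfun_const)
  then show ?thesis
    unfolding peval_def using p by (intro pfun_sum pfun_mult pfun_const) (auto simp: poly_over_def)
qed

text \<open>Failure of density in X, witnessed by a single polynomial. It also makes sense for A not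
  contained in X; the link to the closure is \<open>dense_iff_not_small\<close>.\<close>

definition small :: "nat \<Rightarrow> (nat \<Rightarrow> complex) set \<Rightarrow> (nat \<Rightarrow> complex) set \<Rightarrow> bool" where
  "small N X A \<longleftrightarrow> (\<exists>p. poly_over qbar N p \<and> (\<forall>a\<in>A. peval p a = 0) \<and> (\<exists>x\<in>X. peval p x \<noteq> 0))"

lemma zclosure_subset_closed:
  assumes "zclosed N X" "A \<subseteq> X" shows "zclosure N A \<subseteq> X"
proof -
  obtain S where S: "\<forall>p\<in>S. poly_over qbar N p" "X = zero_set N S" using assms(1) by (auto simp: zclosed_def)
  then show ?thesis using assms(2) by (auto simp: zclosure_def zero_set_def subset_iff)
qed

lemma dense_iff_not_small:
  assumes "zclosed N X" "A \<subseteq> X"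
  shows "zariski_dense_in N A X \<longleftrightarrow> \<not> small N X A"
proof -
  have "X \<subseteq> qbar_pts N" using assms(1) by (auto simp: zclosed_def zero_set_def)
  then have "X \<subseteq> zclosure N A \<longleftrightarrow> \<not> small N X A" unfolding zclosure_def small_def by blast
  then show ?thesis unfolding zariski_dense_in_def using zclosure_subset_closed[OF assms] by blast
qed

text \<open>The product of the two witnesses; by irreducibility it cannot vanish on all of
  X.\<close>

lemma small_Un:
  assumes X: "zirreducible N X" and A: "small N X A" and B: "small N X B"
  shows "small N X (A \<union> B)"
proof -
  obtain p where p: "poly_over qbar N p" "\<forall>a\<in>A. peval p a = 0" "\<exists>x\<in>X. peval p x \<noteq> 0" using A by (auto simp: small_def)
  obtain r where r: "poly_over qbar N r" "\<forall>a\<in>B. peval r a = 0" "\<exists>x\<in>X. peval r x \<noteq> 0" using B by (auto simp: small_def)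
  have "pfun N (\<lambda>x. peval p x * peval r x)" using p(1) r(1) by (intro pfun_mult) (auto simp: pfun_def)
  then obtain s where s: "poly_over qbar N s" "\<And>x. peval p x * peval r x = peval s x" by (auto simp: pfun_def)
  have "\<exists>x\<in>X. peval s x \<noteq> 0"
  proof (rule ccontr)
    assume "\<not> ?thesis"
    then have z: "\<forall>x\<in>X. peval p x = 0 \<or> peval r x = 0" using s(2) by (metis mult_eq_0_iff)
    have Xq: "X \<subseteq> qbar_pts N" using X by (auto simp: zirreducible_def zclosed_def zero_set_def)
    have "zclosed N (zero_set N {p})" "zclosed N (zero_set N {r})" using p(1) r(1) unfolding zclosed_def by blast+
    moreover have "X \<subseteq> zero_set N {p} \<union> zero_set N {r}" using z Xq by (auto simp: zero_set_def)
    ultimately have "X \<subseteq> zero_set N {p} \<or> X \<subseteq> zero_set N {r}" using X unfolding zirreducible_def by blast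
    then show False using p(3) r(3) by (auto simp: zero_set_def)
  qed
  moreover have "\<forall>a\<in>A \<union> B. peval s a = 0" using p(2) r(2) s(2) by (metis UnE mult_eq_0_iff)
  ultimately show ?thesis unfolding small_def using s(1) by blast
qed

lemma small_empty: assumes "zirreducible N X" shows "small N X {}"
proof -
  obtain p where p: "poly_over qbar N p" "\<And>x. 1 = peval p x" using pfun_const[of 1 N] by (auto simp: pfun_def)
  obtain x where "x \<in> X" using assms by (auto simp: zirreducible_def)
  then show ?thesis unfolding small_def using p by (intro exI[of _ p]) (metis empty_iff zero_neq_one)
qed

lemma small_Union:
  assumes "zirreducible N X" "finite \<A>" "\<And>A. A \<in> \<A> \<Longrightarrow> small N X A"
  shows "small N X (\<Union>\<A>)"
  using assms(2,3) by (induction \<A> rule: finite_induct) (auto intro: small_Un[OF assms(1)] small_empty[OF assms(1)])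

lemma small_subset: "small N X A \<Longrightarrow> B \<subseteq> A \<Longrightarrow> small N X B"
  unfolding small_def by blast

section \<open>Minimal representations\<close>

text \<open>One flat tuple of length N * R in which block i carries the R terms of coordinate i;
  thus a single torus serves all coordinates.\<close>

definition term_sums :: "nat \<Rightarrow> nat \<Rightarrow> (nat \<Rightarrow> complex) \<Rightarrow> (nat \<Rightarrow> complex) \<Rightarrow> nat \<Rightarrow> complex" where
  "term_sums N R e z = (\<lambda>i. if i < N then \<Sum>j<R. e (i * R + j) * z (i * R + j) else 0)"

text \<open>Setting z k = 1 where e k = 0 removes the freedom in terms that contribute nothing. On a
  chart it forces the corresponding exponents to vanish.\<close>

definition is_rep :: "nat \<Rightarrow> nat \<Rightarrow> complex set \<Rightarrow> (nat \<Rightarrow> complex) \<Rightarrow> (nat \<Rightarrow> complex) \<Rightarrow> (nat \<Rightarrow> complex) \<Rightarrow> bool" where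
  "is_rep N R E y e z \<longleftrightarrow> (\<forall>k<N * R. e k \<in> E) \<and> (\<forall>k\<ge>N * R. e k = 0) \<and> z \<in> tors (N * R) \<and>
     (\<forall>k<N * R. e k = 0 \<longrightarrow> z k = 1) \<and> y = term_sums N R e z"

definition weight :: "nat \<Rightarrow> (nat \<Rightarrow> complex) \<Rightarrow> nat" where
  "weight m e = card {k. k < m \<and> e k \<noteq> 0}"

definition min_rep :: "nat \<Rightarrow> nat \<Rightarrow> complex set \<Rightarrow> (nat \<Rightarrow> complex) \<Rightarrow> (nat \<Rightarrow> complex) \<Rightarrow> (nat \<Rightarrow> complex) \<Rightarrow> bool" where
  "min_rep N R E y e z \<longleftrightarrow> is_rep N R E y e z \<and> (\<forall>e' z'. is_rep N R E y e' z' \<longrightarrow> weight (N * R) e \<le> weight (N * R) e')"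

lemma index_less: "i < N \<Longrightarrow> j < R \<Longrightarrow> i * R + j < N * (R :: nat)"
proof -
  assume "i < N" "j < R"
  then have "i * R + j < Suc i * R" by simp
  also have "\<dots> \<le> N * R" using \<open>i < N\<close> by (intro mult_le_mono1) simp
  finally show ?thesis .
qed

lemma min_rep_exists:
  assumes E0: "0 \<in> E" and y: "\<And>i. i < N \<Longrightarrow> short_sum R E (y i)" "\<And>i. i \<ge> N \<Longrightarrow> y i = 0"
  shows "\<exists>e z. min_rep N R E y e z"
proof -
  have "\<forall>i. \<exists>e \<zeta>. i < N \<longrightarrow> (\<forall>j<R. e j \<in> E \<and> \<zeta> j \<in> roots_of_unity) \<and> y i = (\<Sum>j<R. e j * \<zeta> j)"
    using y(1) unfolding short_sum_def by blast
  then obtain f \<eta> where f: "\<And>i j. i < N \<Longrightarrow> j < R \<Longrightarrow> f i j \<in> E \<and> \<eta> i j \<in> roots_of_unity"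
    "\<And>i. i < N \<Longrightarrow> y i = (\<Sum>j<R. f i j * \<eta> i j)" by metis
  define e where "e k = (if k < N * R then f (k div R) (k mod R) else 0)" for k
  define z where "z k = (if k < N * R then (if e k = 0 then 1 else \<eta> (k div R) (k mod R)) else 0)" for k
  have dm: "k div R < N" "k mod R < R" if "k < N * R" for k
    using that by (cases "R = 0"; simp add: less_mult_imp_div_less)+
  have "is_rep N R E y e z"
    unfolding is_rep_def
  proof (intro conjI)
    show "\<forall>k<N * R. e k \<in> E" using f(1) dm by (simp add: e_def)
    show "z \<in> tors (N * R)" using f(1) dm by (auto simp: z_def tors_def)
    show "y = term_sums N R e z"
    proof
      fix i
      show "y i = term_sums N R e z i"
      proof (cases "i < N")
        case True
        have "e (i * R + j) * z (i * R + j) = f i j * \<eta> i j" if "j < R" for j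
          using index_less[OF True that] that by (simp add: z_def) (simp add: e_def)
        then show ?thesis using True f(2) by (simp add: term_sums_def)
      qed (simp add: term_sums_def y(2))
    qed
  qed (auto simp: e_def z_def)
  then have "\<exists>p. is_rep N R E y (fst p) (snd p)" by (intro exI[of _ "(e, z)"]) simp
  then obtain p where "is_rep N R E y (fst p) (snd p)" "\<And>q. is_rep N R E y (fst q) (snd q) \<Longrightarrow> weight (N * R) (fst p) \<le> weight (N * R) (fst q)"
    using ex_has_least_nat[of "\<lambda>p. is_rep N R E y (fst p) (snd p)" _ "\<lambda>p. weight (N * R) (fst p)"] by metis
  then show ?thesis unfolding min_rep_def by (metis fst_conv snd_conv)
qed

text \<open>Replacing the coefficients of a vanishing subsum by 0 would represent the same point
  with smaller weight.\<close>

lemma min_rep_no_vanishing_subsum: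
  assumes r: "min_rep N R E y e z" and E0: "0 \<in> E" and i: "i < N" and S: "S \<subseteq> {j. j < R \<and> e (i * R + j) \<noteq> 0}"
    and z: "(\<Sum>j\<in>S. e (i * R + j) * z (i * R + j)) = 0"
  shows "S = {}"
proof (rule ccontr)
  assume "S \<noteq> {}"
  have rep: "is_rep N R E y e z" using r by (simp add: min_rep_def)
  define T where "T = (\<lambda>j. i * R + j) ` S"
  define e' where "e' k = (if k \<in> T then 0 else e k)" for k
  define z' where "z' k = (if k \<in> T then 1 else z k)" for k
  have TN: "k < N * R \<and> e k \<noteq> 0" if "k \<in> T" for k using that S index_less[OF i] by (auto simp: T_def)
  have "term_sums N R e' z' = term_sums N R e z"
  proof
    fix l
    show "term_sums N R e' z' l = term_sums N R e z l"
    proof (cases "l < N \<and> l \<noteq> i")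
      case True
      have "l * R + j \<notin> T" if "j < R" for j
      proof
        assume "l * R + j \<in> T"
        then obtain s where s: "s \<in> S" "l * R + j = i * R + s" by (auto simp: T_def)
        then have "s < R" using S by auto
        have "(l * R + j) div R = l" "(i * R + s) div R = i" using that \<open>s < R\<close> by auto
        then show False using s(2) True by simp
      qed
      then show ?thesis by (simp add: term_sums_def e'_def z'_def)
    next
      case False
      show ?thesis
      proof (cases "l = i")
        case True
        have sub: "S \<subseteq> {..<R}" using S by auto
        have "i * R + j \<in> T \<longleftrightarrow> j \<in> S" for j by (auto simp: T_def)
        then have "(\<Sum>j<R. e' (i * R + j) * z' (i * R + j)) = (\<Sum>j<R. if j \<in> S then 0 else e (i * R + j) * z (i * R + j))"
          by (intro sum.cong refl) (simp add: e'_def z'_def)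
        also have "\<dots> = (\<Sum>j\<in>{..<R} - S. e (i * R + j) * z (i * R + j))"
          by (rule sum.mono_neutral_cong_right) auto
        also have "\<dots> = (\<Sum>j<R. e (i * R + j) * z (i * R + j))"
          using sum.subset_diff[OF sub, of "\<lambda>j. e (i * R + j) * z (i * R + j)"] z by simp
        finally show ?thesis using True i by (simp add: term_sums_def)
      next
        case False
        then show ?thesis using \<open>\<not> (l < N \<and> l \<noteq> i)\<close> by (simp add: term_sums_def)
      qed
    qed
  qed
  then have "is_rep N R E y e' z'"
    using rep E0 TN unfolding is_rep_def e'_def z'_def tors_def by auto
  then have "weight (N * R) e \<le> weight (N * R) e'" using r unfolding min_rep_def by blast
  moreover have "{k. k < N * R \<and> e' k \<noteq> 0} \<subset> {k. k < N * R \<and> e k \<noteq> 0}"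
  proof -
    obtain k where "k \<in> T" using \<open>S \<noteq> {}\<close> by (auto simp: T_def)
    then have "k \<in> {k. k < N * R \<and> e k \<noteq> 0}" "k \<notin> {k. k < N * R \<and> e' k \<noteq> 0}" using TN by (auto simp: e'_def)
    moreover have "{k. k < N * R \<and> e' k \<noteq> 0} \<subseteq> {k. k < N * R \<and> e k \<noteq> 0}" by (auto simp: e'_def)
    ultimately show ?thesis by blast
  qed
  then have "weight (N * R) e' < weight (N * R) e" unfolding weight_def by (intro psubset_card_mono) auto
  ultimately show False by simp
qed

lemma laurent_term_sums_mono_map:
  assumes e: "\<And>k. e k \<in> qbar" and w: "\<And>k. k < N * R \<Longrightarrow> w k \<in> roots_of_unity"
  shows "laurent q UNIV (\<lambda>x. term_sums N R e (mono_map (N * R) q w A x) i)"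
proof (cases "i < N")
  case True
  have "laurent q UNIV (\<lambda>x. \<Sum>j<R. (e (i * R + j) * w (i * R + j)) * lmon q (A (i * R + j)) x)"
    using index_less[OF True] w roots_of_unity_qbar e by (intro laurent_sum laurent_monomial qbar_mult) auto
  moreover have "(\<Sum>j<R. (e (i * R + j) * w (i * R + j)) * lmon q (A (i * R + j)) x) = term_sums N R e (mono_map (N * R) q w A x) i" for x
    using True index_less[OF True] by (simp add: term_sums_def mono_map_def mult.assoc)
  ultimately show ?thesis by simp
qed (simp add: term_sums_def laurent_zero_fun)

lemma laurent_agree:
  assumes "\<And>i. laurent q UNIV (\<lambda>x. g x i)" "\<And>i. laurent q UNIV (\<lambda>x. h x i)"
    and Z: "Z \<subseteq> tors q" "\<not> thin q Z" and eq: "\<And>x. x \<in> Z \<Longrightarrow> g x = h x" and x: "x \<in> torus q"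
  shows "g x = h x"
proof
  fix i
  have "laurent q UNIV (\<lambda>x. g x i + (-1) * h x i)"
    by (intro laurent_add[OF assms(1)] laurent_mult[OF _ laurent_const[OF qbar_uminus[OF qbar_1]] assms(2)]) simp_all
  from laurent_vanish[OF this Z _ x] show "g x i = h x i" using eq by simp
qed

definition tuple_append :: "nat \<Rightarrow> nat \<Rightarrow> (nat \<Rightarrow> complex) \<Rightarrow> (nat \<Rightarrow> complex) \<Rightarrow> nat \<Rightarrow> complex" where
  "tuple_append q r x y = (\<lambda>i. if i < q then x i else if i < q + r then y (i - q) else 0)"

text \<open>The graph of the correspondence is again covered by finitely many charts. By minimality of the
  representations no term of the image can cancel, so its exponents lie in the row space of the first
  projection, and the correspondence is a morphism.\<close>
lemma correspondence_is_monomial: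
  assumes E: "E \<subseteq> qbar" "0 \<in> E"
    and F: "\<And>i. i < N \<Longrightarrow> poly_over qbar N (F i)"
    and e: "\<And>k. e k \<in> qbar" and w: "\<And>k. k < N * R \<Longrightarrow> w k \<in> roots_of_unity"
    and T: "T \<subseteq> tors q" "\<not> thin q T"
    and e': "\<And>k. e' k \<in> qbar" and emb': "torus_emb (N * R) r w' A'"
    and Z': "Z' \<subseteq> tors r" "\<not> thin r Z'"
    and rep': "\<And>x'. x' \<in> Z' \<Longrightarrow> \<exists>y. min_rep N R E y e' (mono_map (N * R) r w' A' x')"
    and cor: "\<And>x. x \<in> T \<Longrightarrow> \<exists>x'\<in>Z'. polymap N F (term_sums N R e (mono_map (N * R) q w A x)) = term_sums N R e' (mono_map (N * R) r w' A' x')"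
  shows "\<exists>u H. (\<forall>k<r. u k \<in> roots_of_unity) \<and>
    (\<forall>x\<in>torus q. polymap N F (term_sums N R e (mono_map (N * R) q w A x)) = term_sums N R e' (mono_map (N * R) r w' A' (mono_map r q u H x)))"
proof -
  let ?m = "N * R"
  define \<phi> where "\<phi> x = term_sums N R e (mono_map ?m q w A x)" for x
  define \<phi>' where "\<phi>' x = term_sums N R e' (mono_map ?m r w' A' x)" for x
  have w': "\<And>k. k < ?m \<Longrightarrow> w' k \<in> roots_of_unity" using emb' by (simp add: torus_emb_def)
  obtain C' where C': "\<forall>k<r. \<forall>l<r. (\<Sum>j<?m. C' k j * A' j l) = (if k = l then 1 else 0)" using emb' by (auto simp: torus_emb_def)
  obtain s where s: "\<And>x. x \<in> T \<Longrightarrow> s x \<in> Z'" "\<And>x. x \<in> T \<Longrightarrow> polymap N F (\<phi> x) = \<phi>' (s x)"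
    using cor unfolding \<phi>_def \<phi>'_def by metis
  define W where "W = (\<lambda>x. tuple_append q r x (s x)) ` T"
  have W: "W \<subseteq> tors (q + r)" using T(1) Z'(1) s(1) unfolding W_def tuple_append_def tors_def by force
  obtain \<D> where D: "finite \<D>" "W = \<Union>\<D>" "\<forall>D\<in>\<D>. chart (q + r) D" using tors_chart_cover[OF W] unfolding chart_cover_def by blast
  \<comment> \<open>T is covered by the first projections \<open>TD D\<close> of finitely many
    charts of the graph, so one of them is not thin.\<close>
  define TD where "TD D = {x \<in> T. tuple_append q r x (s x) \<in> D}" for D
  have "T = \<Union>(TD ` \<D>)" using D(2) unfolding TD_def W_def by auto
  then obtain D where Dm: "D \<in> \<D>" and nt: "\<not> thin q (TD D)"
    using T(2) thin_Union[of "TD ` \<D>" q] D(1) by auto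
  obtain n v B Z where ch: "torus_emb (q + r) n v B" "Z \<subseteq> tors n" "\<not> thin n Z" "D = mono_map (q + r) n v B ` Z"
  proof -
    have "chart (q + r) D" using D(3) Dm by (rule bspec)
    then show ?thesis unfolding chart_def by (elim exE conjE) (rule that)
  qed
  have v: "v k \<in> roots_of_unity" if "k < q + r" for k using ch(1) that by (simp add: torus_emb_def)
  have TDt: "TD D \<subseteq> tors q" using T(1) by (auto simp: TD_def)
  have pt: "\<exists>x\<in>TD D. mono_map (q + r) n v B z = tuple_append q r x (s x)" if "z \<in> Z" for z
  proof -
    have "mono_map (q + r) n v B z \<in> D" using that ch(4) by blast
    moreover from this have "mono_map (q + r) n v B z \<in> W" unfolding D(2) using Dm by (rule UnionI[rotated])
    then obtain x where "x \<in> T" "mono_map (q + r) n v B z = tuple_append q r x (s x)" unfolding W_def by (rule imageE)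
    ultimately show ?thesis unfolding TD_def by (intro bexI[of _ x]) simp_all
  qed
  \<comment> \<open>The lattice spanned by the rows of B belonging to the first projection: the
    exponents, on the chart, of monomials in x.\<close>
  define \<Gamma> where "\<Gamma> = {a. \<exists>c. \<forall>l<n. a l = (\<Sum>i<q. c i * B i l)}"
  have \<Gamma>add: "(\<lambda>i. a i + b i) \<in> \<Gamma>" if ab: "a \<in> \<Gamma>" "b \<in> \<Gamma>" for a b
  proof -
    obtain c d where "\<forall>l<n. a l = (\<Sum>i<q. c i * B i l)" "\<forall>l<n. b l = (\<Sum>i<q. d i * B i l)" using ab by (auto simp: \<Gamma>_def)
    then show ?thesis unfolding \<Gamma>_def by (intro CollectI exI[of _ "\<lambda>i. c i + d i"]) (simp add: distrib_right sum.distrib)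
  qed
  have \<Gamma>add': "\<forall>a\<in>\<Gamma>. \<forall>b\<in>\<Gamma>. (\<lambda>i. a i + b i) \<in> \<Gamma>" using \<Gamma>add by simp
  have \<Gamma>0: "(\<lambda>i. 0) \<in> \<Gamma>" unfolding \<Gamma>_def by (intro CollectI exI[of _ "\<lambda>i. 0"]) simp
  have \<Gamma>scale: "(\<lambda>i. k * a i) \<in> \<Gamma>" if a: "a \<in> \<Gamma>" for a k
  proof -
    obtain c where "\<forall>l<n. a l = (\<Sum>i<q. c i * B i l)" using a by (auto simp: \<Gamma>_def)
    then show ?thesis unfolding \<Gamma>_def by (intro CollectI exI[of _ "\<lambda>i. k * c i"]) (simp add: sum_distrib_left mult.assoc)
  qed
  have \<Gamma>sum: "(\<lambda>l. \<Sum>i\<in>I. a i l) \<in> \<Gamma>" if "\<And>i. i \<in> I \<Longrightarrow> a i \<in> \<Gamma>" for I and a :: "nat \<Rightarrow> nat \<Rightarrow> int"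
    using that by (induction I rule: infinite_finite_induct) (auto intro: \<Gamma>add \<Gamma>0)
  have \<Gamma>cong: "a \<in> \<Gamma>" if "b \<in> \<Gamma>" "\<forall>l<n. a l = b l" for a b using that unfolding \<Gamma>_def by auto
  \<comment> \<open>The exponent on the chart of the k-th term of the image point.\<close>
  define b where "b k = (\<lambda>l. \<Sum>t<r. A' k t * B (q + t) l)" for k
  define v' where "v' t = v (q + t)" for t
  have v'r: "\<And>t. t < r \<Longrightarrow> v' t \<in> roots_of_unity" using v by (simp add: v'_def)
  have xs: "x = mono_map q n v B z" "s x = mono_map r n v' (\<lambda>t. B (q + t)) z" if "mono_map (q + r) n v B z = tuple_append q r x (s x)" "x \<in> TD D" for x z
  proof -
    have xt: "x \<in> tors q" "s x \<in> tors r" using that(2) T(1) s(1) Z'(1) by (auto simp: TD_def)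
    have i: "mono_map (q + r) n v B z i = tuple_append q r x (s x) i" for i using that(1) by simp
    show "x = mono_map q n v B z"
    proof
      fix j show "x j = mono_map q n v B z j" using i[of j] xt(1) by (auto simp: mono_map_def tuple_append_def tors_def split: if_splits)
    qed
    show "s x = mono_map r n v' (\<lambda>t. B (q + t)) z"
    proof
      fix j show "s x j = mono_map r n v' (\<lambda>t. B (q + t)) z j"
        using i[of "q + j"] xt(2) by (auto simp: mono_map_def tuple_append_def tors_def v'_def split: if_splits)
    qed
  qed
  have bA: "lmon r (A' k) (mono_map r n v' (\<lambda>t. B (q + t)) z) = lmon r (A' k) v' * lmon n (b k) z" if "z \<in> torus n" for k z
    unfolding lmon_mono_map[OF that order_refl] b_def ..
  have bG: "b (i * R + j) \<in> \<Gamma>" if i: "i < N" and j: "j < R" and nz: "e' (i * R + j) \<noteq> 0" for i j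
  proof (rule ccontr)
    assume nb: "b (i * R + j) \<notin> \<Gamma>"
    \<comment> \<open>The terms of coordinate i whose exponent is not in \<Gamma>. Everything else,
      including the polynomial expression in x, has exponents in \<Gamma>; separating exponents
      shows that the terms in S sum to 0, which minimality forbids unless S is empty.\<close>
    define S where "S = {j. j < R \<and> e' (i * R + j) \<noteq> 0 \<and> b (i * R + j) \<notin> \<Gamma>}"
    define cf where "cf j = e' (i * R + j) * (w' (i * R + j) * lmon r (A' (i * R + j)) v')" for j
    have cfq: "cf j \<in> qbar" if "j < R" for j
      unfolding cf_def
      by (intro qbar_mult[OF e' roots_of_unity_qbar[OF roots_of_unity_mult[OF w'[OF index_less[OF i that]] lmon_roots_of_unity]]] v'r)
    have SR: "S \<subseteq> {..<R}" by (auto simp: S_def)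
    have lG: "laurent n \<Gamma> (\<lambda>z. peval (F i) (term_sums N R e (mono_map ?m q w A (mono_map q n v B z))))"
    proof (rule laurent_peval[OF \<Gamma>add' \<Gamma>0 F[OF i]])
      fix l assume l: "l < N"
      have "laurent n \<Gamma> (\<lambda>z. \<Sum>j<R. (e (l * R + j) * (w (l * R + j) * lmon q (A (l * R + j)) v)) * lmon n (\<lambda>k. \<Sum>i<q. A (l * R + j) i * B i k) z)"
      proof (intro laurent_sum laurent_monomial)
        fix j assume "j \<in> {..<R}"
        then show "e (l * R + j) * (w (l * R + j) * lmon q (A (l * R + j)) v) \<in> qbar"
          using v by (intro qbar_mult[OF e roots_of_unity_qbar[OF roots_of_unity_mult[OF w[OF index_less[OF l]] lmon_roots_of_unity]]]) auto
        show "(\<lambda>k. \<Sum>i<q. A (l * R + j) i * B i k) \<in> \<Gamma>" unfolding \<Gamma>_def by blast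
      qed
      then show "laurent n \<Gamma> (\<lambda>z. term_sums N R e (mono_map ?m q w A (mono_map q n v B z)) l)"
      proof (rule laurent_cong)
        fix z assume z: "z \<in> torus n"
        show "(\<Sum>j<R. (e (l * R + j) * (w (l * R + j) * lmon q (A (l * R + j)) v)) * lmon n (\<lambda>k. \<Sum>i<q. A (l * R + j) i * B i k) z) =
            term_sums N R e (mono_map ?m q w A (mono_map q n v B z)) l"
          using l index_less[OF l] by (simp add: term_sums_def mono_map_def[of ?m] lmon_mono_map[OF z order_refl] mult.assoc)
      qed
    qed
    have lin: "laurent n \<Gamma> (\<lambda>z. \<Sum>j\<in>{..<R} - S. - cf j * lmon n (b (i * R + j)) z)"
    proof (intro laurent_sum)
      fix j assume j: "j \<in> {..<R} - S"
      show "laurent n \<Gamma> (\<lambda>z. - cf j * lmon n (b (i * R + j)) z)"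
      proof (cases "e' (i * R + j) = 0")
        case True
        then show ?thesis by (simp add: cf_def laurent_zero_fun)
      next
        case False
        then show ?thesis using j cfq by (intro laurent_monomial qbar_uminus) (auto simp: S_def)
      qed
    qed
    have lout: "laurent n (- \<Gamma>) (\<lambda>z. \<Sum>j\<in>S. cf j * lmon n (b (i * R + j)) z)"
      using cfq by (intro laurent_sum laurent_monomial) (auto simp: S_def)
    have zeta: "z \<in> torus n" if "z \<in> Z" for z using that ch(2) tors_torus by blast
    have key: "(\<Sum>j<R. cf j * lmon n (b (i * R + j)) z) = term_sums N R e' (mono_map ?m r w' A' (mono_map r n v' (\<lambda>t. B (q + t)) z)) i" if "z \<in> Z" for z
      using i index_less[OF i] by (simp add: term_sums_def mono_map_def[of ?m] bA[OF zeta[OF that]] cf_def mult.assoc)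
    have out0: "(\<Sum>j\<in>S. cf j * lmon n (b (i * R + j)) z) = 0" if z: "z \<in> Z" for z
    proof (rule laurent_separate[OF laurent_add[OF lG lin] lout ch(2,3) _ _ zeta[OF z]])
      fix a c assume "a \<in> \<Gamma>" "c \<in> - \<Gamma>"
      then show "\<exists>i<n. a i \<noteq> c i" using \<Gamma>cong[of a c] by (metis ComplD)
    next
      fix z assume z: "z \<in> Z"
      obtain x where x: "x \<in> TD D" "mono_map (q + r) n v B z = tuple_append q r x (s x)" using pt[OF z] by blast
      have xT: "x \<in> T" using x(1) by (simp add: TD_def)
      have "peval (F i) (\<phi> x) = \<phi>' (s x) i" using fun_cong[OF s(2)[OF xT], of i] i by (simp add: polymap_def)
      then have "peval (F i) (term_sums N R e (mono_map ?m q w A (mono_map q n v B z))) = (\<Sum>j<R. cf j * lmon n (b (i * R + j)) z)"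
        unfolding key[OF z] \<phi>_def \<phi>'_def using xs[OF x(2,1)] by simp
      also have "\<dots> = (\<Sum>j\<in>S. cf j * lmon n (b (i * R + j)) z) + (\<Sum>j\<in>{..<R} - S. cf j * lmon n (b (i * R + j)) z)"
        using sum.subset_diff[OF SR] by (simp add: add.commute)
      finally show "peval (F i) (term_sums N R e (mono_map ?m q w A (mono_map q n v B z))) + (\<Sum>j\<in>{..<R} - S. - cf j * lmon n (b (i * R + j)) z) =
          (\<Sum>j\<in>S. cf j * lmon n (b (i * R + j)) z)" by (simp add: sum_negf)
    qed
    obtain z where z: "z \<in> Z" using ch(3) thin_empty by fastforce
    obtain x where x: "x \<in> TD D" "mono_map (q + r) n v B z = tuple_append q r x (s x)" using pt[OF z] by blast
    have sx: "s x \<in> Z'" using x(1) s(1) by (simp add: TD_def)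
    obtain y where y: "min_rep N R E y e' (mono_map ?m r w' A' (s x))" using rep'[OF sx] by blast
    have "(\<Sum>j\<in>S. e' (i * R + j) * mono_map ?m r w' A' (s x) (i * R + j)) = (\<Sum>j\<in>S. cf j * lmon n (b (i * R + j)) z)"
    proof (intro sum.cong refl)
      fix j assume "j \<in> S"
      then show "e' (i * R + j) * mono_map ?m r w' A' (s x) (i * R + j) = cf j * lmon n (b (i * R + j)) z"
        unfolding xs(2)[OF x(2,1)] using index_less[OF i, of j] by (simp add: S_def mono_map_def[of ?m] bA[OF zeta[OF z]] cf_def)
    qed
    then have "S = {}" using out0[OF z] by (intro min_rep_no_vanishing_subsum[OF y E(2) i]) (auto simp: S_def)
    then show False using nb j nz by (auto simp: S_def)
  qed
  \<comment> \<open>For a term with coefficient 0 the root of unity is 1 on all of Z', so a nonzero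
    row of A' would confine Z' to a proper torsion coset.\<close>
  have bG': "b k \<in> \<Gamma>" if k: "k < ?m" for k
  proof (cases "e' k = 0")
    case False
    have "k div R < N" "k mod R < R" using k by (cases "R = 0"; simp add: less_mult_imp_div_less)+
    then show ?thesis using bG[of "k div R" "k mod R"] False by simp
  next
    case True
    have "A' k t = 0" if t: "t < r" for t
    proof (rule ccontr)
      assume nz: "A' k t \<noteq> 0"
      have "lmon r (A' k) x' = inverse (w' k)" if x': "x' \<in> Z'" for x'
      proof -
        obtain y where "min_rep N R E y e' (mono_map ?m r w' A' x')" using rep'[OF x'] by blast
        then have "mono_map ?m r w' A' x' k = 1" using True k by (auto simp: min_rep_def is_rep_def)
        then show ?thesis using k w'[OF k] roots_of_unity_nonzero by (simp add: mono_map_def field_simps)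
      qed
      then have "thin r Z'" using thin_single[where i = t and c = "A' k", OF t nz roots_of_unity_inverse[OF w'[OF k]], of Z'] by simp
      then show False using Z'(2) by simp
    qed
    then show ?thesis by (intro \<Gamma>cong[OF \<Gamma>0]) (simp add: b_def)
  qed
  \<comment> \<open>The left inverse C' recovers the rows of the second projection as integral
    combinations of the \<open>b k\<close>, which lie in \<Gamma>.\<close>
  have "\<exists>c. \<forall>l<n. B (q + t) l = (\<Sum>i<q. c i * B i l)" if t: "t < r" for t
  proof -
    have "(\<lambda>l. \<Sum>k<?m. C' t k * b k l) \<in> \<Gamma>" by (intro \<Gamma>sum \<Gamma>scale bG') simp
    moreover have "B (q + t) l = (\<Sum>k<?m. C' t k * b k l)" for l
    proof -
      have "(\<Sum>k<?m. C' t k * b k l) = (\<Sum>t'<r. (\<Sum>k<?m. C' t k * A' k t') * B (q + t') l)"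
        unfolding b_def sum_distrib_left sum_distrib_right by (subst sum.swap) (simp add: mult.assoc)
      also have "\<dots> = (\<Sum>t'<r. if t' = t then B (q + t) l else 0)"
        using C' t by (intro sum.cong refl) auto
      finally show ?thesis using t by simp
    qed
    ultimately show ?thesis unfolding \<Gamma>_def by simp
  qed
  then obtain H where H: "\<And>t l. t < r \<Longrightarrow> l < n \<Longrightarrow> B (q + t) l = (\<Sum>i<q. H t i * B i l)" by metis
  \<comment> \<open>The translation part that remains after the exponents H have been applied to the
    translation v of the chart.\<close>
  define u where "u t = v' t / lmon q (H t) v" for t
  have lu: "lmon q (H t) v \<in> roots_of_unity" for t using v by (intro lmon_roots_of_unity) simp
  have u: "u t \<in> roots_of_unity" if "t < r" for t
    unfolding u_def divide_inverse using v'r[OF that] lu by (intro roots_of_unity_mult roots_of_unity_inverse)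
  have sx: "s x = mono_map r q u H x" if x: "x \<in> TD D" for x
  proof -
    have "tuple_append q r x (s x) \<in> D" using x by (simp add: TD_def)
    then obtain z where z: "z \<in> Z" "mono_map (q + r) n v B z = tuple_append q r x (s x)" using ch(4) by auto
    have zeta: "z \<in> torus n" using z(1) ch(2) tors_torus by blast
    have "lmon n (B (q + t)) z = lmon q (H t) x / lmon q (H t) v" if t: "t < r" for t
    proof -
      have "lmon q (H t) x = lmon q (H t) v * lmon n (\<lambda>l. \<Sum>i<q. H t i * B i l) z"
        unfolding xs(1)[OF z(2) x] by (rule lmon_mono_map[OF zeta order_refl])
      moreover have "lmon n (\<lambda>l. \<Sum>i<q. H t i * B i l) z = lmon n (B (q + t)) z"
        using H[OF t] by (intro lmon_cong) auto
      ultimately show ?thesis using lu[of t] roots_of_unity_nonzero by (simp add: field_simps)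
    qed
    then show ?thesis unfolding xs(2)[OF z(2) x] by (intro ext) (simp add: mono_map_def u_def)
  qed
  \<comment> \<open>Both sides are Laurent in x and agree on the non-thin set \<open>TD D\<close>,
    hence on the whole torus.\<close>
  have "polymap N F (\<phi> x) = term_sums N R e' (mono_map ?m r w' A' (mono_map r q u H x))" if x: "x \<in> torus q" for x
  proof (rule laurent_agree[OF _ _ TDt nt _ x])
    fix i
    show "laurent q UNIV (\<lambda>x. polymap N F (\<phi> x) i)"
      unfolding polymap_def \<phi>_def
      by (cases "i < N") (auto intro!: laurent_peval F laurent_term_sums_mono_map e w simp: laurent_zero_fun)
    show "laurent q UNIV (\<lambda>x. term_sums N R e' (mono_map ?m r w' A' (mono_map r q u H x)) i)"
      by (rule laurent_compose_mono_map[OF laurent_term_sums_mono_map[OF e' w'] u])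
  next
    fix x assume x: "x \<in> TD D"
    then show "polymap N F (\<phi> x) = term_sums N R e' (mono_map ?m r w' A' (mono_map r q u H x))"
      using s(2)[of x] sx[OF x] by (simp add: TD_def \<phi>'_def)
  qed
  then show ?thesis using u unfolding \<phi>_def by blast
qed

section \<open>Monomial self-maps\<close>

lemma mono_map_mono_map:
  assumes "x \<in> torus n"
  shows "mono_map m q w A (mono_map q n u H x) = mono_map m n (\<lambda>j. w j * lmon q (A j) u) (\<lambda>j k. \<Sum>i<q. A j i * H i k) x"
  by (rule ext) (simp add: mono_map_def[of m] lmon_mono_map[OF assms order_refl])

text \<open>Stated for positive iterates, since the identity does not set the entries from q on to 0
  as a monomial map does.\<close>

lemma mono_map_funpow:
  assumes u: "\<forall>k<q. u k \<in> roots_of_unity"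
  shows "\<exists>v B. (\<forall>k<q. v k \<in> roots_of_unity) \<and> (\<forall>x\<in>torus q. (mono_map q q u H ^^ Suc a) x = mono_map q q v B x)"
proof (induction a)
  case 0
  then show ?case using u by (intro exI[of _ u] exI[of _ H]) simp
next
  case (Suc a)
  then obtain v B where vB: "\<forall>k<q. v k \<in> roots_of_unity" "\<forall>x\<in>torus q. (mono_map q q u H ^^ Suc a) x = mono_map q q v B x" by blast
  show ?case
    using u vB by (intro exI[of _ "\<lambda>j. u j * lmon q (H j) v"] exI[of _ "\<lambda>j k. \<Sum>i<q. H j i * B i k"])
      (auto simp: mono_map_mono_map intro: roots_of_unity_mult lmon_roots_of_unity)
qed

lemma finite_tors_bounded:
  assumes "Q > 0" shows "finite {x \<in> tors q. \<forall>i<q. x i ^ Q = 1}"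
proof -
  have "finite {x :: nat \<Rightarrow> complex. \<forall>i. (i \<in> {..<q} \<longrightarrow> x i \<in> {z. z ^ Q = 1}) \<and> (i \<notin> {..<q} \<longrightarrow> x i = 0)}"
    using finite_roots_unity[of Q] assms by (intro finite_set_of_finite_funs) auto
  then show ?thesis by (rule rev_finite_subset) (auto simp: tors_def)
qed

lemma periodic_point:
  assumes "finite S" "x \<in> S" "\<And>x. x \<in> S \<Longrightarrow> g x \<in> S"
  shows "\<exists>a\<ge>1. \<exists>t\<in>S. (g ^^ a) t = t"
proof -
  have it: "(g ^^ n) x \<in> S" for n by (induction n) (simp_all add: assms)
  have "\<not> inj (\<lambda>n. (g ^^ n) x)"
  proof
    assume "inj (\<lambda>n. (g ^^ n) x)"
    moreover have "finite (range (\<lambda>n. (g ^^ n) x))"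
      using assms(1) by (rule finite_subset[rotated]) (rule image_subsetI, rule it)
    ultimately show False by (simp add: finite_image_iff)
  qed
  then obtain i j where ij: "i < j" "(g ^^ i) x = (g ^^ j) x"
    unfolding inj_def by (metis nat_neq_iff)
  have "(g ^^ (j - i)) ((g ^^ i) x) = (g ^^ j) x"
    using ij(1) funpow_add[of "j - i" i g] by simp
  then show ?thesis using ij it[of i] by (intro exI[of _ "j - i"] conjI bexI[of _ "(g ^^ i) x"]) simp_all
qed

text \<open>A common exponent Q of the roots of unity u k makes the points with all coordinates Q-th
  roots of unity a finite invariant set.\<close>

lemma mono_map_periodic_point:
  assumes u: "\<forall>k<q. u k \<in> roots_of_unity"
  shows "\<exists>a\<ge>1. \<exists>t\<in>tors q. (mono_map q q u H ^^ a) t = t"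
proof -
  have "\<forall>k. \<exists>d. k < q \<longrightarrow> d > 0 \<and> u k ^ d = 1" using u by (auto simp: roots_of_unity_def)
  then obtain d where d: "\<And>k. k < q \<Longrightarrow> d k > (0 :: nat) \<and> u k ^ d k = 1" by metis
  define Q where "Q = (\<Prod>k<q. d k)"
  have Q: "Q > 0" using d by (simp add: Q_def prod_pos)
  have uQ: "u k ^ Q = 1" if "k < q" for k
  proof -
    have "d k dvd Q" unfolding Q_def using that by (intro dvd_prodI) auto
    then show ?thesis using d[OF that] by (auto simp: power_mult)
  qed
  define S where "S = {x \<in> tors q. \<forall>i<q. x i ^ Q = 1}"
  have powi1: "(z powi n) ^ Q = 1" if "z ^ Q = 1" for z :: complex and n
    using that by (metis power_int_1_left power_int_commutes power_int_mult power_int_of_nat mult.commute)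
  have S: "mono_map q q u H x \<in> S" if x: "x \<in> S" for x
  proof -
    have "lmon q a x ^ Q = 1" for a
      using x powi1 unfolding lmon_def by (simp add: prod_power_distrib S_def)
    moreover have "mono_map q q u H x \<in> tors q" using u x by (intro mono_map_tors) (simp_all add: S_def)
    ultimately show ?thesis using uQ by (simp add: S_def mono_map_def power_mult_distrib)
  qed
  define x0 :: "nat \<Rightarrow> complex" where "x0 i = (if i < q then 1 else 0)" for i
  have "x0 \<in> S" by (simp add: S_def x0_def tors_def)
  moreover have "finite S" unfolding S_def by (rule finite_tors_bounded[OF Q])
  ultimately obtain a t where "a \<ge> 1" "t \<in> S" "(mono_map q q u H ^^ a) t = t" using periodic_point[of S x0 "mono_map q q u H"] S by blast
  then show ?thesis by (intro exI[of _ a] conjI bexI[of _ t]) (simp_all add: S_def)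
qed

section \<open>Laurent maps as morphisms of tori\<close>

lemma lmon_qbar: "(\<And>i. i < q \<Longrightarrow> x i \<in> qbar) \<Longrightarrow> lmon q a x \<in> qbar"
  unfolding lmon_def by (intro qbar_prod qbar_powi) auto

lemma laurent_qbar: assumes "laurent q \<Gamma> g" "x \<in> gm_pts q" shows "g x \<in> qbar"
proof -
  have x: "x \<in> torus q" "\<And>i. i < q \<Longrightarrow> x i \<in> qbar" using assms(2) by (auto simp: gm_pts_def torus_def)
  obtain J c a where J: "finite (J :: nat set)" "\<forall>j\<in>J. c j \<in> qbar \<and> a j \<in> \<Gamma>" "\<forall>x\<in>torus q. g x = (\<Sum>j\<in>J. c j * lmon q (a j) x)"
    using laurent_expand[OF assms(1)] by (elim exE conjE) (rule that)
  have "(\<Sum>j\<in>J. c j * lmon q (a j) x) \<in> qbar" using J(2) lmon_qbar[OF x(2)] by (intro qbar_sum qbar_mult) auto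
  then show ?thesis using J(3) x(1) by simp
qed

lemma laurent_comp_peval:
  assumes "poly_over qbar N p" "\<And>i. laurent q UNIV (\<lambda>x. \<psi> x i)"
  shows "laurent q UNIV (\<lambda>x. peval p (\<psi> x))"
  by (rule laurent_peval[OF _ _ assms(1) assms(2)]) simp_all

text \<open>The equations of X, pulled back by \<psi>, are Laurent polynomials vanishing on a set
  that is not thin.\<close>

lemma torus_maps_into_closed:
  assumes X: "zclosed N X" and \<psi>: "\<And>i. laurent q UNIV (\<lambda>x. \<psi> x i)" "\<And>x i. i \<ge> N \<Longrightarrow> \<psi> x i = 0"
    and Z: "Z \<subseteq> tors q" "\<not> thin q Z" "\<psi> ` Z \<subseteq> X" and x: "x \<in> gm_pts q"
  shows "\<psi> x \<in> X"
proof -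
  obtain S where S: "\<forall>p\<in>S. poly_over qbar N p" "X = zero_set N S" using X by (auto simp: zclosed_def)
  have xt: "x \<in> torus q" using x by (auto simp: gm_pts_def torus_def)
  have "peval p (\<psi> x) = 0" if p: "p \<in> S" for p
  proof (rule laurent_vanish[OF laurent_comp_peval Z(1,2) _ xt])
    show "poly_over qbar N p" using S(1) p by blast
    show "peval p (\<psi> z) = 0" if "z \<in> Z" for z using that Z(3) S(2) p by (auto simp: zero_set_def)
  qed (rule \<psi>(1))
  moreover have "\<psi> x \<in> qbar_pts N" using laurent_qbar[OF \<psi>(1) x] \<psi>(2) by (simp add: qbar_pts_def)
  ultimately show ?thesis unfolding S(2) zero_set_def by simp
qed

lemma laurent_as_lpoly:
  assumes "\<And>i. i < N \<Longrightarrow> laurent q UNIV (\<lambda>x. \<psi> x i)" "\<And>x i. i \<ge> N \<Longrightarrow> \<psi> x i = 0" and qn: "q \<le> n"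
  shows "\<exists>\<Phi>. (\<forall>i<N. lpoly_over qbar n (\<Phi> i)) \<and> (\<forall>x\<in>torus q. lpmap N \<Phi> x = \<psi> x)"
proof -
  have "\<forall>i. \<exists>p. i < N \<longrightarrow> lpoly_over qbar q p \<and> (\<forall>x\<in>torus q. \<psi> x i = lpeval p x)"
    using assms(1) unfolding laurent_def by blast
  then obtain \<Phi> where \<Phi>: "\<And>i. i < N \<Longrightarrow> lpoly_over qbar q (\<Phi> i) \<and> (\<forall>x\<in>torus q. \<psi> x i = lpeval (\<Phi> i) x)" by metis
  have "lpoly_over qbar n (\<Phi> i)" if "i < N" for i using \<Phi>[OF that] qn by (force simp: lpoly_over_def)
  then show ?thesis using \<Phi> assms(2) by (intro exI[of _ \<Phi>] conjI ballI ext) (auto simp: lpmap_def)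
qed

text \<open>Extends an exponent matrix by zeros: the added coordinates are sent to 1, so the map
  stays a group endomorphism of the larger torus.\<close>

definition pad :: "nat \<Rightarrow> (nat \<Rightarrow> nat \<Rightarrow> int) \<Rightarrow> nat \<Rightarrow> nat \<Rightarrow> int" where
  "pad q B i k = (if i < q \<and> k < q then B i k else 0)"

lemma lmon_pad: assumes "q \<le> n" shows "lmon n (pad q B i) x = (if i < q then lmon q (B i) x else 1)"
proof (cases "i < q")
  case True
  have "lmon n (pad q B i) x = lmon q (pad q B i) x"
    unfolding lmon_def using assms by (intro prod.mono_neutral_right) (auto simp: pad_def)
  also have "\<dots> = lmon q (B i) x" using True by (intro lmon_cong) (auto simp: pad_def)
  finally show ?thesis using True by simp
qed (simp add: pad_def lmon_def)

lemma monomial_gm_endo: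
  "\<exists>G. gm_endo n G \<and> (\<forall>t\<in>gm_pts n. lpmap n G t = (\<lambda>i. if i < n then lmon n (D i) t else 0))"
proof -
  define \<psi> where "\<psi> x = (\<lambda>i. if i < n then lmon n (D i) x else 0)" for x
  have "laurent n UNIV (\<lambda>x. \<psi> x i)" if "i < n" for i
    using that laurent_monomial[OF qbar_1, of "D i" UNIV n] by (simp add: \<psi>_def)
  then obtain G where G: "\<forall>i<n. lpoly_over qbar n (G i)" "\<forall>x\<in>torus n. lpmap n G x = \<psi> x"
    using laurent_as_lpoly[of n n \<psi> n] by (auto simp: \<psi>_def)
  have gt: "t \<in> torus n" if "t \<in> gm_pts n" for t using that by (auto simp: gm_pts_def torus_def)
  have "lpmap n G t \<in> gm_pts n" if t: "t \<in> gm_pts n" for t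
    using G(2) gt[OF t] lmon_nonzero[OF gt[OF t]] lmon_qbar[of n t] t by (auto simp: gm_pts_def \<psi>_def)
  moreover have "lpmap n G (\<lambda>i. s i * t i) = (\<lambda>i. lpmap n G s i * lpmap n G t i)" if st: "s \<in> gm_pts n" "t \<in> gm_pts n" for s t
  proof -
    have "(\<lambda>i. s i * t i) \<in> torus n" using gt[OF st(1)] gt[OF st(2)] by (simp add: torus_def)
    then show ?thesis using G(2) gt[OF st(1)] gt[OF st(2)] by (auto simp: \<psi>_def lmon_mult)
  qed
  ultimately have "gm_endo n G" using G(1) by (auto simp: gm_endo_def)
  then show ?thesis using G(2) gt by (intro exI[of _ G]) (simp add: \<psi>_def)
qed

text \<open>A torsion point that is periodic for \<open>x \<mapsto> u \<cdot> x\<^sup>H\<close> serves as a new origin, in which a power of this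
  map is a group endomorphism.\<close>
lemma monomial_type_if_periodic:
  assumes X: "zirreducible N X"
    and \<psi>: "\<And>i. laurent q UNIV (\<lambda>x. \<psi> x i)" "\<And>x i. i \<ge> N \<Longrightarrow> \<psi> x i = 0"
    and Z: "Z \<subseteq> tors q" "\<not> thin q Z" "\<psi> ` Z \<subseteq> X" "\<not> small N X (\<psi> ` Z)"
    and l: "l \<ge> 1" and u: "\<forall>k<q. u k \<in> roots_of_unity"
    and f: "\<And>x. x \<in> torus q \<Longrightarrow> (f ^^ l) (\<psi> x) = \<psi> (mono_map q q u H x)"
  shows "monomial_type N X f"
proof -
  let ?g = "mono_map q q u H"
  have Xc: "zclosed N X" using X by (simp add: zirreducible_def)
  obtain a t0 where a: "a \<ge> 1" "t0 \<in> tors q" "(?g ^^ a) t0 = t0" using mono_map_periodic_point[OF u] by blast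
  obtain v B where vB: "\<And>k. k < q \<Longrightarrow> v k \<in> roots_of_unity" "\<And>x. x \<in> torus q \<Longrightarrow> (?g ^^ a) x = mono_map q q v B x"
    using mono_map_funpow[OF u, where H = H and a = "a - 1"] a(1) by auto
  have t0: "\<And>k. k < q \<Longrightarrow> t0 k \<in> roots_of_unity" "t0 \<in> torus q" using a(2) tors_torus by (auto simp: tors_def)
  have it: "((f ^^ l) ^^ b) (\<psi> x) = \<psi> ((?g ^^ b) x) \<and> (?g ^^ b) x \<in> torus q" if "x \<in> torus q" for b x
    by (induction b) (use that f u in \<open>auto intro: mono_map_torus\<close>)
  define tr where "tr x = (\<lambda>i. if i < q then t0 i * x i else 0)" for x
  have tr: "tr x = mono_map q q t0 (\<lambda>k i. if i = k then 1 else 0) x" for x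
  proof -
    have "lmon q (\<lambda>i. if i = k then 1 else 0) x = x k" if "k < q" for k
    proof -
      have "lmon q (\<lambda>i. if i = k then 1 else 0) x = (\<Prod>i<q. if i = k then x i else 1)"
        unfolding lmon_def by (intro prod.cong) auto
      then show ?thesis using that by simp
    qed
    then show ?thesis by (intro ext) (simp add: tr_def mono_map_def)
  qed
  have trt: "tr x \<in> torus q" if "x \<in> torus q" for x using that t0(2) by (simp add: tr_def torus_def)
  define n where "n = q + zdim N X"
  have qn: "q \<le> n" by (simp add: n_def)
  have gt: "t \<in> torus q" if "t \<in> gm_pts n" for t using that by (auto simp: gm_pts_def torus_def n_def)
  have "laurent q UNIV (\<lambda>x. \<psi> (tr x) i)" for i unfolding tr by (rule laurent_compose_mono_map[OF \<psi>(1) t0(1)])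
  then obtain \<Phi> where \<Phi>: "\<forall>i<N. lpoly_over qbar n (\<Phi> i)" "\<And>x. x \<in> torus q \<Longrightarrow> lpmap N \<Phi> x = \<psi> (tr x)"
    using laurent_as_lpoly[of N q "\<lambda>x. \<psi> (tr x)" n] \<psi>(2) by (auto simp: n_def)
  obtain G where G: "gm_endo n G" "\<And>t. t \<in> gm_pts n \<Longrightarrow> lpmap n G t = (\<lambda>i. if i < n then lmon n (pad q B i) t else 0)"
    using monomial_gm_endo[of n "pad q B"] by blast
  have "(f ^^ (l * a)) (lpmap N \<Phi> t) = lpmap N \<Phi> (lpmap n G t)" if t: "t \<in> gm_pts n" for t
  proof -
    have "lpmap n G t \<in> gm_pts n" using G(1) t by (auto simp: gm_endo_def)
    then have Gt: "lpmap n G t \<in> torus q" by (rule gt)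
    \<comment> \<open>The iterate is x -> v x^B, and t0 being fixed means v t0^B = t0; conjugation
      by the translation leaves x -> x^B.\<close>
    have "(?g ^^ a) (tr t) = tr (lpmap n G t)"
    proof
      fix k
      show "(?g ^^ a) (tr t) k = tr (lpmap n G t) k"
      proof (cases "k < q")
        case True
        have "lmon q (B k) (tr t) = lmon q (B k) (\<lambda>i. t0 i * t i)" by (rule lmon_cong) (simp_all add: tr_def)
        then have "(?g ^^ a) (tr t) k = (v k * lmon q (B k) t0) * lmon q (B k) t"
          unfolding vB(2)[OF trt[OF gt[OF t]]] using True by (simp add: mono_map_def lmon_mult)
        also have "v k * lmon q (B k) t0 = t0 k" using fun_cong[OF a(3), of k] True unfolding vB(2)[OF t0(2)] by (simp add: mono_map_def)
        finally show ?thesis unfolding G(2)[OF t] using True less_le_trans[OF True qn] lmon_pad[OF qn] by (simp add: tr_def)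
      next
        case False
        then show ?thesis unfolding vB(2)[OF trt[OF gt[OF t]]] by (simp add: mono_map_def tr_def)
      qed
    qed
    then show ?thesis
      using it[OF trt[OF gt[OF t]], of a] by (simp add: \<Phi>(2)[OF gt[OF t]] \<Phi>(2)[OF Gt] funpow_mult)
  qed
  moreover have "dominant_torus_morphism n N \<Phi> X"
  proof -
    have sub: "lpmap N \<Phi> ` gm_pts n \<subseteq> X"
    proof (rule image_subsetI)
      fix t assume t: "t \<in> gm_pts n"
      have trq: "tr t \<in> gm_pts q" using t t0 roots_of_unity_qbar by (auto simp: gm_pts_def tr_def n_def torus_def intro: qbar_mult)
      show "lpmap N \<Phi> t \<in> X"
        unfolding \<Phi>(2)[OF gt[OF t]] by (rule torus_maps_into_closed[OF Xc \<psi> Z(1,2,3) trq])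
    qed
    \<comment> \<open>Dividing by t0 produces a preimage of each point of Z, so the image contains
      the set \<psi>(Z), which is not small.\<close>
    have "\<psi> ` Z \<subseteq> lpmap N \<Phi> ` gm_pts n"
    proof (rule image_subsetI)
      fix x assume "x \<in> Z"
      then have x: "x \<in> tors q" using Z(1) by blast
      then have xt: "x \<in> torus q" using tors_torus by blast
      define t where "t i = (if i < q then inverse (t0 i) * x i else if i < n then 1 else 0)" for i
      have "inverse (t0 i) * x i \<in> qbar" if "i < q" for i
        using x t0(1)[OF that] that by (intro qbar_mult qbar_inverse roots_of_unity_qbar) (auto simp: tors_def)
      then have t: "t \<in> gm_pts n"
        using xt t0(2) qn by (simp add: gm_pts_def t_def torus_def)
      have "tr t = x" using x t0(2) by (intro ext) (auto simp: tr_def t_def tors_def torus_def)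
      then have "\<psi> x = lpmap N \<Phi> t" using \<Phi>(2)[OF gt[OF t]] by simp
      then show "\<psi> x \<in> lpmap N \<Phi> ` gm_pts n" using t by simp
    qed
    then have "\<not> small N X (lpmap N \<Phi> ` gm_pts n)" using Z(4) small_subset by blast
    then show ?thesis using sub \<Phi>(1) dense_iff_not_small[OF Xc sub] by (simp add: dominant_torus_morphism_def)
  qed
  moreover have "l * a \<ge> 1" "n \<ge> zdim N X" using l a(1) by (simp_all add: n_def)
  ultimately show ?thesis unfolding monomial_type_def using G(1) by blast
qed

section \<open>Dense pieces\<close>

definition piece :: "nat \<Rightarrow> nat \<Rightarrow> complex set \<Rightarrow> (nat \<Rightarrow> complex) \<Rightarrow> nat \<Rightarrow> (nat \<Rightarrow> complex) \<Rightarrow> (nat \<Rightarrow> nat \<Rightarrow> int) \<Rightarrow>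
    (nat \<Rightarrow> complex) set \<Rightarrow> (nat \<Rightarrow> complex) set \<Rightarrow> bool" where
  "piece N R E e q w A Z B \<longleftrightarrow> (\<forall>k. e k \<in> qbar) \<and> torus_emb (N * R) q w A \<and> Z \<subseteq> tors q \<and> \<not> thin q Z \<and>
     (\<forall>x\<in>Z. \<exists>y. min_rep N R E y e (mono_map (N * R) q w A x)) \<and> B = (\<lambda>x. term_sums N R e (mono_map (N * R) q w A x)) ` Z"

text \<open>Points are sorted by the coefficient vector of a chosen minimal representation, of which
  there are finitely many because its entries lie in E. The tuples of roots of unity belonging to
  one vector are then covered by charts.\<close>

lemma finite_piece_cover:
  assumes E: "finite E" "E \<subseteq> qbar" "0 \<in> E"
    and P: "\<forall>y\<in>P. \<forall>i<N. short_sum R E (y i)" "P \<subseteq> qbar_pts N"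
  shows "\<exists>\<B>. finite \<B> \<and> P = \<Union>\<B> \<and> (\<forall>B\<in>\<B>. \<exists>e q w A Z. piece N R E e q w A Z B)"
proof -
  let ?m = "N * R"
  have "\<exists>e z. min_rep N R E y e z" if "y \<in> P" for y
    by (rule min_rep_exists[OF E(3)]) (use P that in \<open>auto simp: qbar_pts_def\<close>)
  then obtain er zr where mr: "\<And>y. y \<in> P \<Longrightarrow> min_rep N R E y (er y) (zr y)" by metis
  have ir: "is_rep N R E y (er y) (zr y)" if "y \<in> P" for y using mr[OF that] by (simp add: min_rep_def)
  have "finite {e :: nat \<Rightarrow> complex. \<forall>k. (k \<in> {..<?m} \<longrightarrow> e k \<in> E) \<and> (k \<notin> {..<?m} \<longrightarrow> e k = 0)}"
    using E(1) by (intro finite_set_of_finite_funs) auto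
  then have fin: "finite (er ` P)"
    by (rule rev_finite_subset) (use ir in \<open>auto simp: is_rep_def\<close>)
  define Y where "Y e = zr ` {y \<in> P. er y = e}" for e
  have "chart_cover ?m (Y e)" for e
    by (rule tors_chart_cover) (use ir in \<open>auto simp: Y_def is_rep_def\<close>)
  then obtain \<D> where D: "\<And>e. finite (\<D> e)" "\<And>e. Y e = \<Union>(\<D> e)" "\<And>e D. D \<in> \<D> e \<Longrightarrow> chart ?m D"
    unfolding chart_cover_def by metis
  define \<B> where "\<B> = (\<Union>e\<in>er ` P. (\<lambda>D. term_sums N R e ` D) ` \<D> e)"
  have term_sums: "y = term_sums N R (er y) (zr y)" if "y \<in> P" for y using ir[OF that] by (simp add: is_rep_def)
  have "finite \<B>" unfolding \<B>_def by (rule finite_UN_I[OF fin]) (rule finite_imageI, rule D(1))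
  moreover have "P = \<Union>\<B>"
  proof
    show "P \<subseteq> \<Union>\<B>"
    proof
      fix y assume y: "y \<in> P"
      then have "zr y \<in> Y (er y)" by (simp add: Y_def)
      then obtain D where "D \<in> \<D> (er y)" "zr y \<in> D" unfolding D(2) by (rule UnionE)
      moreover from this have "y \<in> term_sums N R (er y) ` D" using term_sums[OF y] by (intro image_eqI[of _ _ "zr y"]) simp_all
      ultimately show "y \<in> \<Union>\<B>" unfolding \<B>_def using y by (intro UnionI[of "term_sums N R (er y) ` D"] UN_I[of "er y"] imageI)
    qed
    show "\<Union>\<B> \<subseteq> P"
    proof
      fix p assume "p \<in> \<Union>\<B>"
      then obtain e D z where "D \<in> \<D> e" "z \<in> D" and p: "p = term_sums N R e z" by (auto simp: \<B>_def)
      then have "z \<in> Y e" using D(2) by (metis UnionI)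
      then obtain y where "y \<in> P" "er y = e" "z = zr y" by (auto simp: Y_def)
      then show "p \<in> P" using term_sums[of y] p by simp
    qed
  qed
  moreover have "\<exists>e q w A Z. piece N R E e q w A Z B" if "B \<in> \<B>" for B
  proof -
    obtain y0 D where y0: "y0 \<in> P" and Dm: "D \<in> \<D> (er y0)" and B: "B = term_sums N R (er y0) ` D" using \<open>B \<in> \<B>\<close> by (auto simp: \<B>_def)
    have "chart ?m D" using D(3) Dm .
    then obtain q w A Z where ch: "torus_emb ?m q w A" "Z \<subseteq> tors q" "\<not> thin q Z" "D = mono_map ?m q w A ` Z"
      unfolding chart_def by (elim exE conjE) (rule that)
    have "\<forall>k. er y0 k \<in> qbar"
    proof
      fix k
      show "er y0 k \<in> qbar" using ir[OF y0] E(2) by (cases "k < ?m") (auto simp: is_rep_def)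
    qed
    moreover have "\<exists>y. min_rep N R E y (er y0) (mono_map ?m q w A x)" if x: "x \<in> Z" for x
    proof -
      have "mono_map ?m q w A x \<in> D" using x ch(4) by simp
      then have "mono_map ?m q w A x \<in> Y (er y0)" using Dm D(2) by (metis UnionI)
      then obtain y where "y \<in> P" "er y = er y0" "mono_map ?m q w A x = zr y" by (auto simp: Y_def)
      then show ?thesis using mr[of y] by (intro exI[of _ y]) simp
    qed
    moreover have "B = (\<lambda>x. term_sums N R (er y0) (mono_map ?m q w A x)) ` Z" unfolding B ch(4) by (rule image_image)
    ultimately have "piece N R E (er y0) q w A Z B" using ch(1-3) by (simp add: piece_def)
    then show ?thesis by (intro exI)
  qed
  ultimately show ?thesis by (intro exI[of _ \<B>]) simp
qed

lemma thin_zero_set: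
  assumes "\<And>i. laurent q UNIV (\<lambda>x. \<psi> x i)" "Z \<subseteq> tors q" "\<not> small N X (\<psi> ` Z)"
    and p: "poly_over qbar N p" "\<exists>x\<in>X. peval p x \<noteq> 0"
  shows "thin q {x \<in> Z. peval p (\<psi> x) = 0}"
proof (rule ccontr)
  assume nt: "\<not> ?thesis"
  have Z: "{x \<in> Z. peval p (\<psi> x) = 0} \<subseteq> tors q" using assms(2) by blast
  have "peval p (\<psi> x) = 0" if "x \<in> Z" for x
  proof (rule laurent_vanish[OF laurent_comp_peval[OF p(1) assms(1)] Z nt])
    show "x \<in> torus q" using that assms(2) tors_torus by blast
  qed simp
  then have "small N X (\<psi> ` Z)" using p by (auto simp: small_def)
  then show False using assms(3) by simp
qed

text \<open>Points of Z whose image leaves P lie on the pullback of a polynomial witnessing (AI).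
  Those whose image falls into a small piece lie on the pullback of its witness, still nonzero on X
  because f is dominant. Both loci are thin, so if the remaining pieces also had thin preimages, Z
  would be thin.\<close>

lemma dense_piece_successor:
  assumes X: "zirreducible N X" and F: "\<And>i. i < N \<Longrightarrow> poly_over qbar N (F i)"
    and fX: "polymap N F ` X \<subseteq> X" and dom: "zariski_dense_in N (polymap N F ` X) X"
    and P: "P \<subseteq> X" "\<not> zariski_dense_in N (P - {x \<in> X. polymap N F x \<in> P}) X"
    and \<B>: "finite \<B>" "P = \<Union>\<B>"
    and \<psi>: "\<And>i. laurent q UNIV (\<lambda>x. \<psi> x i)" and Z: "Z \<subseteq> tors q" "\<not> thin q Z" "\<psi> ` Z \<subseteq> P" "\<not> small N X (\<psi> ` Z)"
  shows "\<exists>B\<in>\<B>. \<not> small N X B \<and> \<not> thin q {x \<in> Z. polymap N F (\<psi> x) \<in> B}"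
proof (rule ccontr)
  assume neg: "\<not> ?thesis"
  have Xc: "zclosed N X" using X by (simp add: zirreducible_def)
  have "small N X (P - {x \<in> X. polymap N F x \<in> P})"
    using P dense_iff_not_small[OF Xc, of "P - {x \<in> X. polymap N F x \<in> P}"] by blast
  then obtain p where p: "poly_over qbar N p" "\<forall>a\<in>P - {x \<in> X. polymap N F x \<in> P}. peval p a = 0" "\<exists>x\<in>X. peval p x \<noteq> 0"
    by (auto simp: small_def)
  have dom': "\<not> small N X (polymap N F ` X)" using dom dense_iff_not_small[OF Xc fX] by simp
  have thinB: "thin q {x \<in> Z. polymap N F (\<psi> x) \<in> B}" if B: "B \<in> \<B>" for B
  proof (cases "small N X B")
    case False
    then show ?thesis using neg B by blast
  next
    case True
    then obtain r where r: "poly_over qbar N r" "\<forall>a\<in>B. peval r a = 0" "\<exists>x\<in>X. peval r x \<noteq> 0" by (auto simp: small_def)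
    have "pfun N (\<lambda>x. peval r (polymap N F x))"
      by (rule pfun_comp[OF r(1)]) (use F in \<open>auto simp: pfun_def polymap_def\<close>)
    then obtain s where s: "poly_over qbar N s" "\<And>x. peval r (polymap N F x) = peval s x" by (auto simp: pfun_def)
    have "\<exists>x\<in>X. peval s x \<noteq> 0"
    proof (rule ccontr)
      assume "\<not> ?thesis"
      then have "\<forall>a\<in>polymap N F ` X. peval r a = 0" by (simp add: s(2))
      then show False using dom' r(1,3) unfolding small_def by blast
    qed
    then have "thin q {x \<in> Z. peval s (\<psi> x) = 0}" by (rule thin_zero_set[OF \<psi> Z(1,4) s(1)])
    then show ?thesis by (rule thin_subset) (use r(2) in \<open>auto simp: s(2)[symmetric]\<close>)
  qed
  have "Z \<subseteq> {x \<in> Z. peval p (\<psi> x) = 0} \<union> \<Union>((\<lambda>B. {x \<in> Z. polymap N F (\<psi> x) \<in> B}) ` \<B>)"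
  proof
    fix x assume x: "x \<in> Z"
    then have xP: "\<psi> x \<in> P" using Z(3) by blast
    show "x \<in> {x \<in> Z. peval p (\<psi> x) = 0} \<union> \<Union>((\<lambda>B. {x \<in> Z. polymap N F (\<psi> x) \<in> B}) ` \<B>)"
    proof (cases "polymap N F (\<psi> x) \<in> P")
      case True
      then obtain B where "B \<in> \<B>" "polymap N F (\<psi> x) \<in> B" unfolding \<B>(2) by (rule UnionE)
      then show ?thesis using x by (intro UnI2 UN_I[of B]) simp_all
    next
      case False
      then show ?thesis using x xP p(2) by simp
    qed
  qed
  moreover have "thin q ({x \<in> Z. peval p (\<psi> x) = 0} \<union> \<Union>((\<lambda>B. {x \<in> Z. polymap N F (\<psi> x) \<in> B}) ` \<B>))"
  proof (rule thin_Un)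
    show "thin q {x \<in> Z. peval p (\<psi> x) = 0}" by (rule thin_zero_set[OF \<psi> Z(1,4) p(1,3)])
    show "thin q (\<Union>((\<lambda>B. {x \<in> Z. polymap N F (\<psi> x) \<in> B}) ` \<B>))"
    proof (rule thin_Union)
      fix T assume "T \<in> (\<lambda>B. {x \<in> Z. polymap N F (\<psi> x) \<in> B}) ` \<B>"
      then show "thin q T" using thinB by (elim imageE) simp
    qed (use \<B>(1) in simp)
  qed
  ultimately show False using Z(2) thin_subset by blast
qed

text \<open>Loxton's theorem is applied to M * y i with house bound M * c, and the factor M is then
  moved into the coefficient set.\<close>

lemma bounded_points_are_short_sums:
  assumes K: "number_field K" and P: "P \<subseteq> qbar_pts N"
    and M: "\<exists>M::nat. M \<ge> 1 \<and> (\<forall>y\<in>P. \<forall>i<N. of_nat M * y i \<in> alg_integers_of (cyclo_ext K))"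
    and c: "\<exists>c::real. c > 0 \<and> (\<forall>y\<in>P. Max ((\<lambda>i. house (y i)) ` {..<N}) \<le> c)"
  shows "\<exists>R E. finite E \<and> E \<subseteq> qbar \<and> 0 \<in> E \<and> (\<forall>y\<in>P. \<forall>i<N. short_sum R E (y i))"
proof -
  obtain M :: nat where M: "M \<ge> 1" "\<And>y i. y \<in> P \<Longrightarrow> i < N \<Longrightarrow> of_nat M * y i \<in> alg_integers_of (cyclo_ext K)" using M by blast
  obtain c where c: "\<And>y. y \<in> P \<Longrightarrow> Max ((\<lambda>i. house (y i)) ` {..<N}) \<le> c" using c by blast
  obtain R E where RE: "finite E" "E \<subseteq> qbar" "0 \<in> E"
    "\<And>\<alpha>. \<alpha> \<in> alg_integers_of (cyclo_ext K) \<Longrightarrow> (\<forall>\<sigma>. gal \<sigma> \<longrightarrow> cmod (\<sigma> \<alpha>) \<le> M * c) \<Longrightarrow> short_sum R E \<alpha>"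
    using loxton[OF K, of "M * c"] by metis
  let ?E = "(*) (inverse (of_nat M)) ` E"
  have "short_sum R ?E (y i)" if y: "y \<in> P" and i: "i < N" for y i
  proof -
    have yq: "y i \<in> qbar" using P y i by (auto simp: qbar_pts_def)
    have "house (y i) \<le> Max ((\<lambda>i. house (y i)) ` {..<N})" using i by (intro Max_ge) auto
    then have h: "house (y i) \<le> c" using c[OF y] by linarith
    have "cmod (\<sigma> (of_nat M * y i)) \<le> M * c" if \<sigma>: "gal \<sigma>" for \<sigma>
      using house_bound[OF yq h \<sigma>] by (simp add: gal_mult[OF \<sigma> _ yq] gal_of_nat[OF \<sigma>] norm_mult mult_left_mono)
    then have "short_sum R E (of_nat M * y i)" using RE(4)[OF M(2)[OF y i]] by blast
    from short_sum_scale[OF this, of "inverse (of_nat M)"] show ?thesis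
      using M(1) by (simp add: mult.assoc[symmetric])
  qed
  moreover have "finite ?E" "0 \<in> ?E" using RE(1,3) by auto
  moreover have "?E \<subseteq> qbar" using RE(2) by (auto intro!: qbar_mult qbar_inverse)
  ultimately show ?thesis by (intro exI[of _ R] exI[of _ ?E]) simp
qed

text \<open>The dimension q B may change from piece to piece, but monomial maps between different
  tori compose to monomial maps, so every iterate of f along the orbit lifts.\<close>

lemma compose_along_orbit:
  assumes step: "\<And>B. B \<in> I \<Longrightarrow> \<tau> B \<in> I \<and> (\<exists>u H. (\<forall>k<q (\<tau> B). u k \<in> roots_of_unity) \<and>
      (\<forall>x\<in>torus (q B). f (\<psi> B x) = \<psi> (\<tau> B) (mono_map (q (\<tau> B)) (q B) u H x)))"
    and B: "B \<in> I"
  shows "(\<tau> ^^ Suc n) B \<in> I \<and> (\<exists>u H. (\<forall>k<q ((\<tau> ^^ Suc n) B). u k \<in> roots_of_unity) \<and>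
      (\<forall>x\<in>torus (q B). (f ^^ Suc n) (\<psi> B x) = \<psi> ((\<tau> ^^ Suc n) B) (mono_map (q ((\<tau> ^^ Suc n) B)) (q B) u H x)))"
proof (induction n)
  case 0
  show ?case using step[OF B] by simp
next
  case (Suc n)
  define C where "C = (\<tau> ^^ Suc n) B"
  obtain u H where u: "\<forall>k<q C. u k \<in> roots_of_unity" "\<forall>x\<in>torus (q B). (f ^^ Suc n) (\<psi> B x) = \<psi> C (mono_map (q C) (q B) u H x)"
    and C: "C \<in> I" using Suc.IH unfolding C_def by blast
  obtain v G where v: "\<forall>k<q (\<tau> C). v k \<in> roots_of_unity" "\<forall>x\<in>torus (q C). f (\<psi> C x) = \<psi> (\<tau> C) (mono_map (q (\<tau> C)) (q C) v G x)"
    using step[OF C] by blast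
  have "(f ^^ Suc (Suc n)) (\<psi> B x) = \<psi> (\<tau> C) (mono_map (q (\<tau> C)) (q B) (\<lambda>j. v j * lmon (q C) (G j) u) (\<lambda>j k. \<Sum>i<q C. G j i * H i k) x)"
    if x: "x \<in> torus (q B)" for x
  proof -
    have "mono_map (q C) (q B) u H x \<in> torus (q C)" using u(1) x by (intro mono_map_torus) simp_all
    then show ?thesis using u(2) v(2) x by (simp add: mono_map_mono_map[OF x])
  qed
  moreover have "\<forall>k<q (\<tau> C). v k * lmon (q C) (G k) u \<in> roots_of_unity"
    using u(1) v(1) by (auto intro: roots_of_unity_mult lmon_roots_of_unity)
  moreover have "(\<tau> ^^ Suc (Suc n)) B = \<tau> C" by (simp add: C_def)
  ultimately show ?case using step[OF C]
    by (intro conjI exI[of _ "\<lambda>j. v j * lmon (q C) (G j) u"] exI[of _ "\<lambda>j k. \<Sum>i<q C. G j i * H i k"]) auto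
qed

theorem theorem1p2:
  fixes K :: "complex set" and N :: nat and X :: "(nat \<Rightarrow> complex) set"
    and F :: "nat \<Rightarrow> mpoly" and P :: "(nat \<Rightarrow> complex) set"
  assumes K: "number_field K"
    and X_var: "affine_variety_over K N X"
    and X_irr: "zirreducible N X"
    and X_dim: "zdim N X \<ge> 1"
    and F_K: "\<forall>i<N. poly_over K N (F i)"
    and f_endo: "polymap N F ` X \<subseteq> X"
    and f_dom: "zariski_dense_in N (polymap N F ` X) X"
    and P_sub: "P \<subseteq> X"
    and DCI_dense: "zariski_dense_in N P X"
    and DCI_int: "\<exists>M::nat. M \<ge> 1 \<and> (\<forall>y\<in>P. \<forall>i<N. of_nat M * y i \<in> alg_integers_of (cyclo_ext K))"
    and BH: "\<exists>c::real. c > 0 \<and> (\<forall>y\<in>P. Max ((\<lambda>i. house (y i)) ` {..<N}) \<le> c)"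
    and AI: "\<not> zariski_dense_in N (P - {x \<in> X. polymap N F x \<in> P}) X"
  shows "monomial_type N X (polymap N F)"
proof -
  let ?f = "polymap N F"
  have Xc: "zclosed N X" using X_irr by (simp add: zirreducible_def)
  have Pq: "P \<subseteq> qbar_pts N" using P_sub Xc by (auto simp: zclosed_def zero_set_def)
  have F: "\<And>i. i < N \<Longrightarrow> poly_over qbar N (F i)"
    using F_K number_field_subset_qbar[OF K] by (auto simp: poly_over_def)
  obtain R E where E: "finite E" "E \<subseteq> qbar" "0 \<in> E" "\<forall>y\<in>P. \<forall>i<N. short_sum R E (y i)"
    using bounded_points_are_short_sums[OF K Pq DCI_int BH] by (elim exE conjE) (rule that)
  obtain \<B> where \<B>: "finite \<B>" "P = \<Union>\<B>" and pc: "\<forall>B\<in>\<B>. \<exists>e q w A Z. piece N R E e q w A Z B"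
    using finite_piece_cover[OF E Pq] by (elim exE conjE) (rule that)
  obtain e q w A Z where pieces: "\<And>B. B \<in> \<B> \<Longrightarrow> piece N R E (e B) (q B) (w B) (A B) (Z B) B"
    using pc by metis
  define \<psi> where "\<psi> B x = term_sums N R (e B) (mono_map (N * R) (q B) (w B) (A B) x)" for B x
  \<comment> \<open>Only dense pieces are kept: they have dense successors, and by irreducibility
    there is at least one.\<close>
  define I where "I = {B \<in> \<B>. \<not> small N X B}"
  have pB: "\<And>k. e B k \<in> qbar" "\<And>k. k < N * R \<Longrightarrow> w B k \<in> roots_of_unity" "torus_emb (N * R) (q B) (w B) (A B)"
    "Z B \<subseteq> tors (q B)" "\<not> thin (q B) (Z B)" "\<psi> B ` Z B = B"
    "\<And>x. x \<in> Z B \<Longrightarrow> \<exists>y. min_rep N R E y (e B) (mono_map (N * R) (q B) (w B) (A B) x)" if "B \<in> I" for B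
    using pieces[of B] that by (auto simp: piece_def torus_emb_def I_def \<psi>_def)
  have l\<psi>: "laurent (q B) UNIV (\<lambda>x. \<psi> B x i)" if "B \<in> I" for B i
    unfolding \<psi>_def by (rule laurent_term_sums_mono_map[OF pB(1,2)[OF that]])
  have succ: "\<exists>C. C \<in> I \<and> (\<exists>u H. (\<forall>k<q C. u k \<in> roots_of_unity) \<and>
      (\<forall>x\<in>torus (q B). ?f (\<psi> B x) = \<psi> C (mono_map (q C) (q B) u H x)))" if B: "B \<in> I" for B
  proof -
    have Bm: "\<psi> B ` Z B \<subseteq> P" "\<not> small N X (\<psi> B ` Z B)" using B \<B>(2) by (auto simp: pB(6)[OF B] I_def)
    obtain C where C: "C \<in> \<B>" "\<not> small N X C" and nt: "\<not> thin (q B) {x \<in> Z B. ?f (\<psi> B x) \<in> C}"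
      using dense_piece_successor[where F = F and \<psi> = "\<psi> B" and q = "q B" and Z = "Z B", OF X_irr F f_endo f_dom P_sub AI \<B> l\<psi>[OF B] pB(4,5)[OF B] Bm] by blast
    have CI: "C \<in> I" using C by (simp add: I_def)
    have "\<exists>u H. (\<forall>k<q C. u k \<in> roots_of_unity) \<and>
      (\<forall>x\<in>torus (q B). ?f (term_sums N R (e B) (mono_map (N * R) (q B) (w B) (A B) x)) =
        term_sums N R (e C) (mono_map (N * R) (q C) (w C) (A C) (mono_map (q C) (q B) u H x)))"
    proof (rule correspondence_is_monomial[where E = E and T = "{x \<in> Z B. ?f (\<psi> B x) \<in> C}" and Z' = "Z C"])
      fix x assume "x \<in> {x \<in> Z B. ?f (\<psi> B x) \<in> C}"
      then have "?f (\<psi> B x) \<in> \<psi> C ` Z C" using pB(6)[OF CI] by simp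
      then show "\<exists>x'\<in>Z C. ?f (term_sums N R (e B) (mono_map (N * R) (q B) (w B) (A B) x)) = term_sums N R (e C) (mono_map (N * R) (q C) (w C) (A C) x')"
        unfolding \<psi>_def by blast
    qed (use E F pB[OF B] pB[OF CI] nt in auto)
    then show ?thesis using CI unfolding \<psi>_def by blast
  qed
  then obtain \<tau> where \<tau>: "\<And>B. B \<in> I \<Longrightarrow> \<tau> B \<in> I \<and> (\<exists>u H. (\<forall>k<q (\<tau> B). u k \<in> roots_of_unity) \<and>
      (\<forall>x\<in>torus (q B). ?f (\<psi> B x) = \<psi> (\<tau> B) (mono_map (q (\<tau> B)) (q B) u H x)))" by metis
  have "I \<noteq> {}"
  proof
    assume "I = {}"
    then have "small N X P" unfolding \<B>(2) by (intro small_Union[OF X_irr \<B>(1)]) (auto simp: I_def)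
    then show False using DCI_dense dense_iff_not_small[OF Xc P_sub] by simp
  qed
  then obtain B0 where "B0 \<in> I" by blast
  moreover have "finite I" using \<B>(1) by (simp add: I_def)
  \<comment> \<open>The chosen successor is a self-map of the finite nonempty set I, so some piece
    returns to itself after l steps.\<close>
  ultimately obtain l B where l: "l \<ge> 1" and B: "B \<in> I" and cyc: "(\<tau> ^^ l) B = B"
    using periodic_point[of I B0 \<tau>] \<tau> by blast
  obtain n where n: "l = Suc n" using l by (cases l) auto
  obtain u H where u: "\<forall>k<q B. u k \<in> roots_of_unity" "\<And>x. x \<in> torus (q B) \<Longrightarrow> (?f ^^ l) (\<psi> B x) = \<psi> B (mono_map (q B) (q B) u H x)"
    using compose_along_orbit[where n = n and I = I and \<tau> = \<tau> and q = q and f = ?f and \<psi> = \<psi> and B = B, OF \<tau> B] cyc unfolding n by auto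
  show ?thesis
  proof (rule monomial_type_if_periodic[where \<psi> = "\<psi> B" and q = "q B" and Z = "Z B" and l = l and u = u and H = H])
    show "laurent (q B) UNIV (\<lambda>x. \<psi> B x i)" for i by (rule l\<psi>[OF B])
    show "\<psi> B x i = 0" if "i \<ge> N" for x i using that by (simp add: \<psi>_def term_sums_def)
    show "\<psi> B ` Z B \<subseteq> X" "\<not> small N X (\<psi> B ` Z B)" using B P_sub \<B>(2) by (auto simp: pB(6)[OF B] I_def)
  qed (fact X_irr pB(4,5)[OF B] l u)+
qed

end
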